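(* Let $\Bbbk$ be a field, and let $A$ and $B$ be two commutative Noetherian $\Bbbk$-algebras such that $A\otimes_\Bbbk B$ is Noetherian. Let $I$ be an ideal of $A$ and $J$ an ideal of $B$, and let $L$ and $N$ be nonzero finitely generated modules over $A$ and $B$, respectively. Then (a) $\operatorname{grade}(I\otimes_\Bbbk B+A\otimes_\Bbbk J,\ L\otimes_\Bbbk N)=\operatorname{grade}(I,L)+\operatorname{grade}(J,N)$; (b) $\operatorname{cd}(I\otimes_\Bbbk B+A\otimes_\Bbbk J,\ L\otimes_\Bbbk N)=\operatorname{cd}(I,L)+\operatorname{cd}(J,N)$.
   Context: $I\otimes_\Bbbk B$ and $A\otimes_\Bbbk J$ are regarded as ideals of $A\otimes_\Bbbk B$, and $L\otimes_\Bbbk N$ as an $A\otimes_\Bbbk B$-module. For a Noetherian ring $R$, an ideal $\mathfrak a$ of $R$ and a finitely generated $R$-module $M$, $H^i_{\mathfrak a}(M)$ denotes local cohomology, $\operatorname{grade}(\mathfrak a,M)=\inf\{i: H^i_{\mathfrak a}(M)\neq 0\}$ and $\operatorname{cd}(\mathfrak a,M)=\sup\{i: H^i_{\mathfrak a}(M)\neq 0\}$ (the cohomological dimension), with $\inf\emptyset=+\infty$ and $\sup\emptyset=-\infty$; one has $M=\mathfrak aM$ iff $\operatorname{grade}(\mathfrak a,M)=+\infty$ iff $\operatorname{cd}(\mathfrak a,M)=-\infty$. *)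

theory Defs
  imports "HOL-Algebra.Free_Abelian_Groups" "HOL-Algebra.Ring_Divisibility" "HOL-Algebra.Ideal_Product" "HOL-Algebra.Module"
    "HOL-Library.Extended_Real"
begin

section \<open>Modules\<close>

definition module_hom ::
  "('r, 'x) ring_scheme \<Rightarrow> ('r, 'm, 'y) module_scheme \<Rightarrow> ('r, 'n, 'z) module_scheme \<Rightarrow> ('m \<Rightarrow> 'n) set"
  where "module_hom R M N =
    {f \<in> carrier M \<rightarrow> carrier N.
       (\<forall>x\<in>carrier M. \<forall>y\<in>carrier M. f (x \<oplus>\<^bsub>M\<^esub> y) = f x \<oplus>\<^bsub>N\<^esub> f y) \<and>
       (\<forall>r\<in>carrier R. \<forall>x\<in>carrier M. f (r \<odot>\<^bsub>M\<^esub> x) = r \<odot>\<^bsub>N\<^esub> f x)}"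

definition finitely_generated_module ::
  "('r, 'x) ring_scheme \<Rightarrow> ('r, 'm, 'y) module_scheme \<Rightarrow> bool"
  where "finitely_generated_module R M \<longleftrightarrow>
    (\<exists>S. finite S \<and> S \<subseteq> carrier M \<and>
       (\<forall>H. submodule H R M \<and> S \<subseteq> H \<longrightarrow> H = carrier M))"

text \<open>In the records below that represent mere modules, the ring fields \<open>mult\<close> and \<open>one\<close>
  inherited from \<^typ>\<open>('r, 'm) module\<close> carry no information.\<close>

definition quotient_module ::
  "('r, 'm, 'y) module_scheme \<Rightarrow> 'm set \<Rightarrow> ('r, 'm set) module"
  where "quotient_module M H =
    \<lparr> carrier = a_rcosets\<^bsub>M\<^esub> H, monoid.mult = undefined, one = undefined,
      ring.zero = H, add = (<+>\<^bsub>M\<^esub>),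
      smult = (\<lambda>r C. \<Union>x\<in>C. H +>\<^bsub>M\<^esub> (r \<odot>\<^bsub>M\<^esub> x)) \<rparr>"

text \<open>A module over a \<open>K\<close>-algebra \<open>A\<close>, viewed as a \<open>K\<close>-module.\<close>

definition restrict_scalars ::
  "('k, 'a, 'x) module_scheme \<Rightarrow> ('a, 'l, 'y) module_scheme \<Rightarrow> ('k, 'l) module"
  where "restrict_scalars A L =
    \<lparr> carrier = carrier L, monoid.mult = undefined, one = undefined,
      ring.zero = \<zero>\<^bsub>L\<^esub>, add = add L,
      smult = (\<lambda>c x. (c \<odot>\<^bsub>A\<^esub> \<one>\<^bsub>A\<^esub>) \<odot>\<^bsub>L\<^esub> x) \<rparr>"


section \<open>Tensor products\<close>

text \<open>The tensor product of two \<open>K\<close>-modules is the free abelian group on the set of pairs modulo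
  the subgroup generated by the bilinearity and balancing relations; its elements are cosets.\<close>

definition tensor_relations ::
  "('k, 'u) ring_scheme \<Rightarrow> ('k, 'm, 'x) module_scheme \<Rightarrow> ('k, 'n, 'y) module_scheme
    \<Rightarrow> ('m \<times> 'n \<Rightarrow>\<^sub>0 int) set"
  where "tensor_relations K M N = generate (free_Abelian_group (carrier M \<times> carrier N))
    ({frag_of (x \<oplus>\<^bsub>M\<^esub> x', y) - frag_of (x, y) - frag_of (x', y) | x x' y.
        x \<in> carrier M \<and> x' \<in> carrier M \<and> y \<in> carrier N} \<union>
     {frag_of (x, y \<oplus>\<^bsub>N\<^esub> y') - frag_of (x, y) - frag_of (x, y') | x y y'.
        x \<in> carrier M \<and> y \<in> carrier N \<and> y' \<in> carrier N} \<union>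
     {frag_of (c \<odot>\<^bsub>M\<^esub> x, y) - frag_of (x, c \<odot>\<^bsub>N\<^esub> y) | c x y.
        c \<in> carrier K \<and> x \<in> carrier M \<and> y \<in> carrier N})"

definition tensor_coset ::
  "('k, 'u) ring_scheme \<Rightarrow> ('k, 'm, 'x) module_scheme \<Rightarrow> ('k, 'n, 'y) module_scheme
    \<Rightarrow> ('m \<times> 'n \<Rightarrow>\<^sub>0 int) \<Rightarrow> ('m \<times> 'n \<Rightarrow>\<^sub>0 int) set"
  where "tensor_coset K M N c =
    tensor_relations K M N #>\<^bsub>free_Abelian_group (carrier M \<times> carrier N)\<^esub> c"

definition tensor_group ::
  "('k, 'u) ring_scheme \<Rightarrow> ('k, 'm, 'x) module_scheme \<Rightarrow> ('k, 'n, 'y) module_scheme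
    \<Rightarrow> ('m \<times> 'n \<Rightarrow>\<^sub>0 int) set monoid"
  where "tensor_group K M N =
    free_Abelian_group (carrier M \<times> carrier N) Mod tensor_relations K M N"

text \<open>The biadditive extension of \<open>((a, b), (x, y)) \<mapsto> (f a x, g b y)\<close> to formal sums of pairs; it
  induces \<open>(a \<otimes> b) (x \<otimes> y) = f a x \<otimes> g b y\<close>.\<close>

definition frag_act ::
  "('a \<Rightarrow> 'm \<Rightarrow> 'm) \<Rightarrow> ('b \<Rightarrow> 'n \<Rightarrow> 'n) \<Rightarrow> ('a \<times> 'b \<Rightarrow>\<^sub>0 int) \<Rightarrow> ('m \<times> 'n \<Rightarrow>\<^sub>0 int) \<Rightarrow> ('m \<times> 'n \<Rightarrow>\<^sub>0 int)"
  where "frag_act f g c d =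
    frag_extend (\<lambda>(a, b). frag_extend (\<lambda>(x, y). frag_of (f a x, g b y)) d) c"

text \<open>The ring \<open>A \<otimes>\<^sub>K B\<close>. All members of the union defining a product are the same coset, as for
  the multiplication of \<^term>\<open>R Quot I\<close> in the library.\<close>

definition tensor_ring ::
  "('k, 'u) ring_scheme \<Rightarrow> ('k, 'a, 'x) module_scheme \<Rightarrow> ('k, 'b, 'y) module_scheme
    \<Rightarrow> ('a \<times> 'b \<Rightarrow>\<^sub>0 int) set ring"
  where "tensor_ring K A B =
    \<lparr> carrier = carrier (tensor_group K A B),
      monoid.mult = (\<lambda>C D. \<Union>c\<in>C. \<Union>d\<in>D. tensor_coset K A B (frag_act (monoid.mult A) (monoid.mult B) c d)),
      one = tensor_coset K A B (frag_of (\<one>\<^bsub>A\<^esub>, \<one>\<^bsub>B\<^esub>)),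
      ring.zero = \<one>\<^bsub>tensor_group K A B\<^esub>,
      add = monoid.mult (tensor_group K A B) \<rparr>"

text \<open>The \<open>A \<otimes>\<^sub>K B\<close>-module \<open>L \<otimes>\<^sub>K N\<close> of an \<open>A\<close>-module \<open>L\<close> and a \<open>B\<close>-module \<open>N\<close>.\<close>

definition tensor_module ::
  "('k, 'u) ring_scheme \<Rightarrow> ('k, 'a, 'x) module_scheme \<Rightarrow> ('k, 'b, 'y) module_scheme
    \<Rightarrow> ('a, 'l, 'v) module_scheme \<Rightarrow> ('b, 'n, 'w) module_scheme
    \<Rightarrow> (('a \<times> 'b \<Rightarrow>\<^sub>0 int) set, ('l \<times> 'n \<Rightarrow>\<^sub>0 int) set) module"
  where "tensor_module K A B L N =
    (let L' = restrict_scalars A L; N' = restrict_scalars B N in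
    \<lparr> carrier = carrier (tensor_group K L' N'), monoid.mult = undefined, one = undefined,
      ring.zero = \<one>\<^bsub>tensor_group K L' N'\<^esub>,
      add = monoid.mult (tensor_group K L' N'),
      smult = (\<lambda>C D. \<Union>c\<in>C. \<Union>d\<in>D. tensor_coset K L' N' (frag_act (smult L) (smult N) c d)) \<rparr>)"

text \<open>For submodules \<open>U\<close> of \<open>M\<close> and \<open>V\<close> of \<open>N\<close>: the image of the canonical map
  \<open>U \<otimes>\<^sub>K V \<rightarrow> M \<otimes>\<^sub>K N\<close>, which is injective when \<open>K\<close> is a field.\<close>

definition tensor_image ::
  "('k, 'u) ring_scheme \<Rightarrow> ('k, 'm, 'x) module_scheme \<Rightarrow> ('k, 'n, 'y) module_scheme
    \<Rightarrow> 'm set \<Rightarrow> 'n set \<Rightarrow> ('m \<times> 'n \<Rightarrow>\<^sub>0 int) set set"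
  where "tensor_image K M N U V =
    tensor_coset K M N ` carrier (free_Abelian_group (U \<times> V))"


section \<open>Local cohomology\<close>

definition torsion_part ::
  "('r, 'x) ring_scheme \<Rightarrow> 'r set \<Rightarrow> ('r, 'm, 'y) module_scheme \<Rightarrow> 'm set"
  where "torsion_part R \<aa> M =
    {x \<in> carrier M. \<exists>n::nat. \<forall>r \<in> \<aa> [^]\<^bsub>ideals_set R\<^esub> n. r \<odot>\<^bsub>M\<^esub> x = \<zero>\<^bsub>M\<^esub>}"

text \<open>HOL cannot quantify over the carrier type of the test modules inside a definition. The type
  \<^typ>\<open>'r + 'e\<close> contains copies of \<open>R\<close>, of its ideals and of \<open>E\<close>, so by Baer's criterion lifting
  along monomorphisms between modules carried by it gives lifting along all monomorphisms.\<close>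

definition injective_module ::
  "('r, 'x) ring_scheme \<Rightarrow> ('r, 'e) module \<Rightarrow> bool"
  where "injective_module R E \<longleftrightarrow> module R E \<and>
    (\<forall>(P :: ('r, 'r + 'e) module) (Q :: ('r, 'r + 'e) module) f g.
       module R P \<and> module R Q \<and>
       f \<in> module_hom R P Q \<and> inj_on f (carrier P) \<and> g \<in> module_hom R P E \<longrightarrow>
       (\<exists>h \<in> module_hom R Q E. \<forall>x\<in>carrier P. h (f x) = g x))"

definition injective_resolution ::
  "('r, 'x) ring_scheme \<Rightarrow> ('r, 'm, 'y) module_scheme
    \<Rightarrow> ('m \<Rightarrow> 'e) \<Rightarrow> (nat \<Rightarrow> ('r, 'e) module) \<Rightarrow> (nat \<Rightarrow> 'e \<Rightarrow> 'e) \<Rightarrow> bool"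
  where "injective_resolution R M \<epsilon> E d \<longleftrightarrow>
    (\<forall>i. injective_module R (E i)) \<and>
    (\<forall>i. d i \<in> module_hom R (E i) (E (Suc i))) \<and>
    \<epsilon> \<in> module_hom R M (E 0) \<and> inj_on \<epsilon> (carrier M) \<and>
    \<epsilon> ` carrier M = a_kernel (E 0) (E (Suc 0)) (d 0) \<and>
    (\<forall>i. d i ` carrier (E i) = a_kernel (E (Suc i)) (E (Suc (Suc i))) (d (Suc i)))"

text \<open>The cohomology module in degree \<open>i\<close> of the complex
  \<open>0 \<rightarrow> \<Gamma>\<^sub>\<aa>(E\<^sup>0) \<rightarrow> \<Gamma>\<^sub>\<aa>(E\<^sup>1) \<rightarrow> \<dots>\<close>.\<close>

definition torsion_cohomology ::
  "('r, 'x) ring_scheme \<Rightarrow> 'r set \<Rightarrow> (nat \<Rightarrow> ('r, 'e) module) \<Rightarrow> (nat \<Rightarrow> 'e \<Rightarrow> 'e) \<Rightarrow> nat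
    \<Rightarrow> ('r, 'e set) module"
  where "torsion_cohomology R \<aa> E d i =
    quotient_module
      ((E i)\<lparr>carrier := {x \<in> torsion_part R \<aa> (E i). d i x = \<zero>\<^bsub>E (Suc i)\<^esub>}\<rparr>)
      (case i of 0 \<Rightarrow> {\<zero>\<^bsub>E 0\<^esub>} | Suc j \<Rightarrow> d j ` torsion_part R \<aa> (E j))"

text \<open>The right derived functors of \<open>\<Gamma>\<^sub>\<aa>\<close>, computed from an arbitrarily chosen injective resolution;
  up to isomorphism the choice is irrelevant.

  The terms of the resolution must live in one type \<open>T\<close>, and \<^typ>\<open>'r \<times> nat \<Rightarrow> 'm option\<close> is large
  enough for a resolution to exist: a module \<open>C\<close> embeds into the injective module
  \<open>Hom\<^sub>\<int>(R, D)\<close>, where \<open>D\<close> is a divisible abelian group containing \<open>C\<close> with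
  \<open>|D| \<le> max(|C|, \<aleph>\<^sub>0)\<close>. As \<open>|T|\<close> is infinite, \<open>|T| \<ge> |M|\<close> and \<open>|T|\<^sup>|\<^sup>R\<^sup>| = |T|\<close>, this module has at
  most \<open>|T|\<close> elements if \<open>C\<close> has, so the construction, applied to \<open>M\<close> and then to the successive
  cokernels, never leaves \<open>T\<close>.\<close>

definition local_cohomology ::
  "('r, 'x) ring_scheme \<Rightarrow> 'r set \<Rightarrow> ('r, 'm, 'y) module_scheme \<Rightarrow> nat
    \<Rightarrow> ('r, ('r \<times> nat \<Rightarrow> 'm option) set) module"
  where "local_cohomology R \<aa> M i =
    (let (E, d) = (SOME (E, d). \<exists>\<epsilon>. injective_resolution R M \<epsilon> E d)
     in torsion_cohomology R \<aa> E d i)"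

text \<open>In \<^typ>\<open>ereal\<close>, \<open>Inf {} = \<infinity>\<close> and \<open>Sup {} = -\<infinity>\<close>.\<close>

definition grade ::
  "('r, 'x) ring_scheme \<Rightarrow> 'r set \<Rightarrow> ('r, 'm, 'y) module_scheme \<Rightarrow> ereal"
  where "grade R \<aa> M =
    Inf {ereal (real i) | i. carrier (local_cohomology R \<aa> M i) \<noteq> {\<zero>\<^bsub>local_cohomology R \<aa> M i\<^esub>}}"

definition cohom_dim ::
  "('r, 'x) ring_scheme \<Rightarrow> 'r set \<Rightarrow> ('r, 'm, 'y) module_scheme \<Rightarrow> ereal"
  where "cohom_dim R \<aa> M =
    Sup {ereal (real i) | i. carrier (local_cohomology R \<aa> M i) \<noteq> {\<zero>\<^bsub>local_cohomology R \<aa> M i\<^esub>}}"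

end

theory Submission
  imports Defs "HOL-Algebra.IntRing"
begin

text \<open>For a Noetherian ring and an ideal generated by \<open>x\<^sub>1, \<dots>, x\<^sub>p\<close>, the local cohomology of a module
  vanishes in degree \<open>i\<close> if and only if the colimit over \<open>N\<close> of the cohomology in degree \<open>i\<close> of the
  Koszul complexes of \<open>x\<^sub>1\<^sup>N, \<dots>, x\<^sub>p\<^sup>N\<close> does: both agree in degree \<open>0\<close> and vanish in positive degrees
  on injective modules, so dimension shifting along an injective resolution applies. The ideal
  \<open>I \<otimes> B + A \<otimes> J\<close> is generated by the elements \<open>x \<otimes> 1\<close> and \<open>1 \<otimes> y\<close> for generators \<open>x\<close> of \<open>I\<close> and \<open>y\<close>
  of \<open>J\<close>, and their Koszul complex on \<open>L \<otimes> N\<close> is the tensor product over the field \<open>K\<close> of the Koszul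
  complexes on \<open>L\<close> and \<open>N\<close>. By the Kuenneth formula, the degrees of nonzero local cohomology of
  \<open>L \<otimes> N\<close> are the sums of those of \<open>L\<close> and \<open>N\<close>, and infima and suprema of such sets of sums add up.\<close>

section \<open>Module homomorphisms and Baer's criterion\<close>

text \<open>Both invariants depend only on the set of degrees with nonzero local cohomology, so only
  vanishing is transported: no colimit and no Koszul cohomology module is formed, and a connecting
  homomorphism survives as an equivalence of vanishing statements. The definition of local
  cohomology chooses a resolution inside one fixed type. Nothing can be said about that choice until
  a resolution in this type exists, so quotients are built on chosen representatives and the terms
  are moved back into the type by a cardinality argument. For one element \<open>x\<close> and an
  injective \<open>E\<close>, ascending colon ideals show that the submodules \<open>x^k E\<close>
  become constant and that the \<open>x\<close>-torsion of \<open>E\<close> is again injective; this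
  carries the induction on the number of generators in the proof of acyclicity. Over a field each
  complex has a linear \<open>s\<close> with \<open>d s d = d\<close>. The map
  \<open>1 - d s - s d\<close> then sees exactly the cohomology classes, and an explicit homotopy
  takes the place of exactness properties of the tensor product.\<close>

lemma (in abelian_group) minus_eq_zero_iff:
  "x \<in> carrier G \<Longrightarrow> y \<in> carrier G \<Longrightarrow> x \<ominus> y = \<zero> \<longleftrightarrow> x = y"
  using minus_equality[of x "\<ominus> y"] by (auto simp: a_minus_def r_neg)

text \<open>Closure under negatives is the action of the scalar
  \<open>\<ominus> \<one>\<close>.\<close>

lemma (in module) submoduleI':
  assumes "H \<subseteq> carrier M" "\<zero>\<^bsub>M\<^esub> \<in> H"
    and "\<And>a b. a \<in> H \<Longrightarrow> b \<in> H \<Longrightarrow> a \<oplus>\<^bsub>M\<^esub> b \<in> H"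
    and "\<And>a x. a \<in> carrier R \<Longrightarrow> x \<in> H \<Longrightarrow> a \<odot>\<^bsub>M\<^esub> x \<in> H"
  shows "submodule H R M"
proof (rule submoduleI[OF assms(1,2) _ assms(3,4)])
  fix a assume "a \<in> H"
  then have "(\<ominus> \<one>) \<odot>\<^bsub>M\<^esub> a \<in> H" by (intro assms(4)) auto
  with \<open>a \<in> H\<close> assms(1) show "\<ominus>\<^bsub>M\<^esub> a \<in> H" by (auto simp: smult_l_minus)
qed

lemma module_homD:
  assumes "f \<in> module_hom R M N"
  shows "\<And>x. x \<in> carrier M \<Longrightarrow> f x \<in> carrier N"
    and "\<And>x y. x \<in> carrier M \<Longrightarrow> y \<in> carrier M \<Longrightarrow> f (x \<oplus>\<^bsub>M\<^esub> y) = f x \<oplus>\<^bsub>N\<^esub> f y"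
    and "\<And>r x. r \<in> carrier R \<Longrightarrow> x \<in> carrier M \<Longrightarrow> f (r \<odot>\<^bsub>M\<^esub> x) = r \<odot>\<^bsub>N\<^esub> f x"
  using assms by (auto simp: module_hom_def)

lemma module_homI:
  assumes "\<And>x. x \<in> carrier M \<Longrightarrow> f x \<in> carrier N"
    and "\<And>x y. x \<in> carrier M \<Longrightarrow> y \<in> carrier M \<Longrightarrow> f (x \<oplus>\<^bsub>M\<^esub> y) = f x \<oplus>\<^bsub>N\<^esub> f y"
    and "\<And>r x. r \<in> carrier R \<Longrightarrow> x \<in> carrier M \<Longrightarrow> f (r \<odot>\<^bsub>M\<^esub> x) = r \<odot>\<^bsub>N\<^esub> f x"
  shows "f \<in> module_hom R M N"
  using assms by (auto simp: module_hom_def)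

lemma additive_zero:
  assumes "abelian_group M" "abelian_group N"
    and "\<And>x. x \<in> carrier M \<Longrightarrow> f x \<in> carrier N"
    and "\<And>x y. x \<in> carrier M \<Longrightarrow> y \<in> carrier M \<Longrightarrow> f (x \<oplus>\<^bsub>M\<^esub> y) = f x \<oplus>\<^bsub>N\<^esub> f y"
  shows "f \<zero>\<^bsub>M\<^esub> = \<zero>\<^bsub>N\<^esub>"
proof -
  interpret M: abelian_group M by fact
  interpret N: abelian_group N by fact
  have "f \<zero>\<^bsub>M\<^esub> \<oplus>\<^bsub>N\<^esub> f \<zero>\<^bsub>M\<^esub> = f \<zero>\<^bsub>M\<^esub>"
    using assms(4)[of "\<zero>\<^bsub>M\<^esub>" "\<zero>\<^bsub>M\<^esub>"] by simp
  then show ?thesis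
    using assms(3)[of "\<zero>\<^bsub>M\<^esub>"] by simp
qed

lemma additive_minus:
  assumes "abelian_group M" "abelian_group N"
    and "\<And>x. x \<in> carrier M \<Longrightarrow> f x \<in> carrier N"
    and "\<And>x y. x \<in> carrier M \<Longrightarrow> y \<in> carrier M \<Longrightarrow> f (x \<oplus>\<^bsub>M\<^esub> y) = f x \<oplus>\<^bsub>N\<^esub> f y"
    and "x \<in> carrier M"
  shows "f (\<ominus>\<^bsub>M\<^esub> x) = \<ominus>\<^bsub>N\<^esub> f x"
proof -
  interpret M: abelian_group M by fact
  interpret N: abelian_group N by fact
  have "f (\<ominus>\<^bsub>M\<^esub> x) \<oplus>\<^bsub>N\<^esub> f x = \<zero>\<^bsub>N\<^esub>"
    using assms(4)[of "\<ominus>\<^bsub>M\<^esub> x" x] assms(5) additive_zero[OF assms(1-4)] by (simp add: M.l_neg)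
  then show ?thesis
    using assms(3,5) N.minus_equality M.a_inv_closed by metis
qed

lemma module_hom_zero:
  "f \<in> module_hom R M N \<Longrightarrow> module R M \<Longrightarrow> module R N \<Longrightarrow> f \<zero>\<^bsub>M\<^esub> = \<zero>\<^bsub>N\<^esub>"
  by (rule additive_zero) (auto simp: module_hom_def module_def)

lemma module_hom_minus:
  "f \<in> module_hom R M N \<Longrightarrow> module R M \<Longrightarrow> module R N \<Longrightarrow> x \<in> carrier M \<Longrightarrow>
    f (\<ominus>\<^bsub>M\<^esub> x) = \<ominus>\<^bsub>N\<^esub> f x"
  by (rule additive_minus) (auto simp: module_hom_def module_def)

lemma module_hom_diff:
  assumes "f \<in> module_hom R M N" "module R M" "module R N" "x \<in> carrier M" "y \<in> carrier M"
  shows "f (x \<ominus>\<^bsub>M\<^esub> y) = f x \<ominus>\<^bsub>N\<^esub> f y"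
proof -
  interpret M: module R M by fact
  show ?thesis
    using module_hom_minus[OF assms(1-3,5)] module_homD[OF assms(1)] assms(4,5)
    by (simp add: a_minus_def)
qed

lemma module_hom_comp:
  "f \<in> module_hom R M N \<Longrightarrow> g \<in> module_hom R N P \<Longrightarrow> (\<lambda>x. g (f x)) \<in> module_hom R M P"
  unfolding module_hom_def by (simp add: Pi_iff)

lemma module_hom_id: "(\<lambda>x. x) \<in> module_hom R M M"
  by (auto simp: module_hom_def)

lemma module_hom_restrict_carrier:
  "f \<in> module_hom R M N \<Longrightarrow> H \<subseteq> carrier M \<Longrightarrow> f \<in> module_hom R (M\<lparr>carrier := H\<rparr>) N"
  by (auto simp: module_hom_def subset_iff)

lemma submodule_module:
  "submodule H R M \<Longrightarrow> module R M \<Longrightarrow> module R (M\<lparr>carrier := H\<rparr>)"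
  by (rule submodule.submodule_is_module)

lemma module_hom_add:
  assumes "f \<in> module_hom R M N" "g \<in> module_hom R M N" "module R M" "module R N"
  shows "(\<lambda>x. f x \<oplus>\<^bsub>N\<^esub> g x) \<in> module_hom R M N"
proof -
  interpret M: module R M by fact
  interpret N: module R N by fact
  show ?thesis
    using assms(1,2)
    by (auto simp: module_hom_def N.smult_r_distr Pi_iff N.a_ac N.add.m_lcomm)
qed

lemma module_hom_uminus:
  assumes "f \<in> module_hom R M N" "module R M" "module R N"
  shows "(\<lambda>x. \<ominus>\<^bsub>N\<^esub> f x) \<in> module_hom R M N"
proof -
  interpret M: module R M by fact
  interpret N: module R N by fact
  show ?thesis
    using assms(1)
    by (auto simp: module_hom_def N.smult_r_minus N.minus_add Pi_iff)
qed

lemma module_hom_sub: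
  assumes "f \<in> module_hom R M N" "g \<in> module_hom R M N" "module R M" "module R N"
  shows "(\<lambda>x. f x \<ominus>\<^bsub>N\<^esub> g x) \<in> module_hom R M N"
  unfolding a_minus_def by (intro module_hom_add module_hom_uminus assms)

lemma module_hom_smult:
  assumes "r \<in> carrier R" "module R M"
  shows "(\<lambda>x. r \<odot>\<^bsub>M\<^esub> x) \<in> module_hom R M M"
proof -
  interpret M: module R M by fact
  show ?thesis
    using assms(1) by (auto simp: module_hom_def M.smult_r_distr M.smult_assoc1[symmetric] M.m_comm)
qed


text \<open>Transport of structure along an injection into another carrier type. Injectivity and
  resolutions are defined for modules in prescribed types, and this is how modules get
  there.\<close>

definition image_module :: "('m \<Rightarrow> 'e) \<Rightarrow> ('r, 'm, 'y) module_scheme \<Rightarrow> ('r, 'e) module"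
  where "image_module \<phi> M =
    \<lparr> carrier = \<phi> ` carrier M, monoid.mult = undefined, one = undefined,
      ring.zero = \<phi> \<zero>\<^bsub>M\<^esub>,
      add = (\<lambda>x y. \<phi> (inv_into (carrier M) \<phi> x \<oplus>\<^bsub>M\<^esub> inv_into (carrier M) \<phi> y)),
      smult = (\<lambda>r x. \<phi> (r \<odot>\<^bsub>M\<^esub> inv_into (carrier M) \<phi> x)) \<rparr>"

lemma image_module:
  assumes "module R M" "inj_on \<phi> (carrier M)"
  shows module_image_module: "module R (image_module \<phi> M)"
    and "\<phi> \<in> module_hom R M (image_module \<phi> M)"
    and "inv_into (carrier M) \<phi> \<in> module_hom R (image_module \<phi> M) M"
proof -
  interpret M: module R M by fact
  have inv[simp]: "inv_into (carrier M) \<phi> (\<phi> x) = x" if "x \<in> carrier M" for x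
    using assms(2) that by simp
  have "abelian_group (image_module \<phi> M)"
  proof (rule abelian_groupI)
    fix x assume "x \<in> carrier (image_module \<phi> M)"
    then obtain u where "u \<in> carrier M" "x = \<phi> u" by (auto simp: image_module_def)
    then show "\<exists>y\<in>carrier (image_module \<phi> M). y \<oplus>\<^bsub>image_module \<phi> M\<^esub> x = \<zero>\<^bsub>image_module \<phi> M\<^esub>"
      by (intro bexI[of _ "\<phi> (\<ominus>\<^bsub>M\<^esub> u)"]) (auto simp: image_module_def M.l_neg)
  qed (auto simp: image_module_def M.a_ac)
  then show "module R (image_module \<phi> M)"
    by (intro moduleI M.is_cring)
      (auto simp: image_module_def M.smult_l_distr M.smult_r_distr M.smult_assoc1)
  show "\<phi> \<in> module_hom R M (image_module \<phi> M)"
    "inv_into (carrier M) \<phi> \<in> module_hom R (image_module \<phi> M) M"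
    by (auto simp: module_hom_def image_module_def)
qed

lemma carrier_image_module [simp]: "carrier (image_module \<phi> M) = \<phi> ` carrier M"
  by (simp add: image_module_def)


text \<open>Injectivity tested on ideals only. Nothing here depends on the carrier type of a test
  module, so this form rather than \<open>injective_module\<close> is carried through the
  constructions.\<close>

definition baer :: "('r, 'x) ring_scheme \<Rightarrow> ('r, 'e, 'y) module_scheme \<Rightarrow> bool"
  where "baer R E \<longleftrightarrow> (\<forall>J f. ideal J R \<and> f \<in> J \<rightarrow> carrier E \<and>
     (\<forall>x\<in>J. \<forall>y\<in>J. f (x \<oplus>\<^bsub>R\<^esub> y) = f x \<oplus>\<^bsub>E\<^esub> f y) \<and>
     (\<forall>r\<in>carrier R. \<forall>x\<in>J. f (r \<otimes>\<^bsub>R\<^esub> x) = r \<odot>\<^bsub>E\<^esub> f x) \<longrightarrow>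
     (\<exists>e\<in>carrier E. \<forall>x\<in>J. f x = x \<odot>\<^bsub>E\<^esub> e))"

lemma baerD:
  assumes "baer R E" "ideal J R" "\<And>x. x \<in> J \<Longrightarrow> f x \<in> carrier E"
     "\<And>x y. x \<in> J \<Longrightarrow> y \<in> J \<Longrightarrow> f (x \<oplus>\<^bsub>R\<^esub> y) = f x \<oplus>\<^bsub>E\<^esub> f y"
     "\<And>r x. r \<in> carrier R \<Longrightarrow> x \<in> J \<Longrightarrow> f (r \<otimes>\<^bsub>R\<^esub> x) = r \<odot>\<^bsub>E\<^esub> f x"
  obtains e where "e \<in> carrier E" "\<And>x. x \<in> J \<Longrightarrow> f x = x \<odot>\<^bsub>E\<^esub> e"
  using assms unfolding baer_def by (metis (no_types, lifting) Pi_I)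

text \<open>Baer's criterion, by Zorn's lemma for partial extensions. They are kept as graphs
  ordered by inclusion, so a chain is bounded by its union, and a maximal graph is total because a
  missing element could be adjoined.\<close>

theorem baer_extend:
  assumes Q: "module R Q" and E: "module R E" and baer: "baer R E"
    and P: "submodule P R Q" and g: "g \<in> module_hom R (Q\<lparr>carrier := P\<rparr>) E"
  obtains h where "h \<in> module_hom R Q E" "\<And>x. x \<in> P \<Longrightarrow> h x = g x"
proof -
  interpret Q: module R Q by fact
  interpret E: module R E by fact
  interpret P: module R "Q\<lparr>carrier := P\<rparr>" by (rule submodule_module[OF P Q])
  note PE = Q.submoduleE[OF P]
  \<comment> \<open>For a set closed under the operations, being single-valued amounts to having
    only zero over zero.\<close>
  define linear where "linear = (\<lambda>G. G \<subseteq> carrier Q \<times> carrier E \<and>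
     (\<forall>a b c d. (a, b) \<in> G \<longrightarrow> (c, d) \<in> G \<longrightarrow> (a \<oplus>\<^bsub>Q\<^esub> c, b \<oplus>\<^bsub>E\<^esub> d) \<in> G) \<and>
     (\<forall>r a b. r \<in> carrier R \<longrightarrow> (a, b) \<in> G \<longrightarrow> (r \<odot>\<^bsub>Q\<^esub> a, r \<odot>\<^bsub>E\<^esub> b) \<in> G) \<and>
     (\<forall>b. (\<zero>\<^bsub>Q\<^esub>, b) \<in> G \<longrightarrow> b = \<zero>\<^bsub>E\<^esub>))"
  define graphs where "graphs = {G. linear G \<and> (\<lambda>x. (x, g x)) ` P \<subseteq> G}"
  have linear_g: "linear ((\<lambda>x. (x, g x)) ` P)"
    unfolding linear_def using PE(1,4,5) module_homD[OF g] module_hom_zero[OF g P.module_axioms E]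
    by (auto simp: image_iff)
  have "\<exists>G\<in>graphs. \<forall>X\<in>graphs. G \<subseteq> X \<longrightarrow> X = G"
  proof (rule subset_Zorn_nonempty)
    show "graphs \<noteq> {}" using linear_g by (auto simp: graphs_def)
  next
    fix C assume C: "C \<noteq> {}" "subset.chain graphs C"
    have Cg: "G \<in> graphs" if "G \<in> C" for G using C(2) that by (auto simp: subset.chain_def)
    have lin: "linear G" if "G \<in> C" for G using Cg[OF that] by (simp add: graphs_def)
    have common: "\<exists>G\<in>C. p \<in> G \<and> q \<in> G" if "p \<in> \<Union>C" "q \<in> \<Union>C" for p q
    proof -
      obtain G H where GH: "G \<in> C" "H \<in> C" "p \<in> G" "q \<in> H" using \<open>p \<in> \<Union>C\<close> \<open>q \<in> \<Union>C\<close> by blast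
      then have "G \<subseteq> H \<or> H \<subseteq> G" using C(2) by (auto simp: subset.chain_def)
      with GH show ?thesis by blast
    qed
    have "linear (\<Union>C)"
      unfolding linear_def
    proof (intro conjI allI impI)
      show "\<Union>C \<subseteq> carrier Q \<times> carrier E" using lin unfolding linear_def by blast
    next
      fix a b c d assume "(a, b) \<in> \<Union>C" "(c, d) \<in> \<Union>C"
      then obtain G where "G \<in> C" "(a, b) \<in> G" "(c, d) \<in> G" using common by blast
      then show "(a \<oplus>\<^bsub>Q\<^esub> c, b \<oplus>\<^bsub>E\<^esub> d) \<in> \<Union>C" using lin[of G] unfolding linear_def by blast
    next
      fix r a b assume "r \<in> carrier R" "(a, b) \<in> \<Union>C"
      then show "(r \<odot>\<^bsub>Q\<^esub> a, r \<odot>\<^bsub>E\<^esub> b) \<in> \<Union>C" using lin unfolding linear_def by blast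
    next
      fix b assume "(\<zero>\<^bsub>Q\<^esub>, b) \<in> \<Union>C"
      then show "b = \<zero>\<^bsub>E\<^esub>" using lin unfolding linear_def by blast
    qed
    moreover have "(\<lambda>x. (x, g x)) ` P \<subseteq> \<Union>C"
      using C(1) Cg by (fastforce simp: graphs_def)
    ultimately show "\<Union>C \<in> graphs" by (simp add: graphs_def)
  qed
  then obtain G where G: "G \<in> graphs" and max: "\<And>X. X \<in> graphs \<Longrightarrow> G \<subseteq> X \<Longrightarrow> X = G" by blast
  have lin: "linear G" and gG: "\<And>x. x \<in> P \<Longrightarrow> (x, g x) \<in> G" using G by (auto simp: graphs_def)
  have GQ: "a \<in> carrier Q" and GE: "b \<in> carrier E" if "(a, b) \<in> G" for a b
    using lin that by (auto simp: linear_def)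
  have Gadd: "(a \<oplus>\<^bsub>Q\<^esub> c, b \<oplus>\<^bsub>E\<^esub> d) \<in> G" if "(a, b) \<in> G" "(c, d) \<in> G" for a b c d
    using lin that by (simp add: linear_def)
  have Gsm: "(r \<odot>\<^bsub>Q\<^esub> a, r \<odot>\<^bsub>E\<^esub> b) \<in> G" if "(a, b) \<in> G" "r \<in> carrier R" for a b r
    using lin that by (simp add: linear_def)
  have Gz: "b = \<zero>\<^bsub>E\<^esub>" if "(\<zero>\<^bsub>Q\<^esub>, b) \<in> G" for b
    using lin that by (simp add: linear_def)
  have Gneg: "(\<ominus>\<^bsub>Q\<^esub> a, \<ominus>\<^bsub>E\<^esub> b) \<in> G" if "(a, b) \<in> G" for a b
    using Gsm[OF that, of "\<ominus>\<^bsub>R\<^esub> \<one>\<^bsub>R\<^esub>"] GQ[OF that] GE[OF that]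
    by (simp add: Q.smult_l_minus E.smult_l_minus)
  have uniq: "b = b'" if "(a, b) \<in> G" "(a, b') \<in> G" for a b b'
  proof -
    have "(\<zero>\<^bsub>Q\<^esub>, b \<ominus>\<^bsub>E\<^esub> b') \<in> G"
      using Gadd[OF that(1) Gneg[OF that(2)]] GQ[OF that(1)] by (simp add: Q.r_neg a_minus_def)
    then have "b \<ominus>\<^bsub>E\<^esub> b' = \<zero>\<^bsub>E\<^esub>" by (rule Gz)
    then show ?thesis using GE[OF that(1)] GE[OF that(2)] by (simp add: E.M.minus_eq_zero_iff)
  qed
  have dom: "\<exists>b. (q, b) \<in> G" if q: "q \<in> carrier Q" for q
  proof -
    \<comment> \<open>The scalars that move \<open>q\<close> into the domain form an ideal
      \<open>J\<close>, and the graph defines a map \<open>f\<close> on it. The element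
      \<open>e\<close> that represents \<open>f\<close> is a consistent value for
      \<open>q\<close>.\<close>
    define J where "J = {r \<in> carrier R. \<exists>b. (r \<odot>\<^bsub>Q\<^esub> q, b) \<in> G}"
    define f where "f = (\<lambda>r. THE b. (r \<odot>\<^bsub>Q\<^esub> q, b) \<in> G)"
    have f: "f r = b" if "(r \<odot>\<^bsub>Q\<^esub> q, b) \<in> G" for r b
      unfolding f_def using that uniq by blast
    have zG: "(\<zero>\<^bsub>Q\<^esub>, \<zero>\<^bsub>E\<^esub>) \<in> G"
      using gG[of "\<zero>\<^bsub>Q\<^esub>"] P.M.zero_closed module_hom_zero[OF g P.module_axioms E] by simp
    have "ideal J R"
    proof (rule idealI[OF Q.R.ring_axioms])
      show "subgroup J (add_monoid R)"
      proof (rule Q.R.add.subgroupI)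
        show "J \<noteq> {}" using zG q by (auto simp: J_def intro!: exI[of _ "\<zero>\<^bsub>R\<^esub>"])
      next
        fix a assume "a \<in> J" then show "\<ominus>\<^bsub>R\<^esub> a \<in> J"
          using Gneg q by (fastforce simp: J_def Q.smult_l_minus)
      next
        fix a b assume "a \<in> J" "b \<in> J" then show "a \<oplus>\<^bsub>R\<^esub> b \<in> J"
          using Gadd q by (fastforce simp: J_def Q.smult_l_distr)
      qed (auto simp: J_def)
      have *: "x \<otimes>\<^bsub>R\<^esub> a \<in> J" if "a \<in> J" "x \<in> carrier R" for a x
        using that q Gsm by (fastforce simp: J_def Q.smult_assoc1)
      then show "x \<otimes>\<^bsub>R\<^esub> a \<in> J" if "a \<in> J" "x \<in> carrier R" for a x using that by blast
      show "a \<otimes>\<^bsub>R\<^esub> x \<in> J" if "a \<in> J" "x \<in> carrier R" for a x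
        using * that by (metis (no_types, lifting) J_def Q.R.m_comm mem_Collect_eq)
    qed
    moreover have fG: "(r \<odot>\<^bsub>Q\<^esub> q, f r) \<in> G" if "r \<in> J" for r
      using that f by (auto simp: J_def)
    ultimately obtain e where e: "e \<in> carrier E" "\<And>r. r \<in> J \<Longrightarrow> f r = r \<odot>\<^bsub>E\<^esub> e"
    proof (rule_tac baerD[OF baer, of J f], goal_cases)
      case (2 x) then show ?case using GE by blast
    next
      case (3 x y)
      then have "x \<in> carrier R" "y \<in> carrier R" by (auto simp: J_def)
      then show ?case using Gadd[OF fG fG, of x y] 3 q by (intro f) (simp add: Q.smult_l_distr)
    next
      case (4 r x)
      then have "x \<in> carrier R" by (auto simp: J_def)
      then show ?case using Gsm[OF fG, of x r] 4 q by (intro f) (simp add: Q.smult_assoc1)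
    qed auto
    define G' where "G' = {(a \<oplus>\<^bsub>Q\<^esub> r \<odot>\<^bsub>Q\<^esub> q, b \<oplus>\<^bsub>E\<^esub> r \<odot>\<^bsub>E\<^esub> e) | a b r. (a, b) \<in> G \<and> r \<in> carrier R}"
    have G'I: "(a \<oplus>\<^bsub>Q\<^esub> r \<odot>\<^bsub>Q\<^esub> q, b \<oplus>\<^bsub>E\<^esub> r \<odot>\<^bsub>E\<^esub> e) \<in> G'" if "(a, b) \<in> G" "r \<in> carrier R" for a b r
      using that by (auto simp: G'_def)
    have GG': "G \<subseteq> G'"
    proof
      fix p assume "p \<in> G"
      moreover obtain a b where "p = (a, b)" by fastforce
      ultimately show "p \<in> G'" using G'I[of a b "\<zero>\<^bsub>R\<^esub>"] GQ[of a b] GE[of a b] q e(1) by simp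
    qed
    have "linear G'"
      unfolding linear_def
    proof (intro conjI allI impI)
      show "G' \<subseteq> carrier Q \<times> carrier E" using GQ GE q e(1) by (auto simp: G'_def)
    next
      fix a b c d assume "(a, b) \<in> G'" "(c, d) \<in> G'"
      then obtain a' b' r c' d' s where *: "(a', b') \<in> G" "(c', d') \<in> G" "r \<in> carrier R" "s \<in> carrier R"
        "a = a' \<oplus>\<^bsub>Q\<^esub> r \<odot>\<^bsub>Q\<^esub> q" "b = b' \<oplus>\<^bsub>E\<^esub> r \<odot>\<^bsub>E\<^esub> e"
        "c = c' \<oplus>\<^bsub>Q\<^esub> s \<odot>\<^bsub>Q\<^esub> q" "d = d' \<oplus>\<^bsub>E\<^esub> s \<odot>\<^bsub>E\<^esub> e" by (auto simp: G'_def)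
      have "(a \<oplus>\<^bsub>Q\<^esub> c, b \<oplus>\<^bsub>E\<^esub> d) = ((a' \<oplus>\<^bsub>Q\<^esub> c') \<oplus>\<^bsub>Q\<^esub> (r \<oplus>\<^bsub>R\<^esub> s) \<odot>\<^bsub>Q\<^esub> q, (b' \<oplus>\<^bsub>E\<^esub> d') \<oplus>\<^bsub>E\<^esub> (r \<oplus>\<^bsub>R\<^esub> s) \<odot>\<^bsub>E\<^esub> e)"
        using * q e(1) GQ[OF *(1)] GQ[OF *(2)] GE[OF *(1)] GE[OF *(2)]
        by (simp add: Q.smult_l_distr E.smult_l_distr Q.M.a_ac E.M.a_ac)
      also have "\<dots> \<in> G'" using * by (intro G'I Gadd) auto
      finally show "(a \<oplus>\<^bsub>Q\<^esub> c, b \<oplus>\<^bsub>E\<^esub> d) \<in> G'" .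
    next
      fix s a b assume s: "s \<in> carrier R" and "(a, b) \<in> G'"
      then obtain a' b' r where *: "(a', b') \<in> G" "r \<in> carrier R" 
        "a = a' \<oplus>\<^bsub>Q\<^esub> r \<odot>\<^bsub>Q\<^esub> q" "b = b' \<oplus>\<^bsub>E\<^esub> r \<odot>\<^bsub>E\<^esub> e" by (auto simp: G'_def)
      have "(s \<odot>\<^bsub>Q\<^esub> a, s \<odot>\<^bsub>E\<^esub> b) = (s \<odot>\<^bsub>Q\<^esub> a' \<oplus>\<^bsub>Q\<^esub> (s \<otimes>\<^bsub>R\<^esub> r) \<odot>\<^bsub>Q\<^esub> q, s \<odot>\<^bsub>E\<^esub> b' \<oplus>\<^bsub>E\<^esub> (s \<otimes>\<^bsub>R\<^esub> r) \<odot>\<^bsub>E\<^esub> e)"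
        using * q e(1) GQ[OF *(1)] GE[OF *(1)] s
        by (simp add: Q.smult_r_distr E.smult_r_distr Q.smult_assoc1 E.smult_assoc1)
      also have "\<dots> \<in> G'" using * s by (intro G'I Gsm) auto
      finally show "(s \<odot>\<^bsub>Q\<^esub> a, s \<odot>\<^bsub>E\<^esub> b) \<in> G'" .
    next
      fix b assume "(\<zero>\<^bsub>Q\<^esub>, b) \<in> G'"
      then obtain a' b' r where *: "(a', b') \<in> G" "r \<in> carrier R" 
        "\<zero>\<^bsub>Q\<^esub> = a' \<oplus>\<^bsub>Q\<^esub> r \<odot>\<^bsub>Q\<^esub> q" "b = b' \<oplus>\<^bsub>E\<^esub> r \<odot>\<^bsub>E\<^esub> e" by (auto simp: G'_def)
      \<comment> \<open>A combination that equals zero puts \<open>r\<close> into \<open>J\<close>,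
        where \<open>f\<close> already dictates the product of \<open>r\<close> and
        \<open>e\<close>; hence \<open>G'\<close> is still single-valued.\<close>
      have "a' = \<ominus>\<^bsub>Q\<^esub> (r \<odot>\<^bsub>Q\<^esub> q)"
        using *(2,3) q GQ[OF *(1)] by (metis Q.M.minus_equality Q.smult_closed)
      then have rq: "r \<odot>\<^bsub>Q\<^esub> q = \<ominus>\<^bsub>Q\<^esub> a'" using *(2) q by simp
      then have "r \<in> J" using Gneg[OF *(1)] *(2) by (auto simp: J_def)
      then have "r \<odot>\<^bsub>E\<^esub> e = \<ominus>\<^bsub>E\<^esub> b'"
        using e(2) f[of r "\<ominus>\<^bsub>E\<^esub> b'"] Gneg[OF *(1)] rq by simp
      then show "b = \<zero>\<^bsub>E\<^esub>" using *(4) GE[OF *(1)] by (simp add: E.r_neg)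
    qed
    then have "G' \<in> graphs" using GG' G by (auto simp: graphs_def)
    then have "G' = G" using max GG' by blast
    moreover have "(q, e) \<in> G'" using G'I[OF zG, of "\<one>\<^bsub>R\<^esub>"] q e(1) by simp
    ultimately show ?thesis by blast
  qed
  define h where "h = (\<lambda>q. THE b. (q, b) \<in> G)"
  have h: "h q = b" if "(q, b) \<in> G" for q b
    unfolding h_def using that uniq by blast
  have hG: "(q, h q) \<in> G" if "q \<in> carrier Q" for q using dom[OF that] h by metis
  have "h \<in> module_hom R Q E"
  proof (rule module_homI)
    show "h x \<in> carrier E" if "x \<in> carrier Q" for x using GE[OF hG[OF that]] .
    show "h (x \<oplus>\<^bsub>Q\<^esub> y) = h x \<oplus>\<^bsub>E\<^esub> h y" if "x \<in> carrier Q" "y \<in> carrier Q" for x y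
      by (rule h[OF Gadd[OF hG hG]]) fact+
    show "h (r \<odot>\<^bsub>Q\<^esub> x) = r \<odot>\<^bsub>E\<^esub> h x" if "r \<in> carrier R" "x \<in> carrier Q" for r x
      by (rule h[OF Gsm[OF hG]]) fact+
  qed
  moreover have "h x = g x" if "x \<in> P" for x using h gG[OF that] by blast
  ultimately show ?thesis using that by blast
qed

text \<open>An arbitrary monomorphism \<open>f\<close> becomes the inclusion of a submodule once
  \<open>g\<close> is carried over to the image of \<open>f\<close>.\<close>

lemma baer_imp_injective_module:
  assumes E: "module R E" and baer: "baer R E"
  shows "injective_module R E"
  unfolding injective_module_def
proof (intro conjI allI impI, fact E)
  fix P Q :: "('a, 'a + 'c) module" and f g
  assume *: "module R P \<and> module R Q \<and> f \<in> module_hom R P Q \<and> inj_on f (carrier P) \<and> g \<in> module_hom R P E"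
  then have P: "module R P" and Q: "module R Q" and f: "f \<in> module_hom R P Q"
    and inj: "inj_on f (carrier P)" and g: "g \<in> module_hom R P E" by auto
  interpret P: module R P by fact
  interpret Q: module R Q by fact
  note fD = module_homD[OF f]
  have sub: "submodule (f ` carrier P) R Q"
  proof (rule Q.submoduleI')
    show "f ` carrier P \<subseteq> carrier Q" using fD by auto
    show "\<zero>\<^bsub>Q\<^esub> \<in> f ` carrier P" using module_hom_zero[OF f P Q] by force
    show "a \<oplus>\<^bsub>Q\<^esub> b \<in> f ` carrier P" if "a \<in> f ` carrier P" "b \<in> f ` carrier P" for a b
      using that by (auto simp: fD(2)[symmetric])
    show "a \<odot>\<^bsub>Q\<^esub> x \<in> f ` carrier P" if "a \<in> carrier R" "x \<in> f ` carrier P" for a x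
      using that by (auto simp: fD(3)[symmetric])
  qed
  have inv[simp]: "inv_into (carrier P) f (f x) = x" if "x \<in> carrier P" for x
    using inj that by simp
  have "(\<lambda>y. g (inv_into (carrier P) f y)) \<in> module_hom R (Q\<lparr>carrier := f ` carrier P\<rparr>) E"
    using module_homD[OF g] by (auto simp: module_hom_def fD(2,3)[symmetric])
  from baer_extend[OF Q E baer sub this] obtain h where
    "h \<in> module_hom R Q E" "\<And>x. x \<in> f ` carrier P \<Longrightarrow> h x = g (inv_into (carrier P) f x)" by blast
  then show "\<exists>h\<in>module_hom R Q E. \<forall>x\<in>carrier P. h (f x) = g x" by (intro bexI[of _ h]) auto
qed

definition self_module :: "('r, 'x) ring_scheme \<Rightarrow> ('r, 'r) module"
  where "self_module R = \<lparr>carrier = carrier R, monoid.mult = (\<otimes>\<^bsub>R\<^esub>), one = \<one>\<^bsub>R\<^esub>,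
    ring.zero = \<zero>\<^bsub>R\<^esub>, add = (\<oplus>\<^bsub>R\<^esub>), smult = (\<otimes>\<^bsub>R\<^esub>)\<rparr>"

lemma self_module_simps [simp]:
  "carrier (self_module R) = carrier R" "\<zero>\<^bsub>self_module R\<^esub> = \<zero>\<^bsub>R\<^esub>"
  "x \<oplus>\<^bsub>self_module R\<^esub> y = x \<oplus>\<^bsub>R\<^esub> y" "r \<odot>\<^bsub>self_module R\<^esub> x = r \<otimes>\<^bsub>R\<^esub> x"
  by (simp_all add: self_module_def)

lemma module_self_module: "cring R \<Longrightarrow> module R (self_module R)"
proof -
  assume "cring R"
  then interpret R: cring R .
  have "abelian_group (self_module R)"
  proof (rule abelian_groupI)
    fix x assume "x \<in> carrier (self_module R)"
    then show "\<exists>y\<in>carrier (self_module R). y \<oplus>\<^bsub>self_module R\<^esub> x = \<zero>\<^bsub>self_module R\<^esub>"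
      by (intro bexI[of _ "\<ominus>\<^bsub>R\<^esub> x"]) (auto simp: R.l_neg)
  qed (auto simp: R.a_ac)
  then show ?thesis
    by (intro moduleI R.is_cring) (auto simp: R.l_distr R.r_distr R.m_assoc)
qed

text \<open>The inclusion of an ideal into the ring is an admissible test, because copies of both
  under \<open>Inl\<close> live in the type \<open>'r + 'e\<close>. The extension to the whole ring
  is determined by its value at one, which is the required element.\<close>

lemma injective_module_imp_baer:
  fixes E :: "('r, 'e) module"
  assumes inj: "injective_module R E"
  shows "baer R E"
  unfolding baer_def
proof (intro allI impI, elim conjE)
  fix J f
  assume J: "ideal J R" and f: "f \<in> J \<rightarrow> carrier E"
    "\<forall>x\<in>J. \<forall>y\<in>J. f (x \<oplus>\<^bsub>R\<^esub> y) = f x \<oplus>\<^bsub>E\<^esub> f y"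
    "\<forall>r\<in>carrier R. \<forall>x\<in>J. f (r \<otimes>\<^bsub>R\<^esub> x) = r \<odot>\<^bsub>E\<^esub> f x"
  interpret E: module R E using inj by (simp add: injective_module_def)
  interpret J: ideal J R by fact
  define S where "S = self_module R"
  have S: "module R S" unfolding S_def by (rule module_self_module[OF E.R.is_cring])
  have J': "submodule J R S"
    by (rule module.submoduleI'[OF S]) (auto simp: S_def J.I_l_closed J.Icarr)
  define Q where "Q = image_module (Inl :: 'r \<Rightarrow> 'r + 'e) S"
  define P where "P = image_module (Inl :: 'r \<Rightarrow> 'r + 'e) (S\<lparr>carrier := J\<rparr>)"
  have inj_Inl: "inj_on (Inl :: 'r \<Rightarrow> 'r + 'e) X" for X by (simp add: inj_on_def)
  have Q: "module R Q" "Inl \<in> module_hom R S Q"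
    unfolding Q_def by (rule image_module[OF S inj_Inl])+
  have P: "module R P" "inv_into J Inl \<in> module_hom R P (S\<lparr>carrier := J\<rparr>)"
    using image_module(1,3)[OF submodule_module[OF J' S] inj_Inl] by (simp_all add: P_def)
  have carrP: "carrier P = Inl ` J" by (simp add: P_def)
  have inv: "inv_into J Inl (Inl x :: 'r + 'e) = x" if "x \<in> J" for x
    using that inj_Inl by (rule inv_into_f_f[rotated])
  have invR: "inv_into (carrier R) Inl (Inl x :: 'r + 'e) = x" if "x \<in> J" for x
    using J.Icarr[OF that] inj_Inl by (rule inv_into_f_f[rotated])
  have PQ: "(\<lambda>x. x) \<in> module_hom R P Q"
  proof (rule module_homI)
    show "x \<in> carrier Q" if "x \<in> carrier P" for x
      using that J.Icarr by (auto simp: carrP Q_def S_def)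
    show "x \<oplus>\<^bsub>P\<^esub> y = x \<oplus>\<^bsub>Q\<^esub> y" if "x \<in> carrier P" "y \<in> carrier P" for x y
      using that by (auto simp: carrP P_def Q_def S_def image_module_def inv invR)
    show "r \<odot>\<^bsub>P\<^esub> x = r \<odot>\<^bsub>Q\<^esub> x" if "r \<in> carrier R" "x \<in> carrier P" for r x
      using that by (auto simp: carrP P_def Q_def S_def image_module_def inv invR)
  qed
  have "f \<in> module_hom R (S\<lparr>carrier := J\<rparr>) E"
    using f by (simp add: module_hom_def S_def)
  then have "(\<lambda>x. f (inv_into J Inl x)) \<in> module_hom R P E"
    by (rule module_hom_comp[OF P(2)])
  then have "module R P \<and> module R Q \<and> (\<lambda>x. x) \<in> module_hom R P Q \<and>
      inj_on (\<lambda>x. x) (carrier P) \<and> (\<lambda>x. f (inv_into J Inl x)) \<in> module_hom R P E"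
    using P(1) Q(1) PQ by (intro conjI inj_on_id2)
  then obtain h where h: "h \<in> module_hom R Q E"
    and ext: "\<And>x. x \<in> carrier P \<Longrightarrow> h x = f (inv_into J Inl x)"
    using inj[unfolded injective_module_def, THEN conjunct2, THEN spec[of _ P], THEN spec[of _ Q],
        THEN spec, THEN spec, THEN mp] by blast
  have hS: "(\<lambda>x. h (Inl x)) \<in> module_hom R S E" by (rule module_hom_comp[OF Q(2) h])
  show "\<exists>e\<in>carrier E. \<forall>x\<in>J. f x = x \<odot>\<^bsub>E\<^esub> e"
  proof (intro bexI ballI)
    show "h (Inl \<one>\<^bsub>R\<^esub>) \<in> carrier E" using module_homD(1)[OF hS, of "\<one>\<^bsub>R\<^esub>"] by (simp add: S_def)
    fix x assume "x \<in> J"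
    then have "f x = h (Inl x)" using ext[of "Inl x"] by (simp add: carrP inv)
    also have "\<dots> = x \<odot>\<^bsub>E\<^esub> h (Inl \<one>\<^bsub>R\<^esub>)"
      using module_homD(3)[OF hS, of x "\<one>\<^bsub>R\<^esub>"] J.Icarr[OF \<open>x \<in> J\<close>] by (simp add: S_def)
    finally show "f x = x \<odot>\<^bsub>E\<^esub> h (Inl \<one>\<^bsub>R\<^esub>)" .
  qed
qed

section \<open>Modules over the integers and divisible groups\<close>

lemma Z_module_step:
  assumes "module \<Z> M" "x \<in> carrier M"
  shows "(i + 1) \<odot>\<^bsub>M\<^esub> x = i \<odot>\<^bsub>M\<^esub> x \<oplus>\<^bsub>M\<^esub> x"
    and "(i - 1) \<odot>\<^bsub>M\<^esub> x = i \<odot>\<^bsub>M\<^esub> x \<oplus>\<^bsub>M\<^esub> (\<ominus>\<^bsub>M\<^esub> x)"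
proof -
  interpret M: module \<Z> M by fact
  show step: "(i + 1) \<odot>\<^bsub>M\<^esub> x = i \<odot>\<^bsub>M\<^esub> x \<oplus>\<^bsub>M\<^esub> x" for i
    using M.smult_l_distr[of i 1 x] M.smult_one[of x] assms(2) by simp
  show "(i - 1) \<odot>\<^bsub>M\<^esub> x = i \<odot>\<^bsub>M\<^esub> x \<oplus>\<^bsub>M\<^esub> (\<ominus>\<^bsub>M\<^esub> x)"
    using step[of "i - 1"] M.smult_closed[of "i - 1" x] assms(2) by (simp add: M.M.a_assoc M.r_neg)
qed

lemma Z_submoduleI:
  assumes M: "module \<Z> M" and "H \<subseteq> carrier M" "\<zero>\<^bsub>M\<^esub> \<in> H"
    "\<And>a b. a \<in> H \<Longrightarrow> b \<in> H \<Longrightarrow> a \<oplus>\<^bsub>M\<^esub> b \<in> H" "\<And>a. a \<in> H \<Longrightarrow> \<ominus>\<^bsub>M\<^esub> a \<in> H"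
  shows "submodule H \<Z> M"
proof -
  interpret M: module \<Z> M by fact
  have "i \<odot>\<^bsub>M\<^esub> x \<in> H" if "x \<in> H" for i :: int and x
  proof (induction i rule: int_induct[where k = 0])
    case base
    then show ?case using M.smult_l_null[of x] that assms by auto
  qed (use that assms Z_module_step[OF M] in auto)
  with assms show ?thesis by (intro M.submoduleI') auto
qed

lemma additive_imp_Z_linear:
  assumes M: "module \<Z> M" and N: "module \<Z> N"
    and f: "\<And>x. x \<in> carrier M \<Longrightarrow> f x \<in> carrier N"
      "\<And>x y. x \<in> carrier M \<Longrightarrow> y \<in> carrier M \<Longrightarrow> f (x \<oplus>\<^bsub>M\<^esub> y) = f x \<oplus>\<^bsub>N\<^esub> f y"
  shows "f \<in> module_hom \<Z> M N"
proof -
  interpret M: module \<Z> M by fact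
  interpret N: module \<Z> N by fact
  note ab = M.abelian_group_axioms N.abelian_group_axioms
  have "f (i \<odot>\<^bsub>M\<^esub> x) = i \<odot>\<^bsub>N\<^esub> f x" if x: "x \<in> carrier M" for i :: int and x
  proof (induction i rule: int_induct[where k = 0])
    case base
    then show ?case
      using M.smult_l_null[of x] N.smult_l_null[of "f x"] x f additive_zero[OF ab f] by auto
  next
    case (step1 i)
    then show ?case using x f M.smult_closed[of i x] by (simp add: Z_module_step[OF M] Z_module_step[OF N])
  next
    case (step2 i)
    then show ?case using x f M.smult_closed[of i x] additive_minus[OF ab f]
      by (simp add: Z_module_step[OF M] Z_module_step[OF N])
  qed
  then show ?thesis using f by (intro module_homI) auto
qed

lemma int_ideal_principal:
  assumes "ideal J \<Z>"
  obtains n where "J = {x. n dvd x}"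
proof (cases "\<exists>n\<in>J. n > 0")
  case False
  interpret ideal J \<Z> by fact
  have neg: "- x \<in> J" if "x \<in> J" for x using I_l_closed[OF that, of "-1"] by simp
  have "J = {x. 0 dvd x}" using False neg zero_closed by (force simp: not_less)
  then show ?thesis using that by blast
next
  case True
  interpret ideal J \<Z> by fact
  define m where "m = (LEAST m. 0 < m \<and> int m \<in> J)"
  have "\<exists>m. 0 < m \<and> int m \<in> J" using True by (metis pos_int_cases of_nat_0_less_iff)
  from LeastI_ex[OF this] have m: "0 < m" "int m \<in> J" by (auto simp: m_def)
  have "int m dvd x" if "x \<in> J" for x
  proof -
    have "x + (- (x div int m)) * int m \<in> J"
      using a_closed[OF that I_l_closed[OF m(2), of "- (x div int m)"]] by simp
    then have "int (nat (x mod int m)) \<in> J" using m(1) by (simp add: minus_div_mult_eq_mod)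
    moreover have "nat (x mod int m) < m" using m(1) by (simp add: nat_less_iff)
    ultimately have "nat (x mod int m) = 0"
      using not_less_Least[of "nat (x mod int m)" "\<lambda>m. 0 < m \<and> int m \<in> J"] by (auto simp: m_def)
    then show ?thesis using m(1) pos_mod_sign[of "int m" x] by (auto simp: dvd_eq_mod_eq_0)
  qed
  moreover have "x \<in> J" if "int m dvd x" for x
    using that I_r_closed[OF m(2)] by (auto simp: dvd_def)
  ultimately have "J = {x. int m dvd x}" by blast
  then show ?thesis using that by blast
qed

definition Z_module :: "('m, 'x) ring_scheme \<Rightarrow> (int, 'm) module"
  where "Z_module G = \<lparr>carrier = carrier G, monoid.mult = undefined, one = undefined,
    ring.zero = \<zero>\<^bsub>G\<^esub>, add = add G, smult = (\<lambda>n x. [n] \<cdot>\<^bsub>G\<^esub> x)\<rparr>"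

lemma Z_module_simps [simp]:
  "carrier (Z_module G) = carrier G" "\<zero>\<^bsub>Z_module G\<^esub> = \<zero>\<^bsub>G\<^esub>"
  "x \<oplus>\<^bsub>Z_module G\<^esub> y = x \<oplus>\<^bsub>G\<^esub> y" "n \<odot>\<^bsub>Z_module G\<^esub> x = [n] \<cdot>\<^bsub>G\<^esub> x"
  by (simp_all add: Z_module_def)

lemma module_Z_module:
  assumes "abelian_group G"
  shows "module \<Z> (Z_module G)"
proof -
  interpret G: abelian_group G by fact
  have "abelian_group (Z_module G)"
  proof (rule abelian_groupI)
    fix x assume "x \<in> carrier (Z_module G)"
    then show "\<exists>y\<in>carrier (Z_module G). y \<oplus>\<^bsub>Z_module G\<^esub> x = \<zero>\<^bsub>Z_module G\<^esub>"
      by (intro bexI[of _ "\<ominus>\<^bsub>G\<^esub> x"]) (auto simp: G.l_neg)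
  qed (auto simp: G.a_ac)
  then show ?thesis
    by (intro moduleI int_is_cring)
      (auto simp: G.add.int_pow_mult G.add.int_pow_pow mult.commute G.add.int_pow_distrib)
qed

text \<open>An ideal of the integers has a single generator \<open>n\<close>, so a map on it is
  fixed by its value at \<open>n\<close>, and dividing that value by \<open>n\<close> gives the
  representing element. The zero ideal is separate because divisibility excludes
  \<open>n = 0\<close>.\<close>

lemma divisible_imp_baer:
  assumes D: "module \<Z> D"
    and div: "\<And>n x. n \<noteq> 0 \<Longrightarrow> x \<in> carrier D \<Longrightarrow> \<exists>y\<in>carrier D. n \<odot>\<^bsub>D\<^esub> y = x"
  shows "baer \<Z> D"
  unfolding baer_def
proof (intro allI impI, elim conjE)
  interpret D: module \<Z> D by fact
  fix J f
  assume J: "ideal J \<Z>" and f: "f \<in> J \<rightarrow> carrier D"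
    "\<forall>r\<in>carrier \<Z>. \<forall>x\<in>J. f (r \<otimes>\<^bsub>\<Z>\<^esub> x) = r \<odot>\<^bsub>D\<^esub> f x"
  interpret J: ideal J \<Z> by fact
  obtain n where J_eq: "J = {x. n dvd x}" using int_ideal_principal[OF J] by blast
  then have nJ: "n \<in> J" by simp
  show "\<exists>e\<in>carrier D. \<forall>x\<in>J. f x = x \<odot>\<^bsub>D\<^esub> e"
  proof (cases "n = 0")
    case True
    have "f 0 = 0 \<odot>\<^bsub>D\<^esub> f 0" using f(2)[rule_format, of 0 0] nJ True by simp
    then have "f 0 = \<zero>\<^bsub>D\<^esub>" using f(1) nJ True D.smult_l_null[of "f 0"] by auto
    then show ?thesis using True J_eq D.smult_l_null[of "\<zero>\<^bsub>D\<^esub>"] by (intro bexI[of _ "\<zero>\<^bsub>D\<^esub>"]) auto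
  next
    case False
    then obtain e where e: "e \<in> carrier D" "n \<odot>\<^bsub>D\<^esub> e = f n" using div f(1) nJ by blast
    have "f x = x \<odot>\<^bsub>D\<^esub> e" if "x \<in> J" for x
    proof -
      have "n dvd x" using that J_eq by simp
      then obtain k where "x = n * k" by (rule dvdE)
      then have k: "x = k * n" by simp
      then have "f x = k \<odot>\<^bsub>D\<^esub> f n" using f(2) nJ by simp
      also have "\<dots> = x \<odot>\<^bsub>D\<^esub> e" using e D.smult_assoc1[of k n e] k by simp
      finally show ?thesis .
    qed
    then show ?thesis using e(1) by blast
  qed
qed

text \<open>Cosets would raise the carrier type by one level of sets. One representative per coset
  keeps the quotient in the type of \<open>M\<close> and even inside its carrier, which preserves
  the finiteness of supports in \<open>divisible_hull\<close>.\<close>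

lemma quotient_by_representatives:
  fixes M :: "('r, 'm, 'y) module_scheme"
  assumes M: "module R M" and H: "submodule H R M"
  obtains Q :: "('r, 'm) module" and p where
    "module R Q" "p \<in> module_hom R M Q" "carrier Q = p ` carrier M" "carrier Q \<subseteq> carrier M"
    "\<And>x. x \<in> carrier M \<Longrightarrow> p x = \<zero>\<^bsub>Q\<^esub> \<longleftrightarrow> x \<in> H"
proof -
  interpret M: module R M by fact
  note HE = M.submoduleE[OF H]
  define p where "p = (\<lambda>x. SOME y. y \<in> carrier M \<and> y \<ominus>\<^bsub>M\<^esub> x \<in> H)"
  have zH: "\<zero>\<^bsub>M\<^esub> \<in> H" using M.submoduleE(2,4)[OF H] HE(1)
    by (metis M.R.zero_closed M.smult_l_null ex_in_conv subset_iff)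
  have p: "p x \<in> carrier M" "p x \<ominus>\<^bsub>M\<^esub> x \<in> H" if "x \<in> carrier M" for x
  proof -
    have "\<exists>y. y \<in> carrier M \<and> y \<ominus>\<^bsub>M\<^esub> x \<in> H"
      using that zH by (intro exI[of _ x]) (simp add: a_minus_def M.r_neg)
    from someI_ex[OF this] show "p x \<in> carrier M" "p x \<ominus>\<^bsub>M\<^esub> x \<in> H" unfolding p_def by auto
  qed
  have trans: "x \<ominus>\<^bsub>M\<^esub> z \<in> H" if "x \<ominus>\<^bsub>M\<^esub> y \<in> H" "y \<ominus>\<^bsub>M\<^esub> z \<in> H" "x \<in> carrier M" "y \<in> carrier M" "z \<in> carrier M" for x y z
  proof -
    have "x \<ominus>\<^bsub>M\<^esub> z = (x \<ominus>\<^bsub>M\<^esub> y) \<oplus>\<^bsub>M\<^esub> (y \<ominus>\<^bsub>M\<^esub> z)"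
      using that(3-5) by (simp add: a_minus_def M.M.a_assoc M.r_neg1 M.r_neg2)
    then show ?thesis using HE(5)[OF that(1,2)] by simp
  qed
  have sym: "y \<ominus>\<^bsub>M\<^esub> x \<in> H" if "x \<ominus>\<^bsub>M\<^esub> y \<in> H" "x \<in> carrier M" "y \<in> carrier M" for x y
    using HE(3)[OF that(1)] that(2,3) by (simp add: a_minus_def M.minus_add M.M.a_comm)
  have eq: "p x = p y" if "x \<ominus>\<^bsub>M\<^esub> y \<in> H" "x \<in> carrier M" "y \<in> carrier M" for x y
  proof -
    have "(\<lambda>z. z \<in> carrier M \<and> z \<ominus>\<^bsub>M\<^esub> x \<in> H) = (\<lambda>z. z \<in> carrier M \<and> z \<ominus>\<^bsub>M\<^esub> y \<in> H)"
      using trans sym that by blast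
    then show ?thesis by (simp add: p_def)
  qed
  have eqD: "x \<ominus>\<^bsub>M\<^esub> y \<in> H" if "p x = p y" "x \<in> carrier M" "y \<in> carrier M" for x y
    using trans[of x "p x" y] sym p that by metis
  define Q :: "('r, 'm) module" where "Q = \<lparr>carrier = p ` carrier M, monoid.mult = undefined, one = undefined,
    ring.zero = p \<zero>\<^bsub>M\<^esub>, add = (\<lambda>x y. p (x \<oplus>\<^bsub>M\<^esub> y)), smult = (\<lambda>r x. p (r \<odot>\<^bsub>M\<^esub> x))\<rparr>"
  have padd: "p (p x \<oplus>\<^bsub>M\<^esub> p y) = p (x \<oplus>\<^bsub>M\<^esub> y)" if "x \<in> carrier M" "y \<in> carrier M" for x y
  proof (rule eq)
    have "(p x \<oplus>\<^bsub>M\<^esub> p y) \<ominus>\<^bsub>M\<^esub> (x \<oplus>\<^bsub>M\<^esub> y) = (p x \<ominus>\<^bsub>M\<^esub> x) \<oplus>\<^bsub>M\<^esub> (p y \<ominus>\<^bsub>M\<^esub> y)"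
      using that p by (simp add: a_minus_def M.minus_add M.M.a_ac)
    then show "(p x \<oplus>\<^bsub>M\<^esub> p y) \<ominus>\<^bsub>M\<^esub> (x \<oplus>\<^bsub>M\<^esub> y) \<in> H" using HE(5) p that by simp
  qed (use that p in auto)
  have psmult: "p (r \<odot>\<^bsub>M\<^esub> p x) = p (r \<odot>\<^bsub>M\<^esub> x)" if "x \<in> carrier M" "r \<in> carrier R" for x r
  proof (rule eq)
    have "r \<odot>\<^bsub>M\<^esub> p x \<ominus>\<^bsub>M\<^esub> r \<odot>\<^bsub>M\<^esub> x = r \<odot>\<^bsub>M\<^esub> (p x \<ominus>\<^bsub>M\<^esub> x)"
      using that p by (simp add: a_minus_def M.smult_r_distr M.smult_r_minus)
    then show "r \<odot>\<^bsub>M\<^esub> p x \<ominus>\<^bsub>M\<^esub> r \<odot>\<^bsub>M\<^esub> x \<in> H" using HE(4) p that by simp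
  qed (use that p in auto)
  have pp: "p (p x) = p x" if "x \<in> carrier M" for x
    by (rule eq) (use p that in auto)
  have padd1: "p (p x \<oplus>\<^bsub>M\<^esub> y) = p (x \<oplus>\<^bsub>M\<^esub> y)" if "x \<in> carrier M" "y \<in> carrier M" for x y
    using padd[of "p x" y] padd[of x y] pp p that by simp
  have padd2: "p (x \<oplus>\<^bsub>M\<^esub> p y) = p (x \<oplus>\<^bsub>M\<^esub> y)" if "x \<in> carrier M" "y \<in> carrier M" for x y
    using padd[of x "p y"] padd[of x y] pp p that by simp
  have "abelian_group Q"
  proof (rule abelian_groupI)
    fix x assume "x \<in> carrier Q"
    then obtain u where "u \<in> carrier M" "x = p u" by (auto simp: Q_def)
    then show "\<exists>y\<in>carrier Q. y \<oplus>\<^bsub>Q\<^esub> x = \<zero>\<^bsub>Q\<^esub>"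
      by (intro bexI[of _ "p (\<ominus>\<^bsub>M\<^esub> u)"]) (auto simp: Q_def padd M.l_neg)
  next
    fix x y z assume "x \<in> carrier Q" "y \<in> carrier Q" "z \<in> carrier Q"
    then obtain a b c where *: "a \<in> carrier M" "b \<in> carrier M" "c \<in> carrier M"
      "x = p a" "y = p b" "z = p c" by (auto simp: Q_def)
    then show "x \<oplus>\<^bsub>Q\<^esub> y \<oplus>\<^bsub>Q\<^esub> z = x \<oplus>\<^bsub>Q\<^esub> (y \<oplus>\<^bsub>Q\<^esub> z)"
      by (simp add: Q_def padd M.M.a_assoc)
  qed (auto simp: Q_def p padd padd2 pp M.M.a_comm)
  then have Q: "module R Q"
    by (intro moduleI M.R.is_cring)
      (auto simp: Q_def p padd padd1 padd2 psmult pp M.smult_l_distr[symmetric] M.smult_r_distr[symmetric] M.smult_assoc1[symmetric])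
  have "p \<in> module_hom R M Q"
    by (auto simp: module_hom_def Q_def padd psmult)
  moreover have "p x = \<zero>\<^bsub>Q\<^esub> \<longleftrightarrow> x \<in> H" if "x \<in> carrier M" for x
    using eq[of x "\<zero>\<^bsub>M\<^esub>"] eqD[of x "\<zero>\<^bsub>M\<^esub>"] that M.M.minus_equality[of "\<zero>\<^bsub>M\<^esub>" "\<zero>\<^bsub>M\<^esub>"]
    by (auto simp: Q_def a_minus_def)
  ultimately show thesis
    using that[OF Q] p by (auto simp: Q_def)
qed


text \<open>The quotient of \<open>C\<close> by \<open>H\<close> is the free abelian group on the
  elements of \<open>C\<close> modulo the preimage of \<open>H\<close>. The free group sits inside
  the rational vector space on the same basis, which is divisible, and so is the quotient of that
  space by \<open>S\<close>. Basis vectors induce the embedding. Treating \<open>C\<close> and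
  \<open>H\<close> together spares a separate quotient module when cokernels are embedded.\<close>

lemma divisible_hull:
  fixes C :: "('c, 'x) ring_scheme"
  assumes C: "abelian_group C" and H: "subgroup H (add_monoid C)"
  obtains D :: "(int, 'c \<Rightarrow> rat) module" and \<theta> where
    "module \<Z> D" "baer \<Z> D" "carrier D \<subseteq> {f. finite {c. f c \<noteq> 0}}"
    "\<And>x. x \<in> carrier C \<Longrightarrow> \<theta> x \<in> carrier D"
    "\<And>x y. x \<in> carrier C \<Longrightarrow> y \<in> carrier C \<Longrightarrow> \<theta> (x \<oplus>\<^bsub>C\<^esub> y) = \<theta> x \<oplus>\<^bsub>D\<^esub> \<theta> y"
    "\<And>x. x \<in> carrier C \<Longrightarrow> \<theta> x = \<zero>\<^bsub>D\<^esub> \<longleftrightarrow> x \<in> H"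
proof -
  interpret C: abelian_group C by fact
  interpret H: subgroup H "add_monoid C" by fact
  define V :: "(int, 'c \<Rightarrow> rat) module" where
    "V = \<lparr>carrier = {f. finite {c. f c \<noteq> 0}}, monoid.mult = undefined, one = undefined,
      ring.zero = (\<lambda>c. 0), add = (\<lambda>f g c. f c + g c), smult = (\<lambda>n f c. of_int n * f c)\<rparr>"
  have fin_add: "finite {c. f c + g c \<noteq> 0}"
    if "finite {c. f c \<noteq> 0}" "finite {c. g c \<noteq> 0}" for f g :: "'c \<Rightarrow> rat"
    by (rule finite_subset[OF _ finite_UnI[OF that]]) auto
  have fin_mult: "finite {c. q * f c \<noteq> 0}" if "finite {c. f c \<noteq> 0}" for f :: "'c \<Rightarrow> rat" and q
    by (rule finite_subset[OF _ that]) auto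
  have "abelian_group V"
  proof (rule abelian_groupI)
    fix x assume "x \<in> carrier V"
    then show "\<exists>y\<in>carrier V. y \<oplus>\<^bsub>V\<^esub> x = \<zero>\<^bsub>V\<^esub>"
      by (intro bexI[of _ "\<lambda>c. - x c"]) (auto simp: V_def)
  qed (auto simp: V_def fin_add)
  then have V: "module \<Z> V"
    by (intro moduleI int_is_cring) (auto simp: V_def fin_mult distrib_left distrib_right mult.assoc simp del: mult_eq_0_iff)
  interpret V: module \<Z> V by fact
  let ?F = "free_Abelian_group (carrier C)"
  obtain h where h: "h \<in> hom ?F (add_monoid C)" "\<And>x. x \<in> carrier C \<Longrightarrow> h (frag_of x) = x"
    using comm_group.free_Abelian_group_universal[OF C.a_comm_group, of "\<lambda>x. x" "carrier C"] by auto
  interpret h: group_hom ?F "add_monoid C" h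
    by (intro group_hom.intro group_hom_axioms.intro h(1) C.a_group) auto
  define j :: "('c \<Rightarrow>\<^sub>0 int) \<Rightarrow> 'c \<Rightarrow> rat" where "j = (\<lambda>z c. of_int (Poly_Mapping.lookup z c))"
  have j_add: "j (y + z) = j y \<oplus>\<^bsub>V\<^esub> j z" for y z by (simp add: j_def V_def lookup_add)
  have j_carrier: "j z \<in> carrier V" for z by (simp add: j_def V_def)
  have j_inj: "y = z" if "j y = j z" for y z
    by (rule poly_mapping_eqI) (use fun_cong[OF that] in \<open>auto simp: j_def\<close>)
  have j_zero: "j 0 = \<zero>\<^bsub>V\<^esub>" by (simp add: j_def V_def)
  have j_neg: "j (- z) = \<ominus>\<^bsub>V\<^esub> j z" for z
    using V.M.minus_equality[of "j (- z)" "j z"] j_add[of "- z" z] j_zero j_carrier by simp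
  define S where "S = j ` {z \<in> carrier ?F. h z \<in> H}"
  have S: "submodule S \<Z> V"
  proof (rule Z_submoduleI[OF V])
    show "S \<subseteq> carrier V" using j_carrier by (auto simp: S_def)
    show "\<zero>\<^bsub>V\<^esub> \<in> S"
      using h.hom_one H.one_closed by (auto simp: S_def j_zero[symmetric] intro!: imageI)
    show "a \<oplus>\<^bsub>V\<^esub> b \<in> S" if ab: "a \<in> S" "b \<in> S" for a b
    proof -
      obtain y z where *: "y \<in> carrier ?F" "z \<in> carrier ?F" "h y \<in> H" "h z \<in> H" "a = j y" "b = j z"
        using ab unfolding S_def by (elim imageE CollectE conjE)
      have "y + z \<in> carrier ?F" "h (y + z) \<in> H"
        using h.G.m_closed[OF *(1,2)] h.hom_mult[OF *(1,2)] H.m_closed[OF *(3,4)] by auto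
      then show ?thesis using * by (auto simp: S_def j_add[symmetric] simp del: carrier_free_Abelian_group_iff)
    qed
    show "\<ominus>\<^bsub>V\<^esub> a \<in> S" if aS: "a \<in> S" for a
    proof -
      obtain y where *: "y \<in> carrier ?F" "h y \<in> H" "a = j y"
        using aS unfolding S_def by (elim imageE CollectE conjE)
      have "- y \<in> carrier ?F" "h (- y) \<in> H"
        using h.hom_inv[OF *(1)] * H.m_inv_closed[OF *(2)] by auto
      then show ?thesis using * by (auto simp: S_def j_neg[symmetric] simp del: carrier_free_Abelian_group_iff)
    qed
  qed
  obtain D :: "(int, 'c \<Rightarrow> rat) module" and p where D: "module \<Z> D"
    and p: "p \<in> module_hom \<Z> V D" "carrier D = p ` carrier V" "carrier D \<subseteq> carrier V"
    and ker: "\<And>x. x \<in> carrier V \<Longrightarrow> p x = \<zero>\<^bsub>D\<^esub> \<longleftrightarrow> x \<in> S"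
    by (rule quotient_by_representatives[OF V S]) (rule that)
  interpret D: module \<Z> D by fact
  have "baer \<Z> D"
  proof (rule divisible_imp_baer[OF D])
    fix n :: int and x assume n: "n \<noteq> 0" and "x \<in> carrier D"
    then obtain f where f: "f \<in> carrier V" "x = p f" using p(2) by blast
    let ?g = "\<lambda>c. inverse (of_int n) * f c"
    have g: "?g \<in> carrier V" using f(1) fin_mult by (simp add: V_def)
    have "n \<odot>\<^bsub>V\<^esub> ?g = f" using n by (simp add: V_def mult.assoc[symmetric])
    then have "n \<odot>\<^bsub>D\<^esub> p ?g = x" using module_homD(3)[OF p(1) _ g, of n] f by simp
    then show "\<exists>y\<in>carrier D. n \<odot>\<^bsub>D\<^esub> y = x" using module_homD(1)[OF p(1) g] by blast
  qed
  define \<theta> where "\<theta> = (\<lambda>x. p (j (frag_of x)))"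
  have add: "\<theta> (x \<oplus>\<^bsub>C\<^esub> y) = \<theta> x \<oplus>\<^bsub>D\<^esub> \<theta> y" if xy: "x \<in> carrier C" "y \<in> carrier C" for x y
  proof -
    \<comment> \<open>The failure of basis vectors to add up. It is an integral combination that
      \<open>h\<close> sends to zero, so it lies in \<open>S\<close> and disappears in
      \<open>D\<close>.\<close>
    let ?z = "frag_of (x \<oplus>\<^bsub>C\<^esub> y) - (frag_of x + frag_of y)"
    have fx: "frag_of x \<in> carrier ?F" "frag_of y \<in> carrier ?F" "frag_of (x \<oplus>\<^bsub>C\<^esub> y) \<in> carrier ?F"
      using xy by auto
    have "frag_of x + frag_of y \<in> carrier ?F" using h.G.m_closed[OF fx(1,2)] by simp
    moreover have diff: "u - v \<in> carrier ?F \<and> h (u - v) = h u \<oplus>\<^bsub>C\<^esub> \<ominus>\<^bsub>C\<^esub> h v"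
      if "u \<in> carrier ?F" "v \<in> carrier ?F" for u v
      using h.G.m_closed[OF that(1) h.G.inv_closed[OF that(2)]]
        h.hom_mult[OF that(1) h.G.inv_closed[OF that(2)]] h.hom_inv[OF that(2)] that
      by (simp add: a_inv_def)
    ultimately have z: "?z \<in> carrier ?F" "h ?z = (x \<oplus>\<^bsub>C\<^esub> y) \<oplus>\<^bsub>C\<^esub> (\<ominus>\<^bsub>C\<^esub> (x \<oplus>\<^bsub>C\<^esub> y))"
      using diff[OF fx(3), of "frag_of x + frag_of y"] h.hom_mult[OF fx(1,2)] h(2) xy
      by simp_all
    then have "h ?z = \<zero>\<^bsub>C\<^esub>" using xy by (simp add: C.r_neg)
    then have "j ?z \<in> S" using z(1) H.one_closed by (auto simp: S_def simp del: carrier_free_Abelian_group_iff)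
    then have "p (j ?z) = \<zero>\<^bsub>D\<^esub>" using ker j_carrier by blast
    moreover have "j (frag_of (x \<oplus>\<^bsub>C\<^esub> y)) = j ?z \<oplus>\<^bsub>V\<^esub> (j (frag_of x) \<oplus>\<^bsub>V\<^esub> j (frag_of y))"
      by (simp add: j_add[symmetric])
    ultimately show ?thesis
      using module_homD(1,2)[OF p(1)] j_carrier by (simp add: \<theta>_def)
  qed
  have ker': "\<theta> x = \<zero>\<^bsub>D\<^esub> \<longleftrightarrow> x \<in> H" if "x \<in> carrier C" for x
  proof -
    have "j (frag_of x) \<in> S \<longleftrightarrow> frag_of x \<in> {z \<in> carrier ?F. h z \<in> H}"
      unfolding S_def by (rule inj_image_mem_iff) (rule injI, rule j_inj)
    then show ?thesis using ker[OF j_carrier] h(2) that by (simp add: \<theta>_def)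
  qed
  have closed: "\<theta> x \<in> carrier D" for x using p(2) j_carrier by (auto simp: \<theta>_def)
  have fin: "carrier D \<subseteq> {f. finite {c. f c \<noteq> 0}}" using p(3) by (simp add: V_def)
  show thesis by (rule that[OF D \<open>baer \<Z> D\<close> fin closed add ker'])
qed


lemma baer_image_module:
  assumes E: "module R E" and inj: "inj_on \<phi> (carrier E)" and baer: "baer R E"
  shows "baer R (image_module \<phi> E)"
  unfolding baer_def
proof (intro allI impI, elim conjE)
  let ?I = "image_module \<phi> E" and ?i = "inv_into (carrier E) \<phi>"
  fix J f
  assume J: "ideal J R" and f: "f \<in> J \<rightarrow> carrier ?I"
    "\<forall>x\<in>J. \<forall>y\<in>J. f (x \<oplus>\<^bsub>R\<^esub> y) = f x \<oplus>\<^bsub>?I\<^esub> f y"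
    "\<forall>r\<in>carrier R. \<forall>x\<in>J. f (r \<otimes>\<^bsub>R\<^esub> x) = r \<odot>\<^bsub>?I\<^esub> f x"
  note im = image_module[OF E inj]
  have fJ: "f x \<in> carrier ?I" if "x \<in> J" for x using f(1) that by blast
  obtain e where e: "e \<in> carrier E" "\<And>x. x \<in> J \<Longrightarrow> ?i (f x) = x \<odot>\<^bsub>E\<^esub> e"
  proof (rule baerD[OF baer J, of "\<lambda>x. ?i (f x)"], goal_cases)
    case (1 x) then show ?case using module_homD(1)[OF im(3)] fJ by blast
  next
    case (2 x y) then show ?case using module_homD(2)[OF im(3)] fJ f(2) by simp
  next
    case (3 r x) then show ?case using module_homD(3)[OF im(3)] fJ f(3) by simp
  qed auto
  have "f x = x \<odot>\<^bsub>?I\<^esub> \<phi> e" if x: "x \<in> J" for x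
  proof -
    have "f x = \<phi> (?i (f x))" using fJ[OF x] by (simp add: f_inv_into_f)
    also have "\<dots> = x \<odot>\<^bsub>?I\<^esub> \<phi> e"
      using e x module_homD(3)[OF im(2)] ideal.Icarr[OF J x] by simp
    finally show ?thesis .
  qed
  then show "\<exists>e\<in>carrier ?I. \<forall>x\<in>J. f x = x \<odot>\<^bsub>?I\<^esub> e" using e(1) by auto
qed

text \<open>Fixing the values outside the carrier of \<open>R\<close> makes equal maps equal functions.\<close>

definition coinduced_module :: "('r, 'x) ring_scheme \<Rightarrow> ('k, 'd, 'y) module_scheme \<Rightarrow> ('r, 'r \<Rightarrow> 'd) module"
  where "coinduced_module R D =
    \<lparr>carrier = {\<phi>. (\<forall>s. \<phi> s \<in> carrier D) \<and> (\<forall>s. s \<notin> carrier R \<longrightarrow> \<phi> s = \<zero>\<^bsub>D\<^esub>) \<and>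
        (\<forall>s\<in>carrier R. \<forall>t\<in>carrier R. \<phi> (s \<oplus>\<^bsub>R\<^esub> t) = \<phi> s \<oplus>\<^bsub>D\<^esub> \<phi> t)},
      monoid.mult = undefined, one = undefined, ring.zero = (\<lambda>s. \<zero>\<^bsub>D\<^esub>),
      add = (\<lambda>\<phi> \<psi> s. \<phi> s \<oplus>\<^bsub>D\<^esub> \<psi> s),
      smult = (\<lambda>r \<phi> s. if s \<in> carrier R then \<phi> (s \<otimes>\<^bsub>R\<^esub> r) else \<zero>\<^bsub>D\<^esub>)\<rparr>"

lemma module_coinduced_module:
  assumes "cring R" "abelian_group D"
  shows "module R (coinduced_module R D)"
proof -
  interpret R: cring R by fact
  interpret D: abelian_group D by fact
  have "abelian_group (coinduced_module R D)"
  proof (rule abelian_groupI)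
    fix x assume "x \<in> carrier (coinduced_module R D)"
    then show "\<exists>y\<in>carrier (coinduced_module R D).
        y \<oplus>\<^bsub>coinduced_module R D\<^esub> x = \<zero>\<^bsub>coinduced_module R D\<^esub>"
      by (intro bexI[of _ "\<lambda>s. \<ominus>\<^bsub>D\<^esub> x s"])
        (auto simp: coinduced_module_def D.l_neg D.minus_add D.minus_equality)
  qed (auto simp: coinduced_module_def D.a_ac)
  then show ?thesis
    by (intro moduleI R.is_cring)
      (auto simp: coinduced_module_def fun_eq_iff R.l_distr R.r_distr R.m_assoc)
qed

text \<open>Adjunction between restriction and coinduction: \<open>f\<close> corresponds to the
  additive map that sends \<open>x\<close> to the value of \<open>f x\<close> at one. This map
  extends from \<open>J\<close> to the ring because \<open>D\<close> is injective over the integers,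
  and the extension is the representing element.\<close>

lemma baer_coinduced_module:
  assumes R: "cring R" and D: "module \<Z> D" "baer \<Z> D"
  shows "baer R (coinduced_module R D)"
  unfolding baer_def
proof (intro allI impI, elim conjE)
  interpret R: cring R by fact
  interpret D: module \<Z> D by fact
  let ?E = "coinduced_module R D"
  fix J f
  assume J: "ideal J R" and f: "f \<in> J \<rightarrow> carrier ?E"
    "\<forall>x\<in>J. \<forall>y\<in>J. f (x \<oplus>\<^bsub>R\<^esub> y) = f x \<oplus>\<^bsub>?E\<^esub> f y"
    "\<forall>r\<in>carrier R. \<forall>x\<in>J. f (r \<otimes>\<^bsub>R\<^esub> x) = r \<odot>\<^bsub>?E\<^esub> f x"
  interpret J: ideal J R by fact
  have RZ: "module \<Z> (Z_module R)" by (rule module_Z_module[OF R.abelian_group_axioms])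
  have JZ: "submodule J \<Z> (Z_module R)"
  proof (rule Z_submoduleI[OF RZ])
    fix a assume "a \<in> J"
    moreover have "\<ominus>\<^bsub>Z_module R\<^esub> a = \<ominus>\<^bsub>R\<^esub> a"
    proof -
      interpret Z: module \<Z> "Z_module R" by fact
      show ?thesis by (rule Z.M.minus_equality) (use \<open>a \<in> J\<close> J.Icarr in \<open>auto simp: R.l_neg\<close>)
    qed
    ultimately show "\<ominus>\<^bsub>Z_module R\<^esub> a \<in> J" using J.a_inv_closed by simp
  qed (use J.Icarr in auto)
  have fJ: "f x \<in> carrier ?E" if "x \<in> J" for x using f(1) that by blast
  have "(\<lambda>x. f x \<one>\<^bsub>R\<^esub>) \<in> module_hom \<Z> ((Z_module R)\<lparr>carrier := J\<rparr>) D"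
  proof (rule additive_imp_Z_linear[OF submodule_module[OF JZ RZ] D(1)])
    show "f x \<one>\<^bsub>R\<^esub> \<in> carrier D" if "x \<in> carrier (Z_module R\<lparr>carrier := J\<rparr>)" for x
      using fJ[of x] that by (simp add: coinduced_module_def)
    show "f (x \<oplus>\<^bsub>Z_module R\<lparr>carrier := J\<rparr>\<^esub> y) \<one>\<^bsub>R\<^esub> = f x \<one>\<^bsub>R\<^esub> \<oplus>\<^bsub>D\<^esub> f y \<one>\<^bsub>R\<^esub>"
      if "x \<in> carrier (Z_module R\<lparr>carrier := J\<rparr>)" "y \<in> carrier (Z_module R\<lparr>carrier := J\<rparr>)" for x y
      using f(2) that by (simp add: coinduced_module_def)
  qed
  from baer_extend[OF RZ D(1,2) JZ this] obtain g where g: "g \<in> module_hom \<Z> (Z_module R) D"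
    and ext: "\<And>x. x \<in> J \<Longrightarrow> g x = f x \<one>\<^bsub>R\<^esub>" by auto
  define e where "e = (\<lambda>s. if s \<in> carrier R then g s else \<zero>\<^bsub>D\<^esub>)"
  have e: "e \<in> carrier ?E"
    using module_homD(1,2)[OF g] by (auto simp: coinduced_module_def e_def)
  have "f x = x \<odot>\<^bsub>?E\<^esub> e" if x: "x \<in> J" for x
  proof
    fix s
    show "f x s = (x \<odot>\<^bsub>?E\<^esub> e) s"
    proof (cases "s \<in> carrier R")
      case True
      have "f x s = (s \<odot>\<^bsub>?E\<^esub> f x) \<one>\<^bsub>R\<^esub>" using True by (simp add: coinduced_module_def)
      also have "\<dots> = f (s \<otimes>\<^bsub>R\<^esub> x) \<one>\<^bsub>R\<^esub>" using f(3) True x by simp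
      also have "\<dots> = g (s \<otimes>\<^bsub>R\<^esub> x)" using ext J.I_l_closed[OF x True] by simp
      also have "\<dots> = (x \<odot>\<^bsub>?E\<^esub> e) s"
        using True J.Icarr[OF x] by (simp add: coinduced_module_def e_def)
      finally show ?thesis .
    next
      case False
      then show ?thesis using fJ[OF x] by (simp add: coinduced_module_def)
    qed
  qed
  with e show "\<exists>e\<in>carrier ?E. \<forall>x\<in>J. f x = x \<odot>\<^bsub>?E\<^esub> e" by blast
qed

text \<open>The embedding sends \<open>x\<close> to \<open>s \<mapsto> s x\<close> in the coinduced module of a divisible hull.\<close>

lemma embed_quotient_in_baer:
  fixes R :: "('r, 'x) ring_scheme" and C :: "('r, 'c, 'y) module_scheme"
    and \<Phi> :: "('r \<Rightarrow> 'c \<Rightarrow> rat) \<Rightarrow> 'e"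
  assumes C: "module R C" and H: "submodule H R C"
    and inj: "inj_on \<Phi> {\<phi>. \<forall>s. finite {c. \<phi> s c \<noteq> 0}}"
  obtains E :: "('r, 'e) module" and d where "module R E" "baer R E" "d \<in> module_hom R C E"
    "\<And>x. x \<in> carrier C \<Longrightarrow> d x = \<zero>\<^bsub>E\<^esub> \<longleftrightarrow> x \<in> H"
proof -
  interpret C: module R C by fact
  have "subgroup H (add_monoid C)" using H by (simp add: submodule_def)
  obtain D :: "(int, 'c \<Rightarrow> rat) module" and \<theta> where D: "module \<Z> D" "baer \<Z> D"
    and finD: "carrier D \<subseteq> {f. finite {c. f c \<noteq> 0}}"
    and \<theta>: "\<And>x. x \<in> carrier C \<Longrightarrow> \<theta> x \<in> carrier D"
      "\<And>x y. x \<in> carrier C \<Longrightarrow> y \<in> carrier C \<Longrightarrow> \<theta> (x \<oplus>\<^bsub>C\<^esub> y) = \<theta> x \<oplus>\<^bsub>D\<^esub> \<theta> y"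
      "\<And>x. x \<in> carrier C \<Longrightarrow> \<theta> x = \<zero>\<^bsub>D\<^esub> \<longleftrightarrow> x \<in> H"
    by (rule divisible_hull[OF C.abelian_group_axioms \<open>subgroup H (add_monoid C)\<close>]) (rule that)
  interpret D: module \<Z> D by fact
  let ?E = "coinduced_module R D"
  have E: "module R ?E" by (rule module_coinduced_module[OF C.R.is_cring D.abelian_group_axioms])
  have bE: "baer R ?E" by (rule baer_coinduced_module[OF C.R.is_cring D])
  define d where "d = (\<lambda>x s. if s \<in> carrier R then \<theta> (s \<odot>\<^bsub>C\<^esub> x) else \<zero>\<^bsub>D\<^esub>)"
  have d: "d \<in> module_hom R C ?E"
    by (rule module_homI)
      (auto simp: d_def coinduced_module_def fun_eq_iff \<theta>(1,2) C.smult_l_distr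
        C.smult_r_distr C.smult_assoc1[symmetric])
  have ker: "d x = \<zero>\<^bsub>?E\<^esub> \<longleftrightarrow> x \<in> H" if x: "x \<in> carrier C" for x
  proof
    assume "d x = \<zero>\<^bsub>?E\<^esub>"
    then have "d x \<one>\<^bsub>R\<^esub> = \<zero>\<^bsub>D\<^esub>" by (simp add: coinduced_module_def)
    then show "x \<in> H" using x \<theta>(3) by (simp add: d_def)
  next
    assume "x \<in> H"
    then show "d x = \<zero>\<^bsub>?E\<^esub>"
      using C.submoduleE(1,4)[OF H] \<theta>(3) x by (auto simp: d_def coinduced_module_def fun_eq_iff)
  qed
  \<comment> \<open>The finite supports provided by \<open>divisible_hull\<close> bring this carrier
    into the domain on which \<open>\<Phi>\<close> is injective.\<close>
  have sub: "carrier ?E \<subseteq> {\<phi>. \<forall>s. finite {c. \<phi> s c \<noteq> 0}}"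
    using finD by (auto simp: coinduced_module_def)
  have inj': "inj_on \<Phi> (carrier ?E)" by (rule inj_on_subset[OF inj sub])
  note im = image_module[OF E inj']
  show thesis
  proof (rule that)
    show "module R (image_module \<Phi> ?E)" by (rule im)
    show "baer R (image_module \<Phi> ?E)" by (rule baer_image_module[OF E inj' bE])
    show "(\<lambda>x. \<Phi> (d x)) \<in> module_hom R C (image_module \<Phi> ?E)" by (rule module_hom_comp[OF d im(2)])
    show "\<Phi> (d x) = \<zero>\<^bsub>image_module \<Phi> ?E\<^esub> \<longleftrightarrow> x \<in> H" if "x \<in> carrier C" for x
    proof -
      have "\<zero>\<^bsub>?E\<^esub> \<in> carrier ?E"
        using module.axioms(2)[OF E] by (simp add: abelian_group_def abelian_monoid.zero_closed)
      then show ?thesis using ker[OF that] inj_onD[OF inj', of "d x" "\<zero>\<^bsub>?E\<^esub>"] module_homD(1)[OF d that]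
        by (auto simp: image_module_def)
    qed
  qed
qed

text \<open>Expresses that all products of \<open>n\<close> elements of \<open>S\<close> kill
  \<open>x\<close>. The recursion makes sense for a mere set of generators, so powers of an ideal
  and a generating set can be compared by induction on \<open>n\<close>.\<close>

primrec annihilated :: "('r, 'x) ring_scheme \<Rightarrow> 'r set \<Rightarrow> ('r, 'm, 'y) module_scheme \<Rightarrow> nat \<Rightarrow> 'm \<Rightarrow> bool"
  where
    "annihilated R S M 0 x \<longleftrightarrow> x = \<zero>\<^bsub>M\<^esub>"
  | "annihilated R S M (Suc n) x \<longleftrightarrow> (\<forall>s\<in>S. annihilated R S M n (s \<odot>\<^bsub>M\<^esub> x))"

text \<open>Torsion with respect to the single elements of \<open>S\<close>, the form in which it
  appears as the cocycles of degree zero in the Koszul complexes.\<close>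

definition torsion :: "('r, 'x) ring_scheme \<Rightarrow> 'r set \<Rightarrow> ('r, 'm, 'y) module_scheme \<Rightarrow> 'm set"
  where "torsion R S M = {x \<in> carrier M. \<exists>N::nat. \<forall>s\<in>S. (s [^]\<^bsub>R\<^esub> N) \<odot>\<^bsub>M\<^esub> x = \<zero>\<^bsub>M\<^esub>}"

section \<open>Torsion in terms of generators of the ideal\<close>

context module begin

lemma smult_commute:
  "a \<in> carrier R \<Longrightarrow> b \<in> carrier R \<Longrightarrow> x \<in> carrier M \<Longrightarrow>
    a \<odot>\<^bsub>M\<^esub> (b \<odot>\<^bsub>M\<^esub> x) = b \<odot>\<^bsub>M\<^esub> (a \<odot>\<^bsub>M\<^esub> x)"
  by (simp add: smult_assoc1[symmetric] R.m_comm)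

lemma annihilated_zero: "S \<subseteq> carrier R \<Longrightarrow> annihilated R S M n \<zero>\<^bsub>M\<^esub>"
  by (induction n) auto

lemma annihilated_add:
  "S \<subseteq> carrier R \<Longrightarrow> x \<in> carrier M \<Longrightarrow> y \<in> carrier M \<Longrightarrow> annihilated R S M n x \<Longrightarrow>
    annihilated R S M n y \<Longrightarrow> annihilated R S M n (x \<oplus>\<^bsub>M\<^esub> y)"
  by (induction n arbitrary: x y) (auto simp: smult_r_distr subset_iff)

lemma annihilated_smult:
  "S \<subseteq> carrier R \<Longrightarrow> x \<in> carrier M \<Longrightarrow> r \<in> carrier R \<Longrightarrow> annihilated R S M n x \<Longrightarrow>
    annihilated R S M n (r \<odot>\<^bsub>M\<^esub> x)"
proof (induction n arbitrary: x)
  case (Suc n)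
  then have "annihilated R S M n (r \<odot>\<^bsub>M\<^esub> (s \<odot>\<^bsub>M\<^esub> x))" if "s \<in> S" for s
    using that by (intro Suc.IH) auto
  then show ?case using Suc.prems smult_commute by (auto simp: subset_iff)
qed auto

text \<open>The next power of \<open>\<aa>\<close> is additively generated by products
  \<open>r s\<close> with \<open>r\<close> in the previous power and \<open>s\<close> in
  \<open>\<aa>\<close>, so it kills \<open>x\<close> exactly when the previous power kills every
  \<open>s x\<close>.\<close>

lemma annihilated_ideal_power:
  assumes \<aa>: "ideal \<aa> R" and "x \<in> carrier M"
  shows "(\<forall>r \<in> \<aa> [^]\<^bsub>ideals_set R\<^esub> n. r \<odot>\<^bsub>M\<^esub> x = \<zero>\<^bsub>M\<^esub>) \<longleftrightarrow> annihilated R \<aa> M n x"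
  using assms(2)
proof (induction n arbitrary: x)
  case 0
  have "x = \<zero>\<^bsub>M\<^esub>" if "\<forall>r\<in>carrier R. r \<odot>\<^bsub>M\<^esub> x = \<zero>\<^bsub>M\<^esub>"
    using that[rule_format, OF R.one_closed] 0 by simp
  then show ?case by (auto simp: nat_pow_def ideals_set_def)
next
  case (Suc n)
  let ?P = "\<aa> [^]\<^bsub>ideals_set R\<^esub> n"
  have pow: "\<aa> [^]\<^bsub>ideals_set R\<^esub> Suc n = ideal_prod R ?P \<aa>"
    by (simp add: nat_pow_def ideals_set_def)
  have \<aa>R: "r \<in> carrier R" if "r \<in> \<aa>" for r using ideal.Icarr[OF \<aa> that] .
  have P: "ideal ?P R"
  proof (induction n)
    case 0 then show ?case using R.oneideal by (simp add: nat_pow_def ideals_set_def)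
  next
    case (Suc n) then show ?case
      using R.ideal_prod_is_ideal[OF Suc \<aa>] by (simp add: nat_pow_def ideals_set_def)
  qed
  have PR: "r \<in> carrier R" if "r \<in> ?P" for r using ideal.Icarr[OF P that] .
  have "(\<forall>t\<in>ideal_prod R ?P \<aa>. t \<odot>\<^bsub>M\<^esub> x = \<zero>\<^bsub>M\<^esub>) \<longleftrightarrow> (\<forall>s\<in>\<aa>. \<forall>r\<in>?P. r \<odot>\<^bsub>M\<^esub> (s \<odot>\<^bsub>M\<^esub> x) = \<zero>\<^bsub>M\<^esub>)"
  proof (intro iffI ballI)
    fix s r assume "\<forall>t\<in>ideal_prod R ?P \<aa>. t \<odot>\<^bsub>M\<^esub> x = \<zero>\<^bsub>M\<^esub>" "s \<in> \<aa>" "r \<in> ?P"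
    then show "r \<odot>\<^bsub>M\<^esub> (s \<odot>\<^bsub>M\<^esub> x) = \<zero>\<^bsub>M\<^esub>"
      using ideal_prod.prod[of r ?P s \<aa> R] \<aa>R PR Suc.prems by (simp add: smult_assoc1[symmetric])
  next
    fix t assume *: "\<forall>s\<in>\<aa>. \<forall>r\<in>?P. r \<odot>\<^bsub>M\<^esub> (s \<odot>\<^bsub>M\<^esub> x) = \<zero>\<^bsub>M\<^esub>" and "t \<in> ideal_prod R ?P \<aa>"
    from this(2) have "t \<in> carrier R \<and> t \<odot>\<^bsub>M\<^esub> x = \<zero>\<^bsub>M\<^esub>"
    proof (induction t rule: ideal_prod.induct)
      case (prod i j)
      then show ?case using * \<aa>R PR Suc.prems by (simp add: smult_assoc1)
    next
      case (sum s1 s2)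
      then show ?case using Suc.prems by (simp add: smult_l_distr)
    qed
    then show "t \<odot>\<^bsub>M\<^esub> x = \<zero>\<^bsub>M\<^esub>" by simp
  qed
  also have "\<dots> \<longleftrightarrow> (\<forall>s\<in>\<aa>. annihilated R \<aa> M n (s \<odot>\<^bsub>M\<^esub> x))"
    using Suc.IH Suc.prems \<aa>R by simp
  finally show ?case unfolding pow annihilated.simps .
qed

text \<open>For fixed \<open>x\<close> and \<open>n\<close>, the scalars \<open>r\<close> for which
  \<open>r x\<close> is annihilated at level \<open>n\<close> form an ideal; if it contains
  \<open>S\<close>, it contains \<open>\<aa>\<close>.\<close>

lemma annihilated_generators:
  assumes "S \<subseteq> \<aa>" "\<aa> \<subseteq> carrier R" and gen: "\<And>I. ideal I R \<Longrightarrow> S \<subseteq> I \<Longrightarrow> \<aa> \<subseteq> I"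
    and "x \<in> carrier M"
  shows "annihilated R \<aa> M n x \<longleftrightarrow> annihilated R S M n x"
  using assms(4)
proof (induction n arbitrary: x)
  case (Suc n)
  have SR: "S \<subseteq> carrier R" using assms by auto
  show ?case
  proof
    assume "annihilated R \<aa> M (Suc n) x"
    then have "annihilated R S M n (s \<odot>\<^bsub>M\<^esub> x)" if "s \<in> S" for s
      using Suc.IH[of "s \<odot>\<^bsub>M\<^esub> x"] Suc.prems SR assms(1) that by auto
    then show "annihilated R S M (Suc n) x" by simp
  next
    assume S: "annihilated R S M (Suc n) x"
    let ?I = "{r \<in> carrier R. annihilated R S M n (r \<odot>\<^bsub>M\<^esub> x)}"
    have smult: "s \<otimes> r \<in> ?I" if "r \<in> ?I" "s \<in> carrier R" for r s
      using that annihilated_smult[OF SR, of "r \<odot>\<^bsub>M\<^esub> x" s n] Suc.prems by (simp add: smult_assoc1)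
    have "ideal ?I R"
    proof (rule idealI[OF R.ring_axioms])
      show "subgroup ?I (add_monoid R)"
      proof (rule R.add.subgroupI)
        show "?I \<noteq> {}" using annihilated_zero[OF SR] Suc.prems by (auto intro!: exI[of _ \<zero>])
        show "\<ominus> r \<in> ?I" if "r \<in> ?I" for r
          using smult[OF that, of "\<ominus> \<one>"] that by (auto simp: R.l_minus)
        show "r \<oplus> s \<in> ?I" if "r \<in> ?I" "s \<in> ?I" for r s
          using that annihilated_add[OF SR] Suc.prems by (auto simp: smult_l_distr)
      qed auto
      show "s \<otimes> r \<in> ?I" if "r \<in> ?I" "s \<in> carrier R" for r s by (rule smult[OF that])
      show "r \<otimes> s \<in> ?I" if "r \<in> ?I" "s \<in> carrier R" for r s
        using smult[OF that] that R.m_comm[of r s] by simp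
    qed
    moreover have "S \<subseteq> ?I" using S SR by auto
    ultimately have "\<aa> \<subseteq> ?I" by (rule gen)
    then show "annihilated R \<aa> M (Suc n) x" using Suc by auto
  qed
qed simp

lemma annihilated_imp_power:
  "S \<subseteq> carrier R \<Longrightarrow> x \<in> carrier M \<Longrightarrow> annihilated R S M n x \<Longrightarrow> s \<in> S \<Longrightarrow>
    (s [^] n) \<odot>\<^bsub>M\<^esub> x = \<zero>\<^bsub>M\<^esub>"
proof (induction n arbitrary: x)
  case (Suc n)
  then have "(s [^] n) \<odot>\<^bsub>M\<^esub> (s \<odot>\<^bsub>M\<^esub> x) = \<zero>\<^bsub>M\<^esub>" by (intro Suc.IH) auto
  then show ?case using Suc.prems by (auto simp: smult_assoc1 subset_iff)
qed simp

text \<open>The pigeonhole principle: a product of sufficiently many generators contains a high power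
  of one of them.\<close>

lemma powers_imp_annihilated:
  assumes S: "finite S" "S \<subseteq> carrier R" and "x \<in> carrier M"
    and "\<And>s. s \<in> S \<Longrightarrow> (s [^] (N s :: nat)) \<odot>\<^bsub>M\<^esub> x = \<zero>\<^bsub>M\<^esub>"
  shows "annihilated R S M (Suc (sum N S)) x"
  using assms(3,4)
proof (induction "sum N S" arbitrary: N x rule: less_induct)
  case less
  have "annihilated R S M (sum N S) (s \<odot>\<^bsub>M\<^esub> x)" if s: "s \<in> S" for s
  proof (cases "N s = 0")
    case True
    then have "x = \<zero>\<^bsub>M\<^esub>" using less.prems(2)[OF s] less.prems(1) by simp
    then show ?thesis using annihilated_zero[OF S(2)] S(2) s by (auto simp: subset_iff)
  next
    case False
    \<comment> \<open>After multiplication by \<open>s\<close>, one power of \<open>s\<close> less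
      suffices, so the sum of the exponents drops.\<close>
    let ?N = "N(s := N s - 1)"
    have sR: "s \<in> carrier R" using s S(2) by auto
    have sum: "sum N S = Suc (sum ?N S)"
    proof -
      have "sum N S = N s + sum N (S - {s})" "sum ?N S = ?N s + sum ?N (S - {s})"
        by (rule sum.remove[OF S(1) s])+
      then show ?thesis using False by simp
    qed
    have pow: "s [^] N s = s [^] (N s - 1) \<otimes> s" using False by (metis Suc_pred' R.nat_pow_Suc neq0_conv)
    have "annihilated R S M (Suc (sum ?N S)) (s \<odot>\<^bsub>M\<^esub> x)"
    proof (rule less.hyps)
      show "sum ?N S < sum N S" using sum by simp
      show "s \<odot>\<^bsub>M\<^esub> x \<in> carrier M" using sR less.prems by simp
      fix t assume t: "t \<in> S"
      then have tR: "t \<in> carrier R" using S(2) by auto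
      show "(t [^] ?N t) \<odot>\<^bsub>M\<^esub> (s \<odot>\<^bsub>M\<^esub> x) = \<zero>\<^bsub>M\<^esub>"
      proof (cases "t = s")
        case True
        then show ?thesis using less.prems(2)[OF s] less.prems(1) sR pow by (simp add: smult_assoc1)
      next
        case False
        then show ?thesis using less.prems(2)[OF t] less.prems(1) sR tR smult_commute[of "t [^] N t" s x]
          by simp
      qed
    qed
    then show ?thesis using sum by simp
  qed
  then show ?case by simp
qed

lemma torsion_part_eq_torsion:
  assumes \<aa>: "ideal \<aa> R" and S: "finite S" "S \<subseteq> \<aa>"
    and gen: "\<And>I. ideal I R \<Longrightarrow> S \<subseteq> I \<Longrightarrow> \<aa> \<subseteq> I"
  shows "torsion_part R \<aa> M = torsion R S M"
proof -
  have aR: "\<aa> \<subseteq> carrier R" using ideal.Icarr[OF \<aa>] by auto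
  then have SR: "S \<subseteq> carrier R" using S by auto
  have "torsion_part R \<aa> M = {x \<in> carrier M. \<exists>n. annihilated R S M n x}"
    using annihilated_ideal_power[OF \<aa>] annihilated_generators[OF S(2) aR gen]
    by (auto simp: torsion_part_def)
  also have "\<dots> = torsion R S M"
  proof (intro equalityI subsetI)
    fix x assume "x \<in> {x \<in> carrier M. \<exists>n. annihilated R S M n x}"
    then show "x \<in> torsion R S M" using annihilated_imp_power[OF SR] unfolding torsion_def by blast
  next
    fix x assume "x \<in> torsion R S M"
    then obtain N :: nat where "x \<in> carrier M" "\<And>s. s \<in> S \<Longrightarrow> (s [^] N) \<odot>\<^bsub>M\<^esub> x = \<zero>\<^bsub>M\<^esub>"
      by (auto simp: torsion_def)
    then show "x \<in> {x \<in> carrier M. \<exists>n. annihilated R S M n x}"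
      using powers_imp_annihilated[OF S(1) SR, of x "\<lambda>_. N"] by blast
  qed
  finally show ?thesis .
qed

lemma power_smult_zero_mono:
  assumes "s \<in> carrier R" "x \<in> carrier M" "(s [^] (m::nat)) \<odot>\<^bsub>M\<^esub> x = \<zero>\<^bsub>M\<^esub>" "m \<le> n"
  shows "(s [^] n) \<odot>\<^bsub>M\<^esub> x = \<zero>\<^bsub>M\<^esub>"
proof -
  have "s [^] n = s [^] (n - m) \<otimes> s [^] m" using assms by (simp add: R.nat_pow_mult)
  then show ?thesis using assms by (simp add: smult_assoc1)
qed

lemma submodule_torsion:
  assumes "S \<subseteq> carrier R"
  shows "submodule (torsion R S M) R M"
proof (rule submoduleI')
  show "torsion R S M \<subseteq> carrier M" by (auto simp: torsion_def)
  show "\<zero>\<^bsub>M\<^esub> \<in> torsion R S M" using assms by (auto simp: torsion_def subset_iff intro!: exI[of _ 0])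
  fix x y assume "x \<in> torsion R S M" "y \<in> torsion R S M"
  then obtain m n where *: "x \<in> carrier M" "y \<in> carrier M" "\<forall>s\<in>S. (s [^] (m::nat)) \<odot>\<^bsub>M\<^esub> x = \<zero>\<^bsub>M\<^esub>"
    "\<forall>s\<in>S. (s [^] (n::nat)) \<odot>\<^bsub>M\<^esub> y = \<zero>\<^bsub>M\<^esub>" by (auto simp: torsion_def)
  have "(s [^] (m + n)) \<odot>\<^bsub>M\<^esub> (x \<oplus>\<^bsub>M\<^esub> y) = \<zero>\<^bsub>M\<^esub>" if s: "s \<in> S" for s
    using power_smult_zero_mono[of s x m "m + n"] power_smult_zero_mono[of s y n "m + n"] * s assms
    by (auto simp: smult_r_distr subset_iff)
  then show "x \<oplus>\<^bsub>M\<^esub> y \<in> torsion R S M" using * by (auto simp: torsion_def)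
next
  fix a x assume "a \<in> carrier R" "x \<in> torsion R S M"
  then obtain N :: nat where x: "a \<in> carrier R" "x \<in> carrier M"
    and N: "\<And>s. s \<in> S \<Longrightarrow> (s [^] N) \<odot>\<^bsub>M\<^esub> x = \<zero>\<^bsub>M\<^esub>" by (auto simp: torsion_def)
  have "(s [^] N) \<odot>\<^bsub>M\<^esub> (a \<odot>\<^bsub>M\<^esub> x) = \<zero>\<^bsub>M\<^esub>" if "s \<in> S" for s
    using smult_commute[of "s [^] N" a x] N[OF that] that x assms by auto
  with x show "a \<odot>\<^bsub>M\<^esub> x \<in> torsion R S M" by (auto simp: torsion_def)
qed

lemma submodule_zero: "submodule {\<zero>\<^bsub>M\<^esub>} R M"
  by (rule submoduleI') auto

end


lemma module_hom_image_submodule: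
  assumes f: "f \<in> module_hom R P Q" and P: "module R P" and Q: "module R Q"
  shows "submodule (f ` carrier P) R Q"
proof (rule module.submoduleI'[OF Q])
  interpret P: module R P by fact
  note fD = module_homD[OF f]
  show "f ` carrier P \<subseteq> carrier Q" using fD by auto
  show "\<zero>\<^bsub>Q\<^esub> \<in> f ` carrier P" using module_hom_zero[OF f P Q] by force
  show "a \<oplus>\<^bsub>Q\<^esub> b \<in> f ` carrier P" if "a \<in> f ` carrier P" "b \<in> f ` carrier P" for a b
    using that by (auto simp: fD(2)[symmetric])
  show "a \<odot>\<^bsub>Q\<^esub> x \<in> f ` carrier P" if "a \<in> carrier R" "x \<in> f ` carrier P" for a x
    using that by (auto simp: fD(3)[symmetric])
qed

section \<open>Existence of injective resolutions\<close>

text \<open>A function of finite support is known from its graph over the support, a finite subset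
  of \<open>'e \<times> rat\<close>. An infinite set has as many finite subsets as elements, and the
  countable factor does not enlarge it.\<close>

lemma inj_finite_support:
  assumes "infinite (UNIV :: 'e set)"
  obtains g :: "('e \<Rightarrow> rat) \<Rightarrow> 'e" where "inj_on g {f. finite {c. f c \<noteq> 0}}"
proof -
  have "|UNIV :: rat set| \<le>o |UNIV :: 'e set|"
    using assms infinite_iff_card_of_countable[of "UNIV :: rat set" "UNIV :: 'e set"]
    by (simp add: infinite_UNIV_char_0)
  then have le: "|UNIV \<times> UNIV :: ('e \<times> rat) set| =o |UNIV :: 'e set|"
    by (intro card_of_Times_infinite_simps(1)) (use assms in auto)
  have inf: "infinite (UNIV \<times> UNIV :: ('e \<times> rat) set)" using assms by (simp add: finite_prod)
  have "|Fpow (UNIV \<times> UNIV :: ('e \<times> rat) set)| =o |UNIV :: 'e set|"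
    using ordIso_transitive[OF card_of_Fpow_infinite[OF inf] le] .
  then obtain k where k: "inj_on k (Fpow (UNIV \<times> UNIV :: ('e \<times> rat) set))" "range k \<subseteq> (UNIV :: 'e set)"
    using card_of_ordLeq[of "Fpow (UNIV \<times> UNIV :: ('e \<times> rat) set)" "UNIV :: 'e set"]
      ordIso_iff_ordLeq by auto
  define graph :: "('e \<Rightarrow> rat) \<Rightarrow> ('e \<times> rat) set" where "graph = (\<lambda>f. (\<lambda>c. (c, f c)) ` {c. f c \<noteq> 0})"
  have inj: "f = g" if "graph f = graph g" for f g
  proof
    fix c
    have *: "f c \<noteq> 0 \<Longrightarrow> g c = f c" if "graph f = graph g" for f g
    proof -
      assume "f c \<noteq> 0"
      then have "(c, f c) \<in> graph f" by (auto simp: graph_def)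
      then have "(c, f c) \<in> graph g" using that by simp
      then show "g c = f c" by (auto simp: graph_def)
    qed
    show "f c = g c" using *[OF that] *[OF that[symmetric]] by (cases "f c = 0") auto
  qed
  show thesis
  proof (rule that, rule inj_onI)
    fix f g :: "'e \<Rightarrow> rat"
    assume fg: "f \<in> {f. finite {c. f c \<noteq> 0}}" "g \<in> {f. finite {c. f c \<noteq> 0}}" "k (graph f) = k (graph g)"
    then have "graph f \<in> Fpow (UNIV \<times> UNIV)" "graph g \<in> Fpow (UNIV \<times> UNIV)"
      by (auto simp: Fpow_def graph_def)
    then show "f = g" using inj inj_onD[OF k(1) fg(3)] by blast
  qed
qed

text \<open>The factor \<open>nat\<close> makes the type infinite even if \<open>'r\<close> and
  \<open>'m\<close> are finite.\<close>

lemma infinite_resolution_type: "infinite (UNIV :: ('r \<times> nat \<Rightarrow> 'm option) set)"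
proof -
  let ?f = "\<lambda>n::nat. \<lambda>p::'r \<times> nat. if snd p = n then Some (undefined :: 'm) else None"
  have "inj ?f"
  proof (rule injI)
    fix m n assume "?f m = ?f n"
    from fun_cong[OF this, of "(undefined, m)"] show "m = n" by (simp split: if_splits)
  qed
  then show ?thesis using finite_imageD[of ?f UNIV] by (meson finite_subset infinite_UNIV_nat subset_UNIV)
qed

text \<open>Uncurrying turns a family into one function on
  \<open>'r \<times> ('r \<times> nat)\<close>, and this domain injects into
  \<open>'r \<times> nat\<close>.\<close>

lemma inj_functions_resolution_type:
  obtains h :: "('r \<Rightarrow> ('r \<times> nat \<Rightarrow> 'm option)) \<Rightarrow> ('r \<times> nat \<Rightarrow> 'm option)"
  where "inj h"
proof -
  have "infinite (UNIV :: ('r \<times> nat) set)" by (simp add: finite_prod)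
  then obtain b :: "('r \<times> nat) \<times> ('r \<times> nat) \<Rightarrow> 'r \<times> nat" where b: "inj b"
    using card_of_Times_same_infinite[of "UNIV :: ('r \<times> nat) set"]
      card_of_ordLeq[of "UNIV \<times> UNIV :: (('r \<times> nat) \<times> ('r \<times> nat)) set" "UNIV :: ('r \<times> nat) set"]
      ordIso_iff_ordLeq by auto
  define h :: "('r \<Rightarrow> ('r \<times> nat \<Rightarrow> 'm option)) \<Rightarrow> ('r \<times> nat \<Rightarrow> 'm option)"
    where "h = (\<lambda>\<phi> q. \<phi> (fst (fst (inv_into UNIV b q))) (snd (inv_into UNIV b q)))"
  \<comment> \<open>The argument \<open>r\<close> is padded to the pair \<open>(r, 0)\<close>, since
    \<open>b\<close> combines two elements of \<open>'r \<times> nat\<close>.\<close>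
  have h: "h \<phi> (b ((r, 0), p)) = \<phi> r p" for \<phi> r p by (simp add: h_def inv_f_f[OF b])
  have "inj h"
  proof (rule injI, intro ext)
    fix \<phi> \<psi> r p assume "h \<phi> = h \<psi>"
    then show "\<phi> r p = \<psi> r p" using h[of \<phi> r p] h[of \<psi> r p] by simp
  qed
  then show thesis by (rule that)
qed

text \<open>Coinduced modules over divisible hulls consist of maps with finitely supported values.
  Compressing each value and then the whole family returns them to the type of the
  resolution.\<close>

lemma inj_resolution_type:
  obtains \<Phi> :: "('r \<Rightarrow> ('r \<times> nat \<Rightarrow> 'm option) \<Rightarrow> rat) \<Rightarrow> ('r \<times> nat \<Rightarrow> 'm option)"
  where "inj_on \<Phi> {\<phi>. \<forall>s. finite {c. \<phi> s c \<noteq> 0}}"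
proof -
  obtain g :: "(('r \<times> nat \<Rightarrow> 'm option) \<Rightarrow> rat) \<Rightarrow> ('r \<times> nat \<Rightarrow> 'm option)"
    where g: "inj_on g {f. finite {c. f c \<noteq> 0}}"
    by (rule inj_finite_support[OF infinite_resolution_type])
  obtain h :: "('r \<Rightarrow> ('r \<times> nat \<Rightarrow> 'm option)) \<Rightarrow> ('r \<times> nat \<Rightarrow> 'm option)"
    where h: "inj h" by (rule inj_functions_resolution_type)
  show thesis
  proof (rule that, rule inj_onI, rule ext)
    fix \<phi> \<psi> :: "'r \<Rightarrow> ('r \<times> nat \<Rightarrow> 'm option) \<Rightarrow> rat" and r
    assume *: "\<phi> \<in> {\<phi>. \<forall>s. finite {c. \<phi> s c \<noteq> 0}}" "\<psi> \<in> {\<phi>. \<forall>s. finite {c. \<phi> s c \<noteq> 0}}"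
      "h (\<lambda>s. g (\<phi> s)) = h (\<lambda>s. g (\<psi> s))"
    from *(3) have "(\<lambda>s. g (\<phi> s)) = (\<lambda>s. g (\<psi> s))" using h by (simp add: inj_eq)
    then have "g (\<phi> r) = g (\<psi> r)" by meson
    then show "\<phi> r = \<psi> r" using inj_onD[OF g] * by blast
  qed
qed

text \<open>Every stage remembers the image \<open>H\<close> of the preceding map. Embedding the
  current module modulo \<open>H\<close> into the next one makes \<open>H\<close> the kernel of the
  new map, which is exactness.\<close>

theorem injective_resolution_exists:
  fixes M :: "('r, 'm, 'y) module_scheme"
  assumes M: "module R M"
  shows "\<exists>(E :: nat \<Rightarrow> ('r, ('r \<times> nat \<Rightarrow> 'm option)) module) d \<epsilon>. injective_resolution R M \<epsilon> E d"
proof -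
  obtain \<Phi> :: "('r \<Rightarrow> ('r \<times> nat \<Rightarrow> 'm option) \<Rightarrow> rat) \<Rightarrow> ('r \<times> nat \<Rightarrow> 'm option)"
    where \<Phi>: "inj_on \<Phi> {\<phi>. \<forall>s. finite {c. \<phi> s c \<noteq> 0}}"
    by (rule inj_resolution_type)
  \<comment> \<open>Constant functions place \<open>M\<close> inside the type of the
    resolution.\<close>
  define \<iota> :: "'m \<Rightarrow> ('r \<times> nat \<Rightarrow> 'm option)" where "\<iota> = (\<lambda>m _. Some m)"
  have \<iota>: "inj_on \<iota> (carrier M)" by (auto simp: inj_on_def \<iota>_def fun_eq_iff)
  let ?M = "image_module \<iota> M"
  note im = image_module[OF M \<iota>]
  interpret M: module R M by fact
  interpret M': module R ?M by (rule im)
  have zero: "submodule {\<zero>\<^bsub>?M\<^esub>} R ?M" by (rule M'.submodule_zero)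
  obtain E0 :: "('r, ('r \<times> nat \<Rightarrow> 'm option)) module" and e where E0: "module R E0" "baer R E0"
    and e: "e \<in> module_hom R ?M E0" "\<And>x. x \<in> carrier ?M \<Longrightarrow> e x = \<zero>\<^bsub>E0\<^esub> \<longleftrightarrow> x \<in> {\<zero>\<^bsub>?M\<^esub>}"
    by (rule embed_quotient_in_baer[OF im(1) zero \<Phi>]) (rule that)
  define \<epsilon> where "\<epsilon> = (\<lambda>x. e (\<iota> x))"
  have \<epsilon>: "\<epsilon> \<in> module_hom R M E0" unfolding \<epsilon>_def by (rule module_hom_comp[OF im(2) e(1)])
  \<comment> \<open>A stage is a module together with the submodule that the next map must have as
    its kernel. The clause for \<open>n = 0\<close> ties the first stage to
    \<open>M\<close>.\<close>
  let ?P = "\<lambda>n::nat. \<lambda>(E :: ('r, ('r \<times> nat \<Rightarrow> 'm option)) module, H).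
    module R E \<and> baer R E \<and> submodule H R E \<and> (n = 0 \<longrightarrow> E = E0 \<and> H = \<epsilon> ` carrier M)"
  let ?Q = "\<lambda>n::nat. \<lambda>(E :: ('r, ('r \<times> nat \<Rightarrow> 'm option)) module, H) (E', H').
    \<exists>d \<in> module_hom R E E'. a_kernel E E' d = H \<and> d ` carrier E = H'"
  have "\<exists>f. \<forall>n. ?P n (f n) \<and> ?Q n (f n) (f (Suc n))"
  proof (rule dependent_nat_choice)
    show "\<exists>x. ?P 0 x" using E0 module_hom_image_submodule[OF \<epsilon> M E0(1)] by auto
    fix x n assume "?P n x"
    moreover obtain E H where x: "x = (E, H)" by fastforce
    ultimately have E: "module R E" "submodule H R E" by auto
    obtain E' :: "('r, ('r \<times> nat \<Rightarrow> 'm option)) module" and d where E': "module R E'" "baer R E'"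
      and d: "d \<in> module_hom R E E'" "\<And>x. x \<in> carrier E \<Longrightarrow> d x = \<zero>\<^bsub>E'\<^esub> \<longleftrightarrow> x \<in> H"
      by (rule embed_quotient_in_baer[OF E \<Phi>]) (rule that)
    have "a_kernel E E' d = H"
      using d(2) module.submoduleE(1)[OF E] by (auto simp: a_kernel_def kernel_def)
    with E' d(1) module_hom_image_submodule[OF d(1) E(1) E'(1)]
    show "\<exists>y. ?P (Suc n) y \<and> ?Q n x y"
      unfolding x by (intro exI[of _ "(E', d ` carrier E)"]) auto
  qed
  then obtain f where f': "\<forall>n. ?P n (f n) \<and> ?Q n (f n) (f (Suc n))" by (rule exE)
  note f = f'[THEN spec, THEN conjunct1] f'[THEN spec, THEN conjunct2]
  define E where "E = (\<lambda>n. fst (f n))"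
  define H where "H = (\<lambda>n. snd (f n))"
  have f_eq: "f n = (E n, H n)" for n by (simp add: E_def H_def)
  have E: "module R (E n)" "baer R (E n)" for n using f(1)[of n] by (auto simp: f_eq)
  have EH0: "E 0 = E0" "H 0 = \<epsilon> ` carrier M" using f(1)[of 0] by (auto simp: f_eq)
  have "\<forall>n. \<exists>d. d \<in> module_hom R (E n) (E (Suc n)) \<and> a_kernel (E n) (E (Suc n)) d = H n \<and>
      d ` carrier (E n) = H (Suc n)"
    using f(2) by (simp add: f_eq Bex_def)
  then obtain d where d: "\<And>n. d n \<in> module_hom R (E n) (E (Suc n))"
    "\<And>n. a_kernel (E n) (E (Suc n)) (d n) = H n" "\<And>n. d n ` carrier (E n) = H (Suc n)" by metis
  have "inj_on \<epsilon> (carrier M)"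
  proof (rule inj_onI)
    fix x y assume xy: "x \<in> carrier M" "y \<in> carrier M" "\<epsilon> x = \<epsilon> y"
    then have "\<epsilon> (x \<ominus>\<^bsub>M\<^esub> y) = \<zero>\<^bsub>E0\<^esub>"
      using module_hom_diff[OF \<epsilon> M E0(1)] module_homD(1)[OF \<epsilon>]
        abelian_group.minus_eq_zero_iff[OF module.axioms(2)[OF E0(1)]] by simp
    then have "\<iota> (x \<ominus>\<^bsub>M\<^esub> y) = \<zero>\<^bsub>?M\<^esub>"
      using e(2)[of "\<iota> (x \<ominus>\<^bsub>M\<^esub> y)"] xy by (simp add: \<epsilon>_def)
    then have "\<iota> (x \<ominus>\<^bsub>M\<^esub> y) = \<iota> \<zero>\<^bsub>M\<^esub>" by (simp add: image_module_def)
    then show "x = y" using inj_onD[OF \<iota>, of "x \<ominus>\<^bsub>M\<^esub> y" "\<zero>\<^bsub>M\<^esub>"] xy M.minus_eq_zero_iff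
      by (simp add: M.M.minus_closed)
  qed
  then have "injective_resolution R M \<epsilon> E d"
    unfolding injective_resolution_def
    using baer_imp_injective_module[OF E] d \<epsilon> EH0 by auto
  then show ?thesis by blast
qed


section \<open>Vanishing of local cohomology as an inclusion of submodules\<close>

lemma quotient_module_trivial_iff:
  assumes M: "abelian_group M" and H: "subgroup H (add_monoid M)"
  shows "carrier (quotient_module M H) = {\<zero>\<^bsub>quotient_module M H\<^esub>} \<longleftrightarrow> carrier M \<subseteq> H"
proof -
  interpret M: abelian_group M by fact
  have eq: "H +>\<^bsub>M\<^esub> x = H \<longleftrightarrow> x \<in> H" if "x \<in> carrier M" for x
    using M.add.coset_join1[OF _ that H] M.add.coset_join2[OF that H] subgroup.subset[OF H]
    by (auto simp: a_r_coset_def)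
  have carr: "carrier (quotient_module M H) = (\<lambda>x. H +>\<^bsub>M\<^esub> x) ` carrier M"
    by (auto simp: quotient_module_def A_RCOSETS_def')
  have zero: "\<zero>\<^bsub>quotient_module M H\<^esub> = H" by (simp add: quotient_module_def)
  show ?thesis
  proof
    assume l: "carrier (quotient_module M H) = {\<zero>\<^bsub>quotient_module M H\<^esub>}"
    show "carrier M \<subseteq> H"
    proof
      fix x assume x: "x \<in> carrier M"
      then have "H +>\<^bsub>M\<^esub> x \<in> carrier (quotient_module M H)" by (simp add: carr)
      then show "x \<in> H" using l zero eq[OF x] by simp
    qed
  next
    assume "carrier M \<subseteq> H"
    then have "(\<lambda>x. H +>\<^bsub>M\<^esub> x) ` carrier M = (\<lambda>x. H) ` carrier M"
      by (intro image_cong refl) (auto simp: eq)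
    also have "\<dots> = {H}" using M.zero_closed by blast
    finally show "carrier (quotient_module M H) = {\<zero>\<^bsub>quotient_module M H\<^esub>}" by (simp add: carr zero)
  qed
qed

lemma torsion_hom:
  assumes f: "f \<in> module_hom R M N" and M: "module R M" and N: "module R N" and S: "S \<subseteq> carrier R"
    and x: "x \<in> torsion R S M"
  shows "f x \<in> torsion R S N"
proof -
  interpret M: module R M by fact
  obtain n :: nat where n: "x \<in> carrier M" "\<And>s. s \<in> S \<Longrightarrow> (s [^]\<^bsub>R\<^esub> n) \<odot>\<^bsub>M\<^esub> x = \<zero>\<^bsub>M\<^esub>"
    using x by (auto simp: torsion_def)
  have "(s [^]\<^bsub>R\<^esub> n) \<odot>\<^bsub>N\<^esub> f x = \<zero>\<^bsub>N\<^esub>" if "s \<in> S" for s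
    using module_homD(3)[OF f, of "s [^]\<^bsub>R\<^esub> n" x] module_hom_zero[OF f M N] n that S by auto
  then show ?thesis using module_homD(1)[OF f n(1)] by (auto simp: torsion_def)
qed

lemma injective_resolution_complex:
  assumes res: "injective_resolution R M \<epsilon> E d" and "x \<in> carrier (E i)"
  shows "d (Suc i) (d i x) = \<zero>\<^bsub>E (Suc (Suc i))\<^esub>"
proof -
  have "d i ` carrier (E i) = a_kernel (E (Suc i)) (E (Suc (Suc i))) (d (Suc i))"
    using res by (simp add: injective_resolution_def)
  then have "d i x \<in> a_kernel (E (Suc i)) (E (Suc (Suc i))) (d (Suc i))" using assms(2) by blast
  then show ?thesis by (simp add: a_kernel_def kernel_def)
qed

text \<open>Since a resolution exists, the one picked by \<open>SOME\<close> is a genuine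
  resolution. Extracting it here, with vanishing stated as an inclusion of cocycles in coboundaries,
  hides the choice and the cosets from the later arguments.\<close>

lemma local_cohomology_trivial_iff:
  fixes R :: "('r, 'x) ring_scheme" and M :: "('r, 'm, 'y) module_scheme"
  assumes M: "module R M" and tors: "\<And>E :: ('r, ('r \<times> nat \<Rightarrow> 'm option)) module.
      module R E \<Longrightarrow> torsion_part R \<aa> E = torsion R S E" and S: "S \<subseteq> carrier R"
  obtains E :: "nat \<Rightarrow> ('r, ('r \<times> nat \<Rightarrow> 'm option)) module" and d \<epsilon>
  where "injective_resolution R M \<epsilon> E d"
    "\<And>i. carrier (local_cohomology R \<aa> M i) = {\<zero>\<^bsub>local_cohomology R \<aa> M i\<^esub>} \<longleftrightarrow>
      {x \<in> torsion R S (E i). d i x = \<zero>\<^bsub>E (Suc i)\<^esub>} \<subseteq>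
      (case i of 0 \<Rightarrow> {\<zero>\<^bsub>E 0\<^esub>} | Suc j \<Rightarrow> d j ` torsion R S (E j))"
proof -
  define Ed :: "(nat \<Rightarrow> ('r, ('r \<times> nat \<Rightarrow> 'm option)) module) \<times> _"
    where "Ed = (SOME (E, d). \<exists>\<epsilon>. injective_resolution R M \<epsilon> E d)"
  obtain E d where Ed: "Ed = (E, d)" by fastforce
  have "\<exists>Ed :: (nat \<Rightarrow> ('r, ('r \<times> nat \<Rightarrow> 'm option)) module) \<times> _.
      case Ed of (E, d) \<Rightarrow> \<exists>\<epsilon>. injective_resolution R M \<epsilon> E d"
    using injective_resolution_exists[OF M] by auto
  from someI_ex[OF this] obtain \<epsilon> where res: "injective_resolution R M \<epsilon> E d"
    by (auto simp: Ed_def[symmetric] Ed)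
  have E: "module R (E i)" and d: "d i \<in> module_hom R (E i) (E (Suc i))" for i
    using res by (auto simp: injective_resolution_def injective_module_def)
  have "carrier (local_cohomology R \<aa> M i) = {\<zero>\<^bsub>local_cohomology R \<aa> M i\<^esub>} \<longleftrightarrow>
      {x \<in> torsion R S (E i). d i x = \<zero>\<^bsub>E (Suc i)\<^esub>} \<subseteq>
      (case i of 0 \<Rightarrow> {\<zero>\<^bsub>E 0\<^esub>} | Suc j \<Rightarrow> d j ` torsion R S (E j))" (is "_ \<longleftrightarrow> ?Z \<subseteq> ?B") for i
  proof -
    interpret Ei: module R "E i" by (rule E)
    interpret E': module R "E (Suc i)" by (rule E)
    have Z: "submodule ?Z R (E i)"
    proof (rule Ei.submoduleI')
      note T = Ei.submoduleE[OF Ei.submodule_torsion[OF S]]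
      show "?Z \<subseteq> carrier (E i)" using T(1) by auto
      show "\<zero>\<^bsub>E i\<^esub> \<in> ?Z"
        using module_hom_zero[OF d E E] S by (auto simp: torsion_def subset_iff intro!: exI[of _ 0])
      show "x \<oplus>\<^bsub>E i\<^esub> y \<in> ?Z" if "x \<in> ?Z" "y \<in> ?Z" for x y
        using that T(1,5) module_homD(2)[OF d, of x i y] by (auto simp: subset_iff)
      show "a \<odot>\<^bsub>E i\<^esub> x \<in> ?Z" if "a \<in> carrier R" "x \<in> ?Z" for a x
        using that T(1,4) module_homD(3)[OF d, of a x i] by (auto simp: subset_iff)
    qed
    have Zm: "module R ((E i)\<lparr>carrier := ?Z\<rparr>)" by (rule submodule_module[OF Z E])
    have BZ: "?B \<subseteq> ?Z"
    proof (cases i)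
      case 0
      then show ?thesis using subgroup.one_closed[OF submodule.axioms(1)[OF Z]] by simp
    next
      case (Suc j)
      then show ?thesis
        using torsion_hom[OF d[of j] E E S] injective_resolution_complex[OF res, of _ j]
        by (auto simp: torsion_def)
    qed
    have "submodule ?B R ((E i)\<lparr>carrier := ?Z\<rparr>)"
    proof -
      have B: "submodule ?B R (E i)"
      proof (cases i)
        case 0
        then show ?thesis using Ei.submodule_zero by simp
      next
        case (Suc j)
        have T: "submodule (torsion R S (E j)) R (E j)"
          by (rule module.submodule_torsion[OF E S])
        have "submodule (d j ` carrier ((E j)\<lparr>carrier := torsion R S (E j)\<rparr>)) R (E (Suc j))"
          by (rule module_hom_image_submodule[OF module_hom_restrict_carrier[OF d] submodule_module[OF T E] E])
            (use module.submoduleE(1)[OF E T] in auto)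
        then show ?thesis using Suc by simp
      qed
      show ?thesis
        by (rule module.submoduleI'[OF Zm])
          (use BZ Ei.submoduleE(4,5)[OF B] subgroup.one_closed[OF submodule.axioms(1)[OF B]] in auto)
    qed
    then have "subgroup ?B (add_monoid ((E i)\<lparr>carrier := ?Z\<rparr>))" by (simp add: submodule_def)
    moreover have "local_cohomology R \<aa> M i = quotient_module ((E i)\<lparr>carrier := ?Z\<rparr>) ?B"
      unfolding local_cohomology_def torsion_cohomology_def Ed_def[symmetric] Ed
      by (simp add: tors[OF E] cong: nat.case_cong)
    ultimately show ?thesis
      using quotient_module_trivial_iff[OF module.axioms(2)[OF Zm]] by simp
  qed
  then show thesis by (rule that[OF res])
qed

section \<open>Injective modules over Noetherian rings\<close>

text \<open>The colon ideals of \<open>J\<close> by the powers of \<open>x\<close> form an ascending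
  chain, and \<open>c\<close> is an index at which it has become stationary.\<close>

lemma noetherian_colon_stable:
  assumes R: "cring R" "noetherian_ring R" and J: "ideal J R" and x: "x \<in> carrier R"
  obtains c :: nat where
    "\<And>(n::nat) r. r \<in> carrier R \<Longrightarrow> x [^]\<^bsub>R\<^esub> (c + n) \<otimes>\<^bsub>R\<^esub> r \<in> J \<Longrightarrow> x [^]\<^bsub>R\<^esub> c \<otimes>\<^bsub>R\<^esub> r \<in> J"
proof -
  interpret R: cring R by fact
  interpret N: noetherian_ring R by fact
  interpret J: ideal J R by fact
  define Q where "Q = (\<lambda>k::nat. {r \<in> carrier R. x [^]\<^bsub>R\<^esub> k \<otimes>\<^bsub>R\<^esub> r \<in> J})"
  have mult: "s \<otimes>\<^bsub>R\<^esub> r \<in> Q k" if "r \<in> Q k" "s \<in> carrier R" for r s k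
  proof -
    have "x [^]\<^bsub>R\<^esub> k \<otimes>\<^bsub>R\<^esub> (s \<otimes>\<^bsub>R\<^esub> r) = s \<otimes>\<^bsub>R\<^esub> (x [^]\<^bsub>R\<^esub> k \<otimes>\<^bsub>R\<^esub> r)"
      using that x by (simp add: Q_def R.m_lcomm)
    then show ?thesis using that J.I_l_closed by (simp add: Q_def)
  qed
  have ideal: "ideal (Q k) R" for k
  proof (rule idealI[OF R.ring_axioms])
    show "subgroup (Q k) (add_monoid R)"
    proof (rule R.add.subgroupI)
      show "Q k \<noteq> {}" using x by (auto simp: Q_def intro!: exI[of _ "\<zero>\<^bsub>R\<^esub>"])
      show "\<ominus>\<^bsub>R\<^esub> r \<in> Q k" if "r \<in> Q k" for r
        using mult[OF that, of "\<ominus>\<^bsub>R\<^esub> \<one>\<^bsub>R\<^esub>"] that by (auto simp: Q_def R.l_minus)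
      show "r \<oplus>\<^bsub>R\<^esub> s \<in> Q k" if "r \<in> Q k" "s \<in> Q k" for r s
        using that x by (auto simp: Q_def R.r_distr)
    qed (auto simp: Q_def)
    show "s \<otimes>\<^bsub>R\<^esub> r \<in> Q k" if "r \<in> Q k" "s \<in> carrier R" for r s by (rule mult[OF that])
    show "r \<otimes>\<^bsub>R\<^esub> s \<in> Q k" if "r \<in> Q k" "s \<in> carrier R" for r s
      using mult[OF that] that R.m_comm[of r s] by (simp add: Q_def)
  qed
  have mono: "Q m \<subseteq> Q (m + k)" for m k
  proof
    fix r assume r: "r \<in> Q m"
    have "x [^]\<^bsub>R\<^esub> (m + k) \<otimes>\<^bsub>R\<^esub> r = x [^]\<^bsub>R\<^esub> k \<otimes>\<^bsub>R\<^esub> (x [^]\<^bsub>R\<^esub> m \<otimes>\<^bsub>R\<^esub> r)"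
      using r x by (simp add: Q_def R.nat_pow_mult[symmetric] R.m_assoc R.m_lcomm)
    then show "r \<in> Q (m + k)" using r x J.I_l_closed by (simp add: Q_def)
  qed
  have chain: "subset.chain {I. ideal I R} (range Q)"
    unfolding subset_chain_def
  proof (intro conjI ballI)
    show "range Q \<subseteq> {I. ideal I R}" using ideal by auto
    fix X Y assume "X \<in> range Q" "Y \<in> range Q"
    then obtain a b where "X = Q a" "Y = Q b" by auto
    then show "X \<subseteq> Y \<or> Y \<subseteq> X"
      using mono[of a "b - a"] mono[of b "a - b"] by (cases "a \<le> b") auto
  qed
  have "\<Union>(range Q) \<in> range Q" by (rule N.ideal_chain_is_trivial[OF _ chain]) auto
  then obtain c where "\<Union>(range Q) = Q c" by auto
  then have "Q (c + n) \<subseteq> Q c" for n by blast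
  then have "x [^]\<^bsub>R\<^esub> c \<otimes>\<^bsub>R\<^esub> r \<in> J"
    if "r \<in> carrier R" "x [^]\<^bsub>R\<^esub> (c + n) \<otimes>\<^bsub>R\<^esub> r \<in> J" for n r
    using that unfolding Q_def by blast
  then show thesis by (rule that)
qed

text \<open>Once the annihilators of the powers of \<open>x\<close> are stationary at
  \<open>c\<close>, sending \<open>r x^(c + n)\<close> to \<open>r x^c e\<close> is well defined on
  the ideal generated by \<open>x^(c + n)\<close>. The element representing this map is
  \<open>e'\<close>.\<close>

lemma baer_stably_divisible:
  assumes R: "cring R" "noetherian_ring R" and E: "module R E" "baer R E" and x: "x \<in> carrier R"
  obtains c :: nat where
    "\<And>(n::nat) e. e \<in> carrier E \<Longrightarrow>
      \<exists>e'\<in>carrier E. x [^]\<^bsub>R\<^esub> c \<odot>\<^bsub>E\<^esub> e = x [^]\<^bsub>R\<^esub> (c + n) \<odot>\<^bsub>E\<^esub> e'"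
proof -
  interpret R: cring R by fact
  interpret E: module R E by fact
  obtain c :: nat where c: "\<And>(n::nat) r. r \<in> carrier R \<Longrightarrow> x [^]\<^bsub>R\<^esub> (c + n) \<otimes>\<^bsub>R\<^esub> r \<in> {\<zero>\<^bsub>R\<^esub>} \<Longrightarrow> x [^]\<^bsub>R\<^esub> c \<otimes>\<^bsub>R\<^esub> r \<in> {\<zero>\<^bsub>R\<^esub>}"
    using noetherian_colon_stable[OF R R.zeroideal x] by blast
  have "\<exists>e'\<in>carrier E. x [^]\<^bsub>R\<^esub> c \<odot>\<^bsub>E\<^esub> e = x [^]\<^bsub>R\<^esub> (c + n) \<odot>\<^bsub>E\<^esub> e'" if e: "e \<in> carrier E" for n :: nat and e
  proof -
    let ?y = "x [^]\<^bsub>R\<^esub> (c + n)"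
    have y: "?y \<in> carrier R" using x by simp
    let ?J = "PIdl\<^bsub>R\<^esub> ?y"
    have J: "?J = {r \<otimes>\<^bsub>R\<^esub> ?y | r. r \<in> carrier R}" by (simp add: cgenideal_def)
    define f where "f = (\<lambda>j. (x [^]\<^bsub>R\<^esub> c \<otimes>\<^bsub>R\<^esub> (SOME r. r \<in> carrier R \<and> j = r \<otimes>\<^bsub>R\<^esub> ?y)) \<odot>\<^bsub>E\<^esub> e)"
    have f: "f (r \<otimes>\<^bsub>R\<^esub> ?y) = (x [^]\<^bsub>R\<^esub> c \<otimes>\<^bsub>R\<^esub> r) \<odot>\<^bsub>E\<^esub> e" if r: "r \<in> carrier R" for r
    proof -
      define s where "s = (SOME s. s \<in> carrier R \<and> r \<otimes>\<^bsub>R\<^esub> ?y = s \<otimes>\<^bsub>R\<^esub> ?y)"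
      have s: "s \<in> carrier R" "r \<otimes>\<^bsub>R\<^esub> ?y = s \<otimes>\<^bsub>R\<^esub> ?y"
        using someI_ex[of "\<lambda>s. s \<in> carrier R \<and> r \<otimes>\<^bsub>R\<^esub> ?y = s \<otimes>\<^bsub>R\<^esub> ?y"] r unfolding s_def by blast+
      have "?y \<otimes>\<^bsub>R\<^esub> (r \<ominus>\<^bsub>R\<^esub> s) = r \<otimes>\<^bsub>R\<^esub> ?y \<ominus>\<^bsub>R\<^esub> s \<otimes>\<^bsub>R\<^esub> ?y"
        using r s(1) y by (simp add: a_minus_def R.r_distr R.r_minus R.l_minus R.m_comm)
      also have "\<dots> = \<zero>\<^bsub>R\<^esub>" using s r y by (simp add: R.minus_eq_zero_iff)
      finally have "x [^]\<^bsub>R\<^esub> c \<otimes>\<^bsub>R\<^esub> (r \<ominus>\<^bsub>R\<^esub> s) = \<zero>\<^bsub>R\<^esub>" using c[of "r \<ominus>\<^bsub>R\<^esub> s" n] r s by simp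
      then have "x [^]\<^bsub>R\<^esub> c \<otimes>\<^bsub>R\<^esub> r \<ominus>\<^bsub>R\<^esub> x [^]\<^bsub>R\<^esub> c \<otimes>\<^bsub>R\<^esub> s = \<zero>\<^bsub>R\<^esub>"
        using r s x by (simp add: a_minus_def R.r_distr R.r_minus)
      then have "x [^]\<^bsub>R\<^esub> c \<otimes>\<^bsub>R\<^esub> r = x [^]\<^bsub>R\<^esub> c \<otimes>\<^bsub>R\<^esub> s" using r s x by (simp add: R.minus_eq_zero_iff)
      then show ?thesis by (simp add: f_def s_def)
    qed
    obtain e' where e': "e' \<in> carrier E" "\<And>j. j \<in> ?J \<Longrightarrow> f j = j \<odot>\<^bsub>E\<^esub> e'"
    proof (rule baerD[OF E(2) R.cgenideal_ideal[OF y], of f], goal_cases)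
      case (1 j) then show ?case using f e x by (auto simp: J)
    next
      case (2 j k)
      then obtain r s where rs: "r \<in> carrier R" "s \<in> carrier R" "j = r \<otimes>\<^bsub>R\<^esub> ?y" "k = s \<otimes>\<^bsub>R\<^esub> ?y"
        by (auto simp: J)
      then have "j \<oplus>\<^bsub>R\<^esub> k = (r \<oplus>\<^bsub>R\<^esub> s) \<otimes>\<^bsub>R\<^esub> ?y" using y by (simp add: R.l_distr)
      then show ?case using rs f[of r] f[of s] f[of "r \<oplus>\<^bsub>R\<^esub> s"] e x
        by (simp add: R.r_distr E.smult_l_distr)
    next
      case (3 s j)
      then obtain r where r: "r \<in> carrier R" "j = r \<otimes>\<^bsub>R\<^esub> ?y" by (auto simp: J)
      then have "s \<otimes>\<^bsub>R\<^esub> j = (s \<otimes>\<^bsub>R\<^esub> r) \<otimes>\<^bsub>R\<^esub> ?y" using y 3 by (simp add: R.m_assoc)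
      then show ?case using r f[of r] f[of "s \<otimes>\<^bsub>R\<^esub> r"] e x 3
        by (simp add: E.smult_assoc1[symmetric] R.m_lcomm)
    qed auto
    have "?y \<in> ?J" using R.cgenideal_self[OF y] .
    then have "x [^]\<^bsub>R\<^esub> c \<odot>\<^bsub>E\<^esub> e = ?y \<odot>\<^bsub>E\<^esub> e'"
      using e'(2)[of ?y] f[of "\<one>\<^bsub>R\<^esub>"] x y by simp
    then show ?thesis using e'(1) by blast
  qed
  then show thesis by (rule that)
qed

text \<open>The Artin--Rees argument for a principal ideal: a map from an ideal \<open>J\<close> into the torsion part
  is killed by some \<open>x\<^sup>N\<close>, hence vanishes on \<open>J \<inter> x\<^sup>c\<^sup>+\<^sup>N R \<subseteq> x\<^sup>N J\<close> and extends by zero to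
  \<open>J + x\<^sup>c\<^sup>+\<^sup>N R\<close>.\<close>

lemma baer_torsion:
  assumes R: "cring R" "noetherian_ring R" and E: "module R E" "baer R E" and x: "x \<in> carrier R"
  shows "baer R (E\<lparr>carrier := torsion R {x} E\<rparr>)"
  unfolding baer_def
proof (intro allI impI, elim conjE)
  interpret R: cring R by fact
  interpret N: noetherian_ring R by fact
  interpret E: module R E by fact
  let ?G = "E\<lparr>carrier := torsion R {x} E\<rparr>"
  fix J f
  assume J: "ideal J R" and f: "f \<in> J \<rightarrow> carrier ?G"
    "\<forall>x\<in>J. \<forall>y\<in>J. f (x \<oplus>\<^bsub>R\<^esub> y) = f x \<oplus>\<^bsub>?G\<^esub> f y"
    "\<forall>r\<in>carrier R. \<forall>x\<in>J. f (r \<otimes>\<^bsub>R\<^esub> x) = r \<odot>\<^bsub>?G\<^esub> f x"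
  interpret J: ideal J R by fact
  have fE: "f j \<in> carrier E" if "j \<in> J" for j using f(1) that by (auto simp: torsion_def)
  have f_add: "f (j \<oplus>\<^bsub>R\<^esub> k) = f j \<oplus>\<^bsub>E\<^esub> f k" if "j \<in> J" "k \<in> J" for j k using f(2) that by simp
  have f_smult: "f (r \<otimes>\<^bsub>R\<^esub> k) = r \<odot>\<^bsub>E\<^esub> f k" if "r \<in> carrier R" "k \<in> J" for r k using f(3) that by simp
  have f_zero: "f \<zero>\<^bsub>R\<^esub> = \<zero>\<^bsub>E\<^esub>"
    using f_smult[of "\<zero>\<^bsub>R\<^esub>" "\<zero>\<^bsub>R\<^esub>"] fE[of "\<zero>\<^bsub>R\<^esub>"] J.zero_closed by simp
  obtain A where A: "A \<subseteq> carrier R" "finite A" "J = Idl\<^bsub>R\<^esub> A" using N.finetely_gen[OF J] by auto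
  have AJ: "A \<subseteq> J" using R.genideal_self[OF A(1)] A(3) by simp
  have "\<forall>a\<in>A. \<exists>n::nat. x [^]\<^bsub>R\<^esub> n \<odot>\<^bsub>E\<^esub> f a = \<zero>\<^bsub>E\<^esub>"
    using f(1) AJ by (auto simp: torsion_def)
  then obtain n :: "_ \<Rightarrow> nat" where n: "\<And>a. a \<in> A \<Longrightarrow> x [^]\<^bsub>R\<^esub> n a \<odot>\<^bsub>E\<^esub> f a = \<zero>\<^bsub>E\<^esub>" by metis
  \<comment> \<open>A common exponent for the finitely many generators, hence for all values of
    \<open>f\<close>.\<close>
  define m where "m = sum n A"
  have kill: "x [^]\<^bsub>R\<^esub> m \<odot>\<^bsub>E\<^esub> f j = \<zero>\<^bsub>E\<^esub>" if "j \<in> J" for j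
  proof -
    let ?I = "{j \<in> J. x [^]\<^bsub>R\<^esub> m \<odot>\<^bsub>E\<^esub> f j = \<zero>\<^bsub>E\<^esub>}"
    have smult: "r \<otimes>\<^bsub>R\<^esub> k \<in> ?I" if "k \<in> ?I" "r \<in> carrier R" for r k
    proof -
      have "x [^]\<^bsub>R\<^esub> m \<odot>\<^bsub>E\<^esub> (r \<odot>\<^bsub>E\<^esub> f k) = r \<odot>\<^bsub>E\<^esub> (x [^]\<^bsub>R\<^esub> m \<odot>\<^bsub>E\<^esub> f k)"
        using that x fE by (intro E.smult_commute) auto
      then show ?thesis using that J.I_l_closed f_smult by simp
    qed
    have "ideal ?I R"
    proof (rule idealI[OF R.ring_axioms])
      show "subgroup ?I (add_monoid R)"
      proof (rule R.add.subgroupI)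
        show "?I \<subseteq> carrier R" using J.Icarr by auto
        show "?I \<noteq> {}" using J.zero_closed f_zero x by (auto intro!: exI[of _ "\<zero>\<^bsub>R\<^esub>"])
        show "\<ominus>\<^bsub>R\<^esub> r \<in> ?I" if "r \<in> ?I" for r
          using smult[OF that, of "\<ominus>\<^bsub>R\<^esub> \<one>\<^bsub>R\<^esub>"] that J.Icarr by (auto simp: R.l_minus)
        show "r \<oplus>\<^bsub>R\<^esub> s \<in> ?I" if "r \<in> ?I" "s \<in> ?I" for r s
          using that x fE J.a_closed by (simp add: f_add E.smult_r_distr)
      qed
      show "s \<otimes>\<^bsub>R\<^esub> r \<in> ?I" if "r \<in> ?I" "s \<in> carrier R" for r s by (rule smult[OF that])
      show "r \<otimes>\<^bsub>R\<^esub> s \<in> ?I" if "r \<in> ?I" "s \<in> carrier R" for r s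
        using smult[OF that] that R.m_comm[of r s] J.Icarr by simp
    qed
    moreover have "A \<subseteq> ?I"
    proof
      fix a assume a: "a \<in> A"
      have "n a \<le> m" unfolding m_def by (rule member_le_sum[OF a]) (use A in auto)
      then show "a \<in> ?I"
        using E.power_smult_zero_mono[OF x fE n] a AJ by auto
    qed
    ultimately have "J \<subseteq> ?I" unfolding A(3) by (rule R.genideal_minimal[folded A(3)])
    then show ?thesis using that by blast
  qed
  obtain c :: nat where c: "\<And>(n::nat) r. r \<in> carrier R \<Longrightarrow> x [^]\<^bsub>R\<^esub> (c + n) \<otimes>\<^bsub>R\<^esub> r \<in> J \<Longrightarrow> x [^]\<^bsub>R\<^esub> c \<otimes>\<^bsub>R\<^esub> r \<in> J"
    using noetherian_colon_stable[OF R J x] by blast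
  let ?y = "x [^]\<^bsub>R\<^esub> (c + m)"
  have y: "?y \<in> carrier R" using x by simp
  have fy: "f (?y \<otimes>\<^bsub>R\<^esub> r) = \<zero>\<^bsub>E\<^esub>" if "r \<in> carrier R" "?y \<otimes>\<^bsub>R\<^esub> r \<in> J" for r
  proof -
    have "x [^]\<^bsub>R\<^esub> c \<otimes>\<^bsub>R\<^esub> r \<in> J" by (rule c[OF that])
    moreover have "?y \<otimes>\<^bsub>R\<^esub> r = x [^]\<^bsub>R\<^esub> m \<otimes>\<^bsub>R\<^esub> (x [^]\<^bsub>R\<^esub> c \<otimes>\<^bsub>R\<^esub> r)"
      using that x by (simp add: R.nat_pow_mult[symmetric] R.m_assoc R.m_lcomm)
    ultimately show ?thesis using f_smult[of "x [^]\<^bsub>R\<^esub> m"] kill x by simp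
  qed
  define J' where "J' = J <+>\<^bsub>R\<^esub> PIdl\<^bsub>R\<^esub> ?y"
  have J': "ideal J' R" unfolding J'_def by (rule R.add_ideals[OF J R.cgenideal_ideal[OF y]])
  have J'_eq: "J' = {j \<oplus>\<^bsub>R\<^esub> r \<otimes>\<^bsub>R\<^esub> ?y | j r. j \<in> J \<and> r \<in> carrier R}"
    unfolding J'_def set_add_def' cgenideal_def by blast
  \<comment> \<open>The extension of \<open>f\<close> by zero on the multiples of \<open>?y\<close>.
    That both prescriptions agree on the overlap is the content of \<open>fy\<close>.\<close>
  define g where "g = (\<lambda>k. f (SOME j. j \<in> J \<and> (\<exists>r\<in>carrier R. k = j \<oplus>\<^bsub>R\<^esub> r \<otimes>\<^bsub>R\<^esub> ?y)))"
  have g: "g (j \<oplus>\<^bsub>R\<^esub> r \<otimes>\<^bsub>R\<^esub> ?y) = f j" if j: "j \<in> J" and r: "r \<in> carrier R" for j r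
  proof -
    define k where "k = (SOME k. k \<in> J \<and> (\<exists>s\<in>carrier R. j \<oplus>\<^bsub>R\<^esub> r \<otimes>\<^bsub>R\<^esub> ?y = k \<oplus>\<^bsub>R\<^esub> s \<otimes>\<^bsub>R\<^esub> ?y))"
    have "k \<in> J \<and> (\<exists>s\<in>carrier R. j \<oplus>\<^bsub>R\<^esub> r \<otimes>\<^bsub>R\<^esub> ?y = k \<oplus>\<^bsub>R\<^esub> s \<otimes>\<^bsub>R\<^esub> ?y)"
      unfolding k_def by (rule someI_ex) (use j r in blast)
    then obtain s where k: "k \<in> J" "s \<in> carrier R" and eq: "j \<oplus>\<^bsub>R\<^esub> r \<otimes>\<^bsub>R\<^esub> ?y = k \<oplus>\<^bsub>R\<^esub> s \<otimes>\<^bsub>R\<^esub> ?y" by blast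
    have jk: "j \<in> carrier R" "k \<in> carrier R" using j k J.Icarr by auto
    have "j \<ominus>\<^bsub>R\<^esub> k = (j \<oplus>\<^bsub>R\<^esub> r \<otimes>\<^bsub>R\<^esub> ?y) \<ominus>\<^bsub>R\<^esub> (k \<oplus>\<^bsub>R\<^esub> r \<otimes>\<^bsub>R\<^esub> ?y)"
      using jk r y by (simp add: a_minus_def R.minus_add R.a_ac R.r_neg R.r_neg1 R.r_neg2)
    also have "\<dots> = ?y \<otimes>\<^bsub>R\<^esub> (s \<ominus>\<^bsub>R\<^esub> r)"
      unfolding eq using jk r k y
      by (simp add: a_minus_def R.minus_add R.a_ac R.r_neg R.r_neg1 R.r_neg2 R.r_distr R.r_minus R.l_minus R.m_comm)
    finally have jk_eq: "j \<ominus>\<^bsub>R\<^esub> k = ?y \<otimes>\<^bsub>R\<^esub> (s \<ominus>\<^bsub>R\<^esub> r)" .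
    have mem: "j \<ominus>\<^bsub>R\<^esub> k \<in> J" using j k by (simp add: a_minus_def J.a_closed J.a_inv_closed)
    have "f (j \<ominus>\<^bsub>R\<^esub> k) = \<zero>\<^bsub>E\<^esub>" using fy[of "s \<ominus>\<^bsub>R\<^esub> r"] mem jk_eq k r by simp
    then have "f j = f k"
      using f_add[OF mem k(1)] fE[OF k(1)] jk by (simp add: a_minus_def R.a_assoc R.l_neg)
    then show ?thesis by (simp add: g_def k_def)
  qed
  obtain e where e: "e \<in> carrier E" "\<And>j. j \<in> J' \<Longrightarrow> g j = j \<odot>\<^bsub>E\<^esub> e"
  proof (rule baerD[OF E(2) J', of g], goal_cases)
    case (1 j) then show ?case using g fE by (auto simp: J'_eq)
  next
    case (2 j k)
    then obtain a r b s where *: "a \<in> J" "r \<in> carrier R" "j = a \<oplus>\<^bsub>R\<^esub> r \<otimes>\<^bsub>R\<^esub> ?y"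
      "b \<in> J" "s \<in> carrier R" "k = b \<oplus>\<^bsub>R\<^esub> s \<otimes>\<^bsub>R\<^esub> ?y" by (auto simp: J'_eq)
    have "j \<oplus>\<^bsub>R\<^esub> k = (a \<oplus>\<^bsub>R\<^esub> b) \<oplus>\<^bsub>R\<^esub> (r \<oplus>\<^bsub>R\<^esub> s) \<otimes>\<^bsub>R\<^esub> ?y"
      using * y J.Icarr by (simp add: R.l_distr R.a_ac)
    then show ?case
      using g[OF *(1,2)] g[OF *(4,5)] g[OF J.a_closed[OF *(1,4)] R.a_closed[OF *(2,5)]] f_add * by simp
  next
    case (3 s j)
    then obtain a r where *: "a \<in> J" "r \<in> carrier R" "j = a \<oplus>\<^bsub>R\<^esub> r \<otimes>\<^bsub>R\<^esub> ?y" by (auto simp: J'_eq)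
    have "s \<otimes>\<^bsub>R\<^esub> j = (s \<otimes>\<^bsub>R\<^esub> a) \<oplus>\<^bsub>R\<^esub> (s \<otimes>\<^bsub>R\<^esub> r) \<otimes>\<^bsub>R\<^esub> ?y"
      using * 3 y J.Icarr by (simp add: R.r_distr R.m_assoc)
    then show ?case
      using g[OF *(1,2)] g[OF J.I_l_closed[OF *(1) 3(2)] R.m_closed[OF 3(2) *(2)]] f_smult * 3 by simp
  qed auto
  \<comment> \<open>The reason for extending by zero: the representing element is now killed by a
    power of \<open>x\<close> and lies in the torsion part.\<close>
  have "?y \<odot>\<^bsub>E\<^esub> e = \<zero>\<^bsub>E\<^esub>"
  proof -
    have eq: "?y = \<zero>\<^bsub>R\<^esub> \<oplus>\<^bsub>R\<^esub> \<one>\<^bsub>R\<^esub> \<otimes>\<^bsub>R\<^esub> ?y" using y by simp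
    have "?y \<in> J'" unfolding J'_eq using eq J.zero_closed by blast
    then show ?thesis using e(2)[of ?y] g[of "\<zero>\<^bsub>R\<^esub>" "\<one>\<^bsub>R\<^esub>"] J.zero_closed y f_zero by simp
  qed
  then have "e \<in> carrier ?G" using e(1) by (auto simp: torsion_def)
  moreover have "f j = j \<odot>\<^bsub>?G\<^esub> e" if j: "j \<in> J" for j
  proof -
    have eq: "j = j \<oplus>\<^bsub>R\<^esub> \<zero>\<^bsub>R\<^esub> \<otimes>\<^bsub>R\<^esub> ?y" using y J.Icarr[OF j] by simp
    have "j \<in> J'" unfolding J'_eq using eq j by blast
    then show ?thesis using e(2)[of j] g[OF j, of "\<zero>\<^bsub>R\<^esub>"] y J.Icarr[OF j] by simp
  qed
  ultimately show "\<exists>e\<in>carrier ?G. \<forall>j\<in>J. f j = j \<odot>\<^bsub>?G\<^esub> e" by blast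
qed

section \<open>The Koszul complexes of powers of a sequence\<close>

text \<open>Families are total functions that vanish off \<open>I\<close>, so equal families are
  equal functions and the modules for different \<open>I\<close> share their operations. Index sets
  will be all Boolean lists, those of one length, and those of one length and degree.\<close>

definition chains :: "('r, 'm, 'y) module_scheme \<Rightarrow> 'i set \<Rightarrow> ('r, 'i \<Rightarrow> 'm) module"
  where "chains M I = \<lparr>carrier = {c. (\<forall>i. c i \<in> carrier M) \<and> (\<forall>i. i \<notin> I \<longrightarrow> c i = \<zero>\<^bsub>M\<^esub>)},
    monoid.mult = undefined, one = undefined, ring.zero = (\<lambda>i. \<zero>\<^bsub>M\<^esub>),
    add = (\<lambda>c d i. c i \<oplus>\<^bsub>M\<^esub> d i), smult = (\<lambda>r c i. r \<odot>\<^bsub>M\<^esub> c i)\<rparr>"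

lemma chains_simps [simp]:
  "\<zero>\<^bsub>chains M I\<^esub> = (\<lambda>i. \<zero>\<^bsub>M\<^esub>)"
  "(c \<oplus>\<^bsub>chains M I\<^esub> d) = (\<lambda>i. c i \<oplus>\<^bsub>M\<^esub> d i)"
  "(r \<odot>\<^bsub>chains M I\<^esub> c) = (\<lambda>i. r \<odot>\<^bsub>M\<^esub> c i)"
  "c \<in> carrier (chains M I) \<longleftrightarrow> (\<forall>i. c i \<in> carrier M) \<and> (\<forall>i. i \<notin> I \<longrightarrow> c i = \<zero>\<^bsub>M\<^esub>)"
  by (simp_all add: chains_def)

lemma module_chains:
  assumes "module R M"
  shows "module R (chains M I)"
proof -
  interpret M: module R M by fact
  have "abelian_group (chains M I)"
  proof (rule abelian_groupI)
    fix c assume "c \<in> carrier (chains M I)"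
    then show "\<exists>d\<in>carrier (chains M I). d \<oplus>\<^bsub>chains M I\<^esub> c = \<zero>\<^bsub>chains M I\<^esub>"
      by (intro bexI[of _ "\<lambda>i. \<ominus>\<^bsub>M\<^esub> c i"]) (auto simp: M.M.l_neg M.M.minus_equality)
  qed (auto simp: M.M.a_ac)
  then show ?thesis
    by (intro moduleI M.R.is_cring)
      (auto simp: M.smult_l_distr M.smult_r_distr M.smult_assoc1)
qed

lemma chains_minus:
  assumes "module R M" "c \<in> carrier (chains M I)"
  shows "\<ominus>\<^bsub>chains M I\<^esub> c = (\<lambda>i. \<ominus>\<^bsub>M\<^esub> c i)"
proof -
  interpret M: module R M by fact
  interpret C: module R "chains M I" by (rule module_chains) fact
  show ?thesis
    by (rule C.M.minus_equality) (use assms(2) in \<open>auto simp: M.M.l_neg M.M.minus_equality\<close>)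
qed

lemma chains_diff:
  assumes "module R M" "c \<in> carrier (chains M I)" "d \<in> carrier (chains M I)"
  shows "c \<ominus>\<^bsub>chains M I\<^esub> d = (\<lambda>i. c i \<ominus>\<^bsub>M\<^esub> d i)"
  using assms by (simp add: a_minus_def chains_minus[OF assms(1,3)])

text \<open>The two components of a mapping cone in one function, selected by the head of the index.
  The empty list indexes neither component and receives zero.\<close>

definition glue :: "('m, 'y) ring_scheme \<Rightarrow> (bool list \<Rightarrow> 'm) \<Rightarrow> (bool list \<Rightarrow> 'm) \<Rightarrow> bool list \<Rightarrow> 'm"
  where "glue M u v = (\<lambda>bs. case bs of [] \<Rightarrow> \<zero>\<^bsub>M\<^esub> | b # t \<Rightarrow> if b then v t else u t)"

lemma glue_simps [simp]:
  "glue M u v [] = \<zero>\<^bsub>M\<^esub>" "glue M u v (False # t) = u t" "glue M u v (True # t) = v t"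
  by (simp_all add: glue_def)

lemma glue_eqI:
  "f [] = g [] \<Longrightarrow> (\<And>t. f (False # t) = g (False # t)) \<Longrightarrow> (\<And>t. f (True # t) = g (True # t)) \<Longrightarrow> f = g"
  by (metis (full_types) ext list.exhaust)

text \<open>The Koszul complex of \<open>x\<^sub>1\<^sup>N, \<dots>, x\<^sub>p\<^sup>N\<close> on \<open>M\<close>. A subset of \<open>{1, \<dots>, p}\<close> is encoded by its
  indicator list, whose number of entries \<open>True\<close> is the cohomological degree; the recursion
  exhibits the complex as an iterated mapping cone. The maps \<open>koszul_shift m\<close> are the transition
  maps from exponent \<open>N\<close> to exponent \<open>m + N\<close>, whose colimit is the Cech complex.\<close>

primrec koszul_diff :: "('r, 'x) ring_scheme \<Rightarrow> ('r, 'm, 'y) module_scheme \<Rightarrow> nat \<Rightarrow> 'r list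
    \<Rightarrow> (bool list \<Rightarrow> 'm) \<Rightarrow> bool list \<Rightarrow> 'm"
  where
    "koszul_diff R M N [] c = (\<lambda>_. \<zero>\<^bsub>M\<^esub>)"
  | "koszul_diff R M N (x # xs) c =
      glue M (koszul_diff R M N xs (\<lambda>t. c (False # t)))
        (\<lambda>t. (x [^]\<^bsub>R\<^esub> N) \<odot>\<^bsub>M\<^esub> c (False # t) \<ominus>\<^bsub>M\<^esub> koszul_diff R M N xs (\<lambda>t. c (True # t)) t)"

primrec koszul_shift :: "('r, 'x) ring_scheme \<Rightarrow> ('r, 'm, 'y) module_scheme \<Rightarrow> nat \<Rightarrow> 'r list
    \<Rightarrow> (bool list \<Rightarrow> 'm) \<Rightarrow> bool list \<Rightarrow> 'm"
  where
    "koszul_shift R M m [] c = c"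
  | "koszul_shift R M m (x # xs) c =
      glue M (koszul_shift R M m xs (\<lambda>t. c (False # t)))
        (\<lambda>t. (x [^]\<^bsub>R\<^esub> m) \<odot>\<^bsub>M\<^esub> koszul_shift R M m xs (\<lambda>t. c (True # t)) t)"

text \<open>The degree is an integer so that \<open>n - 1\<close> makes sense without a case
  distinction; in negative degrees only the zero chain is left.\<close>

definition koszul_chains :: "('r, 'm, 'y) module_scheme \<Rightarrow> nat \<Rightarrow> int \<Rightarrow> (bool list \<Rightarrow> 'm) set"
  where "koszul_chains M p n = {c. (\<forall>bs. c bs \<in> carrier M) \<and>
    (\<forall>bs. c bs \<noteq> \<zero>\<^bsub>M\<^esub> \<longrightarrow> length bs = p \<and> int (count_list bs True) = n)}"

text \<open>Vanishing of the cohomology of the colimit over the exponents, without the colimit: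
  every class has a representative at some \<open>N\<close>, and it is zero if and only if its image
  at some \<open>m + N\<close> is a coboundary.\<close>

definition cech_vanishes :: "('r, 'x) ring_scheme \<Rightarrow> ('r, 'm, 'y) module_scheme \<Rightarrow> 'r list \<Rightarrow> int \<Rightarrow> bool"
  where "cech_vanishes R M xs n \<longleftrightarrow>
    (\<forall>N. \<forall>c\<in>koszul_chains M (length xs) n. koszul_diff R M N xs c = (\<lambda>_. \<zero>\<^bsub>M\<^esub>) \<longrightarrow>
      (\<exists>m. \<exists>b\<in>koszul_chains M (length xs) (n - 1).
        koszul_shift R M m xs c = koszul_diff R M (m + N) xs b))"

lemma koszul_chainsD:
  "c \<in> koszul_chains M p n \<Longrightarrow> c bs \<in> carrier M"
  "c \<in> koszul_chains M p n \<Longrightarrow> c bs \<noteq> \<zero>\<^bsub>M\<^esub> \<Longrightarrow> length bs = p \<and> int (count_list bs True) = n"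
  by (auto simp: koszul_chains_def)

lemma koszul_chains_Cons:
  assumes "c \<in> koszul_chains M (Suc p) n"
  shows "c [] = \<zero>\<^bsub>M\<^esub>" "(\<lambda>t. c (False # t)) \<in> koszul_chains M p n"
    "(\<lambda>t. c (True # t)) \<in> koszul_chains M p (n - 1)"
  using koszul_chainsD[OF assms] by (fastforce simp: koszul_chains_def)+

lemma koszul_chains_glue:
  assumes "u \<in> koszul_chains M p n" "v \<in> koszul_chains M p (n - 1)" "\<zero>\<^bsub>M\<^esub> \<in> carrier M"
  shows "glue M u v \<in> koszul_chains M (Suc p) n"
  unfolding koszul_chains_def
proof (intro CollectI conjI allI impI)
  fix bs
  show "glue M u v bs \<in> carrier M"
    using assms koszul_chainsD(1) by (cases bs) (auto simp: glue_def)
  assume nz: "glue M u v bs \<noteq> \<zero>\<^bsub>M\<^esub>"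
  then obtain b t where bs: "bs = b # t" by (cases bs) auto
  show "length bs = Suc p" "int (count_list bs True) = n"
    using koszul_chainsD(2)[OF assms(1), of t] koszul_chainsD(2)[OF assms(2), of t] nz
    by (cases b; auto simp: bs)+
qed

lemma glue_split: "c [] = \<zero>\<^bsub>M\<^esub> \<Longrightarrow> c = glue M (\<lambda>t. c (False # t)) (\<lambda>t. c (True # t))"
  by (rule glue_eqI) auto

section \<open>Koszul differentials and transition maps\<close>

context module begin

abbreviation (input) "C \<equiv> chains M (UNIV :: bool list set)"

lemma chains_module: "module R (chains M I)"
  by (rule module_chains) (rule module_axioms)

lemma submodule_koszul_chains: "submodule (koszul_chains M p n) R C"
proof (rule module.submoduleI'[OF chains_module])
  show "c \<oplus>\<^bsub>C\<^esub> d \<in> koszul_chains M p n" if "c \<in> koszul_chains M p n" "d \<in> koszul_chains M p n" for c d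
  proof -
    have "c bs \<noteq> \<zero>\<^bsub>M\<^esub> \<or> d bs \<noteq> \<zero>\<^bsub>M\<^esub>" if "c bs \<oplus>\<^bsub>M\<^esub> d bs \<noteq> \<zero>\<^bsub>M\<^esub>" for bs using that by auto
    then show ?thesis using that unfolding koszul_chains_def by fastforce
  qed
  show "r \<odot>\<^bsub>C\<^esub> c \<in> koszul_chains M p n" if "r \<in> carrier R" "c \<in> koszul_chains M p n" for r c
  proof -
    have "c bs \<noteq> \<zero>\<^bsub>M\<^esub>" if "r \<odot>\<^bsub>M\<^esub> c bs \<noteq> \<zero>\<^bsub>M\<^esub>" for bs using that \<open>r \<in> carrier R\<close> by auto
    then show ?thesis using that unfolding koszul_chains_def by auto
  qed
qed (auto simp: koszul_chains_def)

lemmas koszul_chains_closed = module.submoduleE[OF chains_module submodule_koszul_chains]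

lemma koszul_chains_carrier: "c \<in> koszul_chains M p n \<Longrightarrow> c \<in> carrier C"
  by (auto simp: koszul_chains_def)

lemma koszul_chains_zero: "(\<lambda>_. \<zero>\<^bsub>M\<^esub>) \<in> koszul_chains M p n"
  by (auto simp: koszul_chains_def)

lemma koszul_chains_diff:
  "c \<in> koszul_chains M p n \<Longrightarrow> d \<in> koszul_chains M p n \<Longrightarrow> c \<ominus>\<^bsub>C\<^esub> d \<in> koszul_chains M p n"
  unfolding a_minus_def by (intro koszul_chains_closed(3,5))

lemma koszul_diff_closed:
  "set xs \<subseteq> carrier R \<Longrightarrow> (\<And>i. c i \<in> carrier M) \<Longrightarrow> koszul_diff R M N xs c bs \<in> carrier M"
proof (induction xs arbitrary: c bs)
  case (Cons x xs)
  have IH: "koszul_diff R M N xs (\<lambda>t. c (b # t)) t \<in> carrier M" for b t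
    using Cons by auto
  show ?case using Cons.prems IH[of False] IH[of True]
    by (cases bs; cases "hd bs") (auto simp: a_minus_def)
qed simp

lemma koszul_diff_hom:
  assumes "set xs \<subseteq> carrier R"
  shows "koszul_diff R M N xs \<in> module_hom R C C"
proof (rule module_homI)
  show "koszul_diff R M N xs c \<in> carrier C" if "c \<in> carrier C" for c
    using that koszul_diff_closed[OF assms] by simp
  show "koszul_diff R M N xs (c \<oplus>\<^bsub>C\<^esub> d) = koszul_diff R M N xs c \<oplus>\<^bsub>C\<^esub> koszul_diff R M N xs d"
    if "c \<in> carrier C" "d \<in> carrier C" for c d
    using assms that
  proof (induction xs arbitrary: c d)
    case (Cons x xs)
    have IH: "koszul_diff R M N xs (\<lambda>t. c (b # t) \<oplus>\<^bsub>M\<^esub> d (b # t)) =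
      (\<lambda>t. koszul_diff R M N xs (\<lambda>t. c (b # t)) t \<oplus>\<^bsub>M\<^esub> koszul_diff R M N xs (\<lambda>t. d (b # t)) t)" for b
      using Cons.IH[of "\<lambda>t. c (b # t)" "\<lambda>t. d (b # t)"] Cons.prems by simp
    have cl: "koszul_diff R M N xs (\<lambda>t. c (b # t)) t \<in> carrier M"
      "koszul_diff R M N xs (\<lambda>t. d (b # t)) t \<in> carrier M" for b t
      using koszul_diff_closed Cons.prems by auto
    show ?case
      by (rule glue_eqI)
        (use Cons.prems cl in \<open>auto simp: IH smult_r_distr a_minus_def M.minus_add M.a_ac\<close>)
  qed simp
  show "koszul_diff R M N xs (r \<odot>\<^bsub>C\<^esub> c) = r \<odot>\<^bsub>C\<^esub> koszul_diff R M N xs c"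
    if "r \<in> carrier R" "c \<in> carrier C" for r c
    using assms that
  proof (induction xs arbitrary: c)
    case (Cons x xs)
    have IH: "koszul_diff R M N xs (\<lambda>t. r \<odot>\<^bsub>M\<^esub> c (b # t)) =
      (\<lambda>t. r \<odot>\<^bsub>M\<^esub> koszul_diff R M N xs (\<lambda>t. c (b # t)) t)" for b
      using Cons.IH[of "\<lambda>t. c (b # t)"] Cons.prems by simp
    have cl: "koszul_diff R M N xs (\<lambda>t. c (b # t)) t \<in> carrier M" for b t
      using koszul_diff_closed Cons.prems by auto
    show ?case
      by (rule glue_eqI)
        (use Cons.prems cl smult_commute[of "x [^] N" r] in
          \<open>auto simp: IH smult_r_distr a_minus_def smult_r_minus\<close>)
  qed simp
qed

lemma koszul_shift_closed:
  "set xs \<subseteq> carrier R \<Longrightarrow> (\<And>i. c i \<in> carrier M) \<Longrightarrow> koszul_shift R M m xs c bs \<in> carrier M"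
proof (induction xs arbitrary: c bs)
  case (Cons x xs)
  have IH: "koszul_shift R M m xs (\<lambda>t. c (b # t)) t \<in> carrier M" for b t
    using Cons by auto
  show ?case using Cons.prems IH[of False] IH[of True]
    by (cases bs; cases "hd bs") auto
qed simp

lemma koszul_shift_hom:
  assumes "set xs \<subseteq> carrier R"
  shows "koszul_shift R M m xs \<in> module_hom R C C"
proof (rule module_homI)
  show "koszul_shift R M m xs c \<in> carrier C" if "c \<in> carrier C" for c
    using that koszul_shift_closed[OF assms] by simp
  show "koszul_shift R M m xs (c \<oplus>\<^bsub>C\<^esub> d) = koszul_shift R M m xs c \<oplus>\<^bsub>C\<^esub> koszul_shift R M m xs d"
    if "c \<in> carrier C" "d \<in> carrier C" for c d
    using assms that
  proof (induction xs arbitrary: c d)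
    case (Cons x xs)
    have IH: "koszul_shift R M m xs (\<lambda>t. c (b # t) \<oplus>\<^bsub>M\<^esub> d (b # t)) =
      (\<lambda>t. koszul_shift R M m xs (\<lambda>t. c (b # t)) t \<oplus>\<^bsub>M\<^esub> koszul_shift R M m xs (\<lambda>t. d (b # t)) t)" for b
      using Cons.IH[of "\<lambda>t. c (b # t)" "\<lambda>t. d (b # t)"] Cons.prems by simp
    have cl: "koszul_shift R M m xs (\<lambda>t. c (b # t)) t \<in> carrier M"
      "koszul_shift R M m xs (\<lambda>t. d (b # t)) t \<in> carrier M" for b t
      using koszul_shift_closed Cons.prems by auto
    show ?case
      by (rule glue_eqI) (use Cons.prems cl in \<open>auto simp: IH smult_r_distr\<close>)
  qed simp
  show "koszul_shift R M m xs (r \<odot>\<^bsub>C\<^esub> c) = r \<odot>\<^bsub>C\<^esub> koszul_shift R M m xs c"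
    if "r \<in> carrier R" "c \<in> carrier C" for r c
    using assms that
  proof (induction xs arbitrary: c)
    case (Cons x xs)
    have IH: "koszul_shift R M m xs (\<lambda>t. r \<odot>\<^bsub>M\<^esub> c (b # t)) =
      (\<lambda>t. r \<odot>\<^bsub>M\<^esub> koszul_shift R M m xs (\<lambda>t. c (b # t)) t)" for b
      using Cons.IH[of "\<lambda>t. c (b # t)"] Cons.prems by simp
    have cl: "koszul_shift R M m xs (\<lambda>t. c (b # t)) t \<in> carrier M" for b t
      using koszul_shift_closed Cons.prems by auto
    show ?case
      by (rule glue_eqI)
        (use Cons.prems cl smult_commute[of "x [^] m" r] in \<open>auto simp: IH\<close>)
  qed simp
qed

lemmas koszul_diff_linear =
  module_homD(2)[OF koszul_diff_hom] module_homD(3)[OF koszul_diff_hom]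
  module_hom_diff[OF koszul_diff_hom chains_module chains_module]
  module_hom_zero[OF koszul_diff_hom chains_module chains_module]

lemmas koszul_shift_linear =
  module_homD(2)[OF koszul_shift_hom] module_homD(3)[OF koszul_shift_hom]
  module_hom_diff[OF koszul_shift_hom chains_module chains_module]
  module_hom_zero[OF koszul_shift_hom chains_module chains_module]

lemma koszul_diff_Cons:
  assumes "set (x # xs) \<subseteq> carrier R" "c \<in> carrier C"
  shows "koszul_diff R M N (x # xs) c = glue M (koszul_diff R M N xs (\<lambda>t. c (False # t)))
    ((x [^] N) \<odot>\<^bsub>C\<^esub> (\<lambda>t. c (False # t)) \<ominus>\<^bsub>C\<^esub> koszul_diff R M N xs (\<lambda>t. c (True # t)))"
  using assms koszul_diff_closed[of xs] by (simp add: chains_diff[OF module_axioms])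

lemma koszul_diff_chains:
  "set xs \<subseteq> carrier R \<Longrightarrow> c \<in> koszul_chains M (length xs) n \<Longrightarrow>
    koszul_diff R M N xs c \<in> koszul_chains M (length xs) (n + 1)"
proof (induction xs arbitrary: c n)
  case (Cons x xs)
  note split = koszul_chains_Cons[OF Cons.prems(2)[simplified]]
  have "x [^] N \<odot>\<^bsub>C\<^esub> (\<lambda>t. c (False # t)) \<ominus>\<^bsub>C\<^esub> koszul_diff R M N xs (\<lambda>t. c (True # t))
      \<in> koszul_chains M (length xs) n"
    using Cons.IH[of _ "n - 1"] split Cons.prems by (intro koszul_chains_diff koszul_chains_closed(4)) auto
  then show ?case
    using Cons.IH[of _ n] split Cons.prems koszul_chains_carrier[OF Cons.prems(2)]
    by (subst koszul_diff_Cons) (auto intro!: koszul_chains_glue)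
qed (simp add: koszul_chains_zero)

lemma koszul_shift_chains:
  "set xs \<subseteq> carrier R \<Longrightarrow> c \<in> koszul_chains M (length xs) n \<Longrightarrow>
    koszul_shift R M m xs c \<in> koszul_chains M (length xs) n"
proof (induction xs arbitrary: c n)
  case (Cons x xs)
  note split = koszul_chains_Cons[OF Cons.prems(2)[simplified]]
  have "(x [^] m) \<odot>\<^bsub>C\<^esub> koszul_shift R M m xs (\<lambda>t. c (True # t)) \<in> koszul_chains M (length xs) (n - 1)"
    using Cons.IH[of _ "n - 1"] split Cons.prems by (intro koszul_chains_closed(4)) auto
  then show ?case
    using Cons.IH[of _ n] split Cons.prems by (auto intro!: koszul_chains_glue)
qed simp

text \<open>Because of the minus sign in the second component of the cone, the two contributions
  there are both \<open>x^N\<close> times the differential of the first component, and they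
  cancel.\<close>

lemma koszul_diff_square:
  "set xs \<subseteq> carrier R \<Longrightarrow> c \<in> carrier C \<Longrightarrow>
    koszul_diff R M N xs (koszul_diff R M N xs c) = (\<lambda>_. \<zero>\<^bsub>M\<^esub>)"
proof (induction xs arbitrary: c)
  case (Cons x xs)
  interpret C: module R C by (rule chains_module)
  let ?u = "\<lambda>t. c (False # t)" and ?v = "\<lambda>t. c (True # t)" and ?d = "koszul_diff R M N xs"
  have xs: "set xs \<subseteq> carrier R" and x: "x [^] N \<in> carrier R" and uv: "?u \<in> carrier C" "?v \<in> carrier C"
    using Cons.prems by auto
  have cl: "?d e \<in> carrier C" if "e \<in> carrier C" for e
    using module_homD(1)[OF koszul_diff_hom[OF xs] that] .
  define w where "w = (x [^] N) \<odot>\<^bsub>C\<^esub> ?u \<ominus>\<^bsub>C\<^esub> ?d ?v"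
  have w: "w \<in> carrier C" unfolding w_def using x uv cl by (intro C.M.minus_closed C.smult_closed)
  have "?d w = (x [^] N) \<odot>\<^bsub>C\<^esub> ?d ?u \<ominus>\<^bsub>C\<^esub> \<zero>\<^bsub>C\<^esub>"
    unfolding w_def using koszul_diff_linear(2,3)[OF xs] Cons.IH[OF xs uv(2)] x uv cl C.smult_closed
    by (simp del: chains_simps(2-4))
  also have "\<dots> = (x [^] N) \<odot>\<^bsub>C\<^esub> ?d ?u"
    using C.smult_closed[OF x cl[OF uv(1)]] C.M.add.inv_one by (simp add: a_minus_def del: chains_simps)
  finally have dw: "?d w = (x [^] N) \<odot>\<^bsub>C\<^esub> ?d ?u" .
  have "koszul_diff R M N (x # xs) c = glue M (?d ?u) w"
    unfolding w_def using Cons.prems by (rule koszul_diff_Cons)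
  moreover have "glue M (?d ?u) w \<in> carrier C"
    using cl[OF uv(1)] w by (auto simp: glue_def split: list.split)
  ultimately have "koszul_diff R M N (x # xs) (koszul_diff R M N (x # xs) c) =
      glue M (?d (?d ?u)) ((x [^] N) \<odot>\<^bsub>C\<^esub> ?d ?u \<ominus>\<^bsub>C\<^esub> ?d w)"
    using koszul_diff_Cons[OF Cons.prems(1), of "glue M (?d ?u) w"] by simp
  also have "(x [^] N) \<odot>\<^bsub>C\<^esub> ?d ?u \<ominus>\<^bsub>C\<^esub> ?d w = \<zero>\<^bsub>C\<^esub>"
    unfolding dw using C.M.minus_eq_zero_iff C.smult_closed[OF x cl[OF uv(1)]] by blast
  also have "?d (?d ?u) = \<zero>\<^bsub>C\<^esub>" using Cons.IH[OF xs uv(1)] by simp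
  also have "glue M \<zero>\<^bsub>C\<^esub> \<zero>\<^bsub>C\<^esub> = (\<lambda>_. \<zero>\<^bsub>M\<^esub>)" by (rule glue_eqI) auto
  finally show ?case .
qed simp

text \<open>The factor \<open>x^m\<close> on the second component of the cone turns the connecting
  factor \<open>x^N\<close> into \<open>x^(m + N)\<close>.\<close>

lemma koszul_shift_diff:
  "set xs \<subseteq> carrier R \<Longrightarrow> c \<in> carrier C \<Longrightarrow>
    koszul_shift R M m xs (koszul_diff R M N xs c) = koszul_diff R M (m + N) xs (koszul_shift R M m xs c)"
proof (induction xs arbitrary: c)
  case (Cons x xs)
  interpret C: module R C by (rule chains_module)
  let ?u = "\<lambda>t. c (False # t)" and ?v = "\<lambda>t. c (True # t)"
    and ?d = "koszul_diff R M N xs" and ?s = "koszul_shift R M m xs" and ?e = "koszul_diff R M (m + N) xs"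
  have xs: "set xs \<subseteq> carrier R" and x: "x \<in> carrier R" and uv: "?u \<in> carrier C" "?v \<in> carrier C"
    using Cons.prems by auto
  have cl: "?d e \<in> carrier C" "?s e \<in> carrier C" "?e e \<in> carrier C" if "e \<in> carrier C" for e
    by (rule module_homD(1)[OF koszul_diff_hom[OF xs] that] module_homD(1)[OF koszul_shift_hom[OF xs] that])+
  have xN: "x [^] N \<in> carrier R" "x [^] m \<in> carrier R" using x by auto
  have "(x [^] m) \<odot>\<^bsub>C\<^esub> ?s ((x [^] N) \<odot>\<^bsub>C\<^esub> ?u \<ominus>\<^bsub>C\<^esub> ?d ?v) =
      (x [^] m) \<odot>\<^bsub>C\<^esub> ((x [^] N) \<odot>\<^bsub>C\<^esub> ?s ?u \<ominus>\<^bsub>C\<^esub> ?s (?d ?v))"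
    using koszul_shift_linear(2,3)[OF xs] xN uv cl C.smult_closed by (simp del: chains_simps)
  also have "\<dots> = (x [^] (m + N)) \<odot>\<^bsub>C\<^esub> ?s ?u \<ominus>\<^bsub>C\<^esub> (x [^] m) \<odot>\<^bsub>C\<^esub> ?e (?s ?v)"
    using Cons.IH[OF xs uv(2)] x xN uv cl C.smult_closed C.smult_assoc1
    by (simp add: a_minus_def C.smult_r_distr C.smult_r_minus R.nat_pow_mult[symmetric] del: chains_simps)
  also have "\<dots> = (x [^] (m + N)) \<odot>\<^bsub>C\<^esub> ?s ?u \<ominus>\<^bsub>C\<^esub> ?e ((x [^] m) \<odot>\<^bsub>C\<^esub> ?s ?v)"
    using koszul_diff_linear(2)[OF xs] xN uv cl by (simp del: chains_simps)
  finally have eq: "(x [^] m) \<odot>\<^bsub>C\<^esub> ?s ((x [^] N) \<odot>\<^bsub>C\<^esub> ?u \<ominus>\<^bsub>C\<^esub> ?d ?v) =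
      (x [^] (m + N)) \<odot>\<^bsub>C\<^esub> ?s ?u \<ominus>\<^bsub>C\<^esub> ?e ((x [^] m) \<odot>\<^bsub>C\<^esub> ?s ?v)" .
  have "koszul_shift R M m (x # xs) (koszul_diff R M N (x # xs) c) =
    glue M (?s (?d ?u)) ((x [^] m) \<odot>\<^bsub>C\<^esub> ?s ((x [^] N) \<odot>\<^bsub>C\<^esub> ?u \<ominus>\<^bsub>C\<^esub> ?d ?v))"
    by (subst koszul_diff_Cons[OF Cons.prems]) simp
  also have "\<dots> = koszul_diff R M (m + N) (x # xs) (koszul_shift R M m (x # xs) c)"
  proof (subst koszul_diff_Cons[OF Cons.prems(1)])
    show "koszul_shift R M m (x # xs) c \<in> carrier C"
      using module_homD(1)[OF koszul_shift_hom[OF Cons.prems(1)] Cons.prems(2)] .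
  qed (use eq Cons.IH[OF xs uv(1)] in simp)
  finally show ?case .
qed simp

lemma koszul_shift_shift:
  "set xs \<subseteq> carrier R \<Longrightarrow> c \<in> carrier C \<Longrightarrow>
    koszul_shift R M m xs (koszul_shift R M n xs c) = koszul_shift R M (m + n) xs c"
proof (induction xs arbitrary: c)
  case (Cons x xs)
  interpret C: module R C by (rule chains_module)
  let ?u = "\<lambda>t. c (False # t)" and ?v = "\<lambda>t. c (True # t)"
  have xs: "set xs \<subseteq> carrier R" and x: "x \<in> carrier R" and uv: "?u \<in> carrier C" "?v \<in> carrier C"
    using Cons.prems by auto
  have "koszul_shift R M m xs ((x [^] n) \<odot>\<^bsub>C\<^esub> koszul_shift R M n xs ?v) =
      (x [^] n) \<odot>\<^bsub>C\<^esub> koszul_shift R M m xs (koszul_shift R M n xs ?v)"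
    using koszul_shift_linear(2)[OF xs] x module_homD(1)[OF koszul_shift_hom[OF xs] uv(2)]
    by (simp del: chains_simps)
  then have "koszul_shift R M m xs (\<lambda>t. (x [^] n) \<odot>\<^bsub>M\<^esub> koszul_shift R M n xs ?v t) =
      (\<lambda>t. (x [^] n) \<odot>\<^bsub>M\<^esub> koszul_shift R M (m + n) xs ?v t)"
    using Cons.IH[OF xs uv(2)] by simp
  then show ?case
    using Cons.IH[OF xs uv(1)] x koszul_shift_closed[OF xs, of ?v "m + n"] uv
    by (simp add: smult_assoc1[symmetric] R.nat_pow_mult)
qed simp

text \<open>Stated for chains of the right length, since \<open>glue\<close> replaces the value at
  the empty list by zero.\<close>

lemma koszul_shift_0:
  "set xs \<subseteq> carrier R \<Longrightarrow> c \<in> koszul_chains M (length xs) n \<Longrightarrow> koszul_shift R M 0 xs c = c"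
proof (induction xs arbitrary: c n)
  case (Cons x xs)
  note split = koszul_chains_Cons[OF Cons.prems(2)[simplified]]
  show ?case
    using Cons.IH[OF _ split(2)] Cons.IH[OF _ split(3)] Cons.prems split(1) koszul_chainsD(1)[OF split(3)]
      glue_split[of c, OF split(1)] by simp
qed simp

end

text \<open>Serves for inclusions of torsion submodules, for the maps of a short exact sequence, and
  for scalars of \<open>K\<close> acting on an \<open>A\<close>-module.\<close>

lemma koszul_natural:
  assumes f: "f \<in> module_hom R M N" and M: "module R M" and N: "module R N"
  shows "set xs \<subseteq> carrier R \<Longrightarrow> (\<And>i. c i \<in> carrier M) \<Longrightarrow>
      koszul_diff R N k xs (\<lambda>i. f (c i)) = (\<lambda>i. f (koszul_diff R M k xs c i))"
    and "set xs \<subseteq> carrier R \<Longrightarrow> (\<And>i. c i \<in> carrier M) \<Longrightarrow>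
      koszul_shift R N k xs (\<lambda>i. f (c i)) = (\<lambda>i. f (koszul_shift R M k xs c i))"
proof -
  interpret M: module R M by fact
  note z = module_hom_zero[OF f M N]
  show "koszul_diff R N k xs (\<lambda>i. f (c i)) = (\<lambda>i. f (koszul_diff R M k xs c i))"
    if "set xs \<subseteq> carrier R" "\<And>i. c i \<in> carrier M"
    using that
  proof (induction xs arbitrary: c)
    case (Cons x xs)
    have cl: "koszul_diff R M k xs (\<lambda>t. c (b # t)) t \<in> carrier M" for b t
      using Cons.prems by (intro M.koszul_diff_closed) auto
    show ?case
      by (rule glue_eqI)
        (use Cons cl in \<open>auto simp: z module_hom_diff[OF f M N] module_homD(3)[OF f]\<close>)
  qed (simp add: z)
  show "koszul_shift R N k xs (\<lambda>i. f (c i)) = (\<lambda>i. f (koszul_shift R M k xs c i))"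
    if "set xs \<subseteq> carrier R" "\<And>i. c i \<in> carrier M"
    using that
  proof (induction xs arbitrary: c)
    case (Cons x xs)
    have cl: "koszul_shift R M k xs (\<lambda>t. c (b # t)) t \<in> carrier M" for b t
      using Cons.prems by (intro M.koszul_shift_closed) auto
    show ?case
      by (rule glue_eqI) (use Cons cl in \<open>auto simp: z module_homD(3)[OF f]\<close>)
  qed (simp add: z)
qed

section \<open>Local cohomology and Cech cohomology\<close>

lemma koszul_chains_restrict:
  "H \<subseteq> carrier M \<Longrightarrow> c \<in> koszul_chains (M\<lparr>carrier := H\<rparr>) p n \<longleftrightarrow> c \<in> koszul_chains M p n \<and> (\<forall>i. c i \<in> H)"
  by (auto simp: koszul_chains_def)

lemma koszul_restrict:
  assumes "module R M" "submodule H R M" "set xs \<subseteq> carrier R" "\<And>i. c i \<in> H"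
  shows "koszul_diff R (M\<lparr>carrier := H\<rparr>) N xs c = koszul_diff R M N xs c"
    and "koszul_shift R (M\<lparr>carrier := H\<rparr>) N xs c = koszul_shift R M N xs c"
proof -
  have H: "H \<subseteq> carrier M" using module.submoduleE(1)[OF assms(1,2)] .
  have hom: "(\<lambda>x. x) \<in> module_hom R (M\<lparr>carrier := H\<rparr>) M" using H by (auto simp: module_hom_def)
  note nat = koszul_natural[OF hom submodule_module[OF assms(2,1)] assms(1,3), of c]
  show "koszul_diff R (M\<lparr>carrier := H\<rparr>) N xs c = koszul_diff R M N xs c"
    "koszul_shift R (M\<lparr>carrier := H\<rparr>) N xs c = koszul_shift R M N xs c"
    using nat assms(4) by simp_all
qed

lemma finite_koszul_support:
  assumes "c \<in> koszul_chains M p n"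
  shows "finite {bs. c bs \<noteq> \<zero>\<^bsub>M\<^esub>}"
  by (rule finite_subset[OF _ finite_lists_length_eq[of "UNIV :: bool set" p]])
    (use koszul_chainsD(2)[OF assms] in auto)

text \<open>Induction on the generators, for all modules with Baer's property at once. A cocycle for
  \<open>x # xs\<close> is a pair \<open>u\<close>, \<open>v\<close> with \<open>d u = 0\<close> and
  \<open>x^N u = d v\<close>. After a shift, stable divisibility expresses \<open>v\<close> through
  some \<open>w\<close> such that \<open>u - d w\<close> is a cocycle killed by a power of
  \<open>x\<close>. The induction hypothesis for the torsion submodule writes it, after another
  shift, as \<open>d w'\<close> with \<open>w'\<close> torsion. A last shift makes the power of
  \<open>x\<close> in the cone kill \<open>w'\<close>, and the pair with first component
  \<open>w + w'\<close> and second component zero is the primitive.\<close>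

theorem koszul_acyclic:
  assumes R: "cring R" "noetherian_ring R"
  shows "module R E \<Longrightarrow> baer R E \<Longrightarrow> set xs \<subseteq> carrier R \<Longrightarrow> 0 < n \<Longrightarrow> cech_vanishes R E xs n"
proof (induction xs arbitrary: E)
  case Nil
  have "c = (\<lambda>_. \<zero>\<^bsub>E\<^esub>)" if "c \<in> koszul_chains E 0 n" for c
  proof
    show "c bs = \<zero>\<^bsub>E\<^esub>" for bs using koszul_chainsD(2)[OF that, of bs] Nil
      by (cases "c bs = \<zero>\<^bsub>E\<^esub>") auto
  qed
  then show ?case
    using module.koszul_chains_zero[OF Nil(1)] by (fastforce simp: cech_vanishes_def)
next
  case (Cons x xs)
  interpret E: module R E by fact
  let ?C = "chains E (UNIV :: bool list set)"
  interpret C: module R ?C by (rule E.chains_module)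
  let ?p = "length xs"
  have xs: "set xs \<subseteq> carrier R" and x: "x \<in> carrier R" using Cons.prems by auto
  let ?H = "torsion R {x} E"
  let ?G = "E\<lparr>carrier := ?H\<rparr>"
  have H: "submodule ?H R E" using E.submodule_torsion[of "{x}"] x by simp
  have G: "module R ?G" "baer R ?G"
    by (rule submodule_module[OF H]) (use Cons baer_torsion[OF R] x in auto)
  have IH: "cech_vanishes R ?G xs n" by (rule Cons.IH[OF G xs Cons.prems(4)])
  show ?case
    unfolding cech_vanishes_def
  proof (intro allI ballI impI)
    fix N c
    assume c: "c \<in> koszul_chains E (length (x # xs)) n" "koszul_diff R E N (x # xs) c = (\<lambda>_. \<zero>\<^bsub>E\<^esub>)"
    define u where "u = (\<lambda>t. c (False # t))"
    define v where "v = (\<lambda>t. c (True # t))"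
    have uv: "u \<in> koszul_chains E ?p n" "v \<in> koszul_chains E ?p (n - 1)" and c0: "c [] = \<zero>\<^bsub>E\<^esub>"
      using koszul_chains_Cons[of c E ?p n] c(1) by (auto simp: u_def v_def)
    have uC: "u \<in> carrier ?C" "v \<in> carrier ?C" using uv E.koszul_chains_carrier by blast+
    note dC = module_homD(1)[OF E.koszul_diff_hom[OF xs]]
    note sC = module_homD(1)[OF E.koszul_shift_hom[OF xs]]
    note dl = E.koszul_diff_linear[OF xs]
    note sl = E.koszul_shift_linear[OF xs]
    have xp: "x [^]\<^bsub>R\<^esub> (k::nat) \<in> carrier R" for k using x by simp
    have "glue E (koszul_diff R E N xs u) ((x [^]\<^bsub>R\<^esub> N) \<odot>\<^bsub>?C\<^esub> u \<ominus>\<^bsub>?C\<^esub> koszul_diff R E N xs v) = (\<lambda>_. \<zero>\<^bsub>E\<^esub>)"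
      using c(2) E.koszul_diff_Cons[OF Cons.prems(3) E.koszul_chains_carrier[OF c(1)], of N]
      by (simp add: u_def v_def)
    note eq = this[THEN fun_cong]
    have du: "koszul_diff R E N xs u = \<zero>\<^bsub>?C\<^esub>"
      using eq[of "False # t" for t] by (auto simp: fun_eq_iff)
    have "(x [^]\<^bsub>R\<^esub> N) \<odot>\<^bsub>?C\<^esub> u \<ominus>\<^bsub>?C\<^esub> koszul_diff R E N xs v = \<zero>\<^bsub>?C\<^esub>"
      using eq[of "True # t" for t] by (simp add: fun_eq_iff)
    then have xu: "(x [^]\<^bsub>R\<^esub> N) \<odot>\<^bsub>?C\<^esub> u = koszul_diff R E N xs v"
      using C.M.minus_eq_zero_iff[OF C.smult_closed[OF xp uC(1)] dC[OF uC(2)]] by blast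
    \<comment> \<open>For this \<open>k\<close> the submodules \<open>x^k E\<close> and
      \<open>x^(k + n) E\<close> coincide, so \<open>x^k\<close> times the shifted \<open>v\<close>
      is a multiple of \<open>x^(k + N)\<close>.\<close>
    obtain k :: nat where k: "\<And>(n::nat) e. e \<in> carrier E \<Longrightarrow>
      \<exists>e'\<in>carrier E. x [^]\<^bsub>R\<^esub> k \<odot>\<^bsub>E\<^esub> e = x [^]\<^bsub>R\<^esub> (k + n) \<odot>\<^bsub>E\<^esub> e'"
      using baer_stably_divisible[OF R Cons.prems(1,2) x] by metis
    let ?sv = "koszul_shift R E k xs v"
    have sv: "?sv \<in> koszul_chains E ?p (n - 1)" by (rule E.koszul_shift_chains[OF xs uv(2)])
    \<comment> \<open>Taking zero wherever \<open>?sv\<close> is zero keeps the support, and with it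
      the degree, of the quotient chain.\<close>
    have "\<forall>bs. \<exists>e'\<in>carrier E. x [^]\<^bsub>R\<^esub> k \<odot>\<^bsub>E\<^esub> ?sv bs = x [^]\<^bsub>R\<^esub> (k + N) \<odot>\<^bsub>E\<^esub> e' \<and>
        (?sv bs = \<zero>\<^bsub>E\<^esub> \<longrightarrow> e' = \<zero>\<^bsub>E\<^esub>)"
    proof
      fix bs
      show "\<exists>e'\<in>carrier E. x [^]\<^bsub>R\<^esub> k \<odot>\<^bsub>E\<^esub> ?sv bs = x [^]\<^bsub>R\<^esub> (k + N) \<odot>\<^bsub>E\<^esub> e' \<and>
        (?sv bs = \<zero>\<^bsub>E\<^esub> \<longrightarrow> e' = \<zero>\<^bsub>E\<^esub>)"
      proof (cases "?sv bs = \<zero>\<^bsub>E\<^esub>")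
        case True
        then show ?thesis using x by (intro bexI[of _ "\<zero>\<^bsub>E\<^esub>"]) auto
      next
        case False
        then show ?thesis using k[OF koszul_chainsD(1)[OF sv], of bs N] by auto
      qed
    qed
    then obtain w where w: "\<And>bs. w bs \<in> carrier E"
      "\<And>bs. x [^]\<^bsub>R\<^esub> k \<odot>\<^bsub>E\<^esub> ?sv bs = x [^]\<^bsub>R\<^esub> (k + N) \<odot>\<^bsub>E\<^esub> w bs"
      "\<And>bs. ?sv bs = \<zero>\<^bsub>E\<^esub> \<Longrightarrow> w bs = \<zero>\<^bsub>E\<^esub>" by metis
    have wK: "w \<in> koszul_chains E ?p (n - 1)"
      using w(1,3) koszul_chainsD(2)[OF sv] unfolding koszul_chains_def by blast
    have wC: "w \<in> carrier ?C" using w(1) by simp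
    have xw: "(x [^]\<^bsub>R\<^esub> (k + N)) \<odot>\<^bsub>?C\<^esub> w = (x [^]\<^bsub>R\<^esub> k) \<odot>\<^bsub>?C\<^esub> ?sv" using w(2) by simp
    let ?N = "k + N"
    \<comment> \<open>Correcting \<open>u\<close> by a coboundary leaves a cocycle that
      \<open>x^(k + N)\<close> kills, hence a cocycle of the torsion submodule.\<close>
    define u1 where "u1 = koszul_shift R E k xs u \<ominus>\<^bsub>?C\<^esub> koszul_diff R E ?N xs w"
    have u1K: "u1 \<in> koszul_chains E ?p n"
      unfolding u1_def using E.koszul_diff_chains[OF xs wK]
      by (intro E.koszul_chains_diff E.koszul_shift_chains[OF xs uv(1)]) simp
    have u1C: "u1 \<in> carrier ?C" by (rule E.koszul_chains_carrier[OF u1K])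
    have "(x [^]\<^bsub>R\<^esub> ?N) \<odot>\<^bsub>?C\<^esub> koszul_shift R E k xs u = (x [^]\<^bsub>R\<^esub> k) \<odot>\<^bsub>?C\<^esub> koszul_shift R E k xs ((x [^]\<^bsub>R\<^esub> N) \<odot>\<^bsub>?C\<^esub> u)"
      using sl(2)[OF xp uC(1)] sC[OF uC(1)] x xp
      by (simp add: C.smult_assoc1 E.R.nat_pow_mult[symmetric] del: chains_simps)
    also have "\<dots> = (x [^]\<^bsub>R\<^esub> k) \<odot>\<^bsub>?C\<^esub> koszul_diff R E ?N xs ?sv"
      unfolding xu by (subst E.koszul_shift_diff[OF xs uC(2)]) simp
    also have "\<dots> = (x [^]\<^bsub>R\<^esub> ?N) \<odot>\<^bsub>?C\<^esub> koszul_diff R E ?N xs w"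
      by (simp only: dl(2)[OF xp sC[OF uC(2)], symmetric] dl(2)[OF xp wC, symmetric] xw)
    finally have xu1: "(x [^]\<^bsub>R\<^esub> ?N) \<odot>\<^bsub>?C\<^esub> u1 = \<zero>\<^bsub>?C\<^esub>"
      unfolding u1_def using sC[OF uC(1)] dC[OF wC] xp
      by (simp add: a_minus_def C.smult_r_distr C.smult_r_minus C.M.r_neg del: chains_simps)
    have "koszul_diff R E ?N xs u1 = \<zero>\<^bsub>?C\<^esub>"
      unfolding u1_def using dl(3)[OF sC[OF uC(1)] dC[OF wC]] E.koszul_diff_square[OF xs wC]
        E.koszul_shift_diff[OF xs uC(1), of k N] du sl(4) C.M.minus_eq_zero_iff[OF C.M.zero_closed C.M.zero_closed]
      by simp
    then have dG: "koszul_diff R ?G ?N xs u1 = (\<lambda>_. \<zero>\<^bsub>?G\<^esub>)" if "\<And>i. u1 i \<in> ?H"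
      using koszul_restrict(1)[OF Cons.prems(1) H xs that] by simp
    have u1H: "u1 i \<in> ?H" for i
      using fun_cong[OF xu1, of i] u1C by (auto simp: torsion_def)
    have "u1 \<in> koszul_chains ?G ?p n"
      using u1K u1H koszul_chains_restrict[OF E.submoduleE(1)[OF H]] by blast
    from IH[unfolded cech_vanishes_def, rule_format, OF this dG[OF u1H]]
    obtain m w' where w': "w' \<in> koszul_chains ?G ?p (n - 1)"
      and mw': "koszul_shift R ?G m xs u1 = koszul_diff R ?G (m + ?N) xs w'"
      by blast
    have w'K: "w' \<in> koszul_chains E ?p (n - 1)" and w'H: "w' i \<in> ?H" for i
      using w' koszul_chains_restrict[OF E.submoduleE(1)[OF H]] by blast+
    have w'C: "w' \<in> carrier ?C" by (rule E.koszul_chains_carrier[OF w'K])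
    have mw: "koszul_shift R E m xs u1 = koszul_diff R E (m + ?N) xs w'"
      using mw' koszul_restrict[OF Cons.prems(1) H xs u1H] koszul_restrict[OF Cons.prems(1) H xs w'H] by simp
    have "\<forall>i. \<exists>l::nat. x [^]\<^bsub>R\<^esub> l \<odot>\<^bsub>E\<^esub> w' i = \<zero>\<^bsub>E\<^esub>" using w'H by (auto simp: torsion_def)
    then obtain l :: "_ \<Rightarrow> nat" where l: "\<And>i. x [^]\<^bsub>R\<^esub> l i \<odot>\<^bsub>E\<^esub> w' i = \<zero>\<^bsub>E\<^esub>" by metis
    \<comment> \<open>The support of \<open>w'\<close> is finite, so the sum of the exponents on it
      bounds all of them.\<close>
    define q where "q = sum l {i. w' i \<noteq> \<zero>\<^bsub>E\<^esub>}"
    have q: "x [^]\<^bsub>R\<^esub> r \<odot>\<^bsub>E\<^esub> w' i = \<zero>\<^bsub>E\<^esub>" if "q \<le> r" for i r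
    proof (cases "w' i = \<zero>\<^bsub>E\<^esub>")
      case False
      then have "l i \<le> q" unfolding q_def by (intro member_le_sum) (auto intro: finite_koszul_support[OF w'K])
      then show ?thesis using E.power_smult_zero_mono[OF x _ l, of i] that w'C by simp
    qed (use x in simp)
    have powadd: "(x [^]\<^bsub>R\<^esub> (a + b)) \<odot>\<^bsub>?C\<^esub> e = (x [^]\<^bsub>R\<^esub> a) \<odot>\<^bsub>?C\<^esub> ((x [^]\<^bsub>R\<^esub> b) \<odot>\<^bsub>?C\<^esub> e)"
      if "e \<in> carrier ?C" for a b :: nat and e
      using C.smult_assoc1[OF xp xp that, of a b] x by (simp only: E.R.nat_pow_mult)
    \<comment> \<open>The shift by \<open>m\<close> makes \<open>u1\<close> the coboundary of
      \<open>w'\<close>; the additional \<open>q\<close> raises the power of \<open>x\<close> until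
      it kills \<open>w'\<close>.\<close>
    let ?M = "q + m"
    let ?s = "koszul_shift R E ?M xs" and ?d = "koszul_diff R E (?M + ?N) xs"
    define b1 where "b1 = ?s w \<oplus>\<^bsub>?C\<^esub> koszul_shift R E q xs w'"
    have b1K: "b1 \<in> koszul_chains E ?p (n - 1)"
      unfolding b1_def by (intro E.koszul_chains_closed(5) E.koszul_shift_chains[OF xs] wK w'K)
    have b1C: "b1 \<in> carrier ?C" by (rule E.koszul_chains_carrier[OF b1K])
    have "?d b1 = ?d (?s w) \<oplus>\<^bsub>?C\<^esub> ?d (koszul_shift R E q xs w')"
      unfolding b1_def by (rule dl(1)[OF sC[OF wC] sC[OF w'C]])
    also have "?d (?s w) = ?s (koszul_diff R E ?N xs w)" by (rule E.koszul_shift_diff[OF xs wC, symmetric])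
    also have "?d (koszul_shift R E q xs w') = koszul_shift R E q xs (koszul_shift R E m xs u1)"
      unfolding mw by (subst E.koszul_shift_diff[OF xs w'C]) (simp add: add.assoc)
    also have "\<dots> = ?s u1" by (rule E.koszul_shift_shift[OF xs u1C])
    also have "\<dots> = ?s (koszul_shift R E k xs u) \<ominus>\<^bsub>?C\<^esub> ?s (koszul_diff R E ?N xs w)"
      unfolding u1_def by (rule sl(3)[OF sC[OF uC(1)] dC[OF wC]])
    also have "?s (koszul_diff R E ?N xs w) \<oplus>\<^bsub>?C\<^esub> \<dots> = ?s (koszul_shift R E k xs u)"
      using sC[OF dC[OF wC]] sC[OF sC[OF uC(1)]]
      by (simp add: a_minus_def C.M.a_ac C.M.r_neg C.M.r_neg1 C.M.r_neg2 del: chains_simps)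
    also have "\<dots> = koszul_shift R E (?M + k) xs u" by (rule E.koszul_shift_shift[OF xs uC(1)])
    finally have first: "?d b1 = koszul_shift R E (?M + k) xs u" .
    have "(x [^]\<^bsub>R\<^esub> (?M + ?N)) \<odot>\<^bsub>?C\<^esub> koszul_shift R E q xs w' = koszul_shift R E q xs ((x [^]\<^bsub>R\<^esub> (?M + ?N)) \<odot>\<^bsub>?C\<^esub> w')"
      by (rule sl(2)[OF xp w'C, symmetric])
    also have "(x [^]\<^bsub>R\<^esub> (?M + ?N)) \<odot>\<^bsub>?C\<^esub> w' = \<zero>\<^bsub>?C\<^esub>" using q[of "?M + ?N"] by simp
    finally have z: "(x [^]\<^bsub>R\<^esub> (?M + ?N)) \<odot>\<^bsub>?C\<^esub> koszul_shift R E q xs w' = \<zero>\<^bsub>?C\<^esub>" using sl(4) by simp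
    have "(x [^]\<^bsub>R\<^esub> (?M + ?N)) \<odot>\<^bsub>?C\<^esub> ?s w = (x [^]\<^bsub>R\<^esub> ?M) \<odot>\<^bsub>?C\<^esub> ?s ((x [^]\<^bsub>R\<^esub> ?N) \<odot>\<^bsub>?C\<^esub> w)"
      by (simp only: sl(2)[OF xp wC] powadd[OF sC[OF wC]])
    also have "\<dots> = (x [^]\<^bsub>R\<^esub> ?M) \<odot>\<^bsub>?C\<^esub> ((x [^]\<^bsub>R\<^esub> k) \<odot>\<^bsub>?C\<^esub> ?s ?sv)"
      unfolding xw using sl(2)[OF xp sC[OF uC(2)]] by simp
    also have "\<dots> = (x [^]\<^bsub>R\<^esub> (?M + k)) \<odot>\<^bsub>?C\<^esub> koszul_shift R E (?M + k) xs v"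
      by (simp only: powadd[OF sC[OF uC(2)]] E.koszul_shift_shift[OF xs uC(2)])
    finally have "(x [^]\<^bsub>R\<^esub> (?M + ?N)) \<odot>\<^bsub>?C\<^esub> b1 = (x [^]\<^bsub>R\<^esub> (?M + k)) \<odot>\<^bsub>?C\<^esub> koszul_shift R E (?M + k) xs v"
      unfolding b1_def using z C.smult_r_distr[OF xp sC[OF wC] sC[OF w'C], of "?M + ?N"]
        C.smult_closed[OF xp sC[OF uC(2)]] C.M.r_zero by (simp del: chains_simps)
    then have second: "(x [^]\<^bsub>R\<^esub> (?M + ?N)) \<odot>\<^bsub>?C\<^esub> b1 \<ominus>\<^bsub>?C\<^esub> ?d \<zero>\<^bsub>?C\<^esub> =
        (x [^]\<^bsub>R\<^esub> (?M + k)) \<odot>\<^bsub>?C\<^esub> koszul_shift R E (?M + k) xs v"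
      using dl(4) C.smult_closed[OF xp sC[OF uC(2)]] C.M.minus_equality[of "\<zero>\<^bsub>?C\<^esub>" "\<zero>\<^bsub>?C\<^esub>"] C.M.zero_closed
      by (simp add: a_minus_def del: chains_simps)
    let ?b = "glue E b1 \<zero>\<^bsub>?C\<^esub>"
    have bK: "?b \<in> koszul_chains E (length (x # xs)) (n - 1)"
      using koszul_chains_glue[OF b1K, of "\<zero>\<^bsub>?C\<^esub>"] E.koszul_chains_zero by simp
    have "koszul_diff R E (?M + ?N) (x # xs) ?b =
        glue E (?d b1) ((x [^]\<^bsub>R\<^esub> (?M + ?N)) \<odot>\<^bsub>?C\<^esub> b1 \<ominus>\<^bsub>?C\<^esub> ?d \<zero>\<^bsub>?C\<^esub>)"
      by (subst E.koszul_diff_Cons[OF Cons.prems(3) E.koszul_chains_carrier[OF bK]]) simp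
    also have "\<dots> = koszul_shift R E (?M + k) (x # xs) c"
      unfolding first second by (simp add: u_def v_def)
    finally show "\<exists>m. \<exists>b\<in>koszul_chains E (length (x # xs)) (n - 1).
        koszul_shift R E m (x # xs) c = koszul_diff R E (m + N) (x # xs) b"
      using bK by (intro exI[of _ "?M + k"] bexI[of _ ?b]) (simp_all add: add.assoc)
  qed
qed

lemma koszul_chains_degree_zero:
  assumes "c \<in> koszul_chains M p 0" "bs \<noteq> replicate p False"
  shows "c bs = \<zero>\<^bsub>M\<^esub>"
proof (rule ccontr)
  assume "c bs \<noteq> \<zero>\<^bsub>M\<^esub>"
  then have "length bs = p" "count_list bs True = 0" using koszul_chainsD(2)[OF assms(1)] by auto
  then have "bs = replicate p False"
    by (metis (full_types) count_list_0_iff replicate_eqI)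
  then show False using assms(2) by simp
qed

lemma koszul_chains_negative:
  assumes "c \<in> koszul_chains M p n" "n < 0"
  shows "c = (\<lambda>_. \<zero>\<^bsub>M\<^esub>)"
proof
  fix bs show "c bs = \<zero>\<^bsub>M\<^esub>"
    using koszul_chainsD(2)[OF assms(1), of bs] assms(2) by auto
qed

section \<open>Cocycles of degree zero\<close>

context module begin

text \<open>Transition maps rescale only entries whose index contains \<open>True\<close>, and a
  chain of degree zero has no such entry.\<close>

lemma koszul_shift_degree_zero:
  "set xs \<subseteq> carrier R \<Longrightarrow> c \<in> koszul_chains M (length xs) 0 \<Longrightarrow> koszul_shift R M m xs c = c"
proof (induction xs arbitrary: c)
  case (Cons x xs)
  note split = koszul_chains_Cons[OF Cons.prems(2)[simplified]]
  have v: "(\<lambda>t. c (True # t)) = (\<lambda>_. \<zero>\<^bsub>M\<^esub>)" using koszul_chains_negative[OF split(3)] by simp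
  then have "c (True # t) = \<zero>\<^bsub>M\<^esub>" for t by (rule fun_cong)
  moreover have "koszul_shift R M m xs (\<lambda>_. \<zero>\<^bsub>M\<^esub>) = (\<lambda>_. \<zero>\<^bsub>M\<^esub>)"
    using koszul_shift_linear(4)[of xs] Cons.prems by simp
  ultimately show ?case
    using Cons.IH[OF _ split(2)] Cons.prems split(1) by (intro glue_eqI) (simp_all add: v)
qed simp

text \<open>A chain of degree zero is a single element of \<open>M\<close>, and the components of
  its differential are its multiples by the \<open>N\<close>-th powers of the generators. Over all
  \<open>N\<close>, the cocycles make up the torsion.\<close>

lemma koszul_cocycle_degree_zero:
  "set xs \<subseteq> carrier R \<Longrightarrow> c \<in> koszul_chains M (length xs) 0 \<Longrightarrow>
    koszul_diff R M N xs c = (\<lambda>_. \<zero>\<^bsub>M\<^esub>) \<longleftrightarrow>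
    (\<forall>s\<in>set xs. (s [^] N) \<odot>\<^bsub>M\<^esub> c (replicate (length xs) False) = \<zero>\<^bsub>M\<^esub>)"
proof (induction xs arbitrary: c)
  case (Cons x xs)
  note split = koszul_chains_Cons[OF Cons.prems(2)[simplified]]
  have xs: "set xs \<subseteq> carrier R" and x: "x \<in> carrier R" using Cons.prems by auto
  have v: "(\<lambda>t. c (True # t)) = (\<lambda>_. \<zero>\<^bsub>M\<^esub>)" using koszul_chains_negative[OF split(3)] by simp
  have d0: "koszul_diff R M N xs (\<lambda>_. \<zero>\<^bsub>M\<^esub>) = (\<lambda>_. \<zero>\<^bsub>M\<^esub>)"
    using koszul_diff_linear(4)[of xs] Cons.prems by simp
  have minus_zero: "y \<ominus>\<^bsub>M\<^esub> \<zero>\<^bsub>M\<^esub> = y" if "y \<in> carrier M" for y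
    using M.minus_equality[of "\<zero>\<^bsub>M\<^esub>" "\<zero>\<^bsub>M\<^esub>"] that by (simp add: a_minus_def)
  have eq: "koszul_diff R M N (x # xs) c =
      glue M (koszul_diff R M N xs (\<lambda>t. c (False # t))) (\<lambda>t. (x [^] N) \<odot>\<^bsub>M\<^esub> c (False # t))"
    using Cons.prems koszul_chainsD(1)[OF split(2)] by (simp add: v d0 minus_zero)
  have "koszul_diff R M N (x # xs) c = (\<lambda>_. \<zero>\<^bsub>M\<^esub>) \<longleftrightarrow>
    koszul_diff R M N xs (\<lambda>t. c (False # t)) = (\<lambda>_. \<zero>\<^bsub>M\<^esub>) \<and> (\<forall>t. (x [^] N) \<odot>\<^bsub>M\<^esub> c (False # t) = \<zero>\<^bsub>M\<^esub>)"
    unfolding eq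
  proof (intro iffI conjI allI)
    assume *: "glue M (koszul_diff R M N xs (\<lambda>t. c (False # t))) (\<lambda>t. (x [^] N) \<odot>\<^bsub>M\<^esub> c (False # t)) = (\<lambda>_. \<zero>\<^bsub>M\<^esub>)"
    show "koszul_diff R M N xs (\<lambda>t. c (False # t)) = (\<lambda>_. \<zero>\<^bsub>M\<^esub>)"
      using fun_cong[OF *, of "False # t" for t] by auto
    show "(x [^] N) \<odot>\<^bsub>M\<^esub> c (False # t) = \<zero>\<^bsub>M\<^esub>" for t
      using fun_cong[OF *, of "True # t"] by simp
  next
    assume "koszul_diff R M N xs (\<lambda>t. c (False # t)) = (\<lambda>_. \<zero>\<^bsub>M\<^esub>) \<and> (\<forall>t. (x [^] N) \<odot>\<^bsub>M\<^esub> c (False # t) = \<zero>\<^bsub>M\<^esub>)"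
    then show "glue M (koszul_diff R M N xs (\<lambda>t. c (False # t))) (\<lambda>t. (x [^] N) \<odot>\<^bsub>M\<^esub> c (False # t)) = (\<lambda>_. \<zero>\<^bsub>M\<^esub>)"
      by (intro glue_eqI) simp_all
  qed
  also have "(\<forall>t. (x [^] N) \<odot>\<^bsub>M\<^esub> c (False # t) = \<zero>\<^bsub>M\<^esub>) \<longleftrightarrow>
      (x [^] N) \<odot>\<^bsub>M\<^esub> c (replicate (length (x # xs)) False) = \<zero>\<^bsub>M\<^esub>"
  proof
    assume *: "(x [^] N) \<odot>\<^bsub>M\<^esub> c (replicate (length (x # xs)) False) = \<zero>\<^bsub>M\<^esub>"
    show "\<forall>t. (x [^] N) \<odot>\<^bsub>M\<^esub> c (False # t) = \<zero>\<^bsub>M\<^esub>"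
    proof
      fix t show "(x [^] N) \<odot>\<^bsub>M\<^esub> c (False # t) = \<zero>\<^bsub>M\<^esub>"
        using koszul_chains_degree_zero[OF split(2), of t] * x
        by (cases "t = replicate (length xs) False") auto
    qed
  qed simp
  finally show ?case using Cons.IH[OF xs split(2)] by auto
qed simp

end

section \<open>Short exact sequences and dimension shifting\<close>

locale short_exact = M: module R M + E: module R E + Q: module R Q
  for R (structure) and M :: "('r, 'm, 'y) module_scheme" and E :: "('r, 'e, 'z) module_scheme"
    and Q :: "('r, 'q, 'w) module_scheme" +
  fixes \<iota> f
  assumes \<iota>: "\<iota> \<in> module_hom R M E" "inj_on \<iota> (carrier M)"
    and f: "f \<in> module_hom R E Q" "f ` carrier E = carrier Q"
    and exact: "\<And>x. x \<in> carrier E \<Longrightarrow> f x = \<zero>\<^bsub>Q\<^esub> \<longleftrightarrow> x \<in> \<iota> ` carrier M"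
begin

text \<open>Lifting zero entries to zero preserves the support and therefore the degree.\<close>

lemma lift_chain:
  assumes "q \<in> koszul_chains Q p n"
  obtains e where "e \<in> koszul_chains E p n" "(\<lambda>i. f (e i)) = q"
proof -
  have "\<forall>i. \<exists>e\<in>carrier E. f e = q i \<and> (q i = \<zero>\<^bsub>Q\<^esub> \<longrightarrow> e = \<zero>\<^bsub>E\<^esub>)"
  proof
    fix i
    show "\<exists>e\<in>carrier E. f e = q i \<and> (q i = \<zero>\<^bsub>Q\<^esub> \<longrightarrow> e = \<zero>\<^bsub>E\<^esub>)"
    proof (cases "q i = \<zero>\<^bsub>Q\<^esub>")
      case True
      then show ?thesis
        using module_hom_zero[OF f(1) E.module_axioms Q.module_axioms] by (intro bexI[of _ "\<zero>\<^bsub>E\<^esub>"]) auto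
    next
      case False
      have "q i \<in> f ` carrier E" using koszul_chainsD(1)[OF assms] f(2) by simp
      then show ?thesis using False by auto
    qed
  qed
  then obtain e where e: "\<And>i. e i \<in> carrier E" "\<And>i. f (e i) = q i" "\<And>i. q i = \<zero>\<^bsub>Q\<^esub> \<Longrightarrow> e i = \<zero>\<^bsub>E\<^esub>"
    by metis
  then have "e \<in> koszul_chains E p n"
    using koszul_chainsD(2)[OF assms] unfolding koszul_chains_def by blast
  then show thesis using e(2) by (intro that[of e]) auto
qed

lemma pull_chain:
  assumes e: "e \<in> koszul_chains E p n" and z: "\<And>i. f (e i) = \<zero>\<^bsub>Q\<^esub>"
  obtains c where "c \<in> koszul_chains M p n" "e = (\<lambda>i. \<iota> (c i))"
proof -
  have "\<forall>i. \<exists>c\<in>carrier M. e i = \<iota> c \<and> (e i = \<zero>\<^bsub>E\<^esub> \<longrightarrow> c = \<zero>\<^bsub>M\<^esub>)"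
  proof
    fix i
    show "\<exists>c\<in>carrier M. e i = \<iota> c \<and> (e i = \<zero>\<^bsub>E\<^esub> \<longrightarrow> c = \<zero>\<^bsub>M\<^esub>)"
    proof (cases "e i = \<zero>\<^bsub>E\<^esub>")
      case True
      then show ?thesis
        using module_hom_zero[OF \<iota>(1) M.module_axioms E.module_axioms] by (intro bexI[of _ "\<zero>\<^bsub>M\<^esub>"]) auto
    next
      case False
      have "e i \<in> \<iota> ` carrier M" using exact[OF koszul_chainsD(1)[OF e]] z by blast
      then show ?thesis using False by auto
    qed
  qed
  then obtain c where c: "\<And>i. c i \<in> carrier M" "\<And>i. e i = \<iota> (c i)" "\<And>i. e i = \<zero>\<^bsub>E\<^esub> \<Longrightarrow> c i = \<zero>\<^bsub>M\<^esub>"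
    by metis
  then have "c \<in> koszul_chains M p n"
    using koszul_chainsD(2)[OF e] unfolding koszul_chains_def by blast
  then show thesis using c(2) by (intro that[of c]) auto
qed

lemma push_chain:
  assumes c: "c \<in> koszul_chains M p n"
  shows "(\<lambda>i. \<iota> (c i)) \<in> koszul_chains E p n"
proof -
  have "c i \<noteq> \<zero>\<^bsub>M\<^esub>" if "\<iota> (c i) \<noteq> \<zero>\<^bsub>E\<^esub>" for i
    using that module_hom_zero[OF \<iota>(1) M.module_axioms E.module_axioms] by auto
  then show ?thesis
    using koszul_chainsD[OF c] module_homD(1)[OF \<iota>(1)] unfolding koszul_chains_def by blast
qed

lemma project_chain:
  assumes e: "e \<in> koszul_chains E p n"
  shows "(\<lambda>i. f (e i)) \<in> koszul_chains Q p n"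
proof -
  have "e i \<noteq> \<zero>\<^bsub>E\<^esub>" if "f (e i) \<noteq> \<zero>\<^bsub>Q\<^esub>" for i
    using that module_hom_zero[OF f(1) E.module_axioms Q.module_axioms] by auto
  then show ?thesis
    using koszul_chainsD[OF e] module_homD(1)[OF f(1)] unfolding koszul_chains_def by blast
qed

lemma \<iota>_chain_inj:
  assumes "(\<lambda>i. \<iota> (c i)) = (\<lambda>i. \<iota> (d i))" "\<And>i. c i \<in> carrier M" "\<And>i. d i \<in> carrier M"
  shows "c = d"
  using inj_onD[OF \<iota>(2) fun_cong[OF assms(1)] assms(2,3)] by auto

lemma f_\<iota>: "x \<in> carrier M \<Longrightarrow> f (\<iota> x) = \<zero>\<^bsub>Q\<^esub>"
  using exact[of "\<iota> x"] module_homD(1)[OF \<iota>(1)] by blast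

text \<open>If the middle term is acyclic in degree \<open>n + 1\<close>, the connecting homomorphism identifies
  the vanishing for \<open>M\<close> in degree \<open>n + 1\<close> with the liftability of \<open>Q\<close>-cocycles of degree \<open>n\<close>.\<close>

definition cocycles_lift :: "'r list \<Rightarrow> int \<Rightarrow> bool"
  where "cocycles_lift xs n \<longleftrightarrow>
    (\<forall>N. \<forall>q\<in>koszul_chains Q (length xs) n. koszul_diff R Q N xs q = (\<lambda>_. \<zero>\<^bsub>Q\<^esub>) \<longrightarrow>
      (\<exists>m. \<exists>e\<in>koszul_chains E (length xs) n. koszul_diff R E (m + N) xs e = (\<lambda>_. \<zero>\<^bsub>E\<^esub>) \<and>
        koszul_shift R Q m xs q = (\<lambda>i. f (e i))))"

context
  fixes xs :: "'r list"
  assumes xs: "set xs \<subseteq> carrier R"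
begin

abbreviation "dM \<equiv> \<lambda>N. koszul_diff R M N xs"
abbreviation "dE \<equiv> \<lambda>N. koszul_diff R E N xs"
abbreviation "dQ \<equiv> \<lambda>N. koszul_diff R Q N xs"
abbreviation "sM \<equiv> \<lambda>N. koszul_shift R M N xs"
abbreviation "sE \<equiv> \<lambda>N. koszul_shift R E N xs"
abbreviation "sQ \<equiv> \<lambda>N. koszul_shift R Q N xs"
abbreviation "CE \<equiv> chains E (UNIV :: bool list set)"

lemmas nat_\<iota> = koszul_natural[OF \<iota>(1) M.module_axioms E.module_axioms xs]
lemmas nat_f = koszul_natural[OF f(1) E.module_axioms Q.module_axioms xs]

lemma f_diff:
  assumes "a \<in> carrier CE" "b \<in> carrier CE"
  shows "(\<lambda>i. f ((a \<ominus>\<^bsub>CE\<^esub> b) i)) = (\<lambda>i. f (a i) \<ominus>\<^bsub>Q\<^esub> f (b i))"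
  using assms module_hom_diff[OF f(1) E.module_axioms Q.module_axioms]
  by (simp add: chains_diff[OF E.module_axioms])

text \<open>The diagram chase of the connecting homomorphism, carried out on representatives. A
  cocycle of \<open>M\<close> bounds some \<open>b\<close> in \<open>E\<close>, and correcting
  \<open>b\<close> by a cocycle lifting its image in \<open>Q\<close> moves it into
  \<open>M\<close>. Conversely, a lift of a cocycle of \<open>Q\<close> has its coboundary in
  \<open>M\<close>, and a primitive there corrects the lift. Every use of a hypothesis raises the
  exponent, so the shifts add up.\<close>

lemma vanishes_iff_cocycles_lift:
  assumes vE: "cech_vanishes R E xs (n + 1)"
  shows "cech_vanishes R M xs (n + 1) \<longleftrightarrow> cocycles_lift xs n"
proof
  let ?p = "length xs"
  interpret C: module R CE by (rule E.chains_module)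
  note dC = module_homD(1)[OF E.koszul_diff_hom[OF xs]]
  note sC = module_homD(1)[OF E.koszul_shift_hom[OF xs]]
  note dl = E.koszul_diff_linear[OF xs]
  note sl = E.koszul_shift_linear[OF xs]
  {
    assume lift: "cocycles_lift xs n"
    show "cech_vanishes R M xs (n + 1)"
      unfolding cech_vanishes_def
    proof (intro allI ballI impI)
      fix N c assume c: "c \<in> koszul_chains M ?p (n + 1)" "dM N c = (\<lambda>_. \<zero>\<^bsub>M\<^esub>)"
      have cM: "\<And>i. c i \<in> carrier M" using koszul_chainsD(1)[OF c(1)] .
      let ?c = "\<lambda>i. \<iota> (c i)"
      have "dE N ?c = (\<lambda>_. \<zero>\<^bsub>E\<^esub>)"
        using nat_\<iota>(1)[of c, OF cM] c(2) module_hom_zero[OF \<iota>(1) M.module_axioms E.module_axioms] by simp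
      with vE push_chain[OF c(1)] obtain m b where b: "b \<in> koszul_chains E ?p n" "sE m ?c = dE (m + N) b"
        unfolding cech_vanishes_def by fastforce
      have bE: "\<And>i. b i \<in> carrier E" using koszul_chainsD(1)[OF b(1)] .
      have bC: "b \<in> carrier CE" by (rule E.koszul_chains_carrier[OF b(1)])
      have "dQ (m + N) (\<lambda>i. f (b i)) = (\<lambda>_. \<zero>\<^bsub>Q\<^esub>)"
        unfolding nat_f(1)[of b, OF bE] b(2)[symmetric] nat_\<iota>(2)[of c, OF cM]
        using f_\<iota> M.koszul_shift_closed[OF xs cM] by simp
      with lift project_chain[OF b(1)] obtain k e where e: "e \<in> koszul_chains E ?p n"
        "dE (k + (m + N)) e = (\<lambda>_. \<zero>\<^bsub>E\<^esub>)" "sQ k (\<lambda>i. f (b i)) = (\<lambda>i. f (e i))"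
        unfolding cocycles_lift_def by blast
      have eC: "e \<in> carrier CE" by (rule E.koszul_chains_carrier[OF e(1)])
      have sb: "sE k b \<in> koszul_chains E ?p n" by (rule E.koszul_shift_chains[OF xs b(1)])
      \<comment> \<open>The shifted \<open>b\<close> and the cocycle \<open>e\<close> have the same
        image in \<open>Q\<close>; their difference comes from \<open>M\<close> and still has the
        coboundary of the shifted \<open>b\<close>.\<close>
      define b' where "b' = sE k b \<ominus>\<^bsub>CE\<^esub> e"
      have b'K: "b' \<in> koszul_chains E ?p n" unfolding b'_def by (rule E.koszul_chains_diff[OF sb e(1)])
      have "(\<lambda>i. f (b' i)) = (\<lambda>i. f (sE k b i) \<ominus>\<^bsub>Q\<^esub> f (e i))"
        unfolding b'_def by (rule f_diff[OF E.koszul_chains_carrier[OF sb] eC])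
      moreover have "f (sE k b i) = f (e i)" for i
        using e(3) unfolding nat_f(2)[of b, OF bE] by (rule fun_cong)
      moreover have "f (e i) \<in> carrier Q" for i using module_homD(1)[OF f(1)] eC by simp
      ultimately have "f (b' i) = \<zero>\<^bsub>Q\<^esub>" for i
        by (simp add: fun_eq_iff Q.M.minus_eq_zero_iff)
      from pull_chain[OF b'K this] obtain a where a: "a \<in> koszul_chains M ?p n" "b' = (\<lambda>i. \<iota> (a i))" .
      have aM: "\<And>i. a i \<in> carrier M" using koszul_chainsD(1)[OF a(1)] .
      have "dE (k + (m + N)) b' = dE (k + (m + N)) (sE k b) \<ominus>\<^bsub>CE\<^esub> \<zero>\<^bsub>CE\<^esub>"
        unfolding b'_def using dl(3)[OF sC[OF bC] eC] e(2) by simp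
      also have "\<dots> = dE (k + (m + N)) (sE k b)"
        using dC[OF sC[OF bC]] C.M.minus_equality[of "\<zero>\<^bsub>CE\<^esub>" "\<zero>\<^bsub>CE\<^esub>"] C.M.zero_closed
        by (simp add: a_minus_def del: chains_simps)
      also have "\<dots> = sE k (dE (m + N) b)" by (rule E.koszul_shift_diff[OF xs bC, symmetric])
      also have "\<dots> = sE (k + m) ?c"
        unfolding b(2)[symmetric] by (rule E.koszul_shift_shift[OF xs E.koszul_chains_carrier[OF push_chain[OF c(1)]]])
      finally have "(\<lambda>i. \<iota> (dM (k + (m + N)) a i)) = (\<lambda>i. \<iota> (sM (k + m) c i))"
        unfolding a(2) nat_\<iota>(1)[of a, OF aM] nat_\<iota>(2)[of c, OF cM] .
      then have "dM (k + (m + N)) a = sM (k + m) c"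
        by (rule \<iota>_chain_inj) (rule M.koszul_diff_closed[OF xs aM], rule M.koszul_shift_closed[OF xs cM])
      then have "sM (k + m) c = dM (k + m + N) a" by (simp add: add.assoc)
      then show "\<exists>m. \<exists>b\<in>koszul_chains M ?p (n + 1 - 1). sM m c = dM (m + N) b"
        using a(1) by (intro exI[of _ "k + m"] bexI[of _ a]) auto
    qed
  next
    assume vM: "cech_vanishes R M xs (n + 1)"
    show "cocycles_lift xs n"
      unfolding cocycles_lift_def
    proof (intro allI ballI impI)
      fix N q assume q: "q \<in> koszul_chains Q ?p n" "dQ N q = (\<lambda>_. \<zero>\<^bsub>Q\<^esub>)"
      obtain e where e: "e \<in> koszul_chains E ?p n" "(\<lambda>i. f (e i)) = q" by (rule lift_chain[OF q(1)])
      have eE: "\<And>i. e i \<in> carrier E" using koszul_chainsD(1)[OF e(1)] .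
      have eC: "e \<in> carrier CE" by (rule E.koszul_chains_carrier[OF e(1)])
      have "(\<lambda>i. f (dE N e i)) = (\<lambda>_. \<zero>\<^bsub>Q\<^esub>)"
        using nat_f(1)[of e, OF eE] e(2) q(2) by simp
      then have "f (dE N e i) = \<zero>\<^bsub>Q\<^esub>" for i by (rule fun_cong)
      from pull_chain[OF E.koszul_diff_chains[OF xs e(1)] this] obtain c where
        c: "c \<in> koszul_chains M ?p (n + 1)" "dE N e = (\<lambda>i. \<iota> (c i))" .
      have cM: "\<And>i. c i \<in> carrier M" using koszul_chainsD(1)[OF c(1)] .
      have "(\<lambda>i. \<iota> (dM N c i)) = (\<lambda>i. \<iota> \<zero>\<^bsub>M\<^esub>)"
        using nat_\<iota>(1)[of c, OF cM] E.koszul_diff_square[OF xs eC, of N, unfolded c(2)]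
          module_hom_zero[OF \<iota>(1) M.module_axioms E.module_axioms] by simp
      then have "dM N c = (\<lambda>_. \<zero>\<^bsub>M\<^esub>)"
        using \<iota>_chain_inj[of "dM N c" "\<lambda>_. \<zero>\<^bsub>M\<^esub>"] M.koszul_diff_closed[OF xs cM] by simp
      with vM c(1) obtain m b where b: "b \<in> koszul_chains M ?p n" "sM m c = dM (m + N) b"
        unfolding cech_vanishes_def by fastforce
      have bM: "\<And>i. b i \<in> carrier M" using koszul_chainsD(1)[OF b(1)] .
      let ?b = "\<lambda>i. \<iota> (b i)"
      have bK: "?b \<in> koszul_chains E ?p n" by (rule push_chain[OF b(1)])
      have bC: "?b \<in> carrier CE" by (rule E.koszul_chains_carrier[OF bK])
      have sK: "sE m e \<in> koszul_chains E ?p n" by (rule E.koszul_shift_chains[OF xs e(1)])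
      \<comment> \<open>After the shift \<open>e\<close> and \<open>?b\<close> have the same
        coboundary, and \<open>?b\<close> is zero in \<open>Q\<close>, so the difference is a
        cocycle over the shifted \<open>q\<close>.\<close>
      define e' where "e' = sE m e \<ominus>\<^bsub>CE\<^esub> ?b"
      have e'K: "e' \<in> koszul_chains E ?p n" unfolding e'_def by (rule E.koszul_chains_diff[OF sK bK])
      have "dE (m + N) e' = dE (m + N) (sE m e) \<ominus>\<^bsub>CE\<^esub> dE (m + N) ?b"
        unfolding e'_def by (rule dl(3)[OF sC[OF eC] bC])
      also have "dE (m + N) (sE m e) = sE m (dE N e)" by (rule E.koszul_shift_diff[OF xs eC, symmetric])
      also have "\<dots> = dE (m + N) ?b"
        unfolding c(2) nat_\<iota>(1)[of b, OF bM] nat_\<iota>(2)[of c, OF cM] b(2) ..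
      also have "dE (m + N) ?b \<ominus>\<^bsub>CE\<^esub> dE (m + N) ?b = \<zero>\<^bsub>CE\<^esub>"
        using C.M.minus_eq_zero_iff[OF dC[OF bC] dC[OF bC]] by simp
      finally have "dE (m + N) e' = (\<lambda>_. \<zero>\<^bsub>E\<^esub>)" by simp
      moreover have "sQ m q = (\<lambda>i. f (e' i))"
      proof -
        have "(\<lambda>i. f (e' i)) = (\<lambda>i. f (sE m e i) \<ominus>\<^bsub>Q\<^esub> f (?b i))"
          unfolding e'_def by (rule f_diff[OF sC[OF eC] bC])
        also have "\<dots> = (\<lambda>i. f (sE m e i))"
        proof
          fix i
          have "f (sE m e i) \<in> carrier Q"
            by (rule module_homD(1)[OF f(1)]) (rule E.koszul_shift_closed[OF xs eE])
          then show "f (sE m e i) \<ominus>\<^bsub>Q\<^esub> f (?b i) = f (sE m e i)"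
            using f_\<iota>[OF bM] Q.M.minus_equality[of "\<zero>\<^bsub>Q\<^esub>" "\<zero>\<^bsub>Q\<^esub>"] by (simp add: a_minus_def)
        qed
        also have "\<dots> = sQ m q" using nat_f(2)[of e, OF eE] e(2) by simp
        finally show ?thesis ..
      qed
      ultimately show "\<exists>m. \<exists>e\<in>koszul_chains E ?p n. dE (m + N) e = (\<lambda>_. \<zero>\<^bsub>E\<^esub>) \<and> sQ m q = (\<lambda>i. f (e i))"
        using e'K by blast
    qed
  }
qed

text \<open>If the middle term has no cohomology in degree \<open>n\<close>, a lifted cocycle bounds
  and so does its image in \<open>Q\<close>. Conversely, a coboundary of \<open>b\<close> in
  \<open>Q\<close> lifts to the coboundary of a lift of \<open>b\<close>.\<close>

lemma cocycles_lift_iff_vanishes: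
  assumes vE: "cech_vanishes R E xs n"
  shows "cocycles_lift xs n \<longleftrightarrow> cech_vanishes R Q xs n"
proof
  let ?p = "length xs"
  assume lift: "cocycles_lift xs n"
  show "cech_vanishes R Q xs n"
    unfolding cech_vanishes_def
  proof (intro allI ballI impI)
    fix N q assume q: "q \<in> koszul_chains Q ?p n" "dQ N q = (\<lambda>_. \<zero>\<^bsub>Q\<^esub>)"
    with lift obtain m e where e: "e \<in> koszul_chains E ?p n" "dE (m + N) e = (\<lambda>_. \<zero>\<^bsub>E\<^esub>)"
      "sQ m q = (\<lambda>i. f (e i))" unfolding cocycles_lift_def by blast
    with vE obtain k b where b: "b \<in> koszul_chains E ?p (n - 1)" "sE k e = dE (k + (m + N)) b"
      unfolding cech_vanishes_def by blast
    have "sQ (k + m) q = sQ k (\<lambda>i. f (e i))"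
      using Q.koszul_shift_shift[OF xs Q.koszul_chains_carrier[OF q(1)], of k m] e(3) by simp
    also have "\<dots> = dQ (k + m + N) (\<lambda>i. f (b i))"
      unfolding nat_f(2)[OF koszul_chainsD(1)[OF e(1)]] nat_f(1)[OF koszul_chainsD(1)[OF b(1)]] b(2)
      by (simp add: add.assoc)
    finally show "\<exists>m. \<exists>b\<in>koszul_chains Q ?p (n - 1). sQ m q = dQ (m + N) b"
      using project_chain[OF b(1)] by blast
  qed
next
  let ?p = "length xs"
  assume vQ: "cech_vanishes R Q xs n"
  show "cocycles_lift xs n"
    unfolding cocycles_lift_def
  proof (intro allI ballI impI)
    fix N q assume q: "q \<in> koszul_chains Q ?p n" "dQ N q = (\<lambda>_. \<zero>\<^bsub>Q\<^esub>)"
    with vQ obtain m b where b: "b \<in> koszul_chains Q ?p (n - 1)" "sQ m q = dQ (m + N) b"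
      unfolding cech_vanishes_def by blast
    obtain e where e: "e \<in> koszul_chains E ?p (n - 1)" "(\<lambda>i. f (e i)) = b" by (rule lift_chain[OF b(1)])
    have eE: "\<And>i. e i \<in> carrier E" using koszul_chainsD(1)[OF e(1)] .
    have "dE (m + N) e \<in> koszul_chains E ?p n"
      using E.koszul_diff_chains[OF xs e(1)] by simp
    moreover have "dE (m + N) (dE (m + N) e) = (\<lambda>_. \<zero>\<^bsub>E\<^esub>)"
      by (rule E.koszul_diff_square[OF xs E.koszul_chains_carrier[OF e(1)]])
    moreover have "sQ m q = (\<lambda>i. f (dE (m + N) e i))"
      using b(2) nat_f(1)[of e, OF eE] by (simp add: e(2))
    ultimately show "\<exists>m. \<exists>e\<in>koszul_chains E ?p n. dE (m + N) e = (\<lambda>_. \<zero>\<^bsub>E\<^esub>) \<and> sQ m q = (\<lambda>i. f (e i))"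
      by blast
  qed
qed

text \<open>In degree zero the cocycles are the torsion elements and the transition maps are the
  identity, so lifting becomes surjectivity on torsion. This is the condition that
  \<open>local_cohomology_trivial_iff\<close> produces in positive degrees.\<close>

lemma cocycles_lift_zero_iff:
  "cocycles_lift xs 0 \<longleftrightarrow> torsion R (set xs) Q \<subseteq> f ` torsion R (set xs) E"
proof
  let ?p = "length xs" and ?z = "replicate (length xs) False"
  assume lift: "cocycles_lift xs 0"
  show "torsion R (set xs) Q \<subseteq> f ` torsion R (set xs) E"
  proof
    fix y assume "y \<in> torsion R (set xs) Q"
    then obtain N :: nat where y: "y \<in> carrier Q" "\<And>s. s \<in> set xs \<Longrightarrow> (s [^] N) \<odot>\<^bsub>Q\<^esub> y = \<zero>\<^bsub>Q\<^esub>"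
      by (auto simp: torsion_def)
    define q where "q = (\<lambda>bs. if bs = ?z then y else \<zero>\<^bsub>Q\<^esub>)"
    have "count_list ?z True = 0" by (simp add: count_list_0_iff)
    then have q: "q \<in> koszul_chains Q ?p 0" using y(1) by (auto simp: koszul_chains_def q_def)
    then have "dQ N q = (\<lambda>_. \<zero>\<^bsub>Q\<^esub>)"
      using Q.koszul_cocycle_degree_zero[OF xs q, of N] y(2) by (simp add: q_def)
    with lift q obtain m e where e: "e \<in> koszul_chains E ?p 0" "dE (m + N) e = (\<lambda>_. \<zero>\<^bsub>E\<^esub>)"
      "sQ m q = (\<lambda>i. f (e i))" unfolding cocycles_lift_def by blast
    have "e ?z \<in> torsion R (set xs) E"
      using E.koszul_cocycle_degree_zero[OF xs e(1), of "m + N"] e(2) koszul_chainsD(1)[OF e(1)]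
      by (auto simp: torsion_def)
    moreover have "f (e ?z) = y"
      using e(3) Q.koszul_shift_degree_zero[OF xs q, of m] by (metis q_def)
    ultimately show "y \<in> f ` torsion R (set xs) E" by blast
  qed
next
  let ?p = "length xs" and ?z = "replicate (length xs) False"
  assume sub: "torsion R (set xs) Q \<subseteq> f ` torsion R (set xs) E"
  show "cocycles_lift xs 0"
    unfolding cocycles_lift_def
  proof (intro allI ballI impI)
    fix N q assume q: "q \<in> koszul_chains Q ?p 0" "dQ N q = (\<lambda>_. \<zero>\<^bsub>Q\<^esub>)"
    then have "q ?z \<in> torsion R (set xs) Q"
      using Q.koszul_cocycle_degree_zero[OF xs q(1), of N] koszul_chainsD(1)[OF q(1)]
      by (auto simp: torsion_def)
    then obtain x where x: "x \<in> torsion R (set xs) E" "f x = q ?z" using sub by auto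
    then obtain m :: nat where m: "x \<in> carrier E" "\<And>s. s \<in> set xs \<Longrightarrow> (s [^] m) \<odot>\<^bsub>E\<^esub> x = \<zero>\<^bsub>E\<^esub>"
      by (auto simp: torsion_def)
    define e where "e = (\<lambda>bs. if bs = ?z then x else \<zero>\<^bsub>E\<^esub>)"
    have "count_list ?z True = 0" by (simp add: count_list_0_iff)
    then have e: "e \<in> koszul_chains E ?p 0" using m(1) by (auto simp: koszul_chains_def e_def)
    have "(s [^] (m + N)) \<odot>\<^bsub>E\<^esub> x = \<zero>\<^bsub>E\<^esub>" if "s \<in> set xs" for s
      using E.power_smult_zero_mono[OF _ m(1) m(2)[OF that], of "m + N"] that xs by auto
    then have "dE (m + N) e = (\<lambda>_. \<zero>\<^bsub>E\<^esub>)"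
      using E.koszul_cocycle_degree_zero[OF xs e, of "m + N"] by (simp add: e_def)
    moreover have "sQ m q = (\<lambda>i. f (e i))"
    proof
      fix i
      show "sQ m q i = f (e i)"
        using Q.koszul_shift_degree_zero[OF xs q(1), of m] x(2) koszul_chains_degree_zero[OF q(1), of i]
          module_hom_zero[OF f(1) E.module_axioms Q.module_axioms] by (simp add: e_def)
    qed
    ultimately show "\<exists>m. \<exists>e\<in>koszul_chains E ?p 0. dE (m + N) e = (\<lambda>_. \<zero>\<^bsub>E\<^esub>) \<and> sQ m q = (\<lambda>i. f (e i))"
      using e by blast
  qed
qed

end

end

text \<open>There are no nonzero chains of degree \<open>-1\<close>, so vanishing in degree zero
  means that every cocycle, hence every torsion element, is zero.\<close>

lemma (in module) cech_vanishes_zero_iff: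
  assumes xs: "set xs \<subseteq> carrier R"
  shows "cech_vanishes R M xs 0 \<longleftrightarrow> torsion R (set xs) M \<subseteq> {\<zero>\<^bsub>M\<^esub>}"
proof
  let ?p = "length xs" and ?z = "replicate (length xs) False"
  assume v: "cech_vanishes R M xs 0"
  show "torsion R (set xs) M \<subseteq> {\<zero>\<^bsub>M\<^esub>}"
  proof
    fix y assume "y \<in> torsion R (set xs) M"
    then obtain N :: nat where y: "y \<in> carrier M" "\<And>s. s \<in> set xs \<Longrightarrow> (s [^] N) \<odot>\<^bsub>M\<^esub> y = \<zero>\<^bsub>M\<^esub>"
      by (auto simp: torsion_def)
    define q where "q = (\<lambda>bs. if bs = ?z then y else \<zero>\<^bsub>M\<^esub>)"
    have "count_list ?z True = 0" by (simp add: count_list_0_iff)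
    then have q: "q \<in> koszul_chains M ?p 0" using y(1) by (auto simp: koszul_chains_def q_def)
    then have "koszul_diff R M N xs q = (\<lambda>_. \<zero>\<^bsub>M\<^esub>)"
      using koszul_cocycle_degree_zero[OF xs q, of N] y(2) by (simp add: q_def)
    with v q obtain m b where b: "b \<in> koszul_chains M ?p (0 - 1)"
      "koszul_shift R M m xs q = koszul_diff R M (m + N) xs b" unfolding cech_vanishes_def by blast
    have "b = (\<lambda>_. \<zero>\<^bsub>M\<^esub>)" using koszul_chains_negative[OF b(1)] by simp
    then have "q = (\<lambda>_. \<zero>\<^bsub>M\<^esub>)"
      using b(2) koszul_shift_degree_zero[OF xs q, of m] koszul_diff_linear(4)[OF xs] by simp
    then show "y \<in> {\<zero>\<^bsub>M\<^esub>}" by (metis q_def singletonI)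
  qed
next
  let ?p = "length xs" and ?z = "replicate (length xs) False"
  assume t: "torsion R (set xs) M \<subseteq> {\<zero>\<^bsub>M\<^esub>}"
  show "cech_vanishes R M xs 0"
    unfolding cech_vanishes_def
  proof (intro allI ballI impI)
    fix N q assume q: "q \<in> koszul_chains M ?p 0" "koszul_diff R M N xs q = (\<lambda>_. \<zero>\<^bsub>M\<^esub>)"
    then have "q ?z \<in> torsion R (set xs) M"
      using koszul_cocycle_degree_zero[OF xs q(1), of N] koszul_chainsD(1)[OF q(1)]
      by (auto simp: torsion_def)
    then have z: "q ?z = \<zero>\<^bsub>M\<^esub>" using t by auto
    have "q bs = \<zero>\<^bsub>M\<^esub>" for bs
      using koszul_chains_degree_zero[OF q(1), of bs] z by (cases "bs = ?z") auto
    then have "q = (\<lambda>_. \<zero>\<^bsub>M\<^esub>)" by auto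
    then show "\<exists>m. \<exists>b\<in>koszul_chains M ?p (0 - 1). koszul_shift R M m xs q = koszul_diff R M (m + N) xs b"
      using koszul_chains_zero koszul_shift_linear(4)[OF xs] koszul_diff_linear(4)[OF xs]
      by (intro exI[of _ 0] bexI[of _ "\<lambda>_. \<zero>\<^bsub>M\<^esub>"]) auto
  qed
qed

text \<open>The Koszul complex is only as long as the list of generators. This bounds the degrees of
  local cohomology and keeps the cohomological dimension below \<open>\<infinity>\<close>.\<close>

lemma (in module) cech_vanishes_large:
  assumes "set xs \<subseteq> carrier R" "int (length xs) < n"
  shows "cech_vanishes R M xs n"
  unfolding cech_vanishes_def
proof (intro allI ballI impI)
  fix N c assume c: "c \<in> koszul_chains M (length xs) n"
  have "c bs = \<zero>\<^bsub>M\<^esub>" for bs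
    using koszul_chainsD(2)[OF c, of bs] assms(2) count_le_length[of bs True] by fastforce
  then have "c = (\<lambda>_. \<zero>\<^bsub>M\<^esub>)" by auto
  then show "\<exists>m. \<exists>b\<in>koszul_chains M (length xs) (n - 1).
      koszul_shift R M m xs c = koszul_diff R M (m + N) xs b"
    using koszul_chains_zero koszul_shift_linear(4)[OF assms(1)] koszul_diff_linear(4)[OF assms(1)]
    by (intro exI[of _ 0] bexI[of _ "\<lambda>_. \<zero>\<^bsub>M\<^esub>"]) auto
qed

theorem local_cohomology_trivial_iff_cech:
  fixes R :: "('r, 'x) ring_scheme" and M :: "('r, 'm, 'y) module_scheme"
  assumes R: "noetherian_ring R" and M: "module R M" and \<aa>: "ideal \<aa> R" and xs: "set xs \<subseteq> \<aa>"
    and gen: "\<And>I. ideal I R \<Longrightarrow> set xs \<subseteq> I \<Longrightarrow> \<aa> \<subseteq> I"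
  shows "carrier (local_cohomology R \<aa> M i) = {\<zero>\<^bsub>local_cohomology R \<aa> M i\<^esub>} \<longleftrightarrow>
    cech_vanishes R M xs (int i)"
proof -
  interpret M: module R M by fact
  let ?S = "set xs"
  have S: "?S \<subseteq> carrier R" using xs ideal.Icarr[OF \<aa>] by auto
  obtain E :: "nat \<Rightarrow> ('r, ('r \<times> nat \<Rightarrow> 'm option)) module" and d \<epsilon>
    where res: "injective_resolution R M \<epsilon> E d"
    and triv: "\<And>i. carrier (local_cohomology R \<aa> M i) = {\<zero>\<^bsub>local_cohomology R \<aa> M i\<^esub>} \<longleftrightarrow>
      {x \<in> torsion R ?S (E i). d i x = \<zero>\<^bsub>E (Suc i)\<^esub>} \<subseteq>
      (case i of 0 \<Rightarrow> {\<zero>\<^bsub>E 0\<^esub>} | Suc j \<Rightarrow> d j ` torsion R ?S (E j))"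
  proof (rule local_cohomology_trivial_iff[OF M _ S])
    show "torsion_part R \<aa> E = torsion R ?S E" if "module R E"
      for E :: "('r, ('r \<times> nat \<Rightarrow> 'm option)) module"
      by (rule module.torsion_part_eq_torsion[OF that \<aa> _ xs gen]) auto
  qed (rule that)
  have inj: "injective_module R (E i)" and d: "d i \<in> module_hom R (E i) (E (Suc i))" for i
    using res by (auto simp: injective_resolution_def)
  have E: "module R (E i)" "baer R (E i)" for i
    using inj[of i] injective_module_imp_baer[OF inj[of i]] by (auto simp: injective_module_def)
  have \<epsilon>: "\<epsilon> \<in> module_hom R M (E 0)" "inj_on \<epsilon> (carrier M)"
    and \<epsilon>_im: "\<epsilon> ` carrier M = a_kernel (E 0) (E (Suc 0)) (d 0)"
    and d_im: "d i ` carrier (E i) = a_kernel (E (Suc i)) (E (Suc (Suc i))) (d (Suc i))" for i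
    using res by (auto simp: injective_resolution_def)
  have acyclic: "cech_vanishes R (E i) xs n" if "0 < n" for i n
    by (rule koszul_acyclic[OF M.R.is_cring R E S that])
  \<comment> \<open>The cocycle modules cut the resolution into short exact sequences whose middle
    terms are acyclic.\<close>
  define Z where "Z = (\<lambda>i. (E i)\<lparr>carrier := {x \<in> carrier (E i). d i x = \<zero>\<^bsub>E (Suc i)\<^esub>}\<rparr>)"
  have Zsub: "submodule {x \<in> carrier (E i). d i x = \<zero>\<^bsub>E (Suc i)\<^esub>} R (E i)" for i
  proof (rule module.submoduleI'[OF E(1)])
    interpret Ei: module R "E i" by (rule E)
    interpret E': module R "E (Suc i)" by (rule E)
    show "\<zero>\<^bsub>E i\<^esub> \<in> {x \<in> carrier (E i). d i x = \<zero>\<^bsub>E (Suc i)\<^esub>}"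
      using module_hom_zero[OF d E(1) E(1)] by simp
    show "x \<oplus>\<^bsub>E i\<^esub> y \<in> {x \<in> carrier (E i). d i x = \<zero>\<^bsub>E (Suc i)\<^esub>}"
      if "x \<in> {x \<in> carrier (E i). d i x = \<zero>\<^bsub>E (Suc i)\<^esub>}" "y \<in> {x \<in> carrier (E i). d i x = \<zero>\<^bsub>E (Suc i)\<^esub>}"
      for x y using that module_homD(2)[OF d, of x i y] by simp
    show "a \<odot>\<^bsub>E i\<^esub> x \<in> {x \<in> carrier (E i). d i x = \<zero>\<^bsub>E (Suc i)\<^esub>}"
      if "a \<in> carrier R" "x \<in> {x \<in> carrier (E i). d i x = \<zero>\<^bsub>E (Suc i)\<^esub>}"
      for a x using that module_homD(3)[OF d, of a x i] by simp
  qed auto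
  have Z: "module R (Z i)" for i unfolding Z_def by (rule submodule_module[OF Zsub E(1)])
  have Z_simps: "\<zero>\<^bsub>Z i\<^esub> = \<zero>\<^bsub>E i\<^esub>" "carrier (Z i) = a_kernel (E i) (E (Suc i)) (d i)" for i
    by (simp_all add: Z_def a_kernel_def kernel_def)
  have dZ: "d i \<in> module_hom R (E i) (Z (Suc i))" for i
    using module_homD[OF d] injective_resolution_complex[OF res]
    by (auto simp: module_hom_def Z_def)
  have ker_iff: "d i x = \<zero>\<^bsub>Z (Suc i)\<^esub> \<longleftrightarrow> x \<in> carrier (Z i)" if "x \<in> carrier (E i)" for i x
    using that by (simp add: Z_def)
  have tors_Z: "torsion R ?S (Z i) = {x \<in> torsion R ?S (E i). d i x = \<zero>\<^bsub>E (Suc i)\<^esub>}" for i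
    by (auto simp: torsion_def Z_def)
  have exact: "short_exact R (Z i) (E i) (Z (Suc i)) (\<lambda>x. x) (d i)" for i
  proof (intro short_exact.intro short_exact_axioms.intro Z E(1) dZ)
    show "(\<lambda>x. x) \<in> module_hom R (Z i) (E i)" by (auto simp: module_hom_def Z_def)
    show "d i ` carrier (E i) = carrier (Z (Suc i))" using d_im[of i] by (simp add: Z_simps)
    show "d i x = \<zero>\<^bsub>Z (Suc i)\<^esub> \<longleftrightarrow> x \<in> (\<lambda>x. x) ` carrier (Z i)" if "x \<in> carrier (E i)" for x
      using ker_iff[OF that] by simp
  qed simp
  \<comment> \<open>The first sequence has \<open>M\<close> itself on the left:
    \<open>\<epsilon>\<close> maps it isomorphically onto \<open>Z 0\<close>, which lives in another
    type.\<close>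
  have exact0: "short_exact R M (E 0) (Z 1) \<epsilon> (d 0)"
    by (intro short_exact.intro short_exact_axioms.intro M Z[of 1] E(1) dZ[of 0, simplified] \<epsilon>)
      (use d_im[of 0] ker_iff[of _ 0] \<epsilon>_im dZ[of 0] in \<open>auto simp: Z_simps\<close>)
  \<comment> \<open>Each short exact sequence lowers the degree by one and raises the index by one,
    until degree one is decided by torsion parts.\<close>
  have Z_vanishes: "cech_vanishes R (Z i) xs (int (Suc k)) \<longleftrightarrow>
      torsion R ?S (Z (Suc (i + k))) \<subseteq> d (i + k) ` torsion R ?S (E (i + k))" for i k
  proof (induction k arbitrary: i)
    case 0
    have "cech_vanishes R (Z i) xs (0 + 1) \<longleftrightarrow> torsion R ?S (Z (Suc i)) \<subseteq> d i ` torsion R ?S (E i)"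
      using short_exact.vanishes_iff_cocycles_lift[OF exact S, of i 0] acyclic[of 1 i]
        short_exact.cocycles_lift_zero_iff[OF exact S, of i] by simp
    then show ?case by simp
  next
    case (Suc k)
    have "cech_vanishes R (Z i) xs (int (Suc k) + 1) \<longleftrightarrow> cech_vanishes R (Z (Suc i)) xs (int (Suc k))"
      using short_exact.vanishes_iff_cocycles_lift[OF exact S, of i "int (Suc k)"]
        short_exact.cocycles_lift_iff_vanishes[OF exact S, of i "int (Suc k)"] acyclic[of _ i] by simp
    then show ?case using Suc.IH[of "Suc i"] by (simp add: add.commute)
  qed
  show ?thesis
  proof (cases i)
    case 0
    \<comment> \<open>As \<open>\<epsilon>\<close> is injective with image the kernel of
      \<open>d 0\<close>, it identifies the torsion of \<open>M\<close> with the torsion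
      cocycles.\<close>
    have "{x \<in> torsion R ?S (E 0). d 0 x = \<zero>\<^bsub>E (Suc 0)\<^esub>} \<subseteq> {\<zero>\<^bsub>E 0\<^esub>} \<longleftrightarrow> torsion R ?S M \<subseteq> {\<zero>\<^bsub>M\<^esub>}"
    proof
      assume *: "{x \<in> torsion R ?S (E 0). d 0 x = \<zero>\<^bsub>E (Suc 0)\<^esub>} \<subseteq> {\<zero>\<^bsub>E 0\<^esub>}"
      show "torsion R ?S M \<subseteq> {\<zero>\<^bsub>M\<^esub>}"
      proof
        fix x assume x: "x \<in> torsion R ?S M"
        then have xM: "x \<in> carrier M" by (auto simp: torsion_def)
        have "\<epsilon> x \<in> torsion R ?S (E 0)" by (rule torsion_hom[OF \<epsilon>(1) M E(1) S x])
        moreover have "\<epsilon> x \<in> a_kernel (E 0) (E (Suc 0)) (d 0)" using xM \<epsilon>_im by blast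
        ultimately have "\<epsilon> x = \<epsilon> \<zero>\<^bsub>M\<^esub>"
          using * module_hom_zero[OF \<epsilon>(1) M E(1)] by (auto simp: a_kernel_def kernel_def)
        then show "x \<in> {\<zero>\<^bsub>M\<^esub>}" using inj_onD[OF \<epsilon>(2)] xM by simp
      qed
    next
      assume *: "torsion R ?S M \<subseteq> {\<zero>\<^bsub>M\<^esub>}"
      show "{x \<in> torsion R ?S (E 0). d 0 x = \<zero>\<^bsub>E (Suc 0)\<^esub>} \<subseteq> {\<zero>\<^bsub>E 0\<^esub>}"
      proof
        fix y assume y: "y \<in> {x \<in> torsion R ?S (E 0). d 0 x = \<zero>\<^bsub>E (Suc 0)\<^esub>}"
        then have "y \<in> a_kernel (E 0) (E (Suc 0)) (d 0)" by (auto simp: a_kernel_def kernel_def torsion_def)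
        then obtain x where x: "x \<in> carrier M" "y = \<epsilon> x" using \<epsilon>_im by blast
        obtain N :: nat where N: "\<And>s. s \<in> ?S \<Longrightarrow> (s [^]\<^bsub>R\<^esub> N) \<odot>\<^bsub>E 0\<^esub> \<epsilon> x = \<zero>\<^bsub>E 0\<^esub>"
          using y x(2) by (auto simp: torsion_def)
        have "(s [^]\<^bsub>R\<^esub> N) \<odot>\<^bsub>M\<^esub> x = \<zero>\<^bsub>M\<^esub>" if "s \<in> ?S" for s
        proof -
          have sR: "s [^]\<^bsub>R\<^esub> N \<in> carrier R" using that S by auto
          have "\<epsilon> ((s [^]\<^bsub>R\<^esub> N) \<odot>\<^bsub>M\<^esub> x) = \<epsilon> \<zero>\<^bsub>M\<^esub>"
            using N[OF that] module_homD(3)[OF \<epsilon>(1) sR x(1)] module_hom_zero[OF \<epsilon>(1) M E(1)] by simp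
          then show ?thesis using inj_onD[OF \<epsilon>(2)] sR x(1) by simp
        qed
        then have "x \<in> torsion R ?S M" using x(1) by (auto simp: torsion_def)
        then show "y \<in> {\<zero>\<^bsub>E 0\<^esub>}" using * x(2) module_hom_zero[OF \<epsilon>(1) M E(1)] by auto
      qed
    qed
    then show ?thesis using triv[of 0] M.cech_vanishes_zero_iff[OF S] 0 by simp
  next
    case (Suc j)
    have "cech_vanishes R M xs (int (Suc j)) \<longleftrightarrow>
      torsion R ?S (Z (Suc j)) \<subseteq> d j ` torsion R ?S (E j)"
    proof (cases j)
      case 0
      have "cech_vanishes R M xs (0 + 1) \<longleftrightarrow> torsion R ?S (Z 1) \<subseteq> d 0 ` torsion R ?S (E 0)"
        using short_exact.vanishes_iff_cocycles_lift[OF exact0 S, of 0] acyclic[of 1 0]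
          short_exact.cocycles_lift_zero_iff[OF exact0 S] by simp
      then show ?thesis using 0 by simp
    next
      case (Suc k)
      have "cech_vanishes R M xs (int (Suc k) + 1) \<longleftrightarrow> cech_vanishes R (Z 1) xs (int (Suc k))"
        using short_exact.vanishes_iff_cocycles_lift[OF exact0 S, of "int (Suc k)"]
          short_exact.cocycles_lift_iff_vanishes[OF exact0 S, of "int (Suc k)"] acyclic[of _ 0] by simp
      then show ?thesis using Z_vanishes[of 1 k] Suc by (simp add: add.commute)
    qed
    then show ?thesis using triv[of i] tors_Z[of "Suc j"] Suc by simp
  qed
qed

section \<open>Modules over a field\<close>

text \<open>A nonzero ideal of a field contains one, and the value at one represents the
  map.\<close>

lemma field_imp_baer:
  assumes K: "field K" and V: "module K V"
  shows "baer K V"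
  unfolding baer_def
proof (intro allI impI, elim conjE)
  interpret K: field K by fact
  interpret V: module K V by fact
  fix J f
  assume J: "ideal J K" and f: "f \<in> J \<rightarrow> carrier V"
    "\<forall>r\<in>carrier K. \<forall>x\<in>J. f (r \<otimes>\<^bsub>K\<^esub> x) = r \<odot>\<^bsub>V\<^esub> f x"
  interpret J: ideal J K by fact
  show "\<exists>e\<in>carrier V. \<forall>x\<in>J. f x = x \<odot>\<^bsub>V\<^esub> e"
  proof (cases "J \<subseteq> {\<zero>\<^bsub>K\<^esub>}")
    case True
    have "f \<zero>\<^bsub>K\<^esub> = \<zero>\<^bsub>K\<^esub> \<odot>\<^bsub>V\<^esub> f \<zero>\<^bsub>K\<^esub>" using f(2)[rule_format, OF K.zero_closed J.zero_closed] by simp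
    also have "\<dots> = \<zero>\<^bsub>V\<^esub>" by (rule V.smult_l_null) (use f(1) J.zero_closed in blast)
    finally show ?thesis using True by (intro bexI[of _ "\<zero>\<^bsub>V\<^esub>"]) auto
  next
    case False
    then obtain a where a: "a \<in> J" "a \<noteq> \<zero>\<^bsub>K\<^esub>" by auto
    then have "a \<in> Units K" using J.Icarr K.field_Units by auto
    then have one: "\<one>\<^bsub>K\<^esub> \<in> J"
      using J.I_l_closed[OF a(1) K.Units_inv_closed] K.Units_l_inv by metis
    have "f x = x \<odot>\<^bsub>V\<^esub> f \<one>\<^bsub>K\<^esub>" if "x \<in> J" for x
      using f(2)[rule_format, OF J.Icarr[OF that] one] J.Icarr[OF that] by simp
    moreover have "f \<one>\<^bsub>K\<^esub> \<in> carrier V" using f(1) one by (rule funcset_mem)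
    ultimately show ?thesis by blast
  qed
qed

text \<open>Complements without bases. Every \<open>K\<close>-module is injective, so the kernel of
  \<open>d\<close> has a linear retraction \<open>\<pi>\<close>. The map \<open>1 - \<pi>\<close>
  factors through the image of \<open>d\<close>, and injectivity of \<open>V\<close> extends the
  factor to all of \<open>W\<close>.\<close>

lemma linear_pseudo_inverse:
  assumes K: "field K" and V: "module K V" and W: "module K W" and d: "d \<in> module_hom K V W"
  obtains s where "s \<in> module_hom K W V" "\<And>x. x \<in> carrier V \<Longrightarrow> d (s (d x)) = d x"
proof -
  interpret V: module K V by fact
  interpret W: module K W by fact
  let ?Z = "{x \<in> carrier V. d x = \<zero>\<^bsub>W\<^esub>}"
  have Z: "submodule ?Z K V"
    by (rule V.submoduleI') (auto simp: module_homD[OF d] module_hom_zero[OF d V W])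
  let ?ZM = "V\<lparr>carrier := ?Z\<rparr>"
  have ZM: "module K ?ZM" by (rule submodule_module[OF Z V])
  obtain \<pi> where \<pi>: "\<pi> \<in> module_hom K V ?ZM" "\<And>x. x \<in> ?Z \<Longrightarrow> \<pi> x = x"
    using baer_extend[OF V ZM field_imp_baer[OF K ZM] Z, of "\<lambda>x. x"] module_hom_id by blast
  have \<pi>Z: "\<pi> x \<in> carrier V" "d (\<pi> x) = \<zero>\<^bsub>W\<^esub>" if "x \<in> carrier V" for x
    using module_homD(1)[OF \<pi>(1) that] by auto
  have \<pi>V: "\<pi> \<in> module_hom K V V"
    using \<pi>(1) by (auto simp: module_hom_def)
  let ?B = "d ` carrier V"
  have B: "submodule ?B K W" by (rule module_hom_image_submodule[OF d V W])
  define r where "r = (\<lambda>x. x \<ominus>\<^bsub>V\<^esub> \<pi> x)"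
  have r: "r \<in> module_hom K V V" unfolding r_def by (rule module_hom_sub[OF module_hom_id \<pi>V V V])
  have r_eq: "r x = r y" if "x \<in> carrier V" "y \<in> carrier V" "d x = d y" for x y
  proof -
    have "x \<ominus>\<^bsub>V\<^esub> y \<in> ?Z"
      using that module_hom_diff[OF d V W] module_homD(1)[OF d] W.M.minus_eq_zero_iff by simp
    then have "r (x \<ominus>\<^bsub>V\<^esub> y) = \<zero>\<^bsub>V\<^esub>" using \<pi>(2) by (simp add: r_def V.M.minus_eq_zero_iff)
    then show ?thesis
      using module_hom_diff[OF r V V] that module_homD(1)[OF r] V.M.minus_eq_zero_iff by simp
  qed
  define t where "t = (\<lambda>w. r (SOME x. x \<in> carrier V \<and> d x = w))"
  have t: "t (d x) = r x" if x: "x \<in> carrier V" for x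
  proof -
    have "(SOME y. y \<in> carrier V \<and> d y = d x) \<in> carrier V \<and> d (SOME y. y \<in> carrier V \<and> d y = d x) = d x"
      by (rule someI_ex) (use x in blast)
    then show ?thesis unfolding t_def using r_eq x by blast
  qed
  have "t \<in> module_hom K (W\<lparr>carrier := ?B\<rparr>) V"
  proof (rule module_homI)
    show "t w \<in> carrier V" if "w \<in> carrier (W\<lparr>carrier := ?B\<rparr>)" for w
      using that t module_homD(1)[OF r] by auto
    show "t (v \<oplus>\<^bsub>W\<lparr>carrier := ?B\<rparr>\<^esub> w) = t v \<oplus>\<^bsub>V\<^esub> t w"
      if vw: "v \<in> carrier (W\<lparr>carrier := ?B\<rparr>)" "w \<in> carrier (W\<lparr>carrier := ?B\<rparr>)" for v w
    proof -
      obtain x y where "x \<in> carrier V" "y \<in> carrier V" "v = d x" "w = d y" using vw by auto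
      then show ?thesis using t[of "x \<oplus>\<^bsub>V\<^esub> y"] t[of x] t[of y] module_homD(2)[OF d] module_homD(2)[OF r]
        by simp
    qed
    show "t (k \<odot>\<^bsub>W\<lparr>carrier := ?B\<rparr>\<^esub> w) = k \<odot>\<^bsub>V\<^esub> t w"
      if kw: "k \<in> carrier K" "w \<in> carrier (W\<lparr>carrier := ?B\<rparr>)" for k w
    proof -
      obtain x where "x \<in> carrier V" "w = d x" using kw by auto
      then show ?thesis using t[of "k \<odot>\<^bsub>V\<^esub> x"] t[of x] module_homD(3)[OF d] module_homD(3)[OF r] kw
        by simp
    qed
  qed
  from baer_extend[OF W V field_imp_baer[OF K V] B this] obtain s where
    s: "s \<in> module_hom K W V" "\<And>w. w \<in> ?B \<Longrightarrow> s w = t w" by blast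
  have "d (s (d x)) = d x" if x: "x \<in> carrier V" for x
  proof -
    have "d (s (d x)) = d (x \<ominus>\<^bsub>V\<^esub> \<pi> x)" using s(2)[of "d x"] t[OF x] x by (simp add: r_def)
    also have "\<dots> = d x \<ominus>\<^bsub>W\<^esub> \<zero>\<^bsub>W\<^esub>" using module_hom_diff[OF d V W x \<pi>Z(1)[OF x]] \<pi>Z(2)[OF x] by simp
    also have "\<dots> = d x"
      using module_homD(1)[OF d x] W.M.minus_equality[of "\<zero>\<^bsub>W\<^esub>" "\<zero>\<^bsub>W\<^esub>"] by (simp add: a_minus_def)
    finally show ?thesis .
  qed
  then show thesis using s(1) that by blast
qed

section \<open>The Kuenneth formula\<close>

text \<open>Additivity alone is recorded: the target of a tensor product enters as an abelian group,
  so the \<open>R\<close>-module \<open>T\<close> can be that target without a second scalar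
  action.\<close>

definition additive_endo :: "('m, 'x) ring_scheme \<Rightarrow> ('m \<Rightarrow> 'm) \<Rightarrow> bool"
  where "additive_endo X F \<longleftrightarrow> F \<in> carrier X \<rightarrow> carrier X \<and>
    (\<forall>x\<in>carrier X. \<forall>y\<in>carrier X. F (x \<oplus>\<^bsub>X\<^esub> y) = F x \<oplus>\<^bsub>X\<^esub> F y)"

lemma additive_endoD:
  "additive_endo X F \<Longrightarrow> x \<in> carrier X \<Longrightarrow> F x \<in> carrier X"
  "additive_endo X F \<Longrightarrow> x \<in> carrier X \<Longrightarrow> y \<in> carrier X \<Longrightarrow> F (x \<oplus>\<^bsub>X\<^esub> y) = F x \<oplus>\<^bsub>X\<^esub> F y"
  by (auto simp: additive_endo_def)

lemma additive_endo_comp: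
  "additive_endo X F \<Longrightarrow> additive_endo X G \<Longrightarrow> additive_endo X (\<lambda>x. F (G x))"
  by (simp add: additive_endo_def Pi_iff)

lemma additive_endo_add:
  assumes "abelian_group X" "additive_endo X F" "additive_endo X G"
  shows "additive_endo X (\<lambda>x. F x \<oplus>\<^bsub>X\<^esub> G x)"
proof -
  interpret X: abelian_group X by fact
  show ?thesis using assms(2,3) by (simp add: additive_endo_def Pi_iff X.a_ac)
qed

text \<open>The Kuenneth formula needs only these properties of a tensor product of vector spaces, and they
  pass to modules of chains.\<close>

locale tensor_product = C: module K C + D: module K D + X: abelian_group X
  for K :: "('k, 'u) ring_scheme" and C :: "('k, 'c, 'v) module_scheme"
    and D :: "('k, 'd, 'w) module_scheme" and X :: "('x, 'y) ring_scheme" +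
  fixes t :: "'c \<Rightarrow> 'd \<Rightarrow> 'x"
  assumes closed: "\<And>c d. c \<in> carrier C \<Longrightarrow> d \<in> carrier D \<Longrightarrow> t c d \<in> carrier X"
    and add_left: "\<And>c c' d. c \<in> carrier C \<Longrightarrow> c' \<in> carrier C \<Longrightarrow> d \<in> carrier D \<Longrightarrow>
      t (c \<oplus>\<^bsub>C\<^esub> c') d = t c d \<oplus>\<^bsub>X\<^esub> t c' d"
    and add_right: "\<And>c d d'. c \<in> carrier C \<Longrightarrow> d \<in> carrier D \<Longrightarrow> d' \<in> carrier D \<Longrightarrow>
      t c (d \<oplus>\<^bsub>D\<^esub> d') = t c d \<oplus>\<^bsub>X\<^esub> t c d'"
    and spanning: "\<And>H. \<zero>\<^bsub>X\<^esub> \<in> H \<Longrightarrow> (\<And>c d. c \<in> carrier C \<Longrightarrow> d \<in> carrier D \<Longrightarrow> t c d \<in> H) \<Longrightarrow>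
      (\<And>x y. x \<in> carrier X \<Longrightarrow> y \<in> carrier X \<Longrightarrow> x \<in> H \<Longrightarrow> y \<in> H \<Longrightarrow> x \<oplus>\<^bsub>X\<^esub> y \<in> H) \<Longrightarrow> carrier X \<subseteq> H"
    and functorial: "\<And>f g. f \<in> module_hom K C C \<Longrightarrow> g \<in> module_hom K D D \<Longrightarrow>
      \<exists>F. additive_endo X F \<and> (\<forall>c\<in>carrier C. \<forall>d\<in>carrier D. F (t c d) = t (f c) (g d))"
    and nonzero: "\<And>c d. c \<in> carrier C \<Longrightarrow> d \<in> carrier D \<Longrightarrow> t c d = \<zero>\<^bsub>X\<^esub> \<Longrightarrow>
      c = \<zero>\<^bsub>C\<^esub> \<or> d = \<zero>\<^bsub>D\<^esub>"
begin

lemma zero_left: "d \<in> carrier D \<Longrightarrow> t \<zero>\<^bsub>C\<^esub> d = \<zero>\<^bsub>X\<^esub>"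
  by (rule additive_zero[OF C.abelian_group_axioms X.abelian_group_axioms, of "\<lambda>c. t c d"])
    (auto simp: closed add_left)

lemma zero_right: "c \<in> carrier C \<Longrightarrow> t c \<zero>\<^bsub>D\<^esub> = \<zero>\<^bsub>X\<^esub>"
  by (rule additive_zero[OF D.abelian_group_axioms X.abelian_group_axioms, of "t c"])
    (auto simp: closed add_right)

lemma minus_left: "c \<in> carrier C \<Longrightarrow> d \<in> carrier D \<Longrightarrow> t (\<ominus>\<^bsub>C\<^esub> c) d = \<ominus>\<^bsub>X\<^esub> t c d"
  by (rule additive_minus[OF C.abelian_group_axioms X.abelian_group_axioms, of "\<lambda>c. t c d"])
    (auto simp: closed add_left)

lemma minus_right: "c \<in> carrier C \<Longrightarrow> d \<in> carrier D \<Longrightarrow> t c (\<ominus>\<^bsub>D\<^esub> d) = \<ominus>\<^bsub>X\<^esub> t c d"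
  by (rule additive_minus[OF D.abelian_group_axioms X.abelian_group_axioms, of "t c"])
    (auto simp: closed add_right)

text \<open>Transfers statements about the first factor to the second one.\<close>

lemma swap: "tensor_product K D C X (\<lambda>d c. t c d)"
proof (intro tensor_product.intro tensor_product_axioms.intro D.module_axioms C.module_axioms
    X.abelian_group_axioms)
  show "\<exists>F. additive_endo X F \<and> (\<forall>d\<in>carrier D. \<forall>c\<in>carrier C. F (t c d) = t (f c) (g d))"
    if "g \<in> module_hom K D D" "f \<in> module_hom K C C" for f g
    using functorial[OF that(2,1)] by blast
  show "d = \<zero>\<^bsub>D\<^esub> \<or> c = \<zero>\<^bsub>C\<^esub>" if "d \<in> carrier D" "c \<in> carrier C" "t c d = \<zero>\<^bsub>X\<^esub>" for c d
    using nonzero[OF that(2,1,3)] by blast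
qed (use closed add_left add_right spanning in auto)

end

section \<open>Tensor products of modules of chains\<close>

lemma additive_finsum:
  assumes M: "abelian_group M" and N: "abelian_group N"
    and f: "\<And>x. x \<in> carrier M \<Longrightarrow> f x \<in> carrier N"
      "\<And>x y. x \<in> carrier M \<Longrightarrow> y \<in> carrier M \<Longrightarrow> f (x \<oplus>\<^bsub>M\<^esub> y) = f x \<oplus>\<^bsub>N\<^esub> f y"
    and "finite A" "\<And>a. a \<in> A \<Longrightarrow> h a \<in> carrier M"
  shows "f (finsum M h A) = finsum N (\<lambda>a. f (h a)) A"
  using assms(5,6)
proof (induction A rule: finite_induct)
  interpret M: abelian_group M by fact
  interpret N: abelian_group N by fact
  case empty
  then show ?case using additive_zero[OF M N f] by simp
next
  interpret M: abelian_group M by fact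
  interpret N: abelian_group N by fact
  case (insert a A)
  then have "finsum M h (insert a A) = h a \<oplus>\<^bsub>M\<^esub> finsum M h A"
    "finsum N (\<lambda>a. f (h a)) (insert a A) = f (h a) \<oplus>\<^bsub>N\<^esub> finsum N (\<lambda>a. f (h a)) A"
    by (auto intro!: M.finsum_insert N.finsum_insert f(1))
  moreover have "finsum M h A \<in> carrier M" using insert by (intro M.finsum_closed) auto
  ultimately show ?case using insert f(2) by simp
qed

definition single_chain :: "('m, 'y) ring_scheme \<Rightarrow> 'i \<Rightarrow> 'm \<Rightarrow> 'i \<Rightarrow> 'm"
  where "single_chain M i x = (\<lambda>j. if j = i then x else \<zero>\<^bsub>M\<^esub>)"

lemma chain_eq_finsum:
  assumes M: "module R M" and "finite I" and c: "c \<in> carrier (chains M I)"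
  shows "c = finsum (chains M I) (\<lambda>i. single_chain M i (c i)) I"
proof
  interpret M: module R M by fact
  interpret C: module R "chains M I" by (rule module_chains[OF M])
  fix j
  have "finsum (chains M I) (\<lambda>i. single_chain M i (c i)) I j = finsum M (\<lambda>i. single_chain M i (c i) j) I"
    by (rule additive_finsum[OF C.abelian_group_axioms M.abelian_group_axioms, of "\<lambda>c. c j"])
      (use c assms(2) in \<open>auto simp: single_chain_def\<close>)
  also have "\<dots> = c j"
  proof (cases "j \<in> I")
    case True
    then show ?thesis
      using M.finsum_singleton[OF True assms(2), of c] c by (simp add: single_chain_def)
  next
    case False
    then have "finsum M (\<lambda>i. single_chain M i (c i) j) I = finsum M (\<lambda>i. \<zero>\<^bsub>M\<^esub>) I"
      by (intro M.finsum_cong') (auto simp: single_chain_def)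
    also have "\<dots> = c j" using c False by (simp add: M.finsum_zero)
    finally show ?thesis .
  qed
  finally show "c j = finsum (chains M I) (\<lambda>i. single_chain M i (c i)) I j" ..
qed

lemma single_chain_closed:
  "x \<in> carrier M \<Longrightarrow> i \<in> I \<Longrightarrow> \<zero>\<^bsub>M\<^esub> \<in> carrier M \<Longrightarrow> single_chain M i x \<in> carrier (chains M I)"
  by (auto simp: single_chain_def)

text \<open>\<open>P\<close> plays the product of \<open>I\<close> and \<open>J\<close>. It is given
  by its projections because it will consist of lists that are cut in two by \<open>take\<close> and
  \<open>drop\<close>.\<close>

locale chain_pairing = L: tensor_product K L N T t + T: module R T
  for K :: "('k, 'u) ring_scheme" and L :: "('k, 'l, 'v) module_scheme"
    and N :: "('k, 'n, 'w) module_scheme" and R :: "('r, 'p) ring_scheme"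
    and T :: "('r, 't, 'y) module_scheme" and t +
  fixes I :: "'i set" and J :: "'j set" and P :: "'h set" and \<pi>1 :: "'h \<Rightarrow> 'i" and \<pi>2 :: "'h \<Rightarrow> 'j"
  assumes finite_indices: "finite I" "finite J" "finite P"
    and pairing: "\<And>i j. i \<in> I \<Longrightarrow> j \<in> J \<Longrightarrow> \<exists>!k. k \<in> P \<and> \<pi>1 k = i \<and> \<pi>2 k = j"
    and projections: "\<And>k. k \<in> P \<longleftrightarrow> \<pi>1 k \<in> I \<and> \<pi>2 k \<in> J"
begin

definition tensor_chain :: "('i \<Rightarrow> 'l) \<Rightarrow> ('j \<Rightarrow> 'n) \<Rightarrow> 'h \<Rightarrow> 't"
  where "tensor_chain c d = (\<lambda>k. t (c (\<pi>1 k)) (d (\<pi>2 k)))"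

lemma tensor_chain_closed:
  assumes "c \<in> carrier (chains L I)" "d \<in> carrier (chains N J)"
  shows "tensor_chain c d \<in> carrier (chains T P)"
proof -
  have "t (c (\<pi>1 k)) (d (\<pi>2 k)) = \<zero>\<^bsub>T\<^esub>" if "k \<notin> P" for k
    using that projections[of k] assms L.zero_left[of "d (\<pi>2 k)"] L.zero_right[of "c (\<pi>1 k)"] by auto
  then show ?thesis using assms L.closed by (auto simp: tensor_chain_def)
qed

lemma tensor_single_chain:
  assumes k: "k \<in> P" and "x \<in> carrier L" "y \<in> carrier N"
  shows "tensor_chain (single_chain L (\<pi>1 k) x) (single_chain N (\<pi>2 k) y) = single_chain T k (t x y)"
proof
  fix h
  show "tensor_chain (single_chain L (\<pi>1 k) x) (single_chain N (\<pi>2 k) y) h = single_chain T k (t x y) h"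
  proof (cases "\<pi>1 h = \<pi>1 k \<and> \<pi>2 h = \<pi>2 k")
    case True
    then have "h \<in> P" using projections k by simp
    then have "h = k" using pairing[of "\<pi>1 k" "\<pi>2 k"] projections k True by blast
    then show ?thesis by (simp add: tensor_chain_def single_chain_def)
  next
    case False
    then show ?thesis
      using L.zero_left L.zero_right assms by (auto simp: tensor_chain_def single_chain_def)
  qed
qed

text \<open>The smaller index set \<open>P'\<close> prepares the case of one total degree. Closure
  under addition is asked only for chains on \<open>P'\<close>, where degree-dependent properties
  are available.\<close>

lemma spanning_chains:
  assumes P': "P' \<subseteq> P" and z: "\<zero>\<^bsub>chains T P\<^esub> \<in> H"
    and gen: "\<And>k x y. k \<in> P' \<Longrightarrow> x \<in> carrier L \<Longrightarrow> y \<in> carrier N \<Longrightarrow>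
      tensor_chain (single_chain L (\<pi>1 k) x) (single_chain N (\<pi>2 k) y) \<in> H"
    and add: "\<And>x y. x \<in> carrier (chains T P') \<Longrightarrow> y \<in> carrier (chains T P') \<Longrightarrow> x \<in> H \<Longrightarrow> y \<in> H \<Longrightarrow>
      x \<oplus>\<^bsub>chains T P\<^esub> y \<in> H"
  shows "carrier (chains T P') \<subseteq> H"
proof
  interpret C': module R "chains T P'" by (rule module_chains[OF T.module_axioms])
  have single: "single_chain T k x \<in> H" if k: "k \<in> P'" and x: "x \<in> carrier T" for k x
  proof -
    have "carrier T \<subseteq> {x. single_chain T k x \<in> H}"
    proof (rule L.spanning)
      have "single_chain T k \<zero>\<^bsub>T\<^esub> = \<zero>\<^bsub>chains T P\<^esub>" by (auto simp: single_chain_def)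
      then show "\<zero>\<^bsub>T\<^esub> \<in> {x. single_chain T k x \<in> H}" using z by simp
      show "t x y \<in> {x. single_chain T k x \<in> H}" if "x \<in> carrier L" "y \<in> carrier N" for x y
        using gen[OF k that] tensor_single_chain[OF _ that, of k] k P' by auto
      show "x \<oplus>\<^bsub>T\<^esub> y \<in> {x. single_chain T k x \<in> H}"
        if "x \<in> carrier T" "y \<in> carrier T" "x \<in> {x. single_chain T k x \<in> H}" "y \<in> {x. single_chain T k x \<in> H}"
        for x y
      proof -
        have "single_chain T k (x \<oplus>\<^bsub>T\<^esub> y) = single_chain T k x \<oplus>\<^bsub>chains T P\<^esub> single_chain T k y"
          by (auto simp: single_chain_def)
        then show ?thesis using add[of "single_chain T k x" "single_chain T k y"] that k
          by (auto simp: single_chain_def)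
      qed
    qed
    then show ?thesis using x by blast
  qed
  fix c assume c: "c \<in> carrier (chains T P')"
  have "finsum (chains T P') (\<lambda>k. single_chain T k (c k)) A \<in> H \<and>
      finsum (chains T P') (\<lambda>k. single_chain T k (c k)) A \<in> carrier (chains T P')"
    if "finite A" "A \<subseteq> P'" for A
    using that
  proof (induction A rule: finite_induct)
    case empty
    then show ?case using z by simp
  next
    case (insert k A)
    have sc: "single_chain T j (c j) \<in> carrier (chains T P')" if "j \<in> P'" for j
      using that c by (intro single_chain_closed) auto
    have k: "single_chain T k (c k) \<in> carrier (chains T P')" using insert by (intro sc) auto
    have "finsum (chains T P') (\<lambda>k. single_chain T k (c k)) (insert k A) =
      single_chain T k (c k) \<oplus>\<^bsub>chains T P'\<^esub> finsum (chains T P') (\<lambda>k. single_chain T k (c k)) A"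
      by (rule C'.M.finsum_insert) (use insert sc in auto)
    moreover have "single_chain T k (c k) \<in> H" using single insert c by auto
    ultimately show ?case using insert add[OF k] k C'.M.a_closed[OF k] by simp
  qed
  from this[of P'] show "c \<in> H"
    using chain_eq_finsum[OF T.module_axioms _ c] finite_subset[OF P' finite_indices(3)] by auto
qed

text \<open>A linear map of chains is given by a matrix of linear maps of coefficients.\<close>

lemma functorial_left:
  assumes f: "f \<in> module_hom K (chains L I) (chains L I)"
  shows "\<exists>F. additive_endo (chains T P) F \<and> (\<forall>c\<in>carrier (chains L I). \<forall>d\<in>carrier (chains N J).
    F (tensor_chain c d) = tensor_chain (f c) d)"
proof -
  interpret CL: module K "chains L I" by (rule module_chains[OF L.C.module_axioms])
  interpret CT: module R "chains T P" by (rule module_chains[OF T.module_axioms])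
  note fD = module_homD[OF f]
  have sc: "single_chain L i x \<in> carrier (chains L I)" if "i \<in> I" "x \<in> carrier L" for i x
    by (rule single_chain_closed) (use that in auto)
  \<comment> \<open>The matrix entry of \<open>f\<close> from index \<open>i'\<close> to index
    \<open>i\<close>.\<close>
  define a where "a = (\<lambda>i i' x. f (single_chain L i' x) i)"
  have a: "a i i' \<in> module_hom K L L" if "i' \<in> I" for i i'
  proof (rule module_homI)
    show "a i i' x \<in> carrier L" if "x \<in> carrier L" for x
      using fD(1)[OF sc[OF \<open>i' \<in> I\<close> that]] by (simp add: a_def)
    show "a i i' (x \<oplus>\<^bsub>L\<^esub> y) = a i i' x \<oplus>\<^bsub>L\<^esub> a i i' y" if "x \<in> carrier L" "y \<in> carrier L" for x y
    proof -
      have "single_chain L i' (x \<oplus>\<^bsub>L\<^esub> y) = single_chain L i' x \<oplus>\<^bsub>chains L I\<^esub> single_chain L i' y"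
        by (auto simp: single_chain_def)
      then show ?thesis
        using fD(2)[OF sc[OF \<open>i' \<in> I\<close> that(1)] sc[OF \<open>i' \<in> I\<close> that(2)]] by (simp add: a_def)
    qed
    show "a i i' (r \<odot>\<^bsub>L\<^esub> x) = r \<odot>\<^bsub>L\<^esub> a i i' x" if "r \<in> carrier K" "x \<in> carrier L" for r x
    proof -
      have "single_chain L i' (r \<odot>\<^bsub>L\<^esub> x) = r \<odot>\<^bsub>chains L I\<^esub> single_chain L i' x"
        using that by (auto simp: single_chain_def)
      then show ?thesis
        using fD(3)[OF that(1) sc[OF \<open>i' \<in> I\<close> that(2)]] by (simp add: a_def)
    qed
  qed
  have "\<forall>i. \<forall>i'\<in>I. \<exists>F. additive_endo T F \<and> (\<forall>x\<in>carrier L. \<forall>y\<in>carrier N. F (t x y) = t (a i i' x) y)"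
    using L.functorial[OF a module_hom_id] by blast
  then obtain \<Phi> where \<Phi>: "\<And>i i'. i' \<in> I \<Longrightarrow> additive_endo T (\<Phi> i i')"
    "\<And>i i' x y. i' \<in> I \<Longrightarrow> x \<in> carrier L \<Longrightarrow> y \<in> carrier N \<Longrightarrow> \<Phi> i i' (t x y) = t (a i i' x) y"
    by metis
  define \<rho> where "\<rho> = (\<lambda>i j. THE k. k \<in> P \<and> \<pi>1 k = i \<and> \<pi>2 k = j)"
  have \<rho>: "\<pi>1 (\<rho> i j) = i" "\<pi>2 (\<rho> i j) = j" if "i \<in> I" "j \<in> J" for i j
    using theI'[OF pairing[OF that]] by (auto simp: \<rho>_def)
  \<comment> \<open>Matrix times vector in the first index; \<open>\<rho>\<close> recovers an index
    of \<open>P\<close> from its projections.\<close>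
  define F where "F = (\<lambda>z k. if k \<in> P then finsum T (\<lambda>i'. \<Phi> (\<pi>1 k) i' (z (\<rho> i' (\<pi>2 k)))) I else \<zero>\<^bsub>T\<^esub>)"
  have cl: "\<Phi> i i' (z k) \<in> carrier T" if "i' \<in> I" "z \<in> carrier (chains T P)" for i i' z k
    using additive_endoD(1)[OF \<Phi>(1)[OF that(1)]] that(2) by simp
  have "additive_endo (chains T P) F"
    unfolding additive_endo_def
  proof (intro conjI ballI Pi_I)
    show "F z \<in> carrier (chains T P)" if "z \<in> carrier (chains T P)" for z
      using cl[OF _ that] by (auto simp: F_def intro!: L.X.finsum_closed)
    show "F (y \<oplus>\<^bsub>chains T P\<^esub> z) = F y \<oplus>\<^bsub>chains T P\<^esub> F z"
      if yz: "y \<in> carrier (chains T P)" "z \<in> carrier (chains T P)" for y z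
    proof -
      have "finsum T (\<lambda>i'. \<Phi> (\<pi>1 k) i' (y (\<rho> i' (\<pi>2 k)) \<oplus>\<^bsub>T\<^esub> z (\<rho> i' (\<pi>2 k)))) I =
        finsum T (\<lambda>i'. \<Phi> (\<pi>1 k) i' (y (\<rho> i' (\<pi>2 k))) \<oplus>\<^bsub>T\<^esub> \<Phi> (\<pi>1 k) i' (z (\<rho> i' (\<pi>2 k)))) I" for k
        using cl yz additive_endoD(2)[OF \<Phi>(1)] by (intro L.X.finsum_cong') auto
      also have "\<dots> k = finsum T (\<lambda>i'. \<Phi> (\<pi>1 k) i' (y (\<rho> i' (\<pi>2 k)))) I \<oplus>\<^bsub>T\<^esub>
        finsum T (\<lambda>i'. \<Phi> (\<pi>1 k) i' (z (\<rho> i' (\<pi>2 k)))) I" for k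
        using cl[OF _ yz(1)] cl[OF _ yz(2)] by (intro L.X.finsum_addf) auto
      finally show ?thesis by (auto simp: F_def)
    qed
  qed
  moreover have "F (tensor_chain c d) = tensor_chain (f c) d"
    if c: "c \<in> carrier (chains L I)" and d: "d \<in> carrier (chains N J)" for c d
  proof
    fix k
    show "F (tensor_chain c d) k = tensor_chain (f c) d k"
    proof (cases "k \<in> P")
      case False
      then show ?thesis using tensor_chain_closed[OF fD(1)[OF c] d] by (simp add: F_def)
    next
      case True
      then have k: "\<pi>1 k \<in> I" "\<pi>2 k \<in> J" using projections by auto
      let ?y = "d (\<pi>2 k)"
      have y: "?y \<in> carrier N" using d by simp
      have cc: "c i \<in> carrier L" for i using c by simp
      have "F (tensor_chain c d) k = finsum T (\<lambda>i'. t (a (\<pi>1 k) i' (c i')) ?y) I"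
        unfolding F_def tensor_chain_def using True \<rho> k \<Phi>(2) cc y module_homD(1)[OF a] L.closed
        by (auto intro!: L.X.finsum_cong')
      also have "\<dots> = finsum T (\<lambda>i'. t (f (single_chain L i' (c i')) (\<pi>1 k)) ?y) I" by (simp add: a_def)
      also have "\<dots> = t (f (finsum (chains L I) (\<lambda>i'. single_chain L i' (c i')) I) (\<pi>1 k)) ?y"
      proof (rule additive_finsum[OF CL.abelian_group_axioms L.X.abelian_group_axioms,
            of "\<lambda>c. t (f c (\<pi>1 k)) ?y", symmetric])
        show "t (f x (\<pi>1 k)) ?y \<in> carrier T" if "x \<in> carrier (chains L I)" for x
          using fD(1)[OF that] y by (intro L.closed) auto
        show "t (f (x \<oplus>\<^bsub>chains L I\<^esub> x') (\<pi>1 k)) ?y = t (f x (\<pi>1 k)) ?y \<oplus>\<^bsub>T\<^esub> t (f x' (\<pi>1 k)) ?y"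
          if "x \<in> carrier (chains L I)" "x' \<in> carrier (chains L I)" for x x'
          unfolding fD(2)[OF that] using fD(1)[OF that(1)] fD(1)[OF that(2)] y by (simp add: L.add_left)
      qed (use finite_indices sc cc in auto)
      also have "\<dots> = tensor_chain (f c) d k"
        using chain_eq_finsum[OF L.C.module_axioms finite_indices(1) c] by (simp add: tensor_chain_def)
      finally show ?thesis .
    qed
  qed
  ultimately show ?thesis by blast
qed

end

context chain_pairing begin

text \<open>A pair of linear maps acts first on the right factor and then on the left one. A pure
  tensor of nonzero families has a nonzero entry at a pair of indices where both families are
  nonzero.\<close>

lemma tensor_product_chains:
  "tensor_product K (chains L I) (chains N J) (chains T P) tensor_chain"
proof (intro tensor_product.intro tensor_product_axioms.intro)
  have L: "module K L" and N: "module K N" by (rule L.C.module_axioms L.D.module_axioms)+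
  show "module K (chains L I)" "module K (chains N J)" by (rule module_chains, fact)+
  show "abelian_group (chains T P)" by (rule module.axioms(2)[OF module_chains[OF T.module_axioms]])
  show "tensor_chain c d \<in> carrier (chains T P)" if "c \<in> carrier (chains L I)" "d \<in> carrier (chains N J)" for c d
    by (rule tensor_chain_closed[OF that])
  show "tensor_chain (c \<oplus>\<^bsub>chains L I\<^esub> c') d = tensor_chain c d \<oplus>\<^bsub>chains T P\<^esub> tensor_chain c' d"
    if "c \<in> carrier (chains L I)" "c' \<in> carrier (chains L I)" "d \<in> carrier (chains N J)" for c c' d
    using that by (auto simp: tensor_chain_def L.add_left)
  show "tensor_chain c (d \<oplus>\<^bsub>chains N J\<^esub> d') = tensor_chain c d \<oplus>\<^bsub>chains T P\<^esub> tensor_chain c d'"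
    if "c \<in> carrier (chains L I)" "d \<in> carrier (chains N J)" "d' \<in> carrier (chains N J)" for c d d'
    using that by (auto simp: tensor_chain_def L.add_right)
  show "carrier (chains T P) \<subseteq> H"
    if z: "\<zero>\<^bsub>chains T P\<^esub> \<in> H"
      and gen: "\<And>c d. c \<in> carrier (chains L I) \<Longrightarrow> d \<in> carrier (chains N J) \<Longrightarrow> tensor_chain c d \<in> H"
      and add: "\<And>x y. x \<in> carrier (chains T P) \<Longrightarrow> y \<in> carrier (chains T P) \<Longrightarrow> x \<in> H \<Longrightarrow> y \<in> H \<Longrightarrow>
        x \<oplus>\<^bsub>chains T P\<^esub> y \<in> H" for H
  proof (rule spanning_chains[OF order_refl z _ add])
    fix k x y assume "k \<in> P" "x \<in> carrier L" "y \<in> carrier N"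
    then show "tensor_chain (single_chain L (\<pi>1 k) x) (single_chain N (\<pi>2 k) y) \<in> H"
      using projections by (intro gen single_chain_closed) auto
  qed
  show "\<exists>F. additive_endo (chains T P) F \<and> (\<forall>c\<in>carrier (chains L I). \<forall>d\<in>carrier (chains N J).
      F (tensor_chain c d) = tensor_chain (f c) (g d))"
    if f: "f \<in> module_hom K (chains L I) (chains L I)" and g: "g \<in> module_hom K (chains N J) (chains N J)" for f g
  proof -
    \<comment> \<open>With the factors exchanged, the action on the right is the case already
      treated.\<close>
    interpret S: tensor_product K N L T "\<lambda>d c. t c d" by (rule L.swap)
    interpret S: chain_pairing K N L R T "\<lambda>d c. t c d" J I P \<pi>2 \<pi>1
    proof unfold_locales
      show "\<exists>!k. k \<in> P \<and> \<pi>2 k = j \<and> \<pi>1 k = i" if "j \<in> J" "i \<in> I" for i j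
        using pairing[OF that(2,1)] by (simp add: conj_commute)
      show "k \<in> P \<longleftrightarrow> \<pi>2 k \<in> J \<and> \<pi>1 k \<in> I" for k using projections by blast
    qed (rule finite_indices)+
    have swap: "S.tensor_chain d c = tensor_chain c d" for c d
      by (simp add: S.tensor_chain_def tensor_chain_def)
    obtain F where F: "additive_endo (chains T P) F"
      "\<And>c d. c \<in> carrier (chains L I) \<Longrightarrow> d \<in> carrier (chains N J) \<Longrightarrow> F (tensor_chain c d) = tensor_chain (f c) d"
      using functorial_left[OF f] by blast
    obtain G where G: "additive_endo (chains T P) G"
      "\<And>c d. c \<in> carrier (chains L I) \<Longrightarrow> d \<in> carrier (chains N J) \<Longrightarrow> G (tensor_chain c d) = tensor_chain c (g d)"
      using S.functorial_left[OF g] unfolding swap by blast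
    have "F (G (tensor_chain c d)) = tensor_chain (f c) (g d)"
      if "c \<in> carrier (chains L I)" "d \<in> carrier (chains N J)" for c d
      using F(2)[OF that(1) module_homD(1)[OF g that(2)]] G(2)[OF that] by simp
    then show ?thesis using additive_endo_comp[OF F(1) G(1)] by blast
  qed
  show "c = \<zero>\<^bsub>chains L I\<^esub> \<or> d = \<zero>\<^bsub>chains N J\<^esub>"
    if c: "c \<in> carrier (chains L I)" and d: "d \<in> carrier (chains N J)"
      and z: "tensor_chain c d = \<zero>\<^bsub>chains T P\<^esub>" for c d
  proof (rule ccontr)
    assume nz: "\<not> (c = \<zero>\<^bsub>chains L I\<^esub> \<or> d = \<zero>\<^bsub>chains N J\<^esub>)"
    then obtain i j where ij: "c i \<noteq> \<zero>\<^bsub>L\<^esub>" "d j \<noteq> \<zero>\<^bsub>N\<^esub>" by (auto simp: fun_eq_iff)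
    then have "i \<in> I" "j \<in> J" using c d by auto
    then obtain k where "\<pi>1 k = i" "\<pi>2 k = j" using pairing by blast
    then have "t (c i) (d j) = \<zero>\<^bsub>T\<^esub>" using fun_cong[OF z, of k] by (simp add: tensor_chain_def)
    then show False using L.nonzero[of "c i" "d j"] ij c d by simp
  qed
qed

end

section \<open>Signs and pseudo-inverses on Koszul complexes\<close>

definition degree_index :: "nat \<Rightarrow> int \<Rightarrow> bool list set"
  where "degree_index p n = {bs. length bs = p \<and> int (count_list bs True) = n}"

lemma koszul_chains_eq_carrier: "\<zero>\<^bsub>M\<^esub> \<in> carrier M \<Longrightarrow> koszul_chains M p n = carrier (chains M (degree_index p n))"
  by (auto simp: koszul_chains_def chains_def degree_index_def)

text \<open>The sign \<open>(-1)^n\<close> of the Leibniz rule. It is applied entry by entry, so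
  that it is a linear map on chains of mixed degree.\<close>

definition alternate_sign :: "('m, 'y) ring_scheme \<Rightarrow> (bool list \<Rightarrow> 'm) \<Rightarrow> bool list \<Rightarrow> 'm"
  where "alternate_sign M c = (\<lambda>bs. if even (count_list bs True) then c bs else \<ominus>\<^bsub>M\<^esub> c bs)"

text \<open>One group with two rings of scalars: \<open>A\<close> supplies the Koszul differential
  and \<open>K\<close> the vector space structure. Since \<open>K\<close> acts by
  \<open>A\<close>-linear maps, the differential is \<open>K\<close>-linear.\<close>

locale compatible_module = L: module A L + V: module K V
  for A :: "('a, 'x) ring_scheme" and L :: "('a, 'l, 'y) module_scheme"
    and K :: "('k, 'u) ring_scheme" and V :: "('k, 'l, 'v) module_scheme" +
  assumes same_group: "carrier V = carrier L" "\<zero>\<^bsub>V\<^esub> = \<zero>\<^bsub>L\<^esub>" "add V = add L"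
    and compatible: "\<And>k. k \<in> carrier K \<Longrightarrow> (\<lambda>x. k \<odot>\<^bsub>V\<^esub> x) \<in> module_hom A L L"
begin

abbreviation "length_chains p \<equiv> chains V {bs :: bool list. length bs = p}"

lemma minus_same: "\<ominus>\<^bsub>V\<^esub> x = \<ominus>\<^bsub>L\<^esub> x"
  by (simp add: a_inv_def m_inv_def same_group)

lemma koszul_chains_same: "koszul_chains V p n = koszul_chains L p n"
  by (simp add: koszul_chains_def same_group)

lemma koszul_chains_length: "c \<in> koszul_chains L p n \<Longrightarrow> c \<in> carrier (length_chains p)"
  by (auto simp: koszul_chains_def same_group)

lemma koszul_diff_length:
  "set xs \<subseteq> carrier A \<Longrightarrow> length bs \<noteq> length xs \<Longrightarrow> (\<And>bs. c bs \<in> carrier L) \<Longrightarrow>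
    koszul_diff A L N xs c bs = \<zero>\<^bsub>L\<^esub>" if "\<And>bs. length bs \<noteq> length xs \<Longrightarrow> c bs = \<zero>\<^bsub>L\<^esub>"
  using that
proof (induction xs arbitrary: c bs)
  case (Cons x xs)
  have IH: "koszul_diff A L N xs (\<lambda>t. c (b # t)) t = \<zero>\<^bsub>L\<^esub>" if "length t \<noteq> length xs" for b t
    using that Cons.prems by (intro Cons.IH) auto
  have m: "\<zero>\<^bsub>L\<^esub> \<ominus>\<^bsub>L\<^esub> \<zero>\<^bsub>L\<^esub> = \<zero>\<^bsub>L\<^esub>" by (simp add: L.M.minus_eq_zero_iff)
  show ?case
  proof (cases bs)
    case (Cons b t)
    then show ?thesis using IH[of t] Cons.prems Cons.prems(4)[of "False # t"] m by (cases b) auto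
  qed simp
qed simp

text \<open>Linearity over \<open>K\<close> is naturality of the differential for the
  \<open>A\<close>-linear map given by a scalar.\<close>

lemma koszul_diff_K_hom:
  assumes xs: "set xs \<subseteq> carrier A"
  shows "koszul_diff A L N xs \<in> module_hom K (length_chains (length xs)) (length_chains (length xs))"
proof (rule module_homI)
  let ?d = "koszul_diff A L N xs"
  show "?d c \<in> carrier (length_chains (length xs))" if "c \<in> carrier (length_chains (length xs))" for c
    using that koszul_diff_length[OF _ xs, of c] L.koszul_diff_closed[OF xs, of c] by (auto simp: same_group)
  show "?d (c \<oplus>\<^bsub>length_chains (length xs)\<^esub> c') = ?d c \<oplus>\<^bsub>length_chains (length xs)\<^esub> ?d c'"
    if "c \<in> carrier (length_chains (length xs))" "c' \<in> carrier (length_chains (length xs))" for c c'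
    using L.koszul_diff_linear(1)[OF xs, of c c'] that by (simp add: same_group)
  show "?d (k \<odot>\<^bsub>length_chains (length xs)\<^esub> c) = k \<odot>\<^bsub>length_chains (length xs)\<^esub> ?d c"
    if "k \<in> carrier K" "c \<in> carrier (length_chains (length xs))" for k c
    using koszul_natural(1)[OF compatible[OF that(1)] L.module_axioms L.module_axioms xs, of c] that(2)
    by (simp add: same_group)
qed

lemma alternate_sign_hom:
  "alternate_sign L \<in> module_hom K (length_chains p) (length_chains p)"
  unfolding minus_same[symmetric] alternate_sign_def
  by (rule module_homI) (auto simp: fun_eq_iff V.M.minus_add V.smult_r_minus same_group(2)[symmetric] V.M.minus_equality)

lemma alternate_sign_homogeneous:
  assumes "c \<in> koszul_chains L p n"
  shows "alternate_sign L c = (if even n then c else \<ominus>\<^bsub>length_chains p\<^esub> c)"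
proof -
  have m: "\<ominus>\<^bsub>length_chains p\<^esub> c = (\<lambda>bs. \<ominus>\<^bsub>L\<^esub> c bs)"
    using chains_minus[OF V.module_axioms koszul_chains_length[OF assms]] by (simp add: minus_same)
  have z: "\<ominus>\<^bsub>L\<^esub> \<zero>\<^bsub>L\<^esub> = \<zero>\<^bsub>L\<^esub>" by (rule L.M.minus_equality) auto
  show ?thesis
    unfolding m alternate_sign_def
  proof
    fix bs
    show "(if even (count_list bs True) then c bs else \<ominus>\<^bsub>L\<^esub> c bs) = (if even n then c else (\<lambda>bs. \<ominus>\<^bsub>L\<^esub> c bs)) bs"
      using koszul_chainsD(2)[OF assms, of bs] by (cases "c bs = \<zero>\<^bsub>L\<^esub>") (auto simp: z)
  qed
qed

lemma koszul_chains_uminus: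
  "c \<in> koszul_chains L p n \<Longrightarrow> \<ominus>\<^bsub>length_chains p\<^esub> c \<in> koszul_chains L p n"
  using V.koszul_chains_closed(3)[of c p n] chains_minus[OF V.module_axioms, of c UNIV]
    chains_minus[OF V.module_axioms koszul_chains_length, of c p n] V.koszul_chains_carrier[of c p n]
  by (simp add: koszul_chains_same)

lemma alternate_sign_chains:
  "c \<in> koszul_chains L p n \<Longrightarrow> alternate_sign L c \<in> koszul_chains L p n"
  by (simp add: alternate_sign_homogeneous koszul_chains_uminus)

lemma alternate_sign_twice:
  assumes "c \<in> koszul_chains L p n"
  shows "alternate_sign L (alternate_sign L c) = c"
proof -
  interpret C: module K "length_chains p" by (rule V.chains_module)
  show ?thesis
    using alternate_sign_homogeneous[OF alternate_sign_chains[OF assms]] alternate_sign_homogeneous[OF assms]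
      C.M.minus_minus[OF koszul_chains_length[OF assms]] by simp
qed

text \<open>The differential raises the degree by one, so it anticommutes with the sign.\<close>

lemma koszul_diff_alternate_sign:
  assumes xs: "set xs \<subseteq> carrier A" and c: "c \<in> koszul_chains L (length xs) n"
  shows "koszul_diff A L N xs (alternate_sign L c) =
    \<ominus>\<^bsub>length_chains (length xs)\<^esub> alternate_sign L (koszul_diff A L N xs c)"
proof -
  interpret C: module K "length_chains (length xs)" by (rule V.chains_module)
  show ?thesis
    using alternate_sign_homogeneous[OF c] alternate_sign_homogeneous[OF L.koszul_diff_chains[OF xs c, of N]]
      module_hom_minus[OF koszul_diff_K_hom[OF xs] C.module_axioms C.module_axioms koszul_chains_length[OF c], of N]
      C.M.minus_minus[OF koszul_chains_length[OF L.koszul_diff_chains[OF xs c, of N]]]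
    by simp
qed

text \<open>The component of degree \<open>-1\<close> of a linear pseudo-inverse of the differential.\<close>

lemma koszul_pseudo_inverse:
  assumes K: "field K" and xs: "set xs \<subseteq> carrier A"
  obtains s where "s \<in> module_hom K (length_chains (length xs)) (length_chains (length xs))"
    "\<And>c n. c \<in> koszul_chains L (length xs) n \<Longrightarrow> s c \<in> koszul_chains L (length xs) (n - 1)"
    "\<And>c n. c \<in> koszul_chains L (length xs) n \<Longrightarrow>
      koszul_diff A L N xs (s (koszul_diff A L N xs c)) = koszul_diff A L N xs c"
proof -
  let ?p = "length xs" and ?d = "koszul_diff A L N xs"
  let ?V = "\<lambda>n. chains V (degree_index ?p n)"
  have carr: "carrier (?V n) = koszul_chains L ?p n" for n
    using koszul_chains_eq_carrier[of V ?p n] koszul_chains_same by auto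
  have mV: "module K (?V n)" for n by (rule V.chains_module)
  have "?d \<in> module_hom K (?V n) (?V (n + 1))" for n
  proof (rule module_homI)
    note hom = module_homD[OF koszul_diff_K_hom[OF xs, of N]]
    show "?d c \<in> carrier (?V (n + 1))" if "c \<in> carrier (?V n)" for c
      using that L.koszul_diff_chains[OF xs] unfolding carr by blast
    show "?d (c \<oplus>\<^bsub>?V n\<^esub> c') = ?d c \<oplus>\<^bsub>?V (n + 1)\<^esub> ?d c'"
      if "c \<in> carrier (?V n)" "c' \<in> carrier (?V n)" for c c'
      using hom(2)[OF koszul_chains_length koszul_chains_length] that unfolding carr by simp
    show "?d (k \<odot>\<^bsub>?V n\<^esub> c) = k \<odot>\<^bsub>?V (n + 1)\<^esub> ?d c" if "k \<in> carrier K" "c \<in> carrier (?V n)" for k c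
      using hom(3)[OF that(1) koszul_chains_length] that unfolding carr by simp
  qed
  then have "\<forall>n. \<exists>s. s \<in> module_hom K (?V (n + 1)) (?V n) \<and> (\<forall>c\<in>carrier (?V n). ?d (s (?d c)) = ?d c)"
    using linear_pseudo_inverse[OF K mV mV] by metis
  then obtain s where s: "\<And>n. s n \<in> module_hom K (?V (n + 1)) (?V n)"
    "\<And>n c. c \<in> carrier (?V n) \<Longrightarrow> ?d (s n (?d c)) = ?d c" by metis
  define pr where "pr = (\<lambda>n c bs. if bs \<in> degree_index ?p n then c bs else \<zero>\<^bsub>V\<^esub>)"
  let ?C = "length_chains ?p"
  have pr: "pr n c \<in> carrier (?V n)" if "c \<in> carrier ?C" for n c
    using that by (auto simp: pr_def)
  \<comment> \<open>At an index of degree \<open>n\<close> only the pseudo-inverse from degree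
    \<open>n + 1\<close> to degree \<open>n\<close> is used, applied to the component of degree
    \<open>n + 1\<close>. This makes the assembled map homogeneous of degree
    \<open>-1\<close>.\<close>
  define r where "r = (\<lambda>c bs. if length bs = ?p then
    s (int (count_list bs True)) (pr (int (count_list bs True) + 1) c) bs else \<zero>\<^bsub>V\<^esub>)"
  have r_hom: "r \<in> module_hom K ?C ?C"
  proof (rule module_homI)
    show "r c \<in> carrier ?C" if "c \<in> carrier ?C" for c
      using module_homD(1)[OF s(1) pr[OF that]] by (auto simp: r_def)
    show "r (c \<oplus>\<^bsub>?C\<^esub> c') = r c \<oplus>\<^bsub>?C\<^esub> r c'" if "c \<in> carrier ?C" "c' \<in> carrier ?C" for c c'
    proof -
      have "pr n (c \<oplus>\<^bsub>?C\<^esub> c') = pr n c \<oplus>\<^bsub>?V n\<^esub> pr n c'" for n by (auto simp: pr_def)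
      then show ?thesis
        using module_homD(2)[OF s(1) pr[OF that(1)] pr[OF that(2)]] by (intro ext) (simp add: r_def)
    qed
    show "r (k \<odot>\<^bsub>?C\<^esub> c) = k \<odot>\<^bsub>?C\<^esub> r c" if "k \<in> carrier K" "c \<in> carrier ?C" for k c
    proof -
      have "pr n (k \<odot>\<^bsub>?C\<^esub> c) = k \<odot>\<^bsub>?V n\<^esub> pr n c" for n using that(1) by (auto simp: pr_def)
      then show ?thesis
        using module_homD(3)[OF s(1) that(1) pr[OF that(2)]] that(1) by (intro ext) (simp add: r_def)
    qed
  qed
  have r_eq: "r c = s (n - 1) c" if c: "c \<in> koszul_chains L ?p n" for c n
  proof
    fix bs
    have cV: "c \<in> carrier (?V (n - 1 + 1))" using c unfolding carr by simp
    have sc: "s (n - 1) c \<in> carrier (?V (n - 1))" by (rule module_homD(1)[OF s(1) cV])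
    show "r c bs = s (n - 1) c bs"
    proof (cases "bs \<in> degree_index ?p (n - 1)")
      case True
      have "pr n c = c"
        using c unfolding carr[symmetric] by (auto simp: pr_def fun_eq_iff)
      then show ?thesis using True by (simp add: r_def degree_index_def)
    next
      case False
      have "r c bs = \<zero>\<^bsub>V\<^esub>"
      proof (cases "length bs = ?p")
        case True
        let ?m = "int (count_list bs True)"
        have "pr (?m + 1) c = \<zero>\<^bsub>?V (?m + 1)\<^esub>"
          using False True koszul_chainsD(2)[OF c] by (force simp: pr_def degree_index_def same_group(2))
        then show ?thesis using module_hom_zero[OF s(1)[of ?m] mV mV] True by (simp add: r_def)
      qed (simp add: r_def)
      then show ?thesis using sc False by simp
    qed
  qed
  show thesis
  proof (rule that[OF r_hom])
    fix c n assume c: "c \<in> koszul_chains L ?p n"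
    have "c \<in> carrier (?V (n - 1 + 1))" using c unfolding carr by simp
    then show "r c \<in> koszul_chains L ?p (n - 1)"
      using module_homD(1)[OF s(1)] r_eq[OF c] unfolding carr by metis
    show "?d (r (?d c)) = ?d c"
      using r_eq[OF L.koszul_diff_chains[OF xs c, of N]] s(2)[of c n] c unfolding carr by simp
  qed
qed

end

section \<open>The homotopy on pure tensors\<close>

lemma (in abelian_group) complement_sum:
  assumes "x \<in> carrier G" "a \<in> carrier G" "b \<in> carrier G"
  shows "((x \<ominus> a) \<ominus> b) \<oplus> (a \<oplus> b) = x"
proof -
  have "((x \<ominus> a) \<ominus> b) \<oplus> (a \<oplus> b) = x \<oplus> ((\<ominus> a \<oplus> a) \<oplus> (\<ominus> b \<oplus> b))"
    using assms by (simp add: a_minus_def a_ac)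
  then show ?thesis using assms by (simp add: l_neg)
qed

lemma (in abelian_group) minus_zero_right: "x \<in> carrier G \<Longrightarrow> x \<ominus> \<zero> = x"
  using minus_equality[of \<zero> \<zero>] by (simp add: a_minus_def)

text \<open>The homotopy is the sum of \<open>F1\<close>, which is \<open>e \<otimes> sD\<close>,
  and \<open>F2\<close>, which is \<open>sC \<otimes> p\<close>. Composing it with
  \<open>\<delta>\<close> on both sides and adding gives
  \<open>c \<otimes> (d - p d) + (c - q c) \<otimes> p d\<close>: the mixed terms \<open>u\<close>
  cancel because \<open>dC\<close> anticommutes with \<open>e\<close>, and the other mixed terms
  vanish because \<open>p\<close> takes values in cocycles and kills coboundaries. Adding
  \<open>q c \<otimes> p d\<close> returns \<open>c \<otimes> d\<close>.\<close>

lemma (in tensor_product) homotopy_generator: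
  assumes hom: "dC \<in> module_hom K C C" "e \<in> module_hom K C C" "sC \<in> module_hom K C C"
      "dD \<in> module_hom K D D" "sD \<in> module_hom K D D"
    and q: "\<And>c. q c = (c \<ominus>\<^bsub>C\<^esub> dC (sC c)) \<ominus>\<^bsub>C\<^esub> sC (dC c)"
    and p: "\<And>d. p d = (d \<ominus>\<^bsub>D\<^esub> dD (sD d)) \<ominus>\<^bsub>D\<^esub> sD (dD d)"
    and add: "additive_endo X \<delta>" "additive_endo X F1" "additive_endo X F2"
    and leibniz: "\<And>c d. c \<in> carrier C \<Longrightarrow> d \<in> carrier D \<Longrightarrow> \<delta> (t c d) = t (dC c) d \<oplus>\<^bsub>X\<^esub> t (e c) (dD d)"
    and F1: "\<And>c d. c \<in> carrier C \<Longrightarrow> d \<in> carrier D \<Longrightarrow> F1 (t c d) = t (e c) (sD d)"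
    and F2: "\<And>c d. c \<in> carrier C \<Longrightarrow> d \<in> carrier D \<Longrightarrow> F2 (t c d) = t (sC c) (p d)"
    and F3: "\<And>c d. c \<in> carrier C \<Longrightarrow> d \<in> carrier D \<Longrightarrow> F3 (t c d) = t (q c) (p d)"
    and cd: "c \<in> carrier C" "d \<in> carrier D"
    and sign: "e (e c) = c" "dC (e c) = \<ominus>\<^bsub>C\<^esub> e (dC c)"
    and pd: "dD (p d) = \<zero>\<^bsub>D\<^esub>" "p (dD d) = \<zero>\<^bsub>D\<^esub>"
  shows "(\<delta> (F1 (t c d) \<oplus>\<^bsub>X\<^esub> F2 (t c d)) \<oplus>\<^bsub>X\<^esub> (F1 (\<delta> (t c d)) \<oplus>\<^bsub>X\<^esub> F2 (\<delta> (t c d)))) \<oplus>\<^bsub>X\<^esub> F3 (t c d) = t c d"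
proof -
  note dC = module_homD(1)[OF hom(1)] and e = module_homD(1)[OF hom(2)] and sC = module_homD(1)[OF hom(3)]
    and dD = module_homD(1)[OF hom(4)] and sD = module_homD(1)[OF hom(5)]
  have pc: "p x \<in> carrier D" if "x \<in> carrier D" for x unfolding p using that dD sD by simp
  have qc: "q x \<in> carrier C" if "x \<in> carrier C" for x unfolding q using that dC sC by simp
  define u where "u = t (e (dC c)) (sD d)"
  define a where "a = t c (dD (sD d))"
  define b where "b = t (dC (sC c)) (p d)"
  define g where "g = t (sC (dC c)) (p d)"
  define h where "h = t c (sD (dD d))"
  define m where "m = t (q c) (p d)"
  have cl: "u \<in> carrier X" "a \<in> carrier X" "b \<in> carrier X" "g \<in> carrier X" "h \<in> carrier X" "m \<in> carrier X"
    unfolding u_def a_def b_def g_def h_def m_def using cd dC e sC dD sD pc qc by (auto intro!: closed)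
  have d1: "\<delta> (F1 (t c d)) = \<ominus>\<^bsub>X\<^esub> u \<oplus>\<^bsub>X\<^esub> a"
    unfolding F1[OF cd] leibniz[OF e[OF cd(1)] sD[OF cd(2)]] sign u_def a_def
    using minus_left[OF e[OF dC[OF cd(1)]] sD[OF cd(2)]] by simp
  have d2: "\<delta> (F2 (t c d)) = b"
    unfolding F2[OF cd] leibniz[OF sC[OF cd(1)] pc[OF cd(2)]] pd b_def
    using zero_right[OF e[OF sC[OF cd(1)]]] cl(3) unfolding b_def by simp
  have tX: "t (dC c) d \<in> carrier X" "t (e c) (dD d) \<in> carrier X" "F1 (t c d) \<in> carrier X" "F2 (t c d) \<in> carrier X"
    using closed cd dC e dD additive_endoD(1)[OF add(2) closed[OF cd]] additive_endoD(1)[OF add(3) closed[OF cd]]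
    by auto
  have d3: "F1 (\<delta> (t c d)) = u \<oplus>\<^bsub>X\<^esub> h"
    unfolding leibniz[OF cd] additive_endoD(2)[OF add(2) tX(1,2)] F1[OF dC[OF cd(1)] cd(2)]
      F1[OF e[OF cd(1)] dD[OF cd(2)]] sign u_def h_def by simp
  have d4: "F2 (\<delta> (t c d)) = g"
    unfolding leibniz[OF cd] additive_endoD(2)[OF add(3) tX(1,2)] F2[OF dC[OF cd(1)] cd(2)]
      F2[OF e[OF cd(1)] dD[OF cd(2)]] pd
    using zero_right[OF sC[OF e[OF cd(1)]]] cl(4) unfolding g_def by simp
  have left: "b \<oplus>\<^bsub>X\<^esub> g \<oplus>\<^bsub>X\<^esub> m = t c (p d)"
  proof -
    have "b \<oplus>\<^bsub>X\<^esub> g \<oplus>\<^bsub>X\<^esub> m = m \<oplus>\<^bsub>X\<^esub> (b \<oplus>\<^bsub>X\<^esub> g)" using cl by (simp add: X.a_ac)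
    also have "\<dots> = t (q c \<oplus>\<^bsub>C\<^esub> (dC (sC c) \<oplus>\<^bsub>C\<^esub> sC (dC c))) (p d)"
      unfolding b_def g_def m_def using cd dC sC pc qc by (simp add: add_left)
    also have "q c \<oplus>\<^bsub>C\<^esub> (dC (sC c) \<oplus>\<^bsub>C\<^esub> sC (dC c)) = c"
      unfolding q using cd dC sC by (intro C.M.complement_sum) auto
    finally show ?thesis .
  qed
  have right: "t c (p d) \<oplus>\<^bsub>X\<^esub> (a \<oplus>\<^bsub>X\<^esub> h) = t c d"
  proof -
    have "t c (p d) \<oplus>\<^bsub>X\<^esub> (a \<oplus>\<^bsub>X\<^esub> h) = t c (p d \<oplus>\<^bsub>D\<^esub> (dD (sD d) \<oplus>\<^bsub>D\<^esub> sD (dD d)))"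
      unfolding a_def h_def using cd dD sD pc by (simp add: add_right)
    also have "p d \<oplus>\<^bsub>D\<^esub> (dD (sD d) \<oplus>\<^bsub>D\<^esub> sD (dD d)) = d"
      unfolding p using cd dD sD by (intro D.M.complement_sum) auto
    finally show ?thesis .
  qed
  have "(\<delta> (F1 (t c d) \<oplus>\<^bsub>X\<^esub> F2 (t c d)) \<oplus>\<^bsub>X\<^esub> (F1 (\<delta> (t c d)) \<oplus>\<^bsub>X\<^esub> F2 (\<delta> (t c d)))) \<oplus>\<^bsub>X\<^esub> F3 (t c d) =
      (((\<ominus>\<^bsub>X\<^esub> u \<oplus>\<^bsub>X\<^esub> a) \<oplus>\<^bsub>X\<^esub> b) \<oplus>\<^bsub>X\<^esub> ((u \<oplus>\<^bsub>X\<^esub> h) \<oplus>\<^bsub>X\<^esub> g)) \<oplus>\<^bsub>X\<^esub> m"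
    unfolding additive_endoD(2)[OF add(1) tX(3,4)] d1 d2 d3 d4 F3[OF cd] m_def ..
  also have "\<dots> = (\<ominus>\<^bsub>X\<^esub> u \<oplus>\<^bsub>X\<^esub> u) \<oplus>\<^bsub>X\<^esub> ((b \<oplus>\<^bsub>X\<^esub> g \<oplus>\<^bsub>X\<^esub> m) \<oplus>\<^bsub>X\<^esub> (a \<oplus>\<^bsub>X\<^esub> h))"
    using cl by (simp add: X.a_ac)
  also have "\<dots> = t c d" unfolding left right using cl(1) cd closed by (simp add: X.l_neg)
  finally show ?thesis .
qed

section \<open>Classes that become zero in the colimit\<close>

context module begin

text \<open>The vanishing of one class in the colimit. Unlike \<open>cech_vanishes\<close> it
  concerns a single chain and can therefore be verified summand by summand.\<close>

definition eventually_exact :: "'a list \<Rightarrow> nat \<Rightarrow> int \<Rightarrow> (bool list \<Rightarrow> 'c) \<Rightarrow> bool"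
  where "eventually_exact xs N n c \<longleftrightarrow> (\<exists>m. \<exists>b\<in>koszul_chains M (length xs) (n - 1).
    koszul_shift R M m xs c = koszul_diff R M (m + N) xs b)"

lemma cech_vanishes_iff:
  "cech_vanishes R M xs n \<longleftrightarrow> (\<forall>N. \<forall>c\<in>koszul_chains M (length xs) n.
    koszul_diff R M N xs c = (\<lambda>_. \<zero>\<^bsub>M\<^esub>) \<longrightarrow> eventually_exact xs N n c)"
  by (simp add: cech_vanishes_def eventually_exact_def)

context
  fixes xs
  assumes xs: "set xs \<subseteq> carrier R"
begin

text \<open>Each class is shifted further by the exponent of the other, so that both bound after the
  same shift.\<close>

lemma eventually_exact_add:
  assumes c: "c \<in> carrier C" "eventually_exact xs N n c" and d: "d \<in> carrier C" "eventually_exact xs N n d"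
  shows "eventually_exact xs N n (c \<oplus>\<^bsub>C\<^esub> d)"
proof -
  obtain k a where a: "a \<in> koszul_chains M (length xs) (n - 1)"
    "koszul_shift R M k xs c = koszul_diff R M (k + N) xs a"
    using c(2) by (auto simp: eventually_exact_def)
  obtain l b where b: "b \<in> koszul_chains M (length xs) (n - 1)"
    "koszul_shift R M l xs d = koszul_diff R M (l + N) xs b"
    using d(2) by (auto simp: eventually_exact_def)
  have aC: "a \<in> carrier C" and bC: "b \<in> carrier C" using koszul_chains_carrier a(1) b(1) by blast+
  note sC = module_homD(1)[OF koszul_shift_hom[OF xs]]
  have "koszul_shift R M (l + k) xs c = koszul_diff R M (l + k + N) xs (koszul_shift R M l xs a)"
    using koszul_shift_shift[OF xs c(1), of l k] koszul_shift_diff[OF xs aC, of l "k + N"] a(2)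
    by (simp add: add.assoc)
  moreover have "koszul_shift R M (l + k) xs d = koszul_diff R M (l + k + N) xs (koszul_shift R M k xs b)"
    using koszul_shift_shift[OF xs d(1), of k l] koszul_shift_diff[OF xs bC, of k "l + N"] b(2)
    by (simp add: ac_simps)
  ultimately have "koszul_shift R M (l + k) xs (c \<oplus>\<^bsub>C\<^esub> d) =
      koszul_diff R M (l + k + N) xs (koszul_shift R M l xs a \<oplus>\<^bsub>C\<^esub> koszul_shift R M k xs b)"
    unfolding koszul_shift_linear(1)[OF xs c(1) d(1)] koszul_diff_linear(1)[OF xs sC[OF aC] sC[OF bC]] by simp
  moreover have "koszul_shift R M l xs a \<oplus>\<^bsub>C\<^esub> koszul_shift R M k xs b \<in> koszul_chains M (length xs) (n - 1)"
    by (intro koszul_chains_closed(5) koszul_shift_chains[OF xs] a(1) b(1))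
  ultimately show ?thesis unfolding eventually_exact_def by blast
qed

lemma eventually_exact_coboundary:
  assumes b: "b \<in> koszul_chains M (length xs) (n - 1)"
  shows "eventually_exact xs N n (koszul_diff R M N xs b)"
  using koszul_shift_diff[OF xs koszul_chains_carrier[OF b], of 0 N] koszul_shift_0[OF xs b] b
  unfolding eventually_exact_def by (metis add_0)

lemma eventually_exact_zero: "eventually_exact xs N n (\<lambda>_. \<zero>\<^bsub>M\<^esub>)"
  using eventually_exact_coboundary[OF koszul_chains_zero, where n = n and N = N] koszul_diff_linear(4)[OF xs] by simp

text \<open>A transition map does not change the class in the colimit. This moves nonzero classes of
  two complexes to a common exponent without losing them.\<close>

lemma eventually_exact_shift:
  assumes c: "c \<in> carrier C" and e: "eventually_exact xs (m + N) n (koszul_shift R M m xs c)"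
  shows "eventually_exact xs N n c"
proof -
  obtain k a where "a \<in> koszul_chains M (length xs) (n - 1)"
    "koszul_shift R M k xs (koszul_shift R M m xs c) = koszul_diff R M (k + (m + N)) xs a"
    using e by (auto simp: eventually_exact_def)
  then show ?thesis
    using koszul_shift_shift[OF xs c, of k m] unfolding eventually_exact_def
    by (intro exI[of _ "k + m"] bexI[of _ a]) (simp_all add: add.assoc)
qed

end

text \<open>Makes the results on chains of fixed length available for \<open>T\<close> over
  \<open>R\<close>, with \<open>R\<close> in both roles.\<close>

lemma self_compatible: "compatible_module R M R M"
  by (intro compatible_module.intro compatible_module_axioms.intro module_axioms module_hom_smult refl)

end

section \<open>The Koszul complex on a tensor product of modules\<close>

locale koszul_tensor = L: compatible_module A L K V + N: compatible_module B N K W + T: module R T +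
    VW: tensor_product K V W T t
  for A :: "('a, 'x1) ring_scheme" and L :: "('a, 'l, 'x2) module_scheme"
    and B :: "('b, 'x3) ring_scheme" and N :: "('b, 'n, 'x4) module_scheme"
    and K :: "('k, 'x5) ring_scheme" and V :: "('k, 'l, 'x6) module_scheme"
    and W :: "('k, 'n, 'x7) module_scheme"
    and R :: "('r, 'x8) ring_scheme" and T :: "('r, 't, 'x9) module_scheme" and t
begin

text \<open>\<open>x'\<close> stands for \<open>x \<otimes> 1\<close>. Only its effect on pure
  tensors is recorded, which keeps the argument independent of how \<open>R\<close> is
  built.\<close>

definition acts_left :: "'a \<Rightarrow> 'r \<Rightarrow> bool"
  where "acts_left x x' \<longleftrightarrow> x \<in> carrier A \<and> x' \<in> carrier R \<and>
    (\<forall>l\<in>carrier L. \<forall>n\<in>carrier N. x' \<odot>\<^bsub>T\<^esub> t l n = t (x \<odot>\<^bsub>L\<^esub> l) n)"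

definition acts_right :: "'b \<Rightarrow> 'r \<Rightarrow> bool"
  where "acts_right y y' \<longleftrightarrow> y \<in> carrier B \<and> y' \<in> carrier R \<and>
    (\<forall>l\<in>carrier L. \<forall>n\<in>carrier N. y' \<odot>\<^bsub>T\<^esub> t l n = t l (y \<odot>\<^bsub>N\<^esub> n))"

lemma acts_left_set:
  assumes "list_all2 acts_left xs xs'"
  shows "set xs \<subseteq> carrier A" "set xs' \<subseteq> carrier R"
  using assms by (induction rule: list_all2_induct) (auto simp: acts_left_def)

lemma acts_right_set:
  assumes "list_all2 acts_right ys ys'"
  shows "set ys \<subseteq> carrier B" "set ys' \<subseteq> carrier R"
  using assms by (induction rule: list_all2_induct) (auto simp: acts_right_def)

lemma t_closed: "l \<in> carrier L \<Longrightarrow> n \<in> carrier N \<Longrightarrow> t l n \<in> carrier T"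
  using VW.closed by (simp add: L.same_group N.same_group)

lemma t_diff_left:
  assumes "l \<in> carrier L" "l' \<in> carrier L" "n \<in> carrier N"
  shows "t (l \<ominus>\<^bsub>L\<^esub> l') n = t l n \<oplus>\<^bsub>T\<^esub> \<ominus>\<^bsub>T\<^esub> t l' n"
  using VW.add_left[of l "\<ominus>\<^bsub>V\<^esub> l'" n] VW.minus_left[of l' n] assms
  by (simp add: a_minus_def L.same_group N.same_group L.minus_same)

lemma t_diff_right:
  assumes "l \<in> carrier L" "n \<in> carrier N" "n' \<in> carrier N"
  shows "t l (n \<ominus>\<^bsub>N\<^esub> n') = t l n \<oplus>\<^bsub>T\<^esub> \<ominus>\<^bsub>T\<^esub> t l n'"
  using VW.add_right[of l n "\<ominus>\<^bsub>W\<^esub> n'"] VW.minus_right[of l n'] assms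
  by (simp add: a_minus_def L.same_group N.same_group N.minus_same)

lemma t_minus_left: "l \<in> carrier L \<Longrightarrow> n \<in> carrier N \<Longrightarrow> t (\<ominus>\<^bsub>L\<^esub> l) n = \<ominus>\<^bsub>T\<^esub> t l n"
  using VW.minus_left by (simp add: L.same_group N.same_group L.minus_same)

lemma t_zero: "n \<in> carrier N \<Longrightarrow> t \<zero>\<^bsub>L\<^esub> n = \<zero>\<^bsub>T\<^esub>" "l \<in> carrier L \<Longrightarrow> t l \<zero>\<^bsub>N\<^esub> = \<zero>\<^bsub>T\<^esub>"
  using VW.zero_left VW.zero_right by (simp_all add: L.same_group N.same_group)

lemma acts_left_power:
  assumes x: "acts_left x x'" and "l \<in> carrier L" "n \<in> carrier N"
  shows "(x' [^]\<^bsub>R\<^esub> (k::nat)) \<odot>\<^bsub>T\<^esub> t l n = t ((x [^]\<^bsub>A\<^esub> k) \<odot>\<^bsub>L\<^esub> l) n"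
  using assms(2)
proof (induction k arbitrary: l)
  case (Suc k)
  have xx: "x \<in> carrier A" "x' \<in> carrier R" using x by (auto simp: acts_left_def)
  then show ?case
    using Suc.IH[of "x \<odot>\<^bsub>L\<^esub> l"] x Suc.prems assms(3) t_closed
    by (simp add: T.smult_assoc1 L.L.smult_assoc1 acts_left_def)
qed (use assms t_closed in simp)

lemma acts_right_power:
  assumes y: "acts_right y y'" and "l \<in> carrier L" "n \<in> carrier N"
  shows "(y' [^]\<^bsub>R\<^esub> (k::nat)) \<odot>\<^bsub>T\<^esub> t l n = t l ((y [^]\<^bsub>B\<^esub> k) \<odot>\<^bsub>N\<^esub> n)"
  using assms(3)
proof (induction k arbitrary: n)
  case (Suc k)
  have "y \<in> carrier B" "y' \<in> carrier R" using y by (auto simp: acts_right_def)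
  then show ?case
    using Suc.IH[of "y \<odot>\<^bsub>N\<^esub> n"] y Suc.prems assms(2) t_closed
    by (simp add: T.smult_assoc1 N.L.smult_assoc1 acts_right_def)
qed (use assms t_closed in simp)

lemma koszul_diff_tensor_right:
  assumes ys: "list_all2 acts_right ys ys'" and l: "l \<in> carrier L" and d: "\<And>bs. d bs \<in> carrier N"
  shows "koszul_diff R T k ys' (\<lambda>bs. t l (d bs)) = (\<lambda>bs. t l (koszul_diff B N k ys d bs))"
  using ys d
proof (induction arbitrary: d rule: list_all2_induct)
  case (Cons y ys y' ys')
  have ysB: "set ys \<subseteq> carrier B"
    using acts_right_set(1)[OF Cons(2)] .
  have cl: "koszul_diff B N k ys (\<lambda>t. d (b # t)) s \<in> carrier N" for b s
    using Cons.prems by (intro N.L.koszul_diff_closed[OF ysB]) auto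
  have yB: "y [^]\<^bsub>B\<^esub> k \<in> carrier B" using Cons(1) by (auto simp: acts_right_def)
  show ?case
    using Cons.prems l cl yB
    by (intro glue_eqI) (simp_all add: Cons.IH t_zero acts_right_power[OF Cons(1)] t_diff_right a_minus_def[of T])
qed (use l t_zero in simp)

lemma koszul_shift_tensor_right:
  assumes ys: "list_all2 acts_right ys ys'" and l: "l \<in> carrier L" and d: "\<And>bs. d bs \<in> carrier N"
  shows "koszul_shift R T k ys' (\<lambda>bs. t l (d bs)) = (\<lambda>bs. t l (koszul_shift B N k ys d bs))"
  using ys d
proof (induction arbitrary: d rule: list_all2_induct)
  case (Cons y ys y' ys')
  have ysB: "set ys \<subseteq> carrier B"
    using acts_right_set(1)[OF Cons(2)] .
  have cl: "koszul_shift B N k ys (\<lambda>t. d (b # t)) s \<in> carrier N" for b s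
    using Cons.prems by (intro N.L.koszul_shift_closed[OF ysB]) auto
  show ?case
    using Cons.prems l cl
    by (intro glue_eqI) (simp_all add: Cons.IH t_zero acts_right_power[OF Cons(1)])
qed simp

text \<open>The Leibniz rule, by induction along the cones of the first factor. Passing to the
  second component of a cone reverses \<open>alternate_sign\<close>, which matches the minus sign in
  the differential. The support condition on \<open>c\<close> removes the term with the sign at the
  empty index, where the left side is zero by \<open>glue\<close>.\<close>

lemma koszul_diff_tensor:
  assumes xs: "list_all2 acts_left xs xs'" and ys: "list_all2 acts_right ys ys'"
    and c: "\<And>bs. c bs \<in> carrier L" "\<And>bs. length bs \<noteq> length xs \<Longrightarrow> c bs = \<zero>\<^bsub>L\<^esub>"
    and d: "\<And>bs. d bs \<in> carrier N"
  shows "koszul_diff R T k (xs' @ ys') (\<lambda>bs. t (c (take (length xs) bs)) (d (drop (length xs) bs))) bs =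
    t (koszul_diff A L k xs c (take (length xs) bs)) (d (drop (length xs) bs)) \<oplus>\<^bsub>T\<^esub>
    t (alternate_sign L c (take (length xs) bs)) (koszul_diff B N k ys d (drop (length xs) bs))"
  using xs c
proof (induction arbitrary: c bs rule: list_all2_induct)
  case Nil
  have ysB: "set ys \<subseteq> carrier B" using acts_right_set(1)[OF ys] .
  show ?case
    using koszul_diff_tensor_right[OF ys Nil(1) d] Nil(1)[of "[]"] d t_zero N.L.koszul_diff_closed[OF ysB d] t_closed
    by (simp add: alternate_sign_def)
next
  case (Cons x xs x' xs')
  have xsA: "set xs \<subseteq> carrier A" using acts_left_set(1)[OF Cons(2)] .
  have ysB: "set ys \<subseteq> carrier B" using acts_right_set(1)[OF ys] .
  let ?p = "length xs"
  have cl: "koszul_diff A L k xs (\<lambda>s. c (b # s)) s \<in> carrier L" for b s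
    using Cons.prems by (intro L.L.koszul_diff_closed[OF xsA]) auto
  have dd: "koszul_diff B N k ys d s \<in> carrier N" for s by (rule N.L.koszul_diff_closed[OF ysB d])
  have xA: "x [^]\<^bsub>A\<^esub> k \<in> carrier A" using Cons(1) by (auto simp: acts_left_def)
  have IH: "koszul_diff R T k (xs' @ ys') (\<lambda>s. t (c (b # take ?p s)) (d (drop ?p s))) s =
    t (koszul_diff A L k xs (\<lambda>s. c (b # s)) (take ?p s)) (d (drop ?p s)) \<oplus>\<^bsub>T\<^esub>
    t (alternate_sign L (\<lambda>s. c (b # s)) (take ?p s)) (koszul_diff B N k ys d (drop ?p s))" for b s
    by (rule Cons.IH) (use Cons.prems in auto)
  have sgn: "alternate_sign L (\<lambda>s. c (b # s)) s \<in> carrier L" for b s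
    using Cons.prems(1) by (simp add: alternate_sign_def)
  have sT: "alternate_sign L c (True # s) = \<ominus>\<^bsub>L\<^esub> alternate_sign L (\<lambda>s. c (True # s)) s" for s
    using Cons.prems(1) by (simp add: alternate_sign_def)
  have sF: "alternate_sign L c (False # s) = alternate_sign L (\<lambda>s. c (False # s)) s" for s
    by (simp add: alternate_sign_def)
  show ?case
  proof (cases bs)
    case Nil
    have "alternate_sign L c [] = \<zero>\<^bsub>L\<^esub>" using Cons.prems(2)[of "[]"] by (simp add: alternate_sign_def)
    then show ?thesis using Nil t_zero d dd by simp
  next
    case (Cons b s)
    show ?thesis
    proof (cases b)
      case False
      then show ?thesis using Cons IH[of False] sF by simp
    next
      case True
      let ?d = "d (drop ?p s)"
      have "koszul_diff R T k ((x' # xs') @ ys')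
          (\<lambda>bs. t (c (take (length (x # xs)) bs)) (d (drop (length (x # xs)) bs))) bs =
        t ((x [^]\<^bsub>A\<^esub> k) \<odot>\<^bsub>L\<^esub> c (False # take ?p s)) ?d \<ominus>\<^bsub>T\<^esub>
          (t (koszul_diff A L k xs (\<lambda>s. c (True # s)) (take ?p s)) ?d \<oplus>\<^bsub>T\<^esub>
          t (alternate_sign L (\<lambda>s. c (True # s)) (take ?p s)) (koszul_diff B N k ys d (drop ?p s)))"
        using Cons True IH[of True s] acts_left_power[OF \<open>acts_left x x'\<close> Cons.prems(1) d] by simp
      also have "\<dots> = t (koszul_diff A L k (x # xs) c (take (length (x # xs)) bs)) ?d \<oplus>\<^bsub>T\<^esub>
          t (alternate_sign L c (take (length (x # xs)) bs)) (koszul_diff B N k ys d (drop ?p s))"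
        using Cons True cl sgn d dd xA Cons.prems(1) t_closed
        by (simp add: sT t_diff_left t_minus_left a_minus_def[of T] T.M.minus_add T.M.a_ac)
      finally show ?thesis using Cons True by simp
    qed
  qed
qed

lemma koszul_shift_tensor:
  assumes xs: "list_all2 acts_left xs xs'" and ys: "list_all2 acts_right ys ys'"
    and c: "\<And>bs. c bs \<in> carrier L" and d: "\<And>bs. d bs \<in> carrier N"
  shows "koszul_shift R T k (xs' @ ys') (\<lambda>bs. t (c (take (length xs) bs)) (d (drop (length xs) bs))) bs =
    t (koszul_shift A L k xs c (take (length xs) bs)) (koszul_shift B N k ys d (drop (length xs) bs))"
  using xs c
proof (induction arbitrary: c bs rule: list_all2_induct)
  case Nil
  show ?case using koszul_shift_tensor_right[OF ys Nil(1) d] by simp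
next
  case (Cons x xs x' xs')
  have xsA: "set xs \<subseteq> carrier A" using acts_left_set(1)[OF Cons(2)] .
  have ysB: "set ys \<subseteq> carrier B" using acts_right_set(1)[OF ys] .
  let ?p = "length xs"
  have cl: "koszul_shift A L k xs (\<lambda>s. c (b # s)) s \<in> carrier L" for b s
    using Cons.prems by (intro L.L.koszul_shift_closed[OF xsA]) auto
  have dd: "koszul_shift B N k ys d s \<in> carrier N" for s by (rule N.L.koszul_shift_closed[OF ysB d])
  have IH: "koszul_shift R T k (xs' @ ys') (\<lambda>s. t (c (b # take ?p s)) (d (drop ?p s))) s =
    t (koszul_shift A L k xs (\<lambda>s. c (b # s)) (take ?p s)) (koszul_shift B N k ys d (drop ?p s))" for b s
    by (rule Cons.IH) (use Cons.prems in auto)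
  show ?case
  proof (cases bs)
    case Nil
    then show ?thesis using t_zero dd by simp
  next
    case (Cons b s)
    then show ?thesis
      using IH[of b s] acts_left_power[OF \<open>acts_left x x'\<close> cl dd] by (cases b) auto
  qed
qed

end

section \<open>Cohomology of a tensor product of Koszul complexes\<close>

context koszul_tensor begin

context
  fixes xs xs' ys ys'
  assumes field: "field K" and xs: "list_all2 acts_left xs xs'" and ys: "list_all2 acts_right ys ys'"
begin

abbreviation "p \<equiv> length xs"
abbreviation "q \<equiv> length ys"
abbreviation "CL \<equiv> chains V {bs :: bool list. length bs = p}"
abbreviation "CN \<equiv> chains W {bs :: bool list. length bs = q}"
abbreviation "CT \<equiv> chains T {bs :: bool list. length bs = p + q}"
abbreviation "dL \<equiv> \<lambda>k. koszul_diff A L k xs"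
abbreviation "dN \<equiv> \<lambda>k. koszul_diff B N k ys"
abbreviation "dT \<equiv> \<lambda>k. koszul_diff R T k (xs' @ ys')"
abbreviation "KT \<equiv> koszul_chains T (p + q)"

definition tens :: "(bool list \<Rightarrow> 'l) \<Rightarrow> (bool list \<Rightarrow> 'n) \<Rightarrow> bool list \<Rightarrow> 't"
  where "tens c d = (\<lambda>bs. t (c (take p bs)) (d (drop p bs)))"

lemma length_T: "length (xs' @ ys') = p + q"
  using list_all2_lengthD[OF xs] list_all2_lengthD[OF ys] by simp

lemma set_T: "set (xs' @ ys') \<subseteq> carrier R"
  using acts_left_set(2)[OF xs] acts_right_set(2)[OF ys] by simp

lemma chain_pairing_T:
  "chain_pairing K V W R T t {bs :: bool list. length bs = p} {bs. length bs = q}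
    {bs :: bool list. length bs = p + q} (take p) (drop p)"
proof (intro chain_pairing.intro chain_pairing_axioms.intro)
  show "tensor_product K V W T t" by (rule VW.tensor_product_axioms)
  show "module R T" by (rule T.module_axioms)
  have fin: "finite {bs :: bool list. length bs = n}" for n
    using finite_lists_length_eq[of "UNIV :: bool set" n] by simp
  show "finite {bs :: bool list. length bs = p}" "finite {bs :: bool list. length bs = q}"
    "finite {bs :: bool list. length bs = p + q}" by (rule fin)+
  show "\<exists>!k. k \<in> {bs. length bs = p + q} \<and> take p k = i \<and> drop p k = j"
    if "i \<in> {bs. length bs = p}" "j \<in> {bs. length bs = q}" for i j :: "bool list"
  proof (rule ex1I[of _ "i @ j"])
    show "k = i @ j" if "k \<in> {bs. length bs = p + q} \<and> take p k = i \<and> drop p k = j" for k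
      using that append_take_drop_id[of p k] by simp
  qed (use that in auto)
qed auto

interpretation CP: chain_pairing K V W R T t "{bs :: bool list. length bs = p}" "{bs :: bool list. length bs = q}"
    "{bs :: bool list. length bs = p + q}" "take p" "drop p"
  by (rule chain_pairing_T)

lemma tens_eq: "CP.tensor_chain = tens"
  by (simp add: CP.tensor_chain_def tens_def fun_eq_iff)

interpretation TT: tensor_product K CL CN CT tens
  using CP.tensor_product_chains unfolding tens_eq .

lemma KT_eq: "KT n = carrier (chains T (degree_index (p + q) n))"
  by (rule koszul_chains_eq_carrier) auto

lemma KT_CT: "z \<in> KT n \<Longrightarrow> z \<in> carrier CT"
  by (auto simp: koszul_chains_def)

lemma count_take_drop:
  "count_list bs True = count_list (take p bs) True + count_list (drop p bs) True"
  unfolding count_list_append[symmetric] append_take_drop_id ..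

lemma tens_degree:
  assumes c: "c \<in> koszul_chains L p i" and d: "d \<in> koszul_chains N q j"
  shows "tens c d \<in> KT (i + j)"
  unfolding koszul_chains_def
proof (intro CollectI conjI allI impI)
  fix bs
  show "tens c d bs \<in> carrier T"
    unfolding tens_def by (rule t_closed[OF koszul_chainsD(1)[OF c] koszul_chainsD(1)[OF d]])
  assume nz: "tens c d bs \<noteq> \<zero>\<^bsub>T\<^esub>"
  have "c (take p bs) \<noteq> \<zero>\<^bsub>L\<^esub>" "d (drop p bs) \<noteq> \<zero>\<^bsub>N\<^esub>"
    using nz t_zero(1)[OF koszul_chainsD(1)[OF d]] t_zero(2)[OF koszul_chainsD(1)[OF c]]
    by (auto simp: tens_def)
  then have "length (take p bs) = p" "int (count_list (take p bs) True) = i"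
    "length (drop p bs) = q" "int (count_list (drop p bs) True) = j"
    using koszul_chainsD(2)[OF c, of "take p bs"] koszul_chainsD(2)[OF d, of "drop p bs"] by blast+
  then show "length bs = p + q" "int (count_list bs True) = i + j"
    unfolding count_take_drop[of bs] by (simp_all add: min_def split: if_splits)
qed

text \<open>An index of total degree \<open>n\<close> splits into two lists whose degrees sum to
  \<open>n\<close>, so homogeneous pure tensors generate. Homogeneity matters because the properties
  of signs and pseudo-inverses are stated degree by degree.\<close>

lemma spanning_degree:
  assumes z: "\<zero>\<^bsub>CT\<^esub> \<in> H"
    and gen: "\<And>i j c d. i + j = n \<Longrightarrow> c \<in> koszul_chains L p i \<Longrightarrow> d \<in> koszul_chains N q j \<Longrightarrow> tens c d \<in> H"
    and add: "\<And>x y. x \<in> KT n \<Longrightarrow> y \<in> KT n \<Longrightarrow> x \<in> H \<Longrightarrow> y \<in> H \<Longrightarrow> x \<oplus>\<^bsub>CT\<^esub> y \<in> H"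
  shows "KT n \<subseteq> H"
  unfolding KT_eq
proof (rule CP.spanning_chains)
  show "degree_index (p + q) n \<subseteq> {bs. length bs = p + q}" by (auto simp: degree_index_def)
  show "\<zero>\<^bsub>CT\<^esub> \<in> H" by (rule z)
  show "x \<oplus>\<^bsub>CT\<^esub> y \<in> H" if "x \<in> carrier (chains T (degree_index (p + q) n))"
    "y \<in> carrier (chains T (degree_index (p + q) n))" "x \<in> H" "y \<in> H" for x y
    using add that unfolding KT_eq by blast
  fix k x y assume k: "k \<in> degree_index (p + q) n" and xy: "x \<in> carrier V" "y \<in> carrier W"
  let ?i = "int (count_list (take p k) True)" and ?j = "int (count_list (drop p k) True)"
  have "?i + ?j = n"
    using k count_take_drop[of k] by (simp add: degree_index_def)
  moreover have "single_chain V (take p k) x \<in> koszul_chains L p ?i"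
    using xy k by (auto simp: single_chain_def koszul_chains_def degree_index_def L.same_group)
  moreover have "single_chain W (drop p k) y \<in> koszul_chains N q ?j"
    using xy k by (auto simp: single_chain_def koszul_chains_def degree_index_def N.same_group)
  ultimately show "CP.tensor_chain (single_chain V (take p k) x) (single_chain W (drop p k) y) \<in> H"
    unfolding tens_eq by (rule gen)
qed

lemma dT_leibniz:
  assumes c: "c \<in> carrier CL" and d: "d \<in> carrier CN"
  shows "dT k (tens c d) = tens (dL k c) d \<oplus>\<^bsub>CT\<^esub> tens (alternate_sign L c) (dN k d)"
proof
  fix bs
  show "dT k (tens c d) bs = (tens (dL k c) d \<oplus>\<^bsub>CT\<^esub> tens (alternate_sign L c) (dN k d)) bs"
    using koszul_diff_tensor[OF xs ys, of c d k bs] c d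
    by (simp add: tens_def L.same_group N.same_group)
qed

lemma shift_tens:
  assumes c: "c \<in> carrier CL" and d: "d \<in> carrier CN"
  shows "koszul_shift R T k (xs' @ ys') (tens c d) = tens (koszul_shift A L k xs c) (koszul_shift B N k ys d)"
proof
  fix bs
  show "koszul_shift R T k (xs' @ ys') (tens c d) bs =
      tens (koszul_shift A L k xs c) (koszul_shift B N k ys d) bs"
    using koszul_shift_tensor[OF xs ys, of c d k bs] c d
    by (simp add: tens_def L.same_group N.same_group)
qed

lemma dT_endo: "additive_endo CT (dT k)"
  using compatible_module.koszul_diff_K_hom[OF T.self_compatible set_T, of k]
  unfolding length_T by (auto simp: additive_endo_def module_hom_def)

lemma dT_degree: "z \<in> KT n \<Longrightarrow> dT k z \<in> KT (n + 1)"
  using T.koszul_diff_chains[OF set_T, of z n k] unfolding length_T .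

text \<open>From \<open>d d = 0\<close> and \<open>d s d = d\<close> alone,
  \<open>1 - d s - s d\<close> takes values in cocycles, kills coboundaries and changes a cocycle
  only by a coboundary, so it records cohomology classes faithfully. The factor is left arbitrary so
  that the result serves both of them.\<close>

lemma projection_properties:
  assumes M: "compatible_module A' M K U" and zs: "set zs \<subseteq> carrier A'"
    and s: "s \<in> module_hom K (chains U {bs. length bs = length zs}) (chains U {bs. length bs = length zs})"
      "\<forall>n. \<forall>c\<in>koszul_chains M (length zs) n. s c \<in> koszul_chains M (length zs) (n - 1)"
      "\<forall>n. \<forall>c\<in>koszul_chains M (length zs) n.
        koszul_diff A' M k zs (s (koszul_diff A' M k zs c)) = koszul_diff A' M k zs c"
  defines "C \<equiv> chains U {bs. length bs = length zs}" and "d \<equiv> koszul_diff A' M k zs"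
  assumes r_def: "\<And>c. r c = (c \<ominus>\<^bsub>C\<^esub> d (s c)) \<ominus>\<^bsub>C\<^esub> s (d c)"
  shows "r \<in> module_hom K C C"
    and "\<And>c n. c \<in> koszul_chains M (length zs) n \<Longrightarrow> r c \<in> koszul_chains M (length zs) n"
    and "\<And>c n. c \<in> koszul_chains M (length zs) n \<Longrightarrow> d (r c) = \<zero>\<^bsub>C\<^esub>"
    and "\<And>c n. c \<in> koszul_chains M (length zs) n \<Longrightarrow> r (d c) = \<zero>\<^bsub>C\<^esub>"
    and "\<And>c n. c \<in> koszul_chains M (length zs) n \<Longrightarrow> d c = \<zero>\<^bsub>C\<^esub> \<Longrightarrow> r c = \<zero>\<^bsub>C\<^esub> \<Longrightarrow> c = d (s c)"
proof -
  interpret M: compatible_module A' M K U by fact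
  interpret C: module K C unfolding C_def by (rule M.V.chains_module)
  have d: "d \<in> module_hom K C C" unfolding d_def C_def by (rule M.koszul_diff_K_hom[OF zs])
  have s': "s \<in> module_hom K C C" using s(1) unfolding C_def .
  note dC = module_homD(1)[OF d] and sC = module_homD(1)[OF s']
  note s = s(1) s(2,3)[rule_format]
  note mC = C.module_axioms
  show "r \<in> module_hom K C C"
    unfolding r_def[abs_def]
    by (intro module_hom_sub module_hom_id module_hom_comp[OF s' d] module_hom_comp[OF d s'] mC)
  have KC: "c \<in> carrier C" if "c \<in> koszul_chains M (length zs) n" for c n
    unfolding C_def by (rule M.koszul_chains_length[OF that])
  have dK: "d c \<in> koszul_chains M (length zs) (n + 1)" if "c \<in> koszul_chains M (length zs) n" for c n
    unfolding d_def by (rule M.L.koszul_diff_chains[OF zs that])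
  have dd: "d (d c) = \<zero>\<^bsub>C\<^esub>" if "c \<in> koszul_chains M (length zs) n" for c n
    unfolding d_def C_def
    using M.L.koszul_diff_square[OF zs M.L.koszul_chains_carrier[OF that]] by (simp add: M.same_group)
  have diffK: "a \<ominus>\<^bsub>C\<^esub> b \<in> koszul_chains M (length zs) n"
    if "a \<in> koszul_chains M (length zs) n" "b \<in> koszul_chains M (length zs) n" for a b n
    using M.V.koszul_chains_closed(5)[of a "length zs" n "\<ominus>\<^bsub>C\<^esub> b"] M.koszul_chains_uminus[OF that(2)] that(1)
    unfolding M.koszul_chains_same C_def a_minus_def by simp
  fix c n assume c: "c \<in> koszul_chains M (length zs) n"
  have dsK: "d (s c) \<in> koszul_chains M (length zs) n" and sdK: "s (d c) \<in> koszul_chains M (length zs) n"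
    using dK[OF s(2)[OF c]] s(2)[OF dK[OF c]] by simp_all
  show "r c \<in> koszul_chains M (length zs) n"
    unfolding r_def by (intro diffK c dsK sdK)
  have "d (r c) = (d c \<ominus>\<^bsub>C\<^esub> d (d (s c))) \<ominus>\<^bsub>C\<^esub> d (s (d c))"
    unfolding r_def
    using module_hom_diff[OF d mC mC] KC[OF c] KC[OF dsK] KC[OF sdK] C.M.minus_closed by simp
  also have "\<dots> = \<zero>\<^bsub>C\<^esub>"
    using dd[OF s(2)[OF c]] s(3)[OF c] dC[OF KC[OF c]] C.M.minus_zero_right C.M.minus_eq_zero_iff
    by (simp add: d_def)
  finally show "d (r c) = \<zero>\<^bsub>C\<^esub>" .
  have "r (d c) = (d c \<ominus>\<^bsub>C\<^esub> d (s (d c))) \<ominus>\<^bsub>C\<^esub> s \<zero>\<^bsub>C\<^esub>" unfolding r_def dd[OF c] ..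
  also have "\<dots> = \<zero>\<^bsub>C\<^esub>"
    using s(3)[OF c] dC[OF KC[OF c]] C.M.minus_zero_right C.M.minus_eq_zero_iff module_hom_zero[OF s' mC mC]
    by (simp add: d_def)
  finally show "r (d c) = \<zero>\<^bsub>C\<^esub>" .
  assume "d c = \<zero>\<^bsub>C\<^esub>" "r c = \<zero>\<^bsub>C\<^esub>"
  then have "(c \<ominus>\<^bsub>C\<^esub> d (s c)) \<ominus>\<^bsub>C\<^esub> \<zero>\<^bsub>C\<^esub> = \<zero>\<^bsub>C\<^esub>"
    using module_hom_zero[OF s' mC mC] by (simp add: r_def)
  then show "c = d (s c)"
    using KC[OF c] KC[OF dsK] C.M.minus_zero_right C.M.minus_eq_zero_iff C.M.minus_closed by simp
qed

lemma xsA: "set xs \<subseteq> carrier A" and ysB: "set ys \<subseteq> carrier B"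
  by (rule acts_left_set(1)[OF xs], rule acts_right_set(1)[OF ys])

text \<open>The chain homotopy between the identity and the projection \<open>F3\<close> onto the tensor product of
  representatives of the cohomology.\<close>

lemma kunneth_homotopy:
  obtains r r' F3 H where
    "additive_endo CT F3" "additive_endo CT H"
    "\<And>n z. z \<in> KT n \<Longrightarrow> H z \<in> KT (n - 1)"
    "\<And>n z. z \<in> KT n \<Longrightarrow> (dT k (H z) \<oplus>\<^bsub>CT\<^esub> H (dT k z)) \<oplus>\<^bsub>CT\<^esub> F3 z = z"
    "\<And>n z. z \<in> KT n \<Longrightarrow> F3 (dT k z) = \<zero>\<^bsub>CT\<^esub>"
    "\<And>c d. c \<in> carrier CL \<Longrightarrow> d \<in> carrier CN \<Longrightarrow> F3 (tens c d) = tens (r c) (r' d)"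
    "\<And>c n. c \<in> koszul_chains L p n \<Longrightarrow> r c \<in> koszul_chains L p n \<and> dL k (r c) = (\<lambda>_. \<zero>\<^bsub>L\<^esub>)"
    "\<And>d n. d \<in> koszul_chains N q n \<Longrightarrow> r' d \<in> koszul_chains N q n \<and> dN k (r' d) = (\<lambda>_. \<zero>\<^bsub>N\<^esub>)"
    "\<And>c n. c \<in> koszul_chains L p n \<Longrightarrow> dL k c = (\<lambda>_. \<zero>\<^bsub>L\<^esub>) \<Longrightarrow> r c = (\<lambda>_. \<zero>\<^bsub>L\<^esub>) \<Longrightarrow>
      \<exists>b\<in>koszul_chains L p (n - 1). c = dL k b"
    "\<And>d n. d \<in> koszul_chains N q n \<Longrightarrow> dN k d = (\<lambda>_. \<zero>\<^bsub>N\<^esub>) \<Longrightarrow> r' d = (\<lambda>_. \<zero>\<^bsub>N\<^esub>) \<Longrightarrow>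
      \<exists>b\<in>koszul_chains N q (n - 1). d = dN k b"
proof -
  obtain s where s: "s \<in> module_hom K CL CL"
    "\<And>c n. c \<in> koszul_chains L p n \<Longrightarrow> s c \<in> koszul_chains L p (n - 1)"
    "\<And>c n. c \<in> koszul_chains L p n \<Longrightarrow> dL k (s (dL k c)) = dL k c"
    by (rule L.koszul_pseudo_inverse[OF field xsA, of k]) (rule that)
  obtain s' where s': "s' \<in> module_hom K CN CN"
    "\<And>c n. c \<in> koszul_chains N q n \<Longrightarrow> s' c \<in> koszul_chains N q (n - 1)"
    "\<And>c n. c \<in> koszul_chains N q n \<Longrightarrow> dN k (s' (dN k c)) = dN k c"
    by (rule N.koszul_pseudo_inverse[OF field ysB, of k]) (rule that)
  define r where "r = (\<lambda>c. (c \<ominus>\<^bsub>CL\<^esub> dL k (s c)) \<ominus>\<^bsub>CL\<^esub> s (dL k c))"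
  define r' where "r' = (\<lambda>c. (c \<ominus>\<^bsub>CN\<^esub> dN k (s' c)) \<ominus>\<^bsub>CN\<^esub> s' (dN k c))"
  have sb: "\<forall>n. \<forall>c\<in>koszul_chains L p n. s c \<in> koszul_chains L p (n - 1)"
    "\<forall>n. \<forall>c\<in>koszul_chains L p n. dL k (s (dL k c)) = dL k c" using s(2,3) by blast+
  have sb': "\<forall>n. \<forall>c\<in>koszul_chains N q n. s' c \<in> koszul_chains N q (n - 1)"
    "\<forall>n. \<forall>c\<in>koszul_chains N q n. dN k (s' (dN k c)) = dN k c" using s'(2,3) by blast+
  have r_eq: "r c = (c \<ominus>\<^bsub>CL\<^esub> dL k (s c)) \<ominus>\<^bsub>CL\<^esub> s (dL k c)" for c by (simp add: r_def)
  have r'_eq: "r' c = (c \<ominus>\<^bsub>CN\<^esub> dN k (s' c)) \<ominus>\<^bsub>CN\<^esub> s' (dN k c)" for c by (simp add: r'_def)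
  note rp = projection_properties[OF L.compatible_module_axioms xsA s(1) sb r_eq]
  note rp' = projection_properties[OF N.compatible_module_axioms ysB s'(1) sb' r'_eq]
  note homs = L.koszul_diff_K_hom[OF xsA, of k] L.alternate_sign_hom s(1) N.koszul_diff_K_hom[OF ysB, of k] s'(1)
  obtain F1 where F1: "additive_endo CT F1"
    "\<And>c d. c \<in> carrier CL \<Longrightarrow> d \<in> carrier CN \<Longrightarrow> F1 (tens c d) = tens (alternate_sign L c) (s' d)"
    using TT.functorial[OF homs(2) homs(5)] by blast
  obtain F2 where F2: "additive_endo CT F2"
    "\<And>c d. c \<in> carrier CL \<Longrightarrow> d \<in> carrier CN \<Longrightarrow> F2 (tens c d) = tens (s c) (r' d)"
    using TT.functorial[OF homs(3) rp'(1)] by blast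
  obtain F3 where F3: "additive_endo CT F3"
    "\<And>c d. c \<in> carrier CL \<Longrightarrow> d \<in> carrier CN \<Longrightarrow> F3 (tens c d) = tens (r c) (r' d)"
    using TT.functorial[OF rp(1) rp'(1)] by blast
  \<comment> \<open>The homotopy of \<open>homotopy_generator\<close>, with its two summands of the
    form \<open>e \<otimes> s'\<close> and \<open>s \<otimes> r'\<close>.\<close>
  define H where "H = (\<lambda>z. F1 z \<oplus>\<^bsub>CT\<^esub> F2 z)"
  have aCT: "abelian_group CT" by (rule TT.X.abelian_group_axioms)
  interpret CTm: module R CT by (rule module_chains[OF T.module_axioms])
  have H: "additive_endo CT H" unfolding H_def by (rule additive_endo_add[OF aCT F1(1) F2(1)])
  have zero: "F \<zero>\<^bsub>CT\<^esub> = \<zero>\<^bsub>CT\<^esub>" if "additive_endo CT F" for F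
    by (rule additive_zero[OF aCT aCT]) (use additive_endoD[OF that] in blast)+
  have KTadd: "x \<oplus>\<^bsub>CT\<^esub> y \<in> KT n" if "x \<in> KT n" "y \<in> KT n" for x y n
    using T.koszul_chains_closed(5)[OF that] by simp
  have KTzero: "\<zero>\<^bsub>CT\<^esub> \<in> KT n" for n using T.koszul_chains_zero by simp
  have CL: "c \<in> carrier CL" if "c \<in> koszul_chains L p n" for c n by (rule L.koszul_chains_length[OF that])
  have CN: "d \<in> carrier CN" if "d \<in> koszul_chains N q n" for d n by (rule N.koszul_chains_length[OF that])
  have Hdeg: "H z \<in> KT (n - 1)" if z: "z \<in> KT n" for z n
  proof -
    have "KT n \<subseteq> {z. H z \<in> KT (n - 1)}"
    proof (rule spanning_degree)
      show "\<zero>\<^bsub>CT\<^esub> \<in> {z. H z \<in> KT (n - 1)}" using zero[OF H] KTzero by simp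
      show "x \<oplus>\<^bsub>CT\<^esub> y \<in> {z. H z \<in> KT (n - 1)}"
        if "x \<in> KT n" "y \<in> KT n" "x \<in> {z. H z \<in> KT (n - 1)}" "y \<in> {z. H z \<in> KT (n - 1)}" for x y
        using additive_endoD(2)[OF H KT_CT[OF that(1)] KT_CT[OF that(2)]] KTadd[of "H x" "n - 1" "H y"] that(3,4)
        by (simp del: chains_simps)
      fix i j c d assume ij: "i + j = n" and c: "c \<in> koszul_chains L p i" and d: "d \<in> koszul_chains N q j"
      have "tens (alternate_sign L c) (s' d) \<in> KT (n - 1)"
        using tens_degree[OF L.alternate_sign_chains[OF c] s'(2)[OF d]] ij by (simp add: algebra_simps)
      moreover have "tens (s c) (r' d) \<in> KT (n - 1)"
        using tens_degree[OF s(2)[OF c] rp'(2)[OF d]] ij by (simp add: algebra_simps)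
      ultimately show "tens c d \<in> {z. H z \<in> KT (n - 1)}"
        using F1(2)[OF CL[OF c] CN[OF d]] F2(2)[OF CL[OF c] CN[OF d]] KTadd unfolding H_def by simp
    qed
    then show ?thesis using z by blast
  qed
  have main: "(dT k (H z) \<oplus>\<^bsub>CT\<^esub> H (dT k z)) \<oplus>\<^bsub>CT\<^esub> F3 z = z" if z: "z \<in> KT n" for z n
  proof -
    let ?I = "\<lambda>z. (dT k (H z) \<oplus>\<^bsub>CT\<^esub> H (dT k z)) \<oplus>\<^bsub>CT\<^esub> F3 z"
    have I: "additive_endo CT ?I"
      by (intro additive_endo_add aCT additive_endo_comp[of CT "dT k" H] additive_endo_comp[of CT H "dT k"]
        H dT_endo F3(1))
    \<comment> \<open>Both sides are additive, so homogeneous pure tensors decide.\<close>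
    have "KT n \<subseteq> {z. ?I z = z}"
    proof (rule spanning_degree)
      show "\<zero>\<^bsub>CT\<^esub> \<in> {z. ?I z = z}" using zero[OF I] by simp
      show "x \<oplus>\<^bsub>CT\<^esub> y \<in> {z. ?I z = z}"
        if "x \<in> KT n" "y \<in> KT n" "x \<in> {z. ?I z = z}" "y \<in> {z. ?I z = z}" for x y
        using additive_endoD(2)[OF I KT_CT[OF that(1)] KT_CT[OF that(2)]] that(3,4)
        by (simp only: mem_Collect_eq)
      fix i j c d assume c: "c \<in> koszul_chains L p i" and d: "d \<in> koszul_chains N q j"
      have "?I (tens c d) = tens c d"
        unfolding H_def
        by (rule TT.homotopy_generator[OF homs r_eq r'_eq dT_endo F1(1) F2(1)
              dT_leibniz F1(2) F2(2) F3(2) CL[OF c] CN[OF d] L.alternate_sign_twice[OF c]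
              L.koszul_diff_alternate_sign[OF xsA c] rp'(3)[OF d] rp'(4)[OF d]])
      then show "tens c d \<in> {z. ?I z = z}" by simp
    qed
    then show ?thesis using z by blast
  qed
  have F3d: "F3 (dT k z) = \<zero>\<^bsub>CT\<^esub>" if z: "z \<in> KT n" for z n
  proof -
    have E: "additive_endo CT (\<lambda>z. F3 (dT k z))" by (rule additive_endo_comp[OF F3(1) dT_endo])
    have "KT n \<subseteq> {z. F3 (dT k z) = \<zero>\<^bsub>CT\<^esub>}"
    proof (rule spanning_degree)
      show "\<zero>\<^bsub>CT\<^esub> \<in> {z. F3 (dT k z) = \<zero>\<^bsub>CT\<^esub>}" using zero[OF E] by simp
      show "x \<oplus>\<^bsub>CT\<^esub> y \<in> {z. F3 (dT k z) = \<zero>\<^bsub>CT\<^esub>}"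
        if "x \<in> KT n" "y \<in> KT n" "x \<in> {z. F3 (dT k z) = \<zero>\<^bsub>CT\<^esub>}" "y \<in> {z. F3 (dT k z) = \<zero>\<^bsub>CT\<^esub>}" for x y
        using additive_endoD(2)[OF E KT_CT[OF that(1)] KT_CT[OF that(2)]] that(3,4) TT.X.r_zero[OF TT.X.zero_closed]
        by (simp only: mem_Collect_eq)
      fix i j c d assume c: "c \<in> koszul_chains L p i" and d: "d \<in> koszul_chains N q j"
      have dc: "dL k c \<in> koszul_chains L p (i + 1)" by (rule L.L.koszul_diff_chains[OF xsA c])
      have dd: "dN k d \<in> koszul_chains N q (j + 1)" by (rule N.L.koszul_diff_chains[OF ysB d])
      have ec: "alternate_sign L c \<in> koszul_chains L p i" by (rule L.alternate_sign_chains[OF c])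
      have "F3 (dT k (tens c d)) = F3 (tens (dL k c) d) \<oplus>\<^bsub>CT\<^esub> F3 (tens (alternate_sign L c) (dN k d))"
        unfolding dT_leibniz[OF CL[OF c] CN[OF d]]
        by (rule additive_endoD(2)[OF F3(1) TT.closed[OF CL[OF dc] CN[OF d]] TT.closed[OF CL[OF ec] CN[OF dd]]])
      also have "\<dots> = tens \<zero>\<^bsub>CL\<^esub> (r' d) \<oplus>\<^bsub>CT\<^esub> tens (r (alternate_sign L c)) \<zero>\<^bsub>CN\<^esub>"
        using F3(2)[OF CL[OF dc] CN[OF d]] F3(2)[OF CL[OF ec] CN[OF dd]] rp(4)[OF c] rp'(4)[OF d] by simp
      also have "\<dots> = \<zero>\<^bsub>CT\<^esub>"
        unfolding TT.zero_left[OF CN[OF rp'(2)[OF d]]] TT.zero_right[OF CL[OF rp(2)[OF ec]]]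
        by (rule TT.X.r_zero[OF TT.X.zero_closed])
      finally show "tens c d \<in> {z. F3 (dT k z) = \<zero>\<^bsub>CT\<^esub>}" by simp
    qed
    then show ?thesis using z by blast
  qed
  show thesis
  proof (rule that[OF F3(1) H Hdeg main F3d F3(2)])
    show "r c \<in> koszul_chains L p n \<and> dL k (r c) = (\<lambda>_. \<zero>\<^bsub>L\<^esub>)" if "c \<in> koszul_chains L p n" for c n
      using rp(2,3)[OF that] by (simp add: L.same_group)
    show "r' d \<in> koszul_chains N q n \<and> dN k (r' d) = (\<lambda>_. \<zero>\<^bsub>N\<^esub>)" if "d \<in> koszul_chains N q n" for d n
      using rp'(2,3)[OF that] by (simp add: N.same_group)
    show "\<exists>b\<in>koszul_chains L p (n - 1). c = dL k b"
      if "c \<in> koszul_chains L p n" "dL k c = (\<lambda>_. \<zero>\<^bsub>L\<^esub>)" "r c = (\<lambda>_. \<zero>\<^bsub>L\<^esub>)" for c n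
      using rp(5)[OF that(1)] that(2,3) s(2)[OF that(1)] by (auto simp: L.same_group)
    show "\<exists>b\<in>koszul_chains N q (n - 1). d = dN k b"
      if "d \<in> koszul_chains N q n" "dN k d = (\<lambda>_. \<zero>\<^bsub>N\<^esub>)" "r' d = (\<lambda>_. \<zero>\<^bsub>N\<^esub>)" for d n
      using rp'(5)[OF that(1)] that(2,3) s'(2)[OF that(1)] by (auto simp: N.same_group)
  qed
qed

lemma shift_cocycle_left:
  assumes "c \<in> koszul_chains L p i" "dL k c = (\<lambda>_. \<zero>\<^bsub>L\<^esub>)"
  shows "dL (m + k) (koszul_shift A L m xs c) = (\<lambda>_. \<zero>\<^bsub>L\<^esub>)"
  using L.L.koszul_shift_diff[OF xsA L.L.koszul_chains_carrier[OF assms(1)], of m k]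
    L.L.koszul_shift_linear(4)[OF xsA, of m] assms(2) by simp

lemma shift_cocycle_right:
  assumes "d \<in> koszul_chains N q j" "dN k d = (\<lambda>_. \<zero>\<^bsub>N\<^esub>)"
  shows "dN (m + k) (koszul_shift B N m ys d) = (\<lambda>_. \<zero>\<^bsub>N\<^esub>)"
  using N.L.koszul_shift_diff[OF ysB N.L.koszul_chains_carrier[OF assms(1)], of m k]
    N.L.koszul_shift_linear(4)[OF ysB, of m] assms(2) by simp

text \<open>If a shift of \<open>c\<close> bounds \<open>b\<close>, the tensor of \<open>b\<close>
  with the shifted cocycle \<open>d\<close> is a primitive: the second Leibniz term
  vanishes.\<close>

lemma tens_exact_left:
  assumes c: "c \<in> koszul_chains L p i" "L.L.eventually_exact xs k i c"
    and d: "d \<in> koszul_chains N q j" "dN k d = (\<lambda>_. \<zero>\<^bsub>N\<^esub>)"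
  shows "T.eventually_exact (xs' @ ys') k (i + j) (tens c d)"
proof -
  obtain m b where b: "b \<in> koszul_chains L p (i - 1)" "koszul_shift A L m xs c = dL (m + k) b"
    using c(2) unfolding L.L.eventually_exact_def by blast
  let ?d = "koszul_shift B N m ys d"
  have d': "?d \<in> koszul_chains N q j" by (rule N.L.koszul_shift_chains[OF ysB d(1)])
  have dd: "dN (m + k) ?d = \<zero>\<^bsub>CN\<^esub>" using shift_cocycle_right[OF d] by (simp add: N.same_group)
  note CL = L.koszul_chains_length and CN = N.koszul_chains_length
  have ds: "tens (dL (m + k) b) ?d \<in> carrier CT"
    unfolding b(2)[symmetric]
    by (rule KT_CT[OF tens_degree[OF L.L.koszul_shift_chains[OF xsA c(1)] d']])
  have "dT (m + k) (tens b ?d) = tens (dL (m + k) b) ?d \<oplus>\<^bsub>CT\<^esub> tens (alternate_sign L b) (dN (m + k) ?d)"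
    by (rule dT_leibniz[OF CL[OF b(1)] CN[OF d']])
  also have "\<dots> = tens (dL (m + k) b) ?d"
    unfolding dd TT.zero_right[OF CL[OF L.alternate_sign_chains[OF b(1)]]] by (rule TT.X.r_zero[OF ds])
  also have "\<dots> = koszul_shift R T m (xs' @ ys') (tens c d)"
    unfolding b(2)[symmetric] by (rule shift_tens[OF CL[OF c(1)] CN[OF d(1)], symmetric])
  finally have "koszul_shift R T m (xs' @ ys') (tens c d) = dT (m + k) (tens b ?d)" ..
  moreover have "tens b ?d \<in> KT (i + j - 1)"
    using tens_degree[OF b(1) d'] by (simp add: algebra_simps)
  ultimately show ?thesis unfolding T.eventually_exact_def length_T by blast
qed

lemma tens_exact_right:
  assumes c: "c \<in> koszul_chains L p i" "dL k c = (\<lambda>_. \<zero>\<^bsub>L\<^esub>)"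
    and d: "d \<in> koszul_chains N q j" "N.L.eventually_exact ys k j d"
  shows "T.eventually_exact (xs' @ ys') k (i + j) (tens c d)"
proof -
  obtain m b where b: "b \<in> koszul_chains N q (j - 1)" "koszul_shift B N m ys d = dN (m + k) b"
    using d(2) unfolding N.L.eventually_exact_def by blast
  let ?c = "koszul_shift A L m xs c"
  have c': "?c \<in> koszul_chains L p i" by (rule L.L.koszul_shift_chains[OF xsA c(1)])
  note CL = L.koszul_chains_length and CN = N.koszul_chains_length
  \<comment> \<open>The Leibniz rule will apply a sign to the left factor; inserting the sign
    beforehand cancels it.\<close>
  let ?e = "alternate_sign L ?c"
  have e: "?e \<in> koszul_chains L p i" by (rule L.alternate_sign_chains[OF c'])
  have dc: "dL (m + k) ?c = \<zero>\<^bsub>CL\<^esub>" using shift_cocycle_left[OF c] by (simp add: L.same_group)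
  have "alternate_sign L \<zero>\<^bsub>CL\<^esub> = \<zero>\<^bsub>CL\<^esub>"
    by (rule module_hom_zero[OF L.alternate_sign_hom TT.C.module_axioms TT.C.module_axioms])
  then have de: "dL (m + k) ?e = \<zero>\<^bsub>CL\<^esub>"
    unfolding L.koszul_diff_alternate_sign[OF xsA c'] dc
    using TT.C.M.minus_equality[of "\<zero>\<^bsub>CL\<^esub>" "\<zero>\<^bsub>CL\<^esub>"] TT.C.M.zero_closed TT.C.M.r_zero[OF TT.C.M.zero_closed]
    by (simp del: chains_simps)
  have ds: "tens ?c (dN (m + k) b) \<in> carrier CT"
    unfolding b(2)[symmetric]
    by (rule KT_CT[OF tens_degree[OF c' N.L.koszul_shift_chains[OF ysB d(1)]]])
  have "dT (m + k) (tens ?e b) = tens (dL (m + k) ?e) b \<oplus>\<^bsub>CT\<^esub> tens (alternate_sign L ?e) (dN (m + k) b)"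
    by (rule dT_leibniz[OF CL[OF e] CN[OF b(1)]])
  also have "\<dots> = tens ?c (dN (m + k) b)"
    unfolding de L.alternate_sign_twice[OF c'] TT.zero_left[OF CN[OF b(1)]] by (rule TT.X.l_zero[OF ds])
  also have "\<dots> = koszul_shift R T m (xs' @ ys') (tens c d)"
    unfolding b(2)[symmetric] by (rule shift_tens[OF CL[OF c(1)] CN[OF d(1)], symmetric])
  finally have "koszul_shift R T m (xs' @ ys') (tens c d) = dT (m + k) (tens ?e b)" ..
  moreover have "tens ?e b \<in> KT (i + j - 1)"
    using tens_degree[OF e b(1)] by (simp add: algebra_simps)
  ultimately show ?thesis unfolding T.eventually_exact_def length_T by blast
qed

text \<open>A cocycle differs by a coboundary from its image under \<open>F3\<close>, which is a sum
  of tensors of cocycles, each with a factor that dies in the colimit. Conversely, nonzero classes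
  of \<open>L\<close> and \<open>N\<close> stay nonzero after all shifts, so \<open>r\<close> and
  \<open>r'\<close> send their representatives to nonzero chains. The tensor of those is nonzero
  over the field, whereas \<open>F3\<close> would kill it if the product were a coboundary.\<close>

theorem kunneth_vanishing:
  "cech_vanishes R T (xs' @ ys') n \<longleftrightarrow>
    (\<forall>i j. i + j = n \<longrightarrow> cech_vanishes A L xs i \<or> cech_vanishes B N ys j)"
proof
  assume *: "\<forall>i j. i + j = n \<longrightarrow> cech_vanishes A L xs i \<or> cech_vanishes B N ys j"
  show "cech_vanishes R T (xs' @ ys') n"
    unfolding T.cech_vanishes_iff length_T
  proof (intro allI ballI impI)
    fix k z assume z: "z \<in> KT n" "dT k z = (\<lambda>_. \<zero>\<^bsub>T\<^esub>)"
    obtain r r' F3 H where F3: "additive_endo CT F3" and H: "additive_endo CT H"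
      and Hdeg: "\<And>n z. z \<in> KT n \<Longrightarrow> H z \<in> KT (n - 1)"
      and main: "\<And>n z. z \<in> KT n \<Longrightarrow> (dT k (H z) \<oplus>\<^bsub>CT\<^esub> H (dT k z)) \<oplus>\<^bsub>CT\<^esub> F3 z = z"
      and F3t: "\<And>c d. c \<in> carrier CL \<Longrightarrow> d \<in> carrier CN \<Longrightarrow> F3 (tens c d) = tens (r c) (r' d)"
      and r: "\<And>c n. c \<in> koszul_chains L p n \<Longrightarrow> r c \<in> koszul_chains L p n \<and> dL k (r c) = (\<lambda>_. \<zero>\<^bsub>L\<^esub>)"
      and r': "\<And>d n. d \<in> koszul_chains N q n \<Longrightarrow> r' d \<in> koszul_chains N q n \<and> dN k (r' d) = (\<lambda>_. \<zero>\<^bsub>N\<^esub>)"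
      by (rule kunneth_homotopy[of k]) (rule that)
    have aCT: "abelian_group CT" by (rule TT.X.abelian_group_axioms)
    have zero: "F \<zero>\<^bsub>CT\<^esub> = \<zero>\<^bsub>CT\<^esub>" if "additive_endo CT F" for F
      by (rule additive_zero[OF aCT aCT]) (use additive_endoD[OF that] in blast)+
    let ?ee = "T.eventually_exact (xs' @ ys') k n"
    have ee_zero: "?ee \<zero>\<^bsub>CT\<^esub>" using T.eventually_exact_zero[OF set_T] by simp
    have ee_add: "?ee (x \<oplus>\<^bsub>CT\<^esub> y)" if "x \<in> carrier CT" "y \<in> carrier CT" "?ee x" "?ee y" for x y
      using T.eventually_exact_add[OF set_T, of x k n y] that by simp
    \<comment> \<open>On a homogeneous pure tensor \<open>F3\<close> gives a tensor of two cocycles,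
      and the hypothesis provides a factor without cohomology in its degree.\<close>
    have "KT n \<subseteq> {z. ?ee (F3 z)}"
    proof (rule spanning_degree)
      show "\<zero>\<^bsub>CT\<^esub> \<in> {z. ?ee (F3 z)}" using ee_zero zero[OF F3] by simp
      show "x \<oplus>\<^bsub>CT\<^esub> y \<in> {z. ?ee (F3 z)}"
        if "x \<in> KT n" "y \<in> KT n" "x \<in> {z. ?ee (F3 z)}" "y \<in> {z. ?ee (F3 z)}" for x y
        using ee_add[of "F3 x" "F3 y"] additive_endoD(1)[OF F3 KT_CT] additive_endoD(2)[OF F3 KT_CT KT_CT] that
        by (simp del: chains_simps)
      fix i j c d assume ij: "i + j = n" and c: "c \<in> koszul_chains L p i" and d: "d \<in> koszul_chains N q j"
      have "?ee (tens (r c) (r' d))"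
      proof (cases "cech_vanishes A L xs i")
        case True
        then have "L.L.eventually_exact xs k i (r c)"
          using r[OF c] unfolding L.L.cech_vanishes_iff by blast
        then show ?thesis using tens_exact_left[of "r c" i k "r' d" j] r[OF c] r'[OF d] ij by simp
      next
        case False
        then have "cech_vanishes B N ys j" using * ij by blast
        then have "N.L.eventually_exact ys k j (r' d)"
          using r'[OF d] unfolding N.L.cech_vanishes_iff by blast
        then show ?thesis using tens_exact_right[of "r c" i k "r' d" j] r[OF c] r'[OF d] ij by simp
      qed
      then show "tens c d \<in> {z. ?ee (F3 z)}"
        using F3t[OF L.koszul_chains_length[OF c] N.koszul_chains_length[OF d]] by simp
    qed
    then have e3: "?ee (F3 z)" using z(1) by blast
    have "H (dT k z) = \<zero>\<^bsub>CT\<^esub>" using zero[OF H] z(2) by simp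
    moreover have dH: "dT k (H z) \<in> carrier CT"
      using KT_CT[OF dT_degree[OF Hdeg[OF z(1)]]] .
    \<comment> \<open>On a cocycle the homotopy formula leaves only a coboundary and
      \<open>F3 z\<close>.\<close>
    ultimately have eq: "z = dT k (H z) \<oplus>\<^bsub>CT\<^esub> F3 z"
      using main[OF z(1)] TT.X.r_zero[OF dH] by metis
    have "?ee (dT k (H z))"
      using T.eventually_exact_coboundary[OF set_T, of "H z" n k] Hdeg[OF z(1)] unfolding length_T by blast
    then show "?ee z"
      using ee_add[OF dH additive_endoD(1)[OF F3 KT_CT[OF z(1)]] _ e3] eq by metis
  qed
next
  assume vT: "cech_vanishes R T (xs' @ ys') n"
  show "\<forall>i j. i + j = n \<longrightarrow> cech_vanishes A L xs i \<or> cech_vanishes B N ys j"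
  proof (intro allI impI, rule ccontr)
    fix i j assume ij: "i + j = n" and "\<not> (cech_vanishes A L xs i \<or> cech_vanishes B N ys j)"
    then have nL: "\<not> cech_vanishes A L xs i" and nN: "\<not> cech_vanishes B N ys j" by auto
    obtain N1 c1 where c1: "c1 \<in> koszul_chains L p i" "dL N1 c1 = (\<lambda>_. \<zero>\<^bsub>L\<^esub>)"
      "\<not> L.L.eventually_exact xs N1 i c1" using nL unfolding L.L.cech_vanishes_iff by blast
    obtain N2 d2 where d2: "d2 \<in> koszul_chains N q j" "dN N2 d2 = (\<lambda>_. \<zero>\<^bsub>N\<^esub>)"
      "\<not> N.L.eventually_exact ys N2 j d2" using nN unfolding N.L.cech_vanishes_iff by blast
    \<comment> \<open>Each cocycle is shifted by the exponent of the other, so both arrive at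
      \<open>N2 + N1\<close>.\<close>
    define c where "c = koszul_shift A L N2 xs c1"
    define d where "d = koszul_shift B N N1 ys d2"
    let ?N = "N2 + N1"
    have c: "c \<in> koszul_chains L p i" "dL ?N c = (\<lambda>_. \<zero>\<^bsub>L\<^esub>)"
      unfolding c_def by (rule L.L.koszul_shift_chains[OF xsA c1(1)], rule shift_cocycle_left[OF c1(1,2)])
    have d: "d \<in> koszul_chains N q j" "dN ?N d = (\<lambda>_. \<zero>\<^bsub>N\<^esub>)"
      using N.L.koszul_shift_chains[OF ysB d2(1), of N1] shift_cocycle_right[OF d2(1,2), of N1]
      unfolding d_def by (simp_all add: add.commute)
    have nc: "\<not> L.L.eventually_exact xs ?N i c"
      using L.L.eventually_exact_shift[OF xsA L.L.koszul_chains_carrier[OF c1(1)], of N2 N1 i] c1(3)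
      unfolding c_def by blast
    have nd: "\<not> N.L.eventually_exact ys ?N j d"
      using N.L.eventually_exact_shift[OF ysB N.L.koszul_chains_carrier[OF d2(1)], of N1 N2 j] d2(3)
      unfolding d_def add.commute[of N2 N1] by blast
    note CL = L.koszul_chains_length and CN = N.koszul_chains_length
    have "dT ?N (tens c d) = tens \<zero>\<^bsub>CL\<^esub> d \<oplus>\<^bsub>CT\<^esub> tens (alternate_sign L c) \<zero>\<^bsub>CN\<^esub>"
      using dT_leibniz[OF CL[OF c(1)] CN[OF d(1)], of ?N] c(2) d(2) by (simp add: L.same_group N.same_group)
    also have "\<dots> = \<zero>\<^bsub>CT\<^esub>"
      unfolding TT.zero_left[OF CN[OF d(1)]] TT.zero_right[OF CL[OF L.alternate_sign_chains[OF c(1)]]]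
      by (rule TT.X.r_zero[OF TT.X.zero_closed])
    finally have "dT ?N (tens c d) = (\<lambda>_. \<zero>\<^bsub>T\<^esub>)" by simp
    moreover have "tens c d \<in> KT n" using tens_degree[OF c(1) d(1)] ij by simp
    ultimately have "T.eventually_exact (xs' @ ys') ?N n (tens c d)"
      using vT unfolding T.cech_vanishes_iff length_T by blast
    then obtain m b where b: "b \<in> KT (n - 1)" "koszul_shift R T m (xs' @ ys') (tens c d) = dT (m + ?N) b"
      unfolding T.eventually_exact_def length_T by blast
    define c' where "c' = koszul_shift A L m xs c"
    define d' where "d' = koszul_shift B N m ys d"
    have c': "c' \<in> koszul_chains L p i" "dL (m + ?N) c' = (\<lambda>_. \<zero>\<^bsub>L\<^esub>)"
      unfolding c'_def by (rule L.L.koszul_shift_chains[OF xsA c(1)], rule shift_cocycle_left[OF c])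
    have d': "d' \<in> koszul_chains N q j" "dN (m + ?N) d' = (\<lambda>_. \<zero>\<^bsub>N\<^esub>)"
      unfolding d'_def by (rule N.L.koszul_shift_chains[OF ysB d(1)], rule shift_cocycle_right[OF d])
    have tb: "tens c' d' = dT (m + ?N) b"
      using b(2) shift_tens[OF CL[OF c(1)] CN[OF d(1)], of m] unfolding c'_def d'_def by simp
    obtain r r' F3 H where F3d: "\<And>n z. z \<in> KT n \<Longrightarrow> F3 (dT (m + ?N) z) = \<zero>\<^bsub>CT\<^esub>"
      and F3t: "\<And>c d. c \<in> carrier CL \<Longrightarrow> d \<in> carrier CN \<Longrightarrow> F3 (tens c d) = tens (r c) (r' d)"
      and r: "\<And>c n. c \<in> koszul_chains L p n \<Longrightarrow> r c \<in> koszul_chains L p n \<and> dL (m + ?N) (r c) = (\<lambda>_. \<zero>\<^bsub>L\<^esub>)"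
      and r': "\<And>d n. d \<in> koszul_chains N q n \<Longrightarrow> r' d \<in> koszul_chains N q n \<and> dN (m + ?N) (r' d) = (\<lambda>_. \<zero>\<^bsub>N\<^esub>)"
      and rb: "\<And>c n. c \<in> koszul_chains L p n \<Longrightarrow> dL (m + ?N) c = (\<lambda>_. \<zero>\<^bsub>L\<^esub>) \<Longrightarrow> r c = (\<lambda>_. \<zero>\<^bsub>L\<^esub>) \<Longrightarrow>
        \<exists>b\<in>koszul_chains L p (n - 1). c = dL (m + ?N) b"
      and rb': "\<And>d n. d \<in> koszul_chains N q n \<Longrightarrow> dN (m + ?N) d = (\<lambda>_. \<zero>\<^bsub>N\<^esub>) \<Longrightarrow> r' d = (\<lambda>_. \<zero>\<^bsub>N\<^esub>) \<Longrightarrow>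
        \<exists>b\<in>koszul_chains N q (n - 1). d = dN (m + ?N) b"
      by (rule kunneth_homotopy[of "m + ?N"]) (rule that)
    \<comment> \<open>\<open>F3\<close> kills the coboundary \<open>tens c' d'\<close>. A pure
      tensor that is zero has a zero factor, and then \<open>c'\<close> or \<open>d'\<close> is a
      coboundary.\<close>
    have "tens (r c') (r' d') = \<zero>\<^bsub>CT\<^esub>"
      using F3d[OF b(1)] F3t[OF CL[OF c'(1)] CN[OF d'(1)]] tb by simp
    then have "r c' = \<zero>\<^bsub>CL\<^esub> \<or> r' d' = \<zero>\<^bsub>CN\<^esub>"
      using TT.nonzero[OF CL CN] r[OF c'(1)] r'[OF d'(1)] by blast
    then show False
    proof
      assume "r c' = \<zero>\<^bsub>CL\<^esub>"
      then have "\<exists>b\<in>koszul_chains L p (i - 1). c' = dL (m + ?N) b"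
        using rb[OF c'] by (simp add: L.same_group)
      then show False using nc unfolding L.L.eventually_exact_def c'_def by blast
    next
      assume "r' d' = \<zero>\<^bsub>CN\<^esub>"
      then have "\<exists>b\<in>koszul_chains N q (j - 1). d' = dN (m + ?N) b"
        using rb'[OF d'] by (simp add: N.same_group)
      then show False using nd unfolding N.L.eventually_exact_def d'_def by blast
    qed
  qed
qed

end

end

section \<open>Tensor products\<close>

locale tensor_pair = M: module K M + N: module K N
  for K :: "('k, 'u) ring_scheme" and M :: "('k, 'm, 'x) module_scheme" and N :: "('k, 'n, 'y) module_scheme"
begin

abbreviation "pairs \<equiv> carrier M \<times> carrier N"
abbreviation "Rel \<equiv> tensor_relations K M N"
abbreviation "tc \<equiv> tensor_coset K M N"
abbreviation "TG \<equiv> tensor_group K M N"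
abbreviation "pure x y \<equiv> tensor_coset K M N (frag_of (x, y))"

abbreviation "relators \<equiv>
    {frag_of (x \<oplus>\<^bsub>M\<^esub> x', y) - frag_of (x, y) - frag_of (x', y) | x x' y.
        x \<in> carrier M \<and> x' \<in> carrier M \<and> y \<in> carrier N} \<union>
     {frag_of (x, y \<oplus>\<^bsub>N\<^esub> y') - frag_of (x, y) - frag_of (x, y') | x y y'.
        x \<in> carrier M \<and> y \<in> carrier N \<and> y' \<in> carrier N} \<union>
     {frag_of (c \<odot>\<^bsub>M\<^esub> x, y) - frag_of (x, c \<odot>\<^bsub>N\<^esub> y) | c x y.
        c \<in> carrier K \<and> x \<in> carrier M \<and> y \<in> carrier N}"

lemma keys_diff_subset: "Poly_Mapping.keys c \<subseteq> S \<Longrightarrow> Poly_Mapping.keys d \<subseteq> S \<Longrightarrow> Poly_Mapping.keys (c - d) \<subseteq> S"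
  using keys_diff[of c d] by auto

lemma keys_add_subset: "Poly_Mapping.keys c \<subseteq> S \<Longrightarrow> Poly_Mapping.keys d \<subseteq> S \<Longrightarrow> Poly_Mapping.keys (c + d) \<subseteq> S"
  using keys_add[of c d] by auto

lemma relators_subset: "relators \<subseteq> carrier (free_Abelian_group pairs)"
proof -
  have *: "frag_of a - frag_of b - frag_of c \<in> carrier (free_Abelian_group pairs)"
    if "a \<in> pairs" "b \<in> pairs" "c \<in> pairs" for a b c
    unfolding carrier_free_Abelian_group_iff by (intro keys_diff_subset) (use that in auto)
  have **: "frag_of a - frag_of b \<in> carrier (free_Abelian_group pairs)"
    if "a \<in> pairs" "b \<in> pairs" for a b
    unfolding carrier_free_Abelian_group_iff by (intro keys_diff_subset) (use that in auto)
  show ?thesis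
  proof (intro Un_least subsetI)
    fix z assume "z \<in> {frag_of (x \<oplus>\<^bsub>M\<^esub> x', y) - frag_of (x, y) - frag_of (x', y) | x x' y.
        x \<in> carrier M \<and> x' \<in> carrier M \<and> y \<in> carrier N}"
    then show "z \<in> carrier (free_Abelian_group pairs)" by (elim CollectE exE conjE, hypsubst, intro *) auto
  next
    fix z assume "z \<in> {frag_of (x, y \<oplus>\<^bsub>N\<^esub> y') - frag_of (x, y) - frag_of (x, y') | x y y'.
        x \<in> carrier M \<and> y \<in> carrier N \<and> y' \<in> carrier N}"
    then show "z \<in> carrier (free_Abelian_group pairs)" by (elim CollectE exE conjE, hypsubst, intro *) auto
  next
    fix z assume "z \<in> {frag_of (c \<odot>\<^bsub>M\<^esub> x, y) - frag_of (x, c \<odot>\<^bsub>N\<^esub> y) | c x y.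
        c \<in> carrier K \<and> x \<in> carrier M \<and> y \<in> carrier N}"
    then show "z \<in> carrier (free_Abelian_group pairs)" by (elim CollectE exE conjE, hypsubst, intro **) auto
  qed
qed

lemma Rel_subgroup: "subgroup Rel (free_Abelian_group pairs)"
  unfolding tensor_relations_def
  by (rule group.generate_is_subgroup[OF group_free_Abelian_group relators_subset])

lemma Rel_keys: "c \<in> Rel \<Longrightarrow> Poly_Mapping.keys c \<subseteq> pairs"
  using subsetD[OF subgroup.subset[OF Rel_subgroup]] by (simp only: carrier_free_Abelian_group_iff)

lemma Rel_zero: "0 \<in> Rel"
  using subgroup.one_closed[OF Rel_subgroup] by simp

lemma Rel_diff: "c \<in> Rel \<Longrightarrow> d \<in> Rel \<Longrightarrow> c - d \<in> Rel"
  using subgroup.m_closed[OF Rel_subgroup, of c "- d"] subgroup.m_inv_closed[OF Rel_subgroup, of d] Rel_keys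
  by simp

lemma Rel_add: "c \<in> Rel \<Longrightarrow> d \<in> Rel \<Longrightarrow> c + d \<in> Rel"
  using subgroup.m_closed[OF Rel_subgroup, of c d] by simp

text \<open>Sums and inverses both arise from zero by differences, so one closure step replaces two;
  it has the same shape as the induction over formal sums.\<close>

lemma Rel_induct [consumes 1, case_names zero add_left add_right balanced diff]:
  assumes "c \<in> Rel" and "P 0"
    and "\<And>x x' y. x \<in> carrier M \<Longrightarrow> x' \<in> carrier M \<Longrightarrow> y \<in> carrier N \<Longrightarrow>
      P (frag_of (x \<oplus>\<^bsub>M\<^esub> x', y) - frag_of (x, y) - frag_of (x', y))"
    and "\<And>x y y'. x \<in> carrier M \<Longrightarrow> y \<in> carrier N \<Longrightarrow> y' \<in> carrier N \<Longrightarrow>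
      P (frag_of (x, y \<oplus>\<^bsub>N\<^esub> y') - frag_of (x, y) - frag_of (x, y'))"
    and "\<And>k x y. k \<in> carrier K \<Longrightarrow> x \<in> carrier M \<Longrightarrow> y \<in> carrier N \<Longrightarrow>
      P (frag_of (k \<odot>\<^bsub>M\<^esub> x, y) - frag_of (x, k \<odot>\<^bsub>N\<^esub> y))"
    and diff: "\<And>c d. P c \<Longrightarrow> P d \<Longrightarrow> P (c - d)"
  shows "P c"
proof -
  have gen: "P z" if "z \<in> relators" for z
    using that
  proof (elim UnE CollectE exE conjE)
    fix x x' y
    assume "x \<in> carrier M" "x' \<in> carrier M" "y \<in> carrier N"
      "z = frag_of (x \<oplus>\<^bsub>M\<^esub> x', y) - frag_of (x, y) - frag_of (x', y)"
    then show "P z" using assms(3) by (simp only:)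
  next
    fix x y y'
    assume "x \<in> carrier M" "y \<in> carrier N" "y' \<in> carrier N"
      "z = frag_of (x, y \<oplus>\<^bsub>N\<^esub> y') - frag_of (x, y) - frag_of (x, y')"
    then show "P z" using assms(4) by (simp only:)
  next
    fix k x y
    assume "k \<in> carrier K" "x \<in> carrier M" "y \<in> carrier N"
      "z = frag_of (k \<odot>\<^bsub>M\<^esub> x, y) - frag_of (x, k \<odot>\<^bsub>N\<^esub> y)"
    then show "P z" using assms(5) by (simp only:)
  qed
  from assms(1) show ?thesis
    unfolding tensor_relations_def
  proof (induction c rule: generate.induct)
    case one
    then show ?case using assms(2) by simp
  next
    case (incl h)
    then show ?case by (rule gen)
  next
    case (inv h)
    then have "Poly_Mapping.keys h \<subseteq> pairs"
      using subsetD[OF relators_subset] by (simp only: carrier_free_Abelian_group_iff)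
    then show ?case using diff[OF assms(2) gen[OF inv]] by simp
  next
    case (eng h1 h2)
    have "P (0 - h2)" by (rule diff[OF assms(2) eng(4)])
    then show ?case using diff[OF eng(3), of "0 - h2"] by simp
  qed
qed

lemma Rel_relators:
  shows "x \<in> carrier M \<Longrightarrow> x' \<in> carrier M \<Longrightarrow> y \<in> carrier N \<Longrightarrow>
      frag_of (x \<oplus>\<^bsub>M\<^esub> x', y) - frag_of (x, y) - frag_of (x', y) \<in> Rel"
    and "x \<in> carrier M \<Longrightarrow> y \<in> carrier N \<Longrightarrow> y' \<in> carrier N \<Longrightarrow>
      frag_of (x, y \<oplus>\<^bsub>N\<^esub> y') - frag_of (x, y) - frag_of (x, y') \<in> Rel"
    and "k \<in> carrier K \<Longrightarrow> x \<in> carrier M \<Longrightarrow> y \<in> carrier N \<Longrightarrow>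
      frag_of (k \<odot>\<^bsub>M\<^esub> x, y) - frag_of (x, k \<odot>\<^bsub>N\<^esub> y) \<in> Rel"
  unfolding tensor_relations_def
  subgoal by (rule generate.incl, rule UnI1, rule UnI1, rule CollectI, intro exI conjI, rule refl)
  subgoal by (rule generate.incl, rule UnI1, rule UnI2, rule CollectI, intro exI conjI, rule refl)
  subgoal by (rule generate.incl, rule UnI2, rule CollectI, intro exI conjI, rule refl)
  done

lemma mem_tc: "z \<in> tc c \<longleftrightarrow> z - c \<in> Rel"
proof -
  have "z \<in> tc c \<longleftrightarrow> (\<exists>r\<in>Rel. z = r + c)"
    by (auto simp: tensor_coset_def r_coset_def)
  also have "\<dots> \<longleftrightarrow> z - c \<in> Rel"
    by (metis add_diff_cancel_right' diff_add_cancel)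
  finally show ?thesis .
qed

lemma tc_eq_iff: "tc c = tc d \<longleftrightarrow> c - d \<in> Rel"
proof
  assume "tc c = tc d"
  then have "c \<in> tc d" using mem_tc[of c c] Rel_zero by simp
  then show "c - d \<in> Rel" by (simp add: mem_tc)
next
  assume cd: "c - d \<in> Rel"
  have "z - c \<in> Rel \<longleftrightarrow> z - d \<in> Rel" for z
  proof
    assume "z - c \<in> Rel"
    from Rel_add[OF this cd] show "z - d \<in> Rel" by simp
  next
    assume "z - d \<in> Rel"
    from Rel_diff[OF this cd] show "z - c \<in> Rel" by simp
  qed
  then show "tc c = tc d" by (auto simp: mem_tc)
qed

lemma TG_comm_group: "comm_group TG"
  unfolding tensor_group_def by (rule comm_group.abelian_FactGroup[OF abelian_free_Abelian_group Rel_subgroup])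

lemma carrier_TG: "carrier TG = tc ` {c. Poly_Mapping.keys c \<subseteq> pairs}"
  by (auto simp: tensor_group_def FactGroup_def RCOSETS_def tensor_coset_def)

lemma one_TG: "\<one>\<^bsub>TG\<^esub> = tc 0"
  by (auto simp: tensor_group_def FactGroup_def mem_tc)

lemma mult_TG: "tc c \<otimes>\<^bsub>TG\<^esub> tc d = tc (c + d)"
proof -
  have "tc c \<otimes>\<^bsub>TG\<^esub> tc d = (\<Union>x\<in>tc c. \<Union>y\<in>tc d. {x + y})"
    by (simp add: tensor_group_def FactGroup_def set_mult_def)
  also have "\<dots> = tc (c + d)"
  proof (intro equalityI subsetI)
    fix z assume "z \<in> (\<Union>x\<in>tc c. \<Union>y\<in>tc d. {x + y})"
    then obtain x y where "x - c \<in> Rel" "y - d \<in> Rel" "z = x + y" by (auto simp: mem_tc)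
    then show "z \<in> tc (c + d)" using Rel_add[of "x - c" "y - d"] by (simp add: mem_tc algebra_simps)
  next
    fix z assume "z \<in> tc (c + d)"
    then have "z - d \<in> tc c" by (simp add: mem_tc algebra_simps)
    moreover have "d \<in> tc d" using Rel_zero by (simp add: mem_tc)
    moreover have "z = (z - d) + d" by simp
    ultimately show "z \<in> (\<Union>x\<in>tc c. \<Union>y\<in>tc d. {x + y})" by blast
  qed
  finally show ?thesis .
qed

lemma tc_closed: "Poly_Mapping.keys c \<subseteq> pairs \<Longrightarrow> tc c \<in> carrier TG"
  by (auto simp: carrier_TG)

lemma pure_closed: "x \<in> carrier M \<Longrightarrow> y \<in> carrier N \<Longrightarrow> pure x y \<in> carrier TG"
  by (rule tc_closed) auto

lemma pure_add_left:
  "x \<in> carrier M \<Longrightarrow> x' \<in> carrier M \<Longrightarrow> y \<in> carrier N \<Longrightarrow> pure (x \<oplus>\<^bsub>M\<^esub> x') y = pure x y \<otimes>\<^bsub>TG\<^esub> pure x' y"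
  using Rel_relators(1)[of x x' y] by (simp add: mult_TG tc_eq_iff diff_diff_eq)

lemma pure_add_right:
  "x \<in> carrier M \<Longrightarrow> y \<in> carrier N \<Longrightarrow> y' \<in> carrier N \<Longrightarrow> pure x (y \<oplus>\<^bsub>N\<^esub> y') = pure x y \<otimes>\<^bsub>TG\<^esub> pure x y'"
  using Rel_relators(2)[of x y y'] by (simp add: mult_TG tc_eq_iff diff_diff_eq)

lemma pure_balanced:
  "k \<in> carrier K \<Longrightarrow> x \<in> carrier M \<Longrightarrow> y \<in> carrier N \<Longrightarrow> pure (k \<odot>\<^bsub>M\<^esub> x) y = pure x (k \<odot>\<^bsub>N\<^esub> y)"
  using Rel_relators(3)[of k x y] by (simp add: tc_eq_iff)

text \<open>Absorbs a negative coefficient into the first factor, so that sums of pure tensors,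
  without differences, exhaust the tensor group.\<close>

lemma tc_uminus_pure:
  assumes "x \<in> carrier M" "y \<in> carrier N"
  shows "tc (- frag_of (x, y)) = pure (\<ominus>\<^bsub>M\<^esub> x) y"
proof -
  have z: "frag_of (\<zero>\<^bsub>M\<^esub>, y) \<in> Rel"
  proof -
    have "frag_of (\<zero>\<^bsub>M\<^esub> \<oplus>\<^bsub>M\<^esub> \<zero>\<^bsub>M\<^esub>, y) - frag_of (\<zero>\<^bsub>M\<^esub>, y) - frag_of (\<zero>\<^bsub>M\<^esub>, y) \<in> Rel"
      using assms by (intro Rel_relators) auto
    then have "- frag_of (\<zero>\<^bsub>M\<^esub>, y) \<in> Rel" by simp
    from Rel_diff[OF Rel_zero this] show ?thesis by simp
  qed
  have "frag_of (x \<oplus>\<^bsub>M\<^esub> \<ominus>\<^bsub>M\<^esub> x, y) - frag_of (x, y) - frag_of (\<ominus>\<^bsub>M\<^esub> x, y) \<in> Rel"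
    using assms by (intro Rel_relators) auto
  then have "frag_of (\<zero>\<^bsub>M\<^esub>, y) - frag_of (x, y) - frag_of (\<ominus>\<^bsub>M\<^esub> x, y) \<in> Rel"
    using assms by (simp add: M.M.r_neg)
  from Rel_diff[OF this z] show ?thesis by (simp add: tc_eq_iff)
qed

lemma tensor_spanning:
  assumes z: "\<one>\<^bsub>TG\<^esub> \<in> H" and gen: "\<And>x y. x \<in> carrier M \<Longrightarrow> y \<in> carrier N \<Longrightarrow> pure x y \<in> H"
    and add: "\<And>s t. s \<in> carrier TG \<Longrightarrow> t \<in> carrier TG \<Longrightarrow> s \<in> H \<Longrightarrow> t \<in> H \<Longrightarrow> s \<otimes>\<^bsub>TG\<^esub> t \<in> H"
  shows "carrier TG \<subseteq> H"
proof
  fix s assume "s \<in> carrier TG"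
  then obtain c where c: "Poly_Mapping.keys c \<subseteq> pairs" "s = tc c" by (auto simp: carrier_TG)
  \<comment> \<open>The induction proceeds by differences while \<open>H\<close> is closed under
    sums, hence the claim includes \<open>- c\<close>.\<close>
  from c(1) have "Poly_Mapping.keys c \<subseteq> pairs \<and> tc c \<in> H \<and> tc (- c) \<in> H"
  proof (induction c rule: frag_induction)
    case zero
    then show ?case using z by (simp add: one_TG)
  next
    case (one a)
    then show ?case using gen tc_uminus_pure by (cases a) auto
  next
    case (diff c d)
    then have "Poly_Mapping.keys c \<subseteq> pairs" "Poly_Mapping.keys d \<subseteq> pairs" by blast+
    then have cd: "tc c \<in> carrier TG" "tc d \<in> carrier TG" "tc (- c) \<in> carrier TG" "tc (- d) \<in> carrier TG"
      "Poly_Mapping.keys (c - d) \<subseteq> pairs"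
      by (intro tc_closed keys_diff_subset; simp)+
    show ?case
      using add[OF cd(1,4)] add[OF cd(3,2)] cd(5) diff by (simp add: mult_TG)
  qed
  then show "s \<in> H" using c(2) by simp
qed

lemma tensor_universal:
  assumes H: "comm_group H"
    and \<beta>: "\<And>x y. x \<in> carrier M \<Longrightarrow> y \<in> carrier N \<Longrightarrow> \<beta> x y \<in> carrier H"
      "\<And>x x' y. x \<in> carrier M \<Longrightarrow> x' \<in> carrier M \<Longrightarrow> y \<in> carrier N \<Longrightarrow> \<beta> (x \<oplus>\<^bsub>M\<^esub> x') y = \<beta> x y \<otimes>\<^bsub>H\<^esub> \<beta> x' y"
      "\<And>x y y'. x \<in> carrier M \<Longrightarrow> y \<in> carrier N \<Longrightarrow> y' \<in> carrier N \<Longrightarrow> \<beta> x (y \<oplus>\<^bsub>N\<^esub> y') = \<beta> x y \<otimes>\<^bsub>H\<^esub> \<beta> x y'"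
      "\<And>k x y. k \<in> carrier K \<Longrightarrow> x \<in> carrier M \<Longrightarrow> y \<in> carrier N \<Longrightarrow> \<beta> (k \<odot>\<^bsub>M\<^esub> x) y = \<beta> x (k \<odot>\<^bsub>N\<^esub> y)"
  obtains F where "F \<in> hom TG H" "\<And>x y. x \<in> carrier M \<Longrightarrow> y \<in> carrier N \<Longrightarrow> F (pure x y) = \<beta> x y"
proof -
  interpret H: comm_group H by fact
  let ?G = "free_Abelian_group pairs"
  obtain h where h: "h \<in> hom ?G H" "\<And>a. a \<in> pairs \<Longrightarrow> h (frag_of a) = \<beta> (fst a) (snd a)"
    by (rule comm_group.free_Abelian_group_universal[OF H, of "\<lambda>a. \<beta> (fst a) (snd a)" pairs])
      (use \<beta>(1) in auto)
  interpret h: group_hom ?G H h by (intro group_hom.intro group_hom_axioms.intro h(1) H.is_group) auto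
  have h_diff: "h (c - d) = h c \<otimes>\<^bsub>H\<^esub> inv\<^bsub>H\<^esub> h d" if "Poly_Mapping.keys c \<subseteq> pairs" "Poly_Mapping.keys d \<subseteq> pairs" for c d
    using h.hom_mult[of c "- d"] h.hom_inv[of d] that by simp
  have hc: "h c \<in> carrier H" if "Poly_Mapping.keys c \<subseteq> pairs" for c
    using h.hom_closed[of c] that by simp
  \<comment> \<open>The condition on keys is carried along because \<open>h\<close> is a
    homomorphism only on formal sums of the given pairs.\<close>
  have kill: "Poly_Mapping.keys c \<subseteq> pairs \<and> h c = \<one>\<^bsub>H\<^esub>" if "c \<in> Rel" for c
    using that
  proof (induction c rule: Rel_induct)
    case zero
    then show ?case using h.hom_one by simp
  next
    case (add_left x x' y)
    then have k: "frag_of (x \<oplus>\<^bsub>M\<^esub> x', y) - frag_of (x, y) - frag_of (x', y) \<in> Rel" by (intro Rel_relators)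
    have k': "Poly_Mapping.keys (frag_of (x \<oplus>\<^bsub>M\<^esub> x', y) - frag_of (x, y)) \<subseteq> pairs"
      by (intro keys_diff_subset) (use add_left in auto)
    have *: "\<beta> x y \<in> carrier H" "\<beta> x' y \<in> carrier H" using add_left \<beta>(1) by auto
    have "h (frag_of (x \<oplus>\<^bsub>M\<^esub> x', y) - frag_of (x, y) - frag_of (x', y)) =
        (\<beta> (x \<oplus>\<^bsub>M\<^esub> x') y \<otimes>\<^bsub>H\<^esub> inv\<^bsub>H\<^esub> \<beta> x y) \<otimes>\<^bsub>H\<^esub> inv\<^bsub>H\<^esub> \<beta> x' y"
      using add_left h(2) by (subst h_diff[OF k'], simp, subst h_diff) auto
    also have "\<dots> = (\<beta> x y \<otimes>\<^bsub>H\<^esub> inv\<^bsub>H\<^esub> \<beta> x y) \<otimes>\<^bsub>H\<^esub> (\<beta> x' y \<otimes>\<^bsub>H\<^esub> inv\<^bsub>H\<^esub> \<beta> x' y)"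
      using \<beta>(2)[OF add_left] * by (simp only: H.m_ac H.m_closed H.inv_closed)
    also have "\<dots> = \<one>\<^bsub>H\<^esub>" using * by simp
    finally show ?case using Rel_keys[OF k] by simp
  next
    case (add_right x y y')
    then have k: "frag_of (x, y \<oplus>\<^bsub>N\<^esub> y') - frag_of (x, y) - frag_of (x, y') \<in> Rel" by (intro Rel_relators)
    have k': "Poly_Mapping.keys (frag_of (x, y \<oplus>\<^bsub>N\<^esub> y') - frag_of (x, y)) \<subseteq> pairs"
      by (intro keys_diff_subset) (use add_right in auto)
    have *: "\<beta> x y \<in> carrier H" "\<beta> x y' \<in> carrier H" using add_right \<beta>(1) by auto
    have "h (frag_of (x, y \<oplus>\<^bsub>N\<^esub> y') - frag_of (x, y) - frag_of (x, y')) =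
        (\<beta> x (y \<oplus>\<^bsub>N\<^esub> y') \<otimes>\<^bsub>H\<^esub> inv\<^bsub>H\<^esub> \<beta> x y) \<otimes>\<^bsub>H\<^esub> inv\<^bsub>H\<^esub> \<beta> x y'"
      using add_right h(2) by (subst h_diff[OF k'], simp, subst h_diff) auto
    also have "\<dots> = (\<beta> x y \<otimes>\<^bsub>H\<^esub> inv\<^bsub>H\<^esub> \<beta> x y) \<otimes>\<^bsub>H\<^esub> (\<beta> x y' \<otimes>\<^bsub>H\<^esub> inv\<^bsub>H\<^esub> \<beta> x y')"
      using \<beta>(3)[OF add_right] * by (simp only: H.m_ac H.m_closed H.inv_closed)
    also have "\<dots> = \<one>\<^bsub>H\<^esub>" using * by simp
    finally show ?case using Rel_keys[OF k] by simp
  next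
    case (balanced k x y)
    then have r: "frag_of (k \<odot>\<^bsub>M\<^esub> x, y) - frag_of (x, k \<odot>\<^bsub>N\<^esub> y) \<in> Rel" by (intro Rel_relators)
    have "h (frag_of (k \<odot>\<^bsub>M\<^esub> x, y) - frag_of (x, k \<odot>\<^bsub>N\<^esub> y)) = \<beta> (k \<odot>\<^bsub>M\<^esub> x) y \<otimes>\<^bsub>H\<^esub> inv\<^bsub>H\<^esub> \<beta> x (k \<odot>\<^bsub>N\<^esub> y)"
      using balanced h(2) by (subst h_diff) auto
    also have "\<dots> = \<one>\<^bsub>H\<^esub>" using \<beta>(4)[OF balanced] \<beta>(1) balanced by simp
    finally show ?case using Rel_keys[OF r] by simp
  next
    case (diff c d)
    then have k: "Poly_Mapping.keys c \<subseteq> pairs" "Poly_Mapping.keys d \<subseteq> pairs" by blast+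
    have "h (c - d) = \<one>\<^bsub>H\<^esub>" using h_diff[OF k] diff by simp
    with keys_diff_subset[OF k] show ?case by (rule conjI)
  qed
  have "h c = h d" if "Poly_Mapping.keys c \<subseteq> pairs" "Poly_Mapping.keys d \<subseteq> pairs" "tc c = tc d" for c d
  proof -
    have "h (c - d) = \<one>\<^bsub>H\<^esub>" using kill that(3) by (simp add: tc_eq_iff)
    then show ?thesis using h_diff[OF that(1,2)] hc that H.inv_solve_right'[of "\<one>\<^bsub>H\<^esub>" "h c" "h d"] by auto
  qed
  then obtain F where F: "F \<in> hom TG H" "\<And>c. Poly_Mapping.keys c \<subseteq> pairs \<Longrightarrow> F (tc c) = h c"
    using FactGroup_universal[OF h(1) comm_group.subgroup_imp_normal[OF abelian_free_Abelian_group Rel_subgroup]]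
    unfolding tensor_group_def tensor_coset_def by (metis carrier_free_Abelian_group_iff)
  show thesis
    by (rule that[OF F(1)]) (use F(2) h(2) in auto)
qed

end

section \<open>Actions of one tensor product on another\<close>

lemma frag_act_diff_left: "frag_act f g (c - c') d = frag_act f g c d - frag_act f g c' d"
  by (simp add: frag_act_def frag_extend_diff)

lemma frag_act_diff_right: "frag_act f g c (d - d') = frag_act f g c d - frag_act f g c d'"
proof -
  have "Poly_Mapping.keys c \<subseteq> UNIV" by simp
  then show ?thesis
  proof (induction c rule: frag_induction)
    case (diff a b)
    then show ?case by (simp add: frag_act_diff_left)
  qed (auto simp: frag_act_def frag_extend_diff split: prod.split)
qed

lemma frag_act_zero [simp]: "frag_act f g 0 d = 0" "frag_act f g c 0 = 0"
  using frag_act_diff_left[of f g 0 0 d] frag_act_diff_right[of f g c 0 0] by simp_all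

lemma frag_act_add_left: "frag_act f g (c + c') d = frag_act f g c d + frag_act f g c' d"
  using frag_act_diff_left[of f g c "- c'" d] frag_act_diff_left[of f g 0 c' d] by simp

lemma frag_act_add_right: "frag_act f g c (d + d') = frag_act f g c d + frag_act f g c d'"
  using frag_act_diff_right[of f g c d "- d'"] frag_act_diff_right[of f g c 0 d'] by simp

lemma frag_act_of [simp]: "frag_act f g (frag_of (a, b)) (frag_of (x, y)) = frag_of (f a x, g b y)"
  by (simp add: frag_act_def)

lemma keys_frag_act:
  assumes "Poly_Mapping.keys c \<subseteq> S" "Poly_Mapping.keys d \<subseteq> T"
    and "\<And>a b x y. (a, b) \<in> S \<Longrightarrow> (x, y) \<in> T \<Longrightarrow> (f a x, g b y) \<in> U"
  shows "Poly_Mapping.keys (frag_act f g c d) \<subseteq> U"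
proof
  fix z assume "z \<in> Poly_Mapping.keys (frag_act f g c d)"
  then obtain a b where ab: "(a, b) \<in> Poly_Mapping.keys c"
    "z \<in> Poly_Mapping.keys (frag_extend (\<lambda>(x, y). frag_of (f a x, g b y)) d)"
    unfolding frag_act_def using keys_frag_extend by fastforce
  then obtain x y where "(x, y) \<in> Poly_Mapping.keys d" "z \<in> Poly_Mapping.keys (frag_of (f a x, g b y))"
    using keys_frag_extend by fastforce
  then show "z \<in> U"
    using assms(3)[OF subsetD[OF assms(1) ab(1)] subsetD[OF assms(2), of "(x, y)"]] by simp
qed

text \<open>A common setting for the multiplication of \<open>A \<otimes> B\<close> and for its
  action on \<open>L \<otimes> N\<close>, whose compatibility with the relations is the same
  argument.\<close>

locale tensor_action = P: tensor_pair K A B + Q: tensor_pair K M N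
  for K :: "('k, 'u) ring_scheme" and A :: "('k, 'a, 'v) module_scheme" and B :: "('k, 'b, 'w) module_scheme"
    and M :: "('k, 'm, 'x) module_scheme" and N :: "('k, 'n, 'y) module_scheme" +
  fixes f :: "'a \<Rightarrow> 'm \<Rightarrow> 'm" and g :: "'b \<Rightarrow> 'n \<Rightarrow> 'n"
  assumes f_hom: "\<And>a. a \<in> carrier A \<Longrightarrow> f a \<in> module_hom K M M"
    and f_add: "\<And>a a' x. a \<in> carrier A \<Longrightarrow> a' \<in> carrier A \<Longrightarrow> x \<in> carrier M \<Longrightarrow>
      f (a \<oplus>\<^bsub>A\<^esub> a') x = f a x \<oplus>\<^bsub>M\<^esub> f a' x"
    and f_smult: "\<And>k a x. k \<in> carrier K \<Longrightarrow> a \<in> carrier A \<Longrightarrow> x \<in> carrier M \<Longrightarrow>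
      f (k \<odot>\<^bsub>A\<^esub> a) x = k \<odot>\<^bsub>M\<^esub> f a x"
    and g_hom: "\<And>b. b \<in> carrier B \<Longrightarrow> g b \<in> module_hom K N N"
    and g_add: "\<And>b b' y. b \<in> carrier B \<Longrightarrow> b' \<in> carrier B \<Longrightarrow> y \<in> carrier N \<Longrightarrow>
      g (b \<oplus>\<^bsub>B\<^esub> b') y = g b y \<oplus>\<^bsub>N\<^esub> g b' y"
    and g_smult: "\<And>k b y. k \<in> carrier K \<Longrightarrow> b \<in> carrier B \<Longrightarrow> y \<in> carrier N \<Longrightarrow>
      g (k \<odot>\<^bsub>B\<^esub> b) y = k \<odot>\<^bsub>N\<^esub> g b y"
begin

lemmas f_closed = module_homD(1)[OF f_hom] and g_closed = module_homD(1)[OF g_hom]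

lemma keys_act:
  "Poly_Mapping.keys c \<subseteq> P.pairs \<Longrightarrow> Poly_Mapping.keys d \<subseteq> Q.pairs \<Longrightarrow>
    Poly_Mapping.keys (frag_act f g c d) \<subseteq> Q.pairs"
  by (rule keys_frag_act) (auto intro: f_closed g_closed)

lemma act_Rel_right:
  assumes c: "Poly_Mapping.keys c \<subseteq> P.pairs" and d: "d \<in> Q.Rel"
  shows "frag_act f g c d \<in> Q.Rel"
  using c
proof (induction c rule: frag_induction)
  case zero
  then show ?case by (simp add: Q.Rel_zero)
next
  case (diff c c')
  then show ?case by (simp add: frag_act_diff_left Q.Rel_diff)
next
  case (one a)
  then obtain a1 b1 where a: "a = (a1, b1)" "a1 \<in> carrier A" "b1 \<in> carrier B" by (cases a) auto
  note fD = module_homD[OF f_hom[OF a(2)]] and gD = module_homD[OF g_hom[OF a(3)]]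
  show ?case
    unfolding a(1) using d
  proof (induction d rule: Q.Rel_induct)
    case zero
    then show ?case by (simp add: Q.Rel_zero)
  next
    case (add_left x x' y)
    then show ?case
      using Q.Rel_relators(1)[of "f a1 x" "f a1 x'" "g b1 y"] fD gD by (simp add: frag_act_diff_right)
  next
    case (add_right x y y')
    then show ?case
      using Q.Rel_relators(2)[of "f a1 x" "g b1 y" "g b1 y'"] fD gD by (simp add: frag_act_diff_right)
  next
    case (balanced k x y)
    then show ?case
      using Q.Rel_relators(3)[of k "f a1 x" "g b1 y"] fD gD by (simp add: frag_act_diff_right)
  next
    case (diff c d)
    then show ?case by (simp add: frag_act_diff_right Q.Rel_diff)
  qed
qed

lemma act_Rel_left:
  assumes c: "c \<in> P.Rel" and d: "Poly_Mapping.keys d \<subseteq> Q.pairs"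
  shows "frag_act f g c d \<in> Q.Rel"
  using d
proof (induction d rule: frag_induction)
  case zero
  then show ?case by (simp add: Q.Rel_zero)
next
  case (diff d d')
  then show ?case by (simp add: frag_act_diff_right Q.Rel_diff)
next
  case (one a)
  then obtain x y where a: "a = (x, y)" "x \<in> carrier M" "y \<in> carrier N" by (cases a) auto
  show ?case
    unfolding a(1) using c
  proof (induction c rule: P.Rel_induct)
    case zero
    then show ?case by (simp add: Q.Rel_zero)
  next
    case (add_left a1 a2 b)
    then show ?case
      using Q.Rel_relators(1)[of "f a1 x" "f a2 x" "g b y"] a(2,3) f_add f_closed g_closed
      by (simp add: frag_act_diff_left)
  next
    case (add_right a1 b1 b2)
    then show ?case
      using Q.Rel_relators(2)[of "f a1 x" "g b1 y" "g b2 y"] a(2,3) g_add f_closed g_closed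
      by (simp add: frag_act_diff_left)
  next
    case (balanced k a1 b1)
    then show ?case
      using Q.Rel_relators(3)[of k "f a1 x" "g b1 y"] a(2,3) f_smult g_smult f_closed g_closed
      by (simp add: frag_act_diff_left)
  next
    case (diff c d)
    then show ?case by (simp add: frag_act_diff_left Q.Rel_diff)
  qed
qed

text \<open>Changing either representative changes the result by a relation, so all members of the
  union are one coset.\<close>

lemma act_tc:
  assumes c: "Poly_Mapping.keys c \<subseteq> P.pairs" and d: "Poly_Mapping.keys d \<subseteq> Q.pairs"
  shows "(\<Union>c\<in>P.tc c. \<Union>d\<in>Q.tc d. Q.tc (frag_act f g c d)) = Q.tc (frag_act f g c d)"
proof -
  have "Q.tc (frag_act f g c' d') = Q.tc (frag_act f g c d)" if c': "c' \<in> P.tc c" and d': "d' \<in> Q.tc d" for c' d'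
  proof -
    have cR: "c' - c \<in> P.Rel" and dR: "d' - d \<in> Q.Rel" using c' d' by (simp_all add: P.mem_tc Q.mem_tc)
    have "Poly_Mapping.keys ((d' - d) + d) \<subseteq> Q.pairs"
      by (rule Q.keys_add_subset[OF Q.Rel_keys[OF dR] d])
    then have kd': "Poly_Mapping.keys d' \<subseteq> Q.pairs" by simp
    have "frag_act f g c' d' - frag_act f g c d = frag_act f g (c' - c) d' + frag_act f g c (d' - d)"
      by (simp add: frag_act_diff_left frag_act_diff_right)
    also have "\<dots> \<in> Q.Rel" by (intro Q.Rel_add act_Rel_left[OF cR kd'] act_Rel_right[OF c dR])
    finally show ?thesis by (simp add: Q.tc_eq_iff)
  qed
  moreover have "c \<in> P.tc c" "d \<in> Q.tc d" using P.Rel_zero Q.Rel_zero by (simp_all add: P.mem_tc Q.mem_tc)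
  ultimately show ?thesis by blast
qed

end

section \<open>Restriction of scalars and linear functionals\<close>

lemma restrict_scalars_simps [simp]:
  "carrier (restrict_scalars A L) = carrier L" "\<zero>\<^bsub>restrict_scalars A L\<^esub> = \<zero>\<^bsub>L\<^esub>"
  "add (restrict_scalars A L) = add L"
  "k \<odot>\<^bsub>restrict_scalars A L\<^esub> x = (k \<odot>\<^bsub>A\<^esub> \<one>\<^bsub>A\<^esub>) \<odot>\<^bsub>L\<^esub> x"
  by (simp_all add: restrict_scalars_def)

lemma module_restrict_scalars:
  assumes A: "algebra K A" and L: "module A L"
  shows "module K (restrict_scalars A L)"
proof -
  interpret A: algebra K A by fact
  interpret L: module A L by fact
  have "abelian_group (restrict_scalars A L)"
    by (rule abelian_groupI) (auto simp: L.M.a_ac intro: bexI[of _ "\<ominus>\<^bsub>L\<^esub> x" for x] L.M.l_neg)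
  moreover have "(k \<otimes>\<^bsub>K\<^esub> k') \<odot>\<^bsub>A\<^esub> \<one>\<^bsub>A\<^esub> = (k \<odot>\<^bsub>A\<^esub> \<one>\<^bsub>A\<^esub>) \<otimes>\<^bsub>A\<^esub> (k' \<odot>\<^bsub>A\<^esub> \<one>\<^bsub>A\<^esub>)"
    if "k \<in> carrier K" "k' \<in> carrier K" for k k'
    using that A.smult_assoc1 A.smult_assoc2[of k "\<one>\<^bsub>A\<^esub>" "k' \<odot>\<^bsub>A\<^esub> \<one>\<^bsub>A\<^esub>"] by simp
  ultimately show ?thesis
    by (intro moduleI A.R_cring)
      (auto simp: A.smult_l_distr L.smult_l_distr L.smult_r_distr L.smult_assoc1)
qed

lemma compatible_restrict_scalars:
  assumes A: "algebra K A" and L: "module A L"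
  shows "compatible_module A L K (restrict_scalars A L)"
proof (intro compatible_module.intro compatible_module_axioms.intro L module_restrict_scalars[OF A L])
  interpret A: algebra K A by fact
  show "(\<lambda>x. k \<odot>\<^bsub>restrict_scalars A L\<^esub> x) \<in> module_hom A L L" if "k \<in> carrier K" for k
    using module_hom_smult[OF _ L, of "k \<odot>\<^bsub>A\<^esub> \<one>\<^bsub>A\<^esub>"] that by simp
qed simp_all

text \<open>A pseudo-inverse \<open>s\<close> of the map \<open>k \<mapsto> k x\<close> satisfies
  \<open>(s x) x = x\<close>, so it cannot vanish at a nonzero \<open>x\<close>.\<close>

lemma linear_functional:
  assumes K: "field K" and V: "module K V" and x: "x \<in> carrier V" "x \<noteq> \<zero>\<^bsub>V\<^esub>"
  obtains \<phi> where "\<phi> \<in> module_hom K V (self_module K)" "\<phi> x \<noteq> \<zero>\<^bsub>K\<^esub>"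
proof -
  interpret K: field K by fact
  interpret V: module K V by fact
  have S: "module K (self_module K)" by (rule module_self_module[OF K.is_cring])
  have "(\<lambda>k. k \<odot>\<^bsub>V\<^esub> x) \<in> module_hom K (self_module K) V"
    using x by (intro module_homI) (auto simp: V.smult_l_distr V.smult_assoc1)
  then obtain s where s: "s \<in> module_hom K V (self_module K)"
    "\<And>k. k \<in> carrier K \<Longrightarrow> s (k \<odot>\<^bsub>V\<^esub> x) \<odot>\<^bsub>V\<^esub> x = k \<odot>\<^bsub>V\<^esub> x"
    using linear_pseudo_inverse[OF K S V, of "\<lambda>k. k \<odot>\<^bsub>V\<^esub> x"] by auto
  have "s x \<odot>\<^bsub>V\<^esub> x = x" using s(2)[of "\<one>\<^bsub>K\<^esub>"] x by simp
  then have "s x \<noteq> \<zero>\<^bsub>K\<^esub>" using x by auto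
  then show thesis using that s(1) by blast
qed

text \<open>That \<open>A \<otimes> B\<close> is a ring is part of the hypothesis that it is
  Noetherian; its commutativity and the module structure of \<open>L \<otimes> N\<close> are derived
  here.\<close>

locale tensor_setting = A: algebra K A + B: algebra K B + L: module A L + N: module B N
  for K :: "'k ring" and A :: "('k, 'a) module" and B :: "('k, 'b) module"
    and L :: "('a, 'l) module" and N :: "('b, 'n) module" +
  assumes field: "field K" and ring_R: "ring (tensor_ring K A B)"
begin

abbreviation "R \<equiv> tensor_ring K A B"
abbreviation "T \<equiv> tensor_module K A B L N"
abbreviation "V \<equiv> restrict_scalars A L"
abbreviation "W \<equiv> restrict_scalars B N"

lemmas A_rules = cring.cring_simprules[OF module.axioms(1)[OF L.module_axioms]] and B_rules = cring.cring_simprules[OF module.axioms(1)[OF N.module_axioms]]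

lemma modules: "module K A" "module K B" "module K V" "module K W"
  by (rule A.module B.module module_restrict_scalars[OF A.algebra_axioms L.module_axioms]
      module_restrict_scalars[OF B.algebra_axioms N.module_axioms])+

sublocale RP: tensor_action K A B A B "\<lambda>a x. a \<otimes>\<^bsub>A\<^esub> x" "\<lambda>b y. b \<otimes>\<^bsub>B\<^esub> y"
proof (intro tensor_action.intro tensor_pair.intro tensor_action_axioms.intro modules)
  show "(\<lambda>x. a \<otimes>\<^bsub>A\<^esub> x) \<in> module_hom K A A" if "a \<in> carrier A" for a
    using that A.smult_assoc2[of _ _ a] by (intro module_homI) (auto simp: A_rules)
  show "(\<lambda>x. b \<otimes>\<^bsub>B\<^esub> x) \<in> module_hom K B B" if "b \<in> carrier B" for b
    using that B.smult_assoc2[of _ _ b] by (intro module_homI) (auto simp: B_rules)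
  show "(k \<odot>\<^bsub>A\<^esub> a) \<otimes>\<^bsub>A\<^esub> x = k \<odot>\<^bsub>A\<^esub> (a \<otimes>\<^bsub>A\<^esub> x)"
    if "k \<in> carrier K" "a \<in> carrier A" "x \<in> carrier A" for k a x
    using that by (rule A.smult_assoc2)
  show "(k \<odot>\<^bsub>B\<^esub> b) \<otimes>\<^bsub>B\<^esub> y = k \<odot>\<^bsub>B\<^esub> (b \<otimes>\<^bsub>B\<^esub> y)"
    if "k \<in> carrier K" "b \<in> carrier B" "y \<in> carrier B" for k b y
    using that by (rule B.smult_assoc2)
qed (auto simp: A_rules B_rules)

sublocale TP: tensor_action K A B V W "\<lambda>a x. a \<odot>\<^bsub>L\<^esub> x" "\<lambda>b y. b \<odot>\<^bsub>N\<^esub> y"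
proof (intro tensor_action.intro tensor_pair.intro tensor_action_axioms.intro modules)
  show "(\<lambda>x. a \<odot>\<^bsub>L\<^esub> x) \<in> module_hom K V V" if "a \<in> carrier A" for a
    using that by (intro module_homI) (auto simp: L.smult_r_distr intro: L.smult_commute)
  show "(\<lambda>x. b \<odot>\<^bsub>N\<^esub> x) \<in> module_hom K W W" if "b \<in> carrier B" for b
    using that by (intro module_homI) (auto simp: N.smult_r_distr intro: N.smult_commute)
  show "(k \<odot>\<^bsub>A\<^esub> a) \<odot>\<^bsub>L\<^esub> x = k \<odot>\<^bsub>V\<^esub> (a \<odot>\<^bsub>L\<^esub> x)" if "k \<in> carrier K" "a \<in> carrier A" "x \<in> carrier V" for k a x
    using that A.smult_assoc2[of k "\<one>\<^bsub>A\<^esub>" a] L.smult_assoc1[of "k \<odot>\<^bsub>A\<^esub> \<one>\<^bsub>A\<^esub>" a x] by simp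
  show "(k \<odot>\<^bsub>B\<^esub> b) \<odot>\<^bsub>N\<^esub> y = k \<odot>\<^bsub>W\<^esub> (b \<odot>\<^bsub>N\<^esub> y)" if "k \<in> carrier K" "b \<in> carrier B" "y \<in> carrier W" for k b y
    using that B.smult_assoc2[of k "\<one>\<^bsub>B\<^esub>" b] N.smult_assoc1[of "k \<odot>\<^bsub>B\<^esub> \<one>\<^bsub>B\<^esub>" b y] by simp
qed (auto simp: L.smult_l_distr N.smult_l_distr)

abbreviation "pR \<equiv> RP.P.pairs"
abbreviation "pT \<equiv> TP.Q.pairs"
abbreviation "tcR \<equiv> tensor_coset K A B"
abbreviation "tcT \<equiv> tensor_coset K V W"

lemma R_simps:
  "carrier R = carrier RP.P.TG" "\<one>\<^bsub>R\<^esub> = RP.P.pure \<one>\<^bsub>A\<^esub> \<one>\<^bsub>B\<^esub>" "\<zero>\<^bsub>R\<^esub> = \<one>\<^bsub>RP.P.TG\<^esub>" "add R = monoid.mult RP.P.TG"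
  by (simp_all add: tensor_ring_def)

lemma T_simps:
  "carrier T = carrier TP.Q.TG" "\<zero>\<^bsub>T\<^esub> = \<one>\<^bsub>TP.Q.TG\<^esub>" "add T = monoid.mult TP.Q.TG"
  by (simp_all add: tensor_module_def Let_def)

lemma R_mult: "Poly_Mapping.keys c \<subseteq> pR \<Longrightarrow> Poly_Mapping.keys d \<subseteq> pR \<Longrightarrow>
    tcR c \<otimes>\<^bsub>R\<^esub> tcR d = tcR (frag_act (monoid.mult A) (monoid.mult B) c d)"
  using RP.act_tc by (simp add: tensor_ring_def)

lemma T_smult: "Poly_Mapping.keys c \<subseteq> pR \<Longrightarrow> Poly_Mapping.keys d \<subseteq> pT \<Longrightarrow>
    tcR c \<odot>\<^bsub>T\<^esub> tcT d = tcT (frag_act (smult L) (smult N) c d)"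
  using TP.act_tc by (simp add: tensor_module_def Let_def)

lemma pure_mult:
  "a \<in> carrier A \<Longrightarrow> b \<in> carrier B \<Longrightarrow> a' \<in> carrier A \<Longrightarrow> b' \<in> carrier B \<Longrightarrow>
    tcR (frag_of (a, b)) \<otimes>\<^bsub>R\<^esub> tcR (frag_of (a', b')) = tcR (frag_of (a \<otimes>\<^bsub>A\<^esub> a', b \<otimes>\<^bsub>B\<^esub> b'))"
  by (subst R_mult) auto

lemma pure_smult:
  "a \<in> carrier A \<Longrightarrow> b \<in> carrier B \<Longrightarrow> l \<in> carrier L \<Longrightarrow> n \<in> carrier N \<Longrightarrow>
    tcR (frag_of (a, b)) \<odot>\<^bsub>T\<^esub> tcT (frag_of (l, n)) = tcT (frag_of (a \<odot>\<^bsub>L\<^esub> l, b \<odot>\<^bsub>N\<^esub> n))"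
  by (subst T_smult) auto

lemma frag_mult_comm:
  assumes c: "Poly_Mapping.keys c \<subseteq> pR" and d: "Poly_Mapping.keys d \<subseteq> pR"
  shows "frag_act (monoid.mult A) (monoid.mult B) c d = frag_act (monoid.mult A) (monoid.mult B) d c"
  using c
proof (induction c rule: frag_induction)
  case (one a)
  show ?case
    using d
  proof (induction d rule: frag_induction)
    case (one b)
    then show ?case using \<open>a \<in> pR\<close> A_rules B_rules by (cases a; cases b) auto
  qed (simp_all add: frag_act_diff_left frag_act_diff_right)
qed (simp_all add: frag_act_diff_left frag_act_diff_right)

text \<open>The identity holds already for formal sums, where additivity in each argument reduces it
  to single pairs.\<close>

lemma frag_act_assoc:
  assumes c: "Poly_Mapping.keys c \<subseteq> pR" and c': "Poly_Mapping.keys c' \<subseteq> pR" and d: "Poly_Mapping.keys d \<subseteq> pT"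
  shows "frag_act (smult L) (smult N) (frag_act (monoid.mult A) (monoid.mult B) c c') d =
    frag_act (smult L) (smult N) c (frag_act (smult L) (smult N) c' d)"
  using c
proof (induction c rule: frag_induction)
  case (one a)
  show ?case
    using c'
  proof (induction c' rule: frag_induction)
    case (one a')
    show ?case
      using d
    proof (induction d rule: frag_induction)
      case (one x)
      then show ?case using \<open>a \<in> pR\<close> \<open>a' \<in> pR\<close> L.smult_assoc1 N.smult_assoc1
        by (cases a; cases a'; cases x) auto
    qed (simp_all add: frag_act_diff_left frag_act_diff_right)
  qed (simp_all add: frag_act_diff_left frag_act_diff_right)
qed (simp_all add: frag_act_diff_left frag_act_diff_right)

lemma frag_act_one:
  assumes d: "Poly_Mapping.keys d \<subseteq> pT"
  shows "frag_act (smult L) (smult N) (frag_of (\<one>\<^bsub>A\<^esub>, \<one>\<^bsub>B\<^esub>)) d = d"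
  using d
proof (induction d rule: frag_induction)
  case (one x)
  then show ?case by (cases x) auto
qed (simp_all add: frag_act_diff_right)

lemma R_elem: "r \<in> carrier R \<Longrightarrow> \<exists>c. Poly_Mapping.keys c \<subseteq> pR \<and> r = tcR c"
  by (auto simp: R_simps RP.P.carrier_TG)

lemma T_elem: "x \<in> carrier T \<Longrightarrow> \<exists>d. Poly_Mapping.keys d \<subseteq> pT \<and> x = tcT d"
  by (auto simp: T_simps TP.Q.carrier_TG)

lemma cring_R: "cring R"
proof (intro cring.intro ring_R)
  interpret R: ring R by (rule ring_R)
  show "comm_monoid R"
  proof (rule R.monoid_comm_monoidI)
    fix r s assume "r \<in> carrier R" "s \<in> carrier R"
    then obtain c d where "Poly_Mapping.keys c \<subseteq> pR" "r = tcR c" "Poly_Mapping.keys d \<subseteq> pR" "s = tcR d"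
      using R_elem by metis
    then show "r \<otimes>\<^bsub>R\<^esub> s = s \<otimes>\<^bsub>R\<^esub> r" by (simp add: R_mult frag_mult_comm)
  qed
qed

lemma abelian_group_T: "abelian_group T"
proof -
  interpret TG: comm_group TP.Q.TG by (rule TP.Q.TG_comm_group)
  show ?thesis
    by (rule abelian_groupI) (auto simp: T_simps TG.m_ac intro: TG.l_inv_ex)
qed

lemma module_T: "module R T"
proof (rule moduleI[OF cring_R abelian_group_T])
  fix r s x y assume rs: "r \<in> carrier R" "s \<in> carrier R" and xy: "x \<in> carrier T" "y \<in> carrier T"
  obtain c where c: "Poly_Mapping.keys c \<subseteq> pR" "r = tcR c" using R_elem[OF rs(1)] by blast
  obtain c' where c': "Poly_Mapping.keys c' \<subseteq> pR" "s = tcR c'" using R_elem[OF rs(2)] by blast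
  obtain d where d: "Poly_Mapping.keys d \<subseteq> pT" "x = tcT d" using T_elem[OF xy(1)] by blast
  obtain d' where d': "Poly_Mapping.keys d' \<subseteq> pT" "y = tcT d'" using T_elem[OF xy(2)] by blast
  show "r \<odot>\<^bsub>T\<^esub> x \<in> carrier T"
    unfolding c(2) d(2) T_smult[OF c(1) d(1)] T_simps by (rule TP.Q.tc_closed[OF TP.keys_act[OF c(1) d(1)]])
  show "(r \<oplus>\<^bsub>R\<^esub> s) \<odot>\<^bsub>T\<^esub> x = r \<odot>\<^bsub>T\<^esub> x \<oplus>\<^bsub>T\<^esub> s \<odot>\<^bsub>T\<^esub> x"
    unfolding c(2) c'(2) d(2) R_simps T_simps RP.P.mult_TG T_smult[OF c(1) d(1)] T_smult[OF c'(1) d(1)]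
      T_smult[OF RP.P.keys_add_subset[OF c(1) c'(1)] d(1)] frag_act_add_left TP.Q.mult_TG ..
  show "r \<odot>\<^bsub>T\<^esub> (x \<oplus>\<^bsub>T\<^esub> y) = r \<odot>\<^bsub>T\<^esub> x \<oplus>\<^bsub>T\<^esub> r \<odot>\<^bsub>T\<^esub> y"
    unfolding c(2) d(2) d'(2) T_simps TP.Q.mult_TG T_smult[OF c(1) d(1)] T_smult[OF c(1) d'(1)]
      T_smult[OF c(1) TP.Q.keys_add_subset[OF d(1) d'(1)]] frag_act_add_right ..
  show "(r \<otimes>\<^bsub>R\<^esub> s) \<odot>\<^bsub>T\<^esub> x = r \<odot>\<^bsub>T\<^esub> (s \<odot>\<^bsub>T\<^esub> x)"
    unfolding c(2) c'(2) d(2) R_mult[OF c(1) c'(1)] T_smult[OF RP.keys_act[OF c(1) c'(1)] d(1)]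
      T_smult[OF c'(1) d(1)] T_smult[OF c(1) TP.keys_act[OF c'(1) d(1)]] frag_act_assoc[OF c(1) c'(1) d(1)] ..
next
  fix x assume "x \<in> carrier T"
  then obtain d where d: "Poly_Mapping.keys d \<subseteq> pT" "x = tcT d" using T_elem by blast
  have one: "Poly_Mapping.keys (frag_of (\<one>\<^bsub>A\<^esub>, \<one>\<^bsub>B\<^esub>)) \<subseteq> pR" by simp
  show "\<one>\<^bsub>R\<^esub> \<odot>\<^bsub>T\<^esub> x = x"
    unfolding d(2) R_simps(2) T_smult[OF one d(1)] frag_act_one[OF d(1)] by (rule refl)
qed

text \<open>The universal property provides functoriality. It also shows that a pure tensor of
  nonzero vectors is nonzero: functionals \<open>\<phi>\<close> and \<open>\<psi>\<close> that do
  not vanish on them multiply to an additive map into \<open>K\<close>, which has no zero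
  divisors.\<close>

lemma tensor_product_T: "tensor_product K V W T (\<lambda>l n. tcT (frag_of (l, n)))"
proof (intro tensor_product.intro tensor_product_axioms.intro modules(3,4) abelian_group_T)
  show "tcT (frag_of (c, d)) \<in> carrier T" if "c \<in> carrier V" "d \<in> carrier W" for c d
    unfolding T_simps by (rule TP.Q.pure_closed[OF that])
  show "tcT (frag_of (c \<oplus>\<^bsub>V\<^esub> c', d)) = tcT (frag_of (c, d)) \<oplus>\<^bsub>T\<^esub> tcT (frag_of (c', d))"
    if "c \<in> carrier V" "c' \<in> carrier V" "d \<in> carrier W" for c c' d
    unfolding T_simps by (rule TP.Q.pure_add_left[OF that])
  show "tcT (frag_of (c, d \<oplus>\<^bsub>W\<^esub> d')) = tcT (frag_of (c, d)) \<oplus>\<^bsub>T\<^esub> tcT (frag_of (c, d'))"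
    if "c \<in> carrier V" "d \<in> carrier W" "d' \<in> carrier W" for c d d'
    unfolding T_simps by (rule TP.Q.pure_add_right[OF that])
  show "carrier T \<subseteq> H"
    if "\<zero>\<^bsub>T\<^esub> \<in> H" "\<And>c d. c \<in> carrier V \<Longrightarrow> d \<in> carrier W \<Longrightarrow> tcT (frag_of (c, d)) \<in> H"
      "\<And>x y. x \<in> carrier T \<Longrightarrow> y \<in> carrier T \<Longrightarrow> x \<in> H \<Longrightarrow> y \<in> H \<Longrightarrow> x \<oplus>\<^bsub>T\<^esub> y \<in> H" for H
    using that unfolding T_simps by (rule TP.Q.tensor_spanning)
  show "\<exists>F. additive_endo T F \<and> (\<forall>c\<in>carrier V. \<forall>d\<in>carrier W.
      F (tcT (frag_of (c, d))) = tcT (frag_of (f c, g d)))"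
    if f: "f \<in> module_hom K V V" and g: "g \<in> module_hom K W W" for f g
  proof -
    note fD = module_homD[OF f] and gD = module_homD[OF g]
    obtain F where F: "F \<in> hom TP.Q.TG TP.Q.TG"
      "\<And>x y. x \<in> carrier V \<Longrightarrow> y \<in> carrier W \<Longrightarrow> F (TP.Q.pure x y) = TP.Q.pure (f x) (g y)"
    proof (rule TP.Q.tensor_universal[OF TP.Q.TG_comm_group, of "\<lambda>x y. TP.Q.pure (f x) (g y)"])
      show "TP.Q.pure (f x) (g y) \<in> carrier TP.Q.TG" if "x \<in> carrier V" "y \<in> carrier W" for x y
        by (rule TP.Q.pure_closed[OF fD(1)[OF that(1)] gD(1)[OF that(2)]])
      show "TP.Q.pure (f (x \<oplus>\<^bsub>V\<^esub> x')) (g y) = TP.Q.pure (f x) (g y) \<otimes>\<^bsub>TP.Q.TG\<^esub> TP.Q.pure (f x') (g y)"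
        if "x \<in> carrier V" "x' \<in> carrier V" "y \<in> carrier W" for x x' y
        unfolding fD(2)[OF that(1,2)]
        by (rule TP.Q.pure_add_left[OF fD(1)[OF that(1)] fD(1)[OF that(2)] gD(1)[OF that(3)]])
      show "TP.Q.pure (f x) (g (y \<oplus>\<^bsub>W\<^esub> y')) = TP.Q.pure (f x) (g y) \<otimes>\<^bsub>TP.Q.TG\<^esub> TP.Q.pure (f x) (g y')"
        if "x \<in> carrier V" "y \<in> carrier W" "y' \<in> carrier W" for x y y'
        unfolding gD(2)[OF that(2,3)]
        by (rule TP.Q.pure_add_right[OF fD(1)[OF that(1)] gD(1)[OF that(2)] gD(1)[OF that(3)]])
      show "TP.Q.pure (f (k \<odot>\<^bsub>V\<^esub> x)) (g y) = TP.Q.pure (f x) (g (k \<odot>\<^bsub>W\<^esub> y))"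
        if "k \<in> carrier K" "x \<in> carrier V" "y \<in> carrier W" for k x y
        unfolding fD(3)[OF that(1,2)] gD(3)[OF that(1,3)]
        by (rule TP.Q.pure_balanced[OF that(1) fD(1)[OF that(2)] gD(1)[OF that(3)]])
    qed (rule that)
    have "additive_endo T F"
      using F(1) unfolding additive_endo_def hom_def T_simps by blast
    then show ?thesis using F(2) by blast
  qed
  show "c = \<zero>\<^bsub>V\<^esub> \<or> d = \<zero>\<^bsub>W\<^esub>"
    if c: "c \<in> carrier V" and d: "d \<in> carrier W" and z: "tcT (frag_of (c, d)) = \<zero>\<^bsub>T\<^esub>" for c d
  proof (rule ccontr)
    assume nz: "\<not> (c = \<zero>\<^bsub>V\<^esub> \<or> d = \<zero>\<^bsub>W\<^esub>)"
    interpret K: field K by (rule field)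
    note K_abelian = module.axioms(1)[OF modules(1), THEN cring.axioms(1), THEN ring.axioms(1)]
    note K_rules = cring.cring_simprules[OF module.axioms(1)[OF modules(1)]]
    obtain \<phi> where \<phi>: "\<phi> \<in> module_hom K V (self_module K)" "\<phi> c \<noteq> \<zero>\<^bsub>K\<^esub>"
      using linear_functional[OF field modules(3) c] nz by blast
    obtain \<psi> where \<psi>: "\<psi> \<in> module_hom K W (self_module K)" "\<psi> d \<noteq> \<zero>\<^bsub>K\<^esub>"
      using linear_functional[OF field modules(4) d] nz by blast
    note \<phi>D = module_homD[OF \<phi>(1), simplified self_module_simps]
      and \<psi>D = module_homD[OF \<psi>(1), simplified self_module_simps]
    obtain F where F: "F \<in> hom TP.Q.TG (add_monoid K)"
      "\<And>x y. x \<in> carrier V \<Longrightarrow> y \<in> carrier W \<Longrightarrow> F (TP.Q.pure x y) = \<phi> x \<otimes>\<^bsub>K\<^esub> \<psi> y"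
      by (rule TP.Q.tensor_universal[OF abelian_group.a_comm_group[OF K_abelian], of "\<lambda>x y. \<phi> x \<otimes>\<^bsub>K\<^esub> \<psi> y"])
        (use \<phi>D \<psi>D in \<open>auto simp: K_rules simp del: restrict_scalars_simps(4)\<close>)
    have "F \<one>\<^bsub>TP.Q.TG\<^esub> = \<zero>\<^bsub>K\<^esub>"
      using hom_one[OF F(1)] comm_group.axioms(2)[OF TP.Q.TG_comm_group] abelian_group.a_group[OF K_abelian] by simp
    then have "\<phi> c \<otimes>\<^bsub>K\<^esub> \<psi> d = \<zero>\<^bsub>K\<^esub>" using F(2)[OF c d] z by (simp add: T_simps)
    then show False
      using K.integral \<phi>(2) \<psi>(2) \<phi>D(1)[OF c] \<psi>D(1)[OF d] by blast
  qed
qed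

end

section \<open>Local cohomology of tensor products\<close>

lemma (in cring) idealI_diff:
  assumes "S \<subseteq> carrier R" "\<zero> \<in> S" and diff: "\<And>a b. a \<in> S \<Longrightarrow> b \<in> S \<Longrightarrow> a \<ominus> b \<in> S"
    and mult: "\<And>x a. x \<in> carrier R \<Longrightarrow> a \<in> S \<Longrightarrow> x \<otimes> a \<in> S"
  shows "ideal S R"
proof (rule idealI[OF ring_axioms])
  have neg: "\<ominus> a \<in> S" if "a \<in> S" for a
    using diff[OF assms(2) that] assms(1) that by (auto simp: a_minus_def)
  show "subgroup S (add_monoid R)"
  proof (rule add.subgroupI)
    show "a \<oplus> b \<in> S" if "a \<in> S" "b \<in> S" for a b
      using diff[OF that(1) neg[OF that(2)]] subsetD[OF assms(1) that(2)] by (simp add: a_minus_def)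
    show "\<ominus> a \<in> S" if "a \<in> S" for a
      using that by (rule neg)
  qed (use assms(1,2) in auto)
  show "x \<otimes> a \<in> S" if "a \<in> S" "x \<in> carrier R" for a x
    using mult that by blast
  show "a \<otimes> x \<in> S" if "a \<in> S" "x \<in> carrier R" for a x
    using mult[OF that(2,1)] m_comm[of a x] that assms(1) by auto
qed

lemma noetherian_ideal_generators:
  assumes R: "noetherian_ring R" and \<aa>: "ideal \<aa> R"
  obtains xs where "set xs \<subseteq> \<aa>" "\<And>I. ideal I R \<Longrightarrow> set xs \<subseteq> I \<Longrightarrow> \<aa> \<subseteq> I"
proof -
  interpret noetherian_ring R by fact
  obtain S where S: "S \<subseteq> carrier R" "finite S" "\<aa> = Idl\<^bsub>R\<^esub> S" using finetely_gen[OF \<aa>] by blast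
  obtain xs where "set xs = S" using finite_list[OF S(2)] by blast
  then show thesis using that[of xs] genideal_self[OF S(1)] genideal_minimal S(3) by simp
qed

text \<open>Nonempty sets attain their infima. An empty set contributes \<open>\<infinity>\<close>,
  which absorbs the other summand.\<close>

lemma Inf_real_of_sums:
  fixes S S' :: "nat set"
  shows "(INF n\<in>{i + j | i j. i \<in> S \<and> j \<in> S'}. ereal (real n)) =
    (INF n\<in>S. ereal (real n)) + (INF n\<in>S'. ereal (real n))"
proof (cases "S = {} \<or> S' = {}")
  case True
  then have "{i + j | i j. i \<in> S \<and> j \<in> S'} = {}" by blast
  then show ?thesis using True by (auto simp: top_ereal_def)
next
  case False
  have least: "(INF n\<in>X. ereal (real n)) = ereal (real m)" if "m \<in> X" "\<And>n. n \<in> X \<Longrightarrow> m \<le> n" for m and X :: "nat set"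
    by (intro antisym INF_greatest INF_lower2[OF that(1)]) (use that(2) in auto)
  define m m' where "m = (LEAST n. n \<in> S)" and "m' = (LEAST n. n \<in> S')"
  have mS: "m \<in> S" "m' \<in> S'" unfolding m_def m'_def using False by (auto intro: LeastI)
  have le: "\<And>n. n \<in> S \<Longrightarrow> m \<le> n" "\<And>n. n \<in> S' \<Longrightarrow> m' \<le> n" unfolding m_def m'_def by (auto intro: Least_le)
  have "(INF n\<in>{i + j | i j. i \<in> S \<and> j \<in> S'}. ereal (real n)) = ereal (real (m + m'))"
    by (rule least) (use mS le in \<open>auto intro: add_mono\<close>)
  then show ?thesis using least[OF mS(1) le(1)] least[OF mS(2) le(2)] by simp
qed

text \<open>An empty set contributes \<open>-\<infinity>\<close>. Finiteness keeps the other
  supremum away from \<open>\<infinity>\<close>, since in \<open>ereal\<close> the sum of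
  \<open>\<infinity>\<close> and \<open>-\<infinity>\<close> is \<open>\<infinity>\<close>.\<close>

lemma Sup_real_of_sums:
  fixes S S' :: "nat set"
  assumes fin: "finite S" "finite S'"
  shows "(SUP n\<in>{i + j | i j. i \<in> S \<and> j \<in> S'}. ereal (real n)) =
    (SUP n\<in>S. ereal (real n)) + (SUP n\<in>S'. ereal (real n))"
proof -
  have greatest: "(SUP n\<in>X. ereal (real n)) = ereal (real m)" if "m \<in> X" "\<And>n. n \<in> X \<Longrightarrow> n \<le> m" for m and X :: "nat set"
    by (intro antisym SUP_least SUP_upper2[OF that(1)]) (use that(2) in auto)
  show ?thesis
  proof (cases "S = {} \<or> S' = {}")
    case True
    then have e: "{i + j | i j. i \<in> S \<and> j \<in> S'} = {}" by blast
    have "(SUP n\<in>X. ereal (real n)) \<noteq> \<infinity>" if "finite X" for X :: "nat set"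
    proof (cases "X = {}")
      case False
      then show ?thesis using greatest[OF Max_in[OF that False]] Max_ge[OF that] by simp
    qed (simp add: bot_ereal_def)
    then show ?thesis using True fin e by (auto simp: bot_ereal_def)
  next
    case False
    have "(SUP n\<in>{i + j | i j. i \<in> S \<and> j \<in> S'}. ereal (real n)) = ereal (real (Max S + Max S'))"
      by (rule greatest) (use fin False in \<open>auto intro: add_mono Max_in\<close>)
    then show ?thesis
      using greatest[of "Max S" S] greatest[of "Max S'" S'] fin False by simp
  qed
qed

section \<open>Generators of the sum ideal\<close>

context tensor_setting begin

lemma koszul_tensor_T: "koszul_tensor A L B N K V W R T (\<lambda>l n. tcT (frag_of (l, n)))"
  by (intro koszul_tensor.intro compatible_restrict_scalars A.algebra_axioms B.algebra_axioms
      L.module_axioms N.module_axioms module_T tensor_product_T)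

lemma R_diff:
  assumes "Poly_Mapping.keys c \<subseteq> pR" "Poly_Mapping.keys d \<subseteq> pR"
  shows "tcR c \<ominus>\<^bsub>R\<^esub> tcR d = tcR (c - d)"
proof -
  interpret R: ring R by (rule ring_R)
  have cl: "tcR x \<in> carrier R" if "Poly_Mapping.keys x \<subseteq> pR" for x
    unfolding R_simps by (rule RP.P.tc_closed[OF that])
  have "tcR (c - d) \<oplus>\<^bsub>R\<^esub> tcR d = tcR c" unfolding R_simps RP.P.mult_TG by simp
  then show ?thesis
    using cl[OF assms(1)] cl[OF assms(2)] cl[OF RP.P.keys_diff_subset[OF assms]]
    by (metis R.add.inv_solve_right R.minus_eq)
qed

lemma tensor_image_eq: "tensor_image K A B U V' = tcR ` {c. Poly_Mapping.keys c \<subseteq> U \<times> V'}"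
  unfolding tensor_image_def by (auto simp: carrier_free_Abelian_group_iff)

lemma ideal_tensor_image:
  assumes U: "ideal U A" and V: "ideal V' B"
  shows "ideal (tensor_image K A B U V') R"
proof -
  interpret R: cring R by (rule cring_R)
  interpret U: ideal U A by fact
  interpret V: ideal V' B by fact
  have sub: "U \<times> V' \<subseteq> pR" using U.a_subset V.a_subset by blast
  show ?thesis
    unfolding tensor_image_eq
  proof (rule R.idealI_diff)
    show "tcR ` {c. Poly_Mapping.keys c \<subseteq> U \<times> V'} \<subseteq> carrier R"
      unfolding R_simps RP.P.carrier_TG using sub by blast
    show "\<zero>\<^bsub>R\<^esub> \<in> tcR ` {c. Poly_Mapping.keys c \<subseteq> U \<times> V'}"
      unfolding R_simps RP.P.one_TG by (rule imageI) simp
    fix a assume "a \<in> tcR ` {c. Poly_Mapping.keys c \<subseteq> U \<times> V'}"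
    then obtain c where c: "Poly_Mapping.keys c \<subseteq> U \<times> V'" "a = tcR c" by blast
    note c' = order_trans[OF c(1) sub]
    {
      fix b assume "b \<in> tcR ` {c. Poly_Mapping.keys c \<subseteq> U \<times> V'}"
      then obtain d where d: "Poly_Mapping.keys d \<subseteq> U \<times> V'" "b = tcR d" by blast
      show "a \<ominus>\<^bsub>R\<^esub> b \<in> tcR ` {c. Poly_Mapping.keys c \<subseteq> U \<times> V'}"
        unfolding c(2) d(2) R_diff[OF c' order_trans[OF d(1) sub]]
        using RP.P.keys_diff_subset[OF c(1) d(1)] by blast
    next
      fix x assume "x \<in> carrier R"
      then obtain d where d: "Poly_Mapping.keys d \<subseteq> pR" "x = tcR d" using R_elem by blast
      have "Poly_Mapping.keys (frag_act (monoid.mult A) (monoid.mult B) d c) \<subseteq> U \<times> V'"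
        by (rule keys_frag_act[OF d(1) c(1)]) (auto intro: U.I_l_closed V.I_l_closed)
      then show "x \<otimes>\<^bsub>R\<^esub> a \<in> tcR ` {c. Poly_Mapping.keys c \<subseteq> U \<times> V'}"
        unfolding c(2) d(2) R_mult[OF d(1) c'] by blast
    }
  qed
qed

lemma tensor_image_subset_ideal:
  assumes Q: "ideal Q R" and UV: "U \<subseteq> carrier A" "V' \<subseteq> carrier B"
    and gen: "\<And>u v. u \<in> U \<Longrightarrow> v \<in> V' \<Longrightarrow> tcR (frag_of (u, v)) \<in> Q"
  shows "tensor_image K A B U V' \<subseteq> Q"
proof
  interpret Q: ideal Q R by fact
  fix z assume "z \<in> tensor_image K A B U V'"
  then obtain c where c: "Poly_Mapping.keys c \<subseteq> U \<times> V'" "z = tcR c" unfolding tensor_image_eq by blast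
  from c(1) have "Poly_Mapping.keys c \<subseteq> pR \<and> tcR c \<in> Q"
  proof (induction c rule: frag_induction)
    case zero
    then show ?case using additive_subgroup.zero_closed[OF ideal.axioms(1)[OF Q]] by (simp add: R_simps RP.P.one_TG)
  next
    case (one a)
    then show ?case using UV gen by (cases a) auto
  next
    case (diff c d)
    then have k: "Poly_Mapping.keys c \<subseteq> pR" "Poly_Mapping.keys d \<subseteq> pR" and "tcR c \<in> Q" "tcR d \<in> Q" by blast+
    then have "tcR c \<ominus>\<^bsub>R\<^esub> tcR d \<in> Q"
      by (simp add: a_minus_def Q.a_closed Q.a_inv_closed)
    then show ?case using RP.P.keys_diff_subset[OF k] R_diff[OF k] by simp
  qed
  then show "z \<in> Q" using c(2) by simp
qed

text \<open>The preimage of \<open>Q\<close> under the ring homomorphism that sends \<open>a\<close>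
  to \<open>a \<otimes> 1\<close>.\<close>

lemma ideal_contraction_left:
  assumes Q: "ideal Q R"
  shows "ideal {a \<in> carrier A. tcR (frag_of (a, \<one>\<^bsub>B\<^esub>)) \<in> Q} A"
proof -
  have "(\<lambda>a. tcR (frag_of (a, \<one>\<^bsub>B\<^esub>))) \<in> ring_hom A R"
    by (rule ring_hom_memI)
      (simp_all add: R_simps RP.P.pure_closed RP.P.pure_add_left pure_mult B_rules)
  then interpret h: ring_hom_ring A R "\<lambda>a. tcR (frag_of (a, \<one>\<^bsub>B\<^esub>))"
    by (intro ring_hom_ringI2 ring_R cring.axioms(1)[OF module.axioms(1)[OF L.module_axioms]])
  show ?thesis by (rule h.ideal_vimage[OF Q])
qed

lemma ideal_contraction_right:
  assumes Q: "ideal Q R"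
  shows "ideal {b \<in> carrier B. tcR (frag_of (\<one>\<^bsub>A\<^esub>, b)) \<in> Q} B"
proof -
  have "(\<lambda>b. tcR (frag_of (\<one>\<^bsub>A\<^esub>, b))) \<in> ring_hom B R"
    by (rule ring_hom_memI)
      (simp_all add: R_simps RP.P.pure_closed RP.P.pure_add_right pure_mult A_rules)
  then interpret h: ring_hom_ring B R "\<lambda>b. tcR (frag_of (\<one>\<^bsub>A\<^esub>, b))"
    by (intro ring_hom_ringI2 ring_R cring.axioms(1)[OF module.axioms(1)[OF N.module_axioms]])
  show ?thesis by (rule h.ideal_vimage[OF Q])
qed

abbreviation "sum_ideal I J \<equiv> tensor_image K A B I (carrier B) <+>\<^bsub>R\<^esub> tensor_image K A B (carrier A) J"

text \<open>An ideal \<open>Q\<close> that contains the listed elements contracts to an ideal of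
  \<open>A\<close> containing the generators of \<open>I\<close>, hence all of \<open>I\<close>, and
  likewise for \<open>J\<close>. Then \<open>i \<otimes> b\<close> lies in \<open>Q\<close> as the
  multiple of \<open>i \<otimes> 1\<close> by \<open>1 \<otimes> b\<close>, and symmetrically for
  \<open>a \<otimes> j\<close>.\<close>

lemma sum_ideal_generators:
  assumes I: "ideal I A" and J: "ideal J B"
    and xs: "set xs \<subseteq> I" "\<And>Q. ideal Q A \<Longrightarrow> set xs \<subseteq> Q \<Longrightarrow> I \<subseteq> Q"
    and ys: "set ys \<subseteq> J" "\<And>Q. ideal Q B \<Longrightarrow> set ys \<subseteq> Q \<Longrightarrow> J \<subseteq> Q"
  defines "zs \<equiv> map (\<lambda>x. tcR (frag_of (x, \<one>\<^bsub>B\<^esub>))) xs @ map (\<lambda>y. tcR (frag_of (\<one>\<^bsub>A\<^esub>, y))) ys"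
  shows "ideal (sum_ideal I J) R" "set zs \<subseteq> sum_ideal I J"
    "\<And>Q. ideal Q R \<Longrightarrow> set zs \<subseteq> Q \<Longrightarrow> sum_ideal I J \<subseteq> Q"
proof -
  interpret R: cring R by (rule cring_R)
  interpret I: ideal I A by fact
  interpret J: ideal J B by fact
  have oA: "ideal (carrier A) A" and oB: "ideal (carrier B) B"
    using ring.oneideal[OF cring.axioms(1)[OF module.axioms(1)[OF L.module_axioms]]]
      ring.oneideal[OF cring.axioms(1)[OF module.axioms(1)[OF N.module_axioms]]] .
  have i1: "ideal (tensor_image K A B I (carrier B)) R" and i2: "ideal (tensor_image K A B (carrier A) J) R"
    using ideal_tensor_image I J oA oB by blast+
  interpret i1: ideal "tensor_image K A B I (carrier B)" R by (rule i1)
  interpret i2: ideal "tensor_image K A B (carrier A) J" R by (rule i2)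
  show "ideal (sum_ideal I J) R" by (rule R.add_ideals[OF i1 i2])
  have incl: "a \<in> sum_ideal I J" if "a \<in> tensor_image K A B I (carrier B) \<or> a \<in> tensor_image K A B (carrier A) J" for a
    using that
  proof
    assume a: "a \<in> tensor_image K A B I (carrier B)"
    then have "a = a \<oplus>\<^bsub>R\<^esub> \<zero>\<^bsub>R\<^esub>" using i1.a_subset R.r_zero[of a] by fastforce
    moreover have "\<zero>\<^bsub>R\<^esub> \<in> tensor_image K A B (carrier A) J"
      by (rule additive_subgroup.zero_closed[OF ideal.axioms(1)[OF i2]])
    ultimately show ?thesis unfolding set_add_def' using a by blast
  next
    assume a: "a \<in> tensor_image K A B (carrier A) J"
    then have "a = \<zero>\<^bsub>R\<^esub> \<oplus>\<^bsub>R\<^esub> a" using i2.a_subset R.l_zero[of a] by fastforce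
    moreover have "\<zero>\<^bsub>R\<^esub> \<in> tensor_image K A B I (carrier B)"
      by (rule additive_subgroup.zero_closed[OF ideal.axioms(1)[OF i1]])
    ultimately show ?thesis unfolding set_add_def' using a by blast
  qed
  show "set zs \<subseteq> sum_ideal I J"
  proof
    fix z assume "z \<in> set zs"
    then consider x where "x \<in> set xs" "z = tcR (frag_of (x, \<one>\<^bsub>B\<^esub>))"
      | y where "y \<in> set ys" "z = tcR (frag_of (\<one>\<^bsub>A\<^esub>, y))" unfolding zs_def by auto
    then show "z \<in> sum_ideal I J"
    proof cases
      case 1
      then show ?thesis using xs(1) unfolding tensor_image_eq[symmetric]
        by (intro incl disjI1) (auto simp: tensor_image_eq)
    next
      case 2
      then show ?thesis using ys(1)
        by (intro incl disjI2) (auto simp: tensor_image_eq)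
    qed
  qed
  fix Q assume Q: "ideal Q R" and zs: "set zs \<subseteq> Q"
  interpret Q: ideal Q R by fact
  have "I \<subseteq> {a \<in> carrier A. tcR (frag_of (a, \<one>\<^bsub>B\<^esub>)) \<in> Q}"
    by (rule xs(2)[OF ideal_contraction_left[OF Q]])
      (use xs(1) I.a_subset zs in \<open>auto simp: zs_def image_subset_iff\<close>)
  then have inI: "tcR (frag_of (i, \<one>\<^bsub>B\<^esub>)) \<in> Q" if "i \<in> I" for i using that by blast
  have "J \<subseteq> {b \<in> carrier B. tcR (frag_of (\<one>\<^bsub>A\<^esub>, b)) \<in> Q}"
    by (rule ys(2)[OF ideal_contraction_right[OF Q]])
      (use ys(1) J.a_subset zs in \<open>auto simp: zs_def image_subset_iff\<close>)
  then have inJ: "tcR (frag_of (\<one>\<^bsub>A\<^esub>, j)) \<in> Q" if "j \<in> J" for j using that by blast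
  have "tensor_image K A B I (carrier B) \<subseteq> Q"
  proof (rule tensor_image_subset_ideal[OF Q I.a_subset order_refl])
    fix i b assume ib: "i \<in> I" "b \<in> carrier B"
    then have iA: "i \<in> carrier A" using I.a_subset by blast
    have "tcR (frag_of (\<one>\<^bsub>A\<^esub>, b)) \<otimes>\<^bsub>R\<^esub> tcR (frag_of (i, \<one>\<^bsub>B\<^esub>)) \<in> Q"
      by (rule Q.I_l_closed[OF inI[OF ib(1)]]) (use ib in \<open>simp add: R_simps RP.P.pure_closed\<close>)
    then show "tcR (frag_of (i, b)) \<in> Q" using ib iA by (simp add: pure_mult A_rules B_rules)
  qed
  moreover have "tensor_image K A B (carrier A) J \<subseteq> Q"
  proof (rule tensor_image_subset_ideal[OF Q order_refl J.a_subset])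
    fix a j assume aj: "a \<in> carrier A" "j \<in> J"
    then have jB: "j \<in> carrier B" using J.a_subset by blast
    have "tcR (frag_of (a, \<one>\<^bsub>B\<^esub>)) \<otimes>\<^bsub>R\<^esub> tcR (frag_of (\<one>\<^bsub>A\<^esub>, j)) \<in> Q"
      by (rule Q.I_l_closed[OF inJ[OF aj(2)]]) (use aj in \<open>simp add: R_simps RP.P.pure_closed\<close>)
    then show "tcR (frag_of (a, j)) \<in> Q" using aj jB by (simp add: pure_mult A_rules B_rules)
  qed
  ultimately show "sum_ideal I J \<subseteq> Q"
    unfolding set_add_def' using Q.a_closed by blast
qed

end

section \<open>Degrees of nonzero local cohomology\<close>

lemma (in module) cech_vanishes_negative:
  assumes xs: "set xs \<subseteq> carrier R" and "n < 0"
  shows "cech_vanishes R M xs n"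
  unfolding cech_vanishes_iff
proof (intro allI ballI impI)
  fix k c assume "c \<in> koszul_chains M (length xs) n"
  then have "c = (\<lambda>_. \<zero>\<^bsub>M\<^esub>)" using assms(2) by (rule koszul_chains_negative)
  then show "eventually_exact xs k n c" using eventually_exact_zero[OF xs] by simp
qed

abbreviation nonzero_degrees :: "('r, 'x) ring_scheme \<Rightarrow> 'r set \<Rightarrow> ('r, 'm, 'y) module_scheme \<Rightarrow> nat set"
  where "nonzero_degrees R \<aa> M \<equiv> {i. carrier (local_cohomology R \<aa> M i) \<noteq> {\<zero>\<^bsub>local_cohomology R \<aa> M i\<^esub>}}"

text \<open>The number of generators of \<open>\<aa>\<close> bounds the degrees; this is the
  finiteness that the addition of suprema requires.\<close>

lemma finite_nonzero_degrees:
  assumes R: "noetherian_ring R" and M: "module R M" and \<aa>: "ideal \<aa> R"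
  shows "finite (nonzero_degrees R \<aa> M)"
proof -
  interpret M: module R M by fact
  obtain xs where xs: "set xs \<subseteq> \<aa>" "\<And>I. ideal I R \<Longrightarrow> set xs \<subseteq> I \<Longrightarrow> \<aa> \<subseteq> I"
    using noetherian_ideal_generators[OF R \<aa>] by blast
  have "nonzero_degrees R \<aa> M \<subseteq> {..length xs}"
  proof
    fix i assume "i \<in> nonzero_degrees R \<aa> M"
    then have "\<not> cech_vanishes R M xs (int i)"
      using local_cohomology_trivial_iff_cech[OF R M \<aa> xs] by simp
    then show "i \<in> {..length xs}"
      using M.cech_vanishes_large[of xs "int i"] xs(1) ideal.axioms(1)[OF \<aa>] additive_subgroup.a_subset by fastforce
  qed
  then show ?thesis using finite_subset by blast
qed

theorem (in tensor_setting) nonzero_degrees_tensor: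
  assumes A: "noetherian_ring A" and B: "noetherian_ring B" and R: "noetherian_ring R"
    and I: "ideal I A" and J: "ideal J B"
  shows "nonzero_degrees R (sum_ideal I J) T =
    {i + j | i j. i \<in> nonzero_degrees A I L \<and> j \<in> nonzero_degrees B J N}"
proof -
  obtain xs where xs: "set xs \<subseteq> I" "\<And>Q. ideal Q A \<Longrightarrow> set xs \<subseteq> Q \<Longrightarrow> I \<subseteq> Q"
    using noetherian_ideal_generators[OF A I] by blast
  obtain ys where ys: "set ys \<subseteq> J" "\<And>Q. ideal Q B \<Longrightarrow> set ys \<subseteq> Q \<Longrightarrow> J \<subseteq> Q"
    using noetherian_ideal_generators[OF B J] by blast
  have xsA: "set xs \<subseteq> carrier A" and ysB: "set ys \<subseteq> carrier B"
    using xs(1) ys(1) additive_subgroup.a_subset[OF ideal.axioms(1)[OF I]]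
      additive_subgroup.a_subset[OF ideal.axioms(1)[OF J]] by blast+
  define xs' ys' where "xs' = map (\<lambda>x. tcR (frag_of (x, \<one>\<^bsub>B\<^esub>))) xs" and "ys' = map (\<lambda>y. tcR (frag_of (\<one>\<^bsub>A\<^esub>, y))) ys"
  interpret KT: koszul_tensor A L B N K V W R T "\<lambda>l n. tcT (frag_of (l, n))"
    by (rule koszul_tensor_T)
  have l: "list_all2 KT.acts_left xs xs'"
    using xsA unfolding xs'_def KT.acts_left_def
    by (auto simp: list.rel_map list_all2_same R_simps RP.P.pure_closed pure_smult)
  have r: "list_all2 KT.acts_right ys ys'"
    using ysB unfolding ys'_def KT.acts_right_def
    by (auto simp: list.rel_map list_all2_same R_simps RP.P.pure_closed pure_smult)
  note gen = sum_ideal_generators[OF I J xs ys, folded xs'_def ys'_def]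
  have T_iff: "n \<in> nonzero_degrees R (sum_ideal I J) T \<longleftrightarrow>
      (\<exists>i j. i + j = int n \<and> \<not> cech_vanishes A L xs i \<and> \<not> cech_vanishes B N ys j)" for n
    using local_cohomology_trivial_iff_cech[OF R module_T gen, of n] KT.kunneth_vanishing[OF field l r, of "int n"]
    by auto
  have L_iff: "n \<in> nonzero_degrees A I L \<longleftrightarrow> \<not> cech_vanishes A L xs (int n)" for n
    using local_cohomology_trivial_iff_cech[OF A L.module_axioms I xs] by simp
  have N_iff: "n \<in> nonzero_degrees B J N \<longleftrightarrow> \<not> cech_vanishes B N ys (int n)" for n
    using local_cohomology_trivial_iff_cech[OF B N.module_axioms J ys] by simp
  \<comment> \<open>The Kuenneth formula ranges over integer degrees. Negative ones always vanish,
    so only sums of natural numbers remain.\<close>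
  have "(\<exists>i j. i + j = int n \<and> \<not> cech_vanishes A L xs i \<and> \<not> cech_vanishes B N ys j) \<longleftrightarrow>
      (\<exists>i j. n = i + j \<and> \<not> cech_vanishes A L xs (int i) \<and> \<not> cech_vanishes B N ys (int j))" for n
  proof
    assume "\<exists>i j. i + j = int n \<and> \<not> cech_vanishes A L xs i \<and> \<not> cech_vanishes B N ys j"
    then obtain i j where ij: "i + j = int n" "\<not> cech_vanishes A L xs i" "\<not> cech_vanishes B N ys j" by blast
    then have "i \<ge> 0" "j \<ge> 0"
      using module.cech_vanishes_negative[OF L.module_axioms xsA, of i] module.cech_vanishes_negative[OF N.module_axioms ysB, of j]
      by fastforce+
    then obtain i' j' where "i = int i'" "j = int j'" using nonneg_int_cases by metis
    then show "\<exists>i j. n = i + j \<and> \<not> cech_vanishes A L xs (int i) \<and> \<not> cech_vanishes B N ys (int j)"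
      using ij by (intro exI[of _ i'] exI[of _ j']) auto
  next
    assume "\<exists>i j. n = i + j \<and> \<not> cech_vanishes A L xs (int i) \<and> \<not> cech_vanishes B N ys (int j)"
    then show "\<exists>i j. i + j = int n \<and> \<not> cech_vanishes A L xs i \<and> \<not> cech_vanishes B N ys j"
      by (metis of_nat_add)
  qed
  then show ?thesis
    by (intro equalityI subsetI) (simp_all add: T_iff L_iff N_iff del: mem_Collect_eq, simp_all add: L_iff[simplified] N_iff[simplified])
qed

theorem theorem2p6:
  fixes K :: "'k ring"
    and A :: "('k, 'a) module" and B :: "('k, 'b) module"
    and L :: "('a, 'l) module" and N :: "('b, 'n) module"
    and I :: "'a set" and J :: "'b set"
  assumes "field K"
    and "algebra K A" and "algebra K B"
    and "noetherian_ring A" and "noetherian_ring B"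
    and "noetherian_ring (tensor_ring K A B)"
    and "ideal I A" and "ideal J B"
    and "module A L" and "module B N"
    and "finitely_generated_module A L" and "finitely_generated_module B N"
    and "carrier L \<noteq> {\<zero>\<^bsub>L\<^esub>}" and "carrier N \<noteq> {\<zero>\<^bsub>N\<^esub>}"
  shows "grade (tensor_ring K A B)
           (tensor_image K A B I (carrier B) <+>\<^bsub>tensor_ring K A B\<^esub> tensor_image K A B (carrier A) J)
           (tensor_module K A B L N)
         = grade A I L + grade B J N
       \<and> cohom_dim (tensor_ring K A B)
           (tensor_image K A B I (carrier B) <+>\<^bsub>tensor_ring K A B\<^esub> tensor_image K A B (carrier A) J)
           (tensor_module K A B L N)
         = cohom_dim A I L + cohom_dim B J N"
proof -
  interpret tensor_setting K A B L N
    by (intro tensor_setting.intro tensor_setting_axioms.intro assms noetherian_ring.axioms(1))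
  have grade_eq: "grade S \<aa> M = (INF n\<in>nonzero_degrees S \<aa> M. ereal (real n))"
    and cohom_dim_eq: "cohom_dim S \<aa> M = (SUP n\<in>nonzero_degrees S \<aa> M. ereal (real n))"
    for S :: "('r, 'x) ring_scheme" and \<aa> and M :: "('r, 'm, 'y) module_scheme"
    by (simp_all only: grade_def cohom_dim_def image_Collect)
  show ?thesis
    unfolding grade_eq cohom_dim_eq nonzero_degrees_tensor[OF assms(4-8)]
    using Inf_real_of_sums Sup_real_of_sums[OF finite_nonzero_degrees[OF assms(4,9,7)]
        finite_nonzero_degrees[OF assms(5,10,8)]]
    by (intro conjI)
qed

end
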